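(* Let $\mathfrak g$ be a finite-dimensional complex simple Lie algebra, let $N\in\{2,3,4,5\}$, let $\Gamma=\Gamma(N)$ be the principal congruence subgroup of level $N$, and let $\rho:\Gamma\to\mathrm{Aut}(\mathfrak g)$ be the restriction to $\Gamma$ of a homomorphism of complex Lie groups $\bar\rho:\mathrm{SL}(2,\mathbb C)\to\mathrm{Aut}(\mathfrak g)$. For $N=3,4,5$ the zero weight automorphic Lie algebra $\mathfrak M^!_0(\mathfrak g,\Gamma(N),\rho)$ is isomorphic, as a Lie algebra, respectively to the tetrahedral loop algebra $$\mathfrak g\otimes_{\mathbb C}\mathbb C[t,(t-1)^{-1},(t-\omega)^{-1},(t-\bar\omega)^{-1}],\quad \omega=e^{2\pi i/3},$$ the octahedral loop algebra $$\mathfrak g\otimes_{\mathbb C}\mathbb C[t,t^{-1},(t-1)^{-1},(t+1)^{-1},(t-i)^{-1},(t+i)^{-1}],$$ and the icosahedral loop algebra $$\mathfrak g\otimes_{\mathbb C}\mathbb C[t,t^{-1},(t-\varepsilon^j(\varepsilon+\varepsilon^4))^{-1},(t-\varepsilon^j(\varepsilon^2+\varepsilon^3))^{-1}: j=0,\dots,4],\quad \varepsilon=e^{2\pi i/5}.$$ For $N=2$, if $\rho(-\mathrm{Id})=\mathrm{id}$, then $\mathfrak M^!_0(\mathfrak g,\Gamma(2),\rho)$ is isomorphic to the dihedral loop algebra $\mathfrak g\otimes_{\mathbb C}\mathbb C[t,t^{-1},(t-1)^{-1}]$.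
   Context: $\Gamma(N)=\{\gamma\in\mathrm{SL}(2,\mathbb Z):\gamma\equiv\mathrm{Id}\bmod N\}$. $\mathbb H^2$ is the upper half-plane with the action $\gamma\tau=\frac{a\tau+b}{c\tau+d}$. $\mathfrak M^!_0(\mathfrak g,\Gamma,\rho)$ is the Lie algebra, under the pointwise bracket, of holomorphic maps $f:\mathbb H^2\to\mathfrak g$ with $f(\gamma\tau)=\rho(\gamma)f(\tau)$ for all $\gamma\in\Gamma$, having at most exponential growth at every cusp: for each $s\in\mathbb Q\cup\{\infty\}$ and $g\in\mathrm{SL}(2,\mathbb Z)$ with $gs=\infty$, putting $\tau_s=g\tau$, there are constants $C,M$ with $\|f(\tau)\|<Ce^{M|\tau_s|}$ whenever $\operatorname{Im}\tau_s$ is large enough. The loop algebras carry the bracket $[x\otimes p,y\otimes q]=[x,y]\otimes pq$. *)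

theory Defs
  imports
    "HOL-Analysis.Analysis"
    "HOL-Library.Poly_Mapping"
    "HOL-Computational_Algebra.Fraction_Field"
    "HOL-Number_Theory.Cong"
    "HOL-Algebra.Algebra"
    "HOL-Algebra.Algebraic_Closure_Type"
begin

section \<open>Lie algebras\<close>

text \<open>
  As with \<^locale>\<open>Module.module\<close>, the inherited fields \<^const>\<open>mult\<close> and \<^const>\<open>one\<close> carry no
  information in a Lie algebra; they are left unspecified in the instances below.
\<close>

record ('r, 'a) lie_algebra = "('r, 'a) module" +
  lie_bracket :: "'a \<Rightarrow> 'a \<Rightarrow> 'a"

locale lie_algebra = Module.module R L
  for R :: "('r, 'm) ring_scheme" and L :: "('r, 'a, 'n) lie_algebra_scheme" (structure) +
  assumes bracket_closed:
      "\<lbrakk>x \<in> carrier L; y \<in> carrier L\<rbrakk> \<Longrightarrow> lie_bracket L x y \<in> carrier L"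
    and bracket_add_left:
      "\<lbrakk>x \<in> carrier L; y \<in> carrier L; z \<in> carrier L\<rbrakk> \<Longrightarrow>
       lie_bracket L (x \<oplus> y) z = lie_bracket L x z \<oplus> lie_bracket L y z"
    and bracket_add_right:
      "\<lbrakk>x \<in> carrier L; y \<in> carrier L; z \<in> carrier L\<rbrakk> \<Longrightarrow>
       lie_bracket L x (y \<oplus> z) = lie_bracket L x y \<oplus> lie_bracket L x z"
    and bracket_smult_left:
      "\<lbrakk>c \<in> carrier R; x \<in> carrier L; y \<in> carrier L\<rbrakk> \<Longrightarrow>
       lie_bracket L (c \<odot> x) y = c \<odot> lie_bracket L x y"
    and bracket_smult_right:
      "\<lbrakk>c \<in> carrier R; x \<in> carrier L; y \<in> carrier L\<rbrakk> \<Longrightarrow>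
       lie_bracket L x (c \<odot> y) = c \<odot> lie_bracket L x y"
    and bracket_self: "x \<in> carrier L \<Longrightarrow> lie_bracket L x x = \<zero>"
    and jacobi:
      "\<lbrakk>x \<in> carrier L; y \<in> carrier L; z \<in> carrier L\<rbrakk> \<Longrightarrow>
       lie_bracket L x (lie_bracket L y z) \<oplus> lie_bracket L y (lie_bracket L z x)
         \<oplus> lie_bracket L z (lie_bracket L x y) = \<zero>"

definition lie_ideal ::
  "'a set \<Rightarrow> ('r, 'm) ring_scheme \<Rightarrow> ('r, 'a, 'n) lie_algebra_scheme \<Rightarrow> bool" where
  "lie_ideal I R L \<longleftrightarrow>
     submodule I R L \<and> (\<forall>x\<in>carrier L. \<forall>y\<in>I. lie_bracket L x y \<in> I)"

locale simple_lie_algebra = lie_algebra +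
  assumes non_abelian: "\<exists>x\<in>carrier L. \<exists>y\<in>carrier L. lie_bracket L x y \<noteq> \<zero>"
    and ideals_trivial: "lie_ideal I R L \<Longrightarrow> I = {\<zero>} \<or> I = carrier L"

definition finitely_spanned ::
  "('r, 'm) ring_scheme \<Rightarrow> ('r, 'a, 'n) module_scheme \<Rightarrow> bool" where
  "finitely_spanned R M \<longleftrightarrow>
     (\<exists>B. finite B \<and> B \<subseteq> carrier M \<and>
          (\<forall>H. submodule H R M \<and> B \<subseteq> H \<longrightarrow> H = carrier M))"

definition lie_hom ::
  "('r, 'm) ring_scheme \<Rightarrow> ('r, 'a, 'n) lie_algebra_scheme \<Rightarrow>
   ('r, 'b, 'p) lie_algebra_scheme \<Rightarrow> ('a \<Rightarrow> 'b) set" where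
  "lie_hom R L L' =
     {h. h \<in> carrier L \<rightarrow> carrier L' \<and>
         (\<forall>x\<in>carrier L. \<forall>y\<in>carrier L. h (x \<oplus>\<^bsub>L\<^esub> y) = h x \<oplus>\<^bsub>L'\<^esub> h y) \<and>
         (\<forall>c\<in>carrier R. \<forall>x\<in>carrier L. h (c \<odot>\<^bsub>L\<^esub> x) = c \<odot>\<^bsub>L'\<^esub> h x) \<and>
         (\<forall>x\<in>carrier L. \<forall>y\<in>carrier L. h (lie_bracket L x y) = lie_bracket L' (h x) (h y))}"

definition lie_iso ::
  "('r, 'm) ring_scheme \<Rightarrow> ('r, 'a, 'n) lie_algebra_scheme \<Rightarrow>
   ('r, 'b, 'p) lie_algebra_scheme \<Rightarrow> ('a \<Rightarrow> 'b) set" where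
  "lie_iso R L L' = {h \<in> lie_hom R L L'. bij_betw h (carrier L) (carrier L')}"

definition lie_isomorphic ::
  "('r, 'm) ring_scheme \<Rightarrow> ('r, 'a, 'n) lie_algebra_scheme \<Rightarrow>
   ('r, 'b, 'p) lie_algebra_scheme \<Rightarrow> bool" where
  "lie_isomorphic R L L' \<longleftrightarrow> lie_iso R L L' \<noteq> {}"

text \<open>Extensional functions, following \<^const>\<open>AutoGroup\<close>.\<close>

definition lie_AutoGroup ::
  "('r, 'm) ring_scheme \<Rightarrow> ('r, 'a, 'n) lie_algebra_scheme \<Rightarrow> ('a \<Rightarrow> 'a) monoid" where
  "lie_AutoGroup R L =
     BijGroup (carrier L) \<lparr>carrier := lie_iso R L L \<inter> Bij (carrier L)\<rparr>"

abbreviation complex_field :: "complex ring" where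
  "complex_field \<equiv> ring_of_type_algebra"


section \<open>Complex analysis with values in a finite-dimensional space\<close>

definition dual_space :: "(complex, 'a, 'n) module_scheme \<Rightarrow> ('a \<Rightarrow> complex) set" where
  "dual_space V =
     {\<phi>. (\<forall>x\<in>carrier V. \<forall>y\<in>carrier V. \<phi> (x \<oplus>\<^bsub>V\<^esub> y) = \<phi> x + \<phi> y) \<and>
         (\<forall>c. \<forall>x\<in>carrier V. \<phi> (c \<odot>\<^bsub>V\<^esub> x) = c * \<phi> x)}"

definition is_norm :: "(complex, 'a, 'n) module_scheme \<Rightarrow> ('a \<Rightarrow> real) \<Rightarrow> bool" where
  "is_norm V \<nu> \<longleftrightarrow>
     (\<forall>x\<in>carrier V. 0 \<le> \<nu> x \<and> (\<nu> x = 0 \<longleftrightarrow> x = \<zero>\<^bsub>V\<^esub>)) \<and>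
     (\<forall>c. \<forall>x\<in>carrier V. \<nu> (c \<odot>\<^bsub>V\<^esub> x) = cmod c * \<nu> x) \<and>
     (\<forall>x\<in>carrier V. \<forall>y\<in>carrier V. \<nu> (x \<oplus>\<^bsub>V\<^esub> y) \<le> \<nu> x + \<nu> y)"

text \<open>
  For finite-dimensional \<^term>\<open>V\<close> this says that the coordinates of \<^term>\<open>f\<close> with respect to
  some (equivalently, any) basis are holomorphic.
\<close>

definition vholomorphic_on ::
  "(complex, 'a, 'n) module_scheme \<Rightarrow> (complex \<Rightarrow> 'a) \<Rightarrow> complex set \<Rightarrow> bool" where
  "vholomorphic_on V f S \<longleftrightarrow> (\<forall>\<phi>\<in>dual_space V. (\<lambda>z. \<phi> (f z)) holomorphic_on S)"


section \<open>The complex Lie group SL(2,C)\<close>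

definition SL2C :: "(complex^2^2) monoid" where
  "SL2C = \<lparr>carrier = {A. det A = 1}, monoid.mult = (**), monoid.one = mat 1\<rparr>"

definition matrix_holomorphic_on ::
  "(complex^2^2 \<Rightarrow> complex) \<Rightarrow> (complex^2^2) set \<Rightarrow> bool" where
  "matrix_holomorphic_on F U \<longleftrightarrow>
     (\<forall>A\<in>U. \<exists>F'. (F has_derivative F') (at A) \<and> (\<forall>c B. F' (map_matrix ((*) c) B) = c * F' B))"

text \<open>
  SL(2,C) is a closed complex submanifold of the space of matrices, so its holomorphic functions
  are those that extend locally to holomorphic functions on open sets of matrices.
\<close>

definition SL2C_holomorphic :: "(complex^2^2 \<Rightarrow> complex) \<Rightarrow> bool" where
  "SL2C_holomorphic F \<longleftrightarrow>
     (\<forall>A\<in>carrier SL2C. \<exists>U G. open U \<and> A \<in> U \<and> matrix_holomorphic_on G U \<and>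
        (\<forall>B\<in>U \<inter> carrier SL2C. F B = G B))"

text \<open>
  The complex structure on the automorphism group is the one it has as a closed subgroup of
  GL(L); a map into it is holomorphic iff its matrix coefficients are.
\<close>

definition SL2C_complex_lie_hom ::
  "(complex, 'a, 'n) lie_algebra_scheme \<Rightarrow> (complex^2^2 \<Rightarrow> 'a \<Rightarrow> 'a) \<Rightarrow> bool" where
  "SL2C_complex_lie_hom L \<sigma> \<longleftrightarrow>
     \<sigma> \<in> hom SL2C (lie_AutoGroup complex_field L) \<and>
     (\<forall>x\<in>carrier L. \<forall>\<phi>\<in>dual_space L. SL2C_holomorphic (\<lambda>A. \<phi> (\<sigma> A x)))"


section \<open>Automorphic Lie algebras of weight zero\<close>

definition SL2Z :: "(int^2^2) set" where
  "SL2Z = {\<gamma>. det \<gamma> = 1}"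

definition principal_congruence_subgroup :: "nat \<Rightarrow> (int^2^2) set" where
  "principal_congruence_subgroup N =
     {\<gamma> \<in> SL2Z. \<forall>i j. [\<gamma> $ i $ j = mat 1 $ i $ j] (mod int N)}"

definition upper_half_plane :: "complex set" where
  "upper_half_plane = {\<tau>. 0 < Im \<tau>}"

definition modular_action :: "int^2^2 \<Rightarrow> complex \<Rightarrow> complex" where
  "modular_action \<gamma> \<tau> =
     (of_int (\<gamma> $ 1 $ 1) * \<tau> + of_int (\<gamma> $ 1 $ 2)) /
     (of_int (\<gamma> $ 2 $ 1) * \<tau> + of_int (\<gamma> $ 2 $ 2))"

datatype cusp = Finite_Cusp rat | Infinity_Cusp

fun cusp_action :: "int^2^2 \<Rightarrow> cusp \<Rightarrow> cusp" where
  "cusp_action \<gamma> (Finite_Cusp r) =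
     (if of_int (\<gamma> $ 2 $ 1) * r + of_int (\<gamma> $ 2 $ 2) = 0 then Infinity_Cusp
      else Finite_Cusp ((of_int (\<gamma> $ 1 $ 1) * r + of_int (\<gamma> $ 1 $ 2)) /
                        (of_int (\<gamma> $ 2 $ 1) * r + of_int (\<gamma> $ 2 $ 2))))"
| "cusp_action \<gamma> Infinity_Cusp =
     (if \<gamma> $ 2 $ 1 = 0 then Infinity_Cusp
      else Finite_Cusp (of_int (\<gamma> $ 1 $ 1) / of_int (\<gamma> $ 2 $ 1)))"

definition exp_growth_at_cusps :: "('a \<Rightarrow> real) \<Rightarrow> (complex \<Rightarrow> 'a) \<Rightarrow> bool" where
  "exp_growth_at_cusps \<nu> f \<longleftrightarrow>
     (\<forall>s. \<forall>g\<in>SL2Z. cusp_action g s = Infinity_Cusp \<longrightarrow>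
        (\<exists>C M Y. \<forall>\<tau>\<in>upper_half_plane. Im (modular_action g \<tau>) > Y \<longrightarrow>
           \<nu> (f \<tau>) < C * exp (M * cmod (modular_action g \<tau>))))"

definition zero_weight_automorphic ::
  "(complex, 'a, 'n) lie_algebra_scheme \<Rightarrow> ('a \<Rightarrow> real) \<Rightarrow> (int^2^2) set \<Rightarrow>
   (int^2^2 \<Rightarrow> 'a \<Rightarrow> 'a) \<Rightarrow> (complex, complex \<Rightarrow> 'a) lie_algebra" where
  "zero_weight_automorphic L \<nu> \<Gamma> \<rho> =
     \<lparr>carrier =
        {f \<in> upper_half_plane \<rightarrow>\<^sub>E carrier L.
           vholomorphic_on L f upper_half_plane \<and>
           (\<forall>\<gamma>\<in>\<Gamma>. \<forall>\<tau>\<in>upper_half_plane. f (modular_action \<gamma> \<tau>) = \<rho> \<gamma> (f \<tau>)) \<and>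
           exp_growth_at_cusps \<nu> f},
      monoid.mult = undefined, monoid.one = undefined,
      ring.zero = (\<lambda>\<tau>\<in>upper_half_plane. \<zero>\<^bsub>L\<^esub>),
      ring.add = (\<lambda>f g. \<lambda>\<tau>\<in>upper_half_plane. f \<tau> \<oplus>\<^bsub>L\<^esub> g \<tau>),
      module.smult = (\<lambda>c f. \<lambda>\<tau>\<in>upper_half_plane. c \<odot>\<^bsub>L\<^esub> f \<tau>),
      lie_bracket = (\<lambda>f g. \<lambda>\<tau>\<in>upper_half_plane. lie_bracket L (f \<tau>) (g \<tau>))\<rparr>"


section \<open>Loop algebras\<close>

text \<open>
  The tensor product of complex vector spaces is the free complex vector space on
  \<^term>\<open>carrier V \<times> carrier W\<close> (finitely supported functions) modulo the bilinearity relations;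
  its elements are the cosets.
\<close>

definition free_smult :: "complex \<Rightarrow> ('k \<Rightarrow>\<^sub>0 complex) \<Rightarrow> ('k \<Rightarrow>\<^sub>0 complex)" where
  "free_smult c = Poly_Mapping.map ((*) c)"

definition tensor_relations ::
  "(complex, 'a, 'n) module_scheme \<Rightarrow> (complex, 'b, 'p) module_scheme \<Rightarrow>
   ('a \<times> 'b \<Rightarrow>\<^sub>0 complex) set" where
  "tensor_relations V W = Modules.module.span free_smult
     ({Poly_Mapping.single (x \<oplus>\<^bsub>V\<^esub> x', y) 1
         - Poly_Mapping.single (x, y) 1 - Poly_Mapping.single (x', y) 1 | x x' y.
         x \<in> carrier V \<and> x' \<in> carrier V \<and> y \<in> carrier W} \<union>
      {Poly_Mapping.single (x, y \<oplus>\<^bsub>W\<^esub> y') 1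
         - Poly_Mapping.single (x, y) 1 - Poly_Mapping.single (x, y') 1 | x y y'.
         x \<in> carrier V \<and> y \<in> carrier W \<and> y' \<in> carrier W} \<union>
      {Poly_Mapping.single (c \<odot>\<^bsub>V\<^esub> x, y) 1 - Poly_Mapping.single (x, y) c | c x y.
         x \<in> carrier V \<and> y \<in> carrier W} \<union>
      {Poly_Mapping.single (x, c \<odot>\<^bsub>W\<^esub> y) 1 - Poly_Mapping.single (x, y) c | c x y.
         x \<in> carrier V \<and> y \<in> carrier W})"

definition tensor_product ::
  "(complex, 'a, 'n) module_scheme \<Rightarrow> (complex, 'b, 'p) module_scheme \<Rightarrow>
   (complex, ('a \<times> 'b \<Rightarrow>\<^sub>0 complex) set) module" where
  "tensor_product V W =
     \<lparr>carrier = {(+) u ` tensor_relations V W | u. Poly_Mapping.keys u \<subseteq> carrier V \<times> carrier W},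
      monoid.mult = undefined, monoid.one = undefined,
      ring.zero = tensor_relations V W,
      ring.add = (\<lambda>P Q. {u + v | u v. u \<in> P \<and> v \<in> Q}),
      module.smult = (\<lambda>c P. {free_smult c u + n | u n. u \<in> P \<and> n \<in> tensor_relations V W})\<rparr>"

text \<open>
  The bilinear extension of \<open>[x \<otimes> p, y \<otimes> q] = [x, y] \<otimes> pq\<close> to the free vector space;
  it descends to cosets of the bilinearity relations.
\<close>

definition free_loop_bracket ::
  "(complex, 'a, 'n) lie_algebra_scheme \<Rightarrow> (complex, 'b, 'p) module_scheme \<Rightarrow>
   ('a \<times> 'b \<Rightarrow>\<^sub>0 complex) \<Rightarrow> ('a \<times> 'b \<Rightarrow>\<^sub>0 complex) \<Rightarrow> ('a \<times> 'b \<Rightarrow>\<^sub>0 complex)" where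
  "free_loop_bracket L A u v =
     (\<Sum>(x, p)\<in>Poly_Mapping.keys u. \<Sum>(y, q)\<in>Poly_Mapping.keys v.
        Poly_Mapping.single (lie_bracket L x y, p \<otimes>\<^bsub>A\<^esub> q)
          (Poly_Mapping.lookup u (x, p) * Poly_Mapping.lookup v (y, q)))"

definition loop_algebra ::
  "(complex, 'a, 'n) lie_algebra_scheme \<Rightarrow> (complex, 'b, 'p) module_scheme \<Rightarrow>
   (complex, ('a \<times> 'b \<Rightarrow>\<^sub>0 complex) set) lie_algebra" where
  "loop_algebra L A = module.extend (tensor_product L A)
     \<lparr>lie_bracket = (\<lambda>P Q.
        {free_loop_bracket L A u v + n | u v n. u \<in> P \<and> v \<in> Q \<and> n \<in> tensor_relations L A})\<rparr>"

definition ratfun_const :: "complex \<Rightarrow> complex poly fract" where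
  "ratfun_const c = Fract [:c:] 1"

definition ratfun_t :: "complex poly fract" where
  "ratfun_t = Fract [:0, 1:] 1"

text \<open>
  The algebra of polynomials in \<open>t\<close> with \<open>(t - a)\<inverse>\<close> adjoined for all \<open>a \<in> S\<close>, as the subalgebra
  of the field of rational functions generated by these elements.
\<close>

definition punctured_line_algebra :: "complex set \<Rightarrow> (complex, complex poly fract) module" where
  "punctured_line_algebra S =
     \<lparr>carrier = generate_ring ring_of_type_algebra
        (range ratfun_const \<union> {ratfun_t} \<union> (\<lambda>a. inverse (ratfun_t - ratfun_const a)) ` S),
      monoid.mult = (*), monoid.one = 1, ring.zero = 0, ring.add = (+),
      module.smult = (\<lambda>c p. ratfun_const c * p)\<rparr>"

definition tetrahedral_punctures :: "complex set" where
  "tetrahedral_punctures =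
     (let \<omega> = exp (2 * of_real pi * \<i> / 3) in {1, \<omega>, cnj \<omega>})"

definition octahedral_punctures :: "complex set" where
  "octahedral_punctures = {0, 1, -1, \<i>, -\<i>}"

definition icosahedral_punctures :: "complex set" where
  "icosahedral_punctures =
     (let \<epsilon> = exp (2 * of_real pi * \<i> / 5) in
        {0} \<union> {\<epsilon> ^ j * (\<epsilon> + \<epsilon> ^ 4) | j::nat. j \<le> 4}
            \<union> {\<epsilon> ^ j * (\<epsilon> ^ 2 + \<epsilon> ^ 3) | j::nat. j \<le> 4})"

definition dihedral_punctures :: "complex set" where
  "dihedral_punctures = {0, 1}"

end

theory Submission
  imports Defs "HOL-Complex_Analysis.Complex_Analysis"
begin

text \<open>
  Products of Klein forms give a Hauptmodul \<open>t\<close> of \<open>\<Gamma>(N)\<close> with its pole at the cusp \<open>\<infinity>\<close>, and a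
  form \<open>\<phi>\<close> of weight 1 without zeros in the upper half-plane.
  Since \<open>t(\<tau> + 1)\<close> and \<open>t(-1/\<tau>)\<close> are Moebius transforms of \<open>t\<close>, the values of a normalised \<open>t\<close> at
  the remaining cusps are the orbit of \<open>\<infinity>\<close> under a finite group, namely the given set of punctures;
  hence the invariant holomorphic functions of exponential growth at the cusps are the regular functions
  of \<open>t\<close> on the punctured line.  The vector valued form \<open>\<phi> (\<tau>, 1)\<close> and its derivative are the
  columns of a map \<open>F\<close> from the upper half-plane to \<open>SL(2,\<complex>)\<close> with \<open>F(\<gamma>\<tau>) = \<gamma> F(\<tau>)\<close>, up to sign if
  \<open>N = 2\<close>.  As \<open>\<rho>\<close> extends to \<open>SL(2,\<complex>)\<close>, where its matrix coefficients grow polynomially, twisting by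
  \<open>\<rho>(F(\<tau>))\<close> turns equivariant maps into invariant ones: \<open>x \<otimes> p \<mapsto> p(t(\<tau>)) \<rho>(F(\<tau>)) x\<close> is the isomorphism.
\<close>

section \<open>The theta function in product form\<close>

text \<open>Genus zero of the modular curve is not quoted but witnessed: an invariant function with
  one simple pole is written down, and the global principle behind all later identities is that an
  invariant function bounded at every cusp is constant. Klein forms suit this because a matrix acts
  on them by a linear substitution of the parameter (r, s), so order at any cusp, weight and
  multiplier of a product become integer arithmetic modulo N. The main analytic difficulty is the
  substitution of -1/\<tau> for \<tau> in an infinite product, which Liouville's theorem settles.
  The relation of \<open>t\<close> under inversion still contains an unknown constant; it is found
  from (ST)^3 alone, without computing special values of \<open>t\<close>. The second obstacle is
  growth: the twist and its inverse must both preserve exponential growth at all cusps, while the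
  representation is known only to be a holomorphic homomorphism. Conjugation inside SL(2,C) rescales
  unipotent matrices, which forces the polynomial bound without a classification of representations.
  The tensor product, given by cosets, is handled in coordinates: an element becomes a finite family
  of rational functions.\<close>

definition qp :: "complex \<Rightarrow> complex \<Rightarrow> complex" where
  "qp x q = prodinf (\<lambda>n. 1 - x * q ^ n)"

lemma qp_convergent:
  fixes x q :: complex
  assumes "norm q < 1"
  shows "convergent_prod (\<lambda>n. 1 - x * q ^ n)"
proof -
  have "summable (\<lambda>n. norm x * norm q ^ n)"
    using assms by (intro summable_mult summable_geometric) auto
  moreover have "norm ((1 - x * q ^ n) - 1) = norm x * norm q ^ n" for n
    by (simp add: norm_mult norm_power)
  ultimately have "summable (\<lambda>n. norm ((1 - x * q ^ n) - 1))" by simp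
  thus ?thesis
    using abs_convergent_prod_conv_summable abs_convergent_prod_imp_convergent_prod by blast
qed

lemma qp_LIMSEQ: "norm q < 1 \<Longrightarrow> (\<lambda>n. \<Prod>k\<le>n. 1 - x * q ^ k) \<longlonglongrightarrow> qp x q"
  unfolding qp_def by (rule convergent_prod_LIMSEQ[OF qp_convergent])

lemma qp_eq_0_iff: "norm q < 1 \<Longrightarrow> qp x q = 0 \<longleftrightarrow> (\<exists>n. x * q ^ n = 1)"
  unfolding qp_def
  using has_prod_eq_0_iff[OF convergent_prod_has_prod[OF qp_convergent[of q x]]]
  by (auto simp: image_iff)

lemma qp_rec:
  assumes "norm q < 1"
  shows "qp x q = (1 - x) * qp (x * q) q"
proof -
  have "(\<lambda>n. \<Prod>k\<le>Suc n. 1 - x * q ^ k) \<longlonglongrightarrow> qp x q"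
    using LIMSEQ_Suc[OF qp_LIMSEQ[OF assms]] .
  moreover have "(\<Prod>k\<le>Suc n. 1 - x * q ^ k) = (1 - x) * (\<Prod>k\<le>n. 1 - (x * q) * q ^ k)" for n
    by (subst prod.atMost_Suc_shift) (simp add: mult_ac)
  moreover have "(\<lambda>n. (1 - x) * (\<Prod>k\<le>n. 1 - (x * q) * q ^ k)) \<longlonglongrightarrow> (1 - x) * qp (x * q) q"
    by (intro tendsto_intros qp_LIMSEQ assms)
  ultimately have "(\<lambda>n. (1 - x) * (\<Prod>k\<le>n. 1 - (x * q) * q ^ k)) \<longlonglongrightarrow> qp x q" by simp
  thus ?thesis
    using \<open>(\<lambda>n. (1 - x) * (\<Prod>k\<le>n. 1 - (x * q) * q ^ k)) \<longlonglongrightarrow> (1 - x) * qp (x * q) q\<close>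
    by (rule LIMSEQ_unique)
qed

text \<open>Weierstrass M-test with majorant \<open>B * r ^ n\<close>. Both arguments may vary with
  \<open>w\<close>, because \<open>ex z\<close> and \<open>ex \<tau>\<close> will be substituted and
  holomorphy is needed in \<tau>, which enters both.\<close>

lemma qp_uniform:
  fixes x q :: "'a::topological_space \<Rightarrow> complex"
  assumes "compact A" "continuous_on A x" "continuous_on A q"
    and "\<And>w. w \<in> A \<Longrightarrow> norm (x w) \<le> B" "\<And>w. w \<in> A \<Longrightarrow> norm (q w) \<le> r" "0 \<le> r" "r < 1"
  shows "uniform_limit A (\<lambda>N w. \<Prod>n<N. 1 - x w * q w ^ n) (\<lambda>w. qp (x w) (q w)) sequentially"
proof (cases "A = {}")
  case False
  hence "0 \<le> B" using assms(4) norm_ge_zero order_trans by blast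
  have "uniformly_convergent_on A (\<lambda>N w. \<Sum>n<N. norm ((1 - x w * q w ^ n) - 1))"
  proof (rule Weierstrass_m_test'[of _ _ "\<lambda>n. B * r ^ n"])
    show "norm (norm (1 - x w * q w ^ n - 1)) \<le> B * r ^ n" if "w \<in> A" for n w
      using assms(4,5)[OF that] \<open>0 \<le> B\<close> by (simp add: norm_mult norm_power mult_mono power_mono)
    show "summable (\<lambda>n. B * r ^ n)"
      using assms by (intro summable_mult summable_geometric) auto
  qed
  hence "uniformly_convergent_on A (\<lambda>N w. \<Prod>n<N. 1 - x w * q w ^ n)"
    using assms by (intro Infinite_Products.uniformly_convergent_on_prod') (auto intro!: continuous_intros)
  then obtain l where l: "uniform_limit A (\<lambda>N w. \<Prod>n<N. 1 - x w * q w ^ n) l sequentially"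
    by (auto simp: uniformly_convergent_on_def)
  have "l w = qp (x w) (q w)" if "w \<in> A" for w
  proof -
    have "norm (q w) < 1" using assms(5)[OF that] assms(7) by simp
    hence "(\<lambda>n. \<Prod>k<Suc n. 1 - x w * q w ^ k) \<longlonglongrightarrow> qp (x w) (q w)"
      unfolding lessThan_Suc_atMost by (rule qp_LIMSEQ)
    moreover have "(\<lambda>n. \<Prod>k<n. 1 - x w * q w ^ k) \<longlonglongrightarrow> l w"
      using tendsto_uniform_limitI[OF l that] .
    ultimately show ?thesis by (intro LIMSEQ_unique[OF LIMSEQ_Suc])
  qed
  thus ?thesis using l by (simp cong: uniform_limit_cong')
qed simp

lemma qp_holomorphic:
  assumes "open S" "x holomorphic_on S" "q holomorphic_on S" "\<And>w. w \<in> S \<Longrightarrow> norm (q w) < 1"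
  shows "(\<lambda>w. qp (x w) (q w)) holomorphic_on S"
proof (rule holomorphic_uniform_sequence[OF assms(1)])
  show "(\<lambda>w. \<Prod>n<N. 1 - x w * q w ^ n) holomorphic_on S" for N
    using assms by (intro holomorphic_intros) auto
  fix w assume "w \<in> S"
  then obtain d where d: "d > 0" "cball w d \<subseteq> S"
    using assms(1) open_contains_cball by blast
  have cx: "continuous_on (cball w d) x" and cq: "continuous_on (cball w d) q"
    using d assms holomorphic_on_imp_continuous_on continuous_on_subset by blast+
  obtain B where B: "\<And>y. y \<in> cball w d \<Longrightarrow> norm (x y) \<le> B"
    using compact_imp_bounded[OF compact_continuous_image[OF cx compact_cball]]
    unfolding bounded_iff by blast
  obtain v where v: "v \<in> cball w d" "\<And>y. y \<in> cball w d \<Longrightarrow> norm (q y) \<le> norm (q v)"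
    using continuous_attains_sup[of "cball w d" "\<lambda>y. norm (q y)"] continuous_on_norm[OF cq] d
    by fastforce
  have "uniform_limit (cball w d) (\<lambda>N w. \<Prod>n<N. 1 - x w * q w ^ n) (\<lambda>w. qp (x w) (q w)) sequentially"
    using v d assms(4) by (intro qp_uniform[of _ _ _ B "norm (q v)"] cx cq B) auto
  thus "\<exists>d>0. cball w d \<subseteq> S \<and>
      uniform_limit (cball w d) (\<lambda>N w. \<Prod>n<N. 1 - x w * q w ^ n) (\<lambda>w. qp (x w) (q w)) sequentially"
    using d by blast
qed

text \<open>The product is a uniform limit of polynomials on
  \<open>cball 0 1 \<times> cball 0 (1/2)\<close>, so it is jointly continuous there, and its value
  at the origin is 1.\<close>

lemma qp_tendsto_1:
  assumes "(x \<longlongrightarrow> 0) F" "(q \<longlongrightarrow> 0) F"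
  shows "((\<lambda>w. qp (x w) (q w)) \<longlongrightarrow> 1) F"
proof -
  define A :: "(complex \<times> complex) set" where "A = cball 0 1 \<times> cball 0 (1/2)"
  have "uniform_limit A (\<lambda>N w. \<Prod>n<N. 1 - fst w * snd w ^ n) (\<lambda>w. qp (fst w) (snd w)) sequentially"
    by (rule qp_uniform[of _ _ _ 1 "1/2"]) (auto simp: A_def intro!: continuous_intros compact_Times)
  hence "continuous_on A (\<lambda>w. qp (fst w) (snd w))"
    by (rule uniform_limit_theorem[rotated]) (auto intro!: continuous_intros always_eventually)
  moreover have "((\<lambda>w. (x w, q w)) \<longlongrightarrow> (0, 0)) F"
    using assms by (intro tendsto_intros)
  moreover have "eventually (\<lambda>w. (x w, q w) \<in> A) F"
  proof -
    have "eventually (\<lambda>w. dist (x w) 0 < 1) F" "eventually (\<lambda>w. dist (q w) 0 < 1/2) F"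
      using tendstoD[OF assms(1), of 1] tendstoD[OF assms(2), of "1/2"] by simp_all
    thus ?thesis by eventually_elim (auto simp: A_def)
  qed
  ultimately have "((\<lambda>w. qp (fst (x w, q w)) (snd (x w, q w))) \<longlongrightarrow> qp (fst (0::complex,0::complex)) (snd (0::complex,0::complex))) F"
    by (intro continuous_on_tendsto_compose[of A "\<lambda>w. qp (fst w) (snd w)"]) (auto simp: A_def)
  moreover have "qp 0 0 = 1" by (simp add: qp_def)
  ultimately show ?thesis by simp
qed

section \<open>The theta function: zeros, quasi-periods and inversion\<close>

definition ex :: "complex \<Rightarrow> complex" where "ex z = exp (2 * of_real pi * \<i> * z)"

text \<open>The odd theta function with simple zeros on the lattice \<open>\<int> + \<int>\<tau>\<close> and derivative 1 at 0; it is the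
  Weierstrass sigma function up to a Gaussian factor.\<close>

definition kappa :: "complex \<Rightarrow> complex \<Rightarrow> complex" where
  "kappa z \<tau> = - exp (- (of_real pi * \<i> * z)) / (2 * of_real pi * \<i>) *
      qp (ex z) (ex \<tau>) * qp (ex \<tau> / ex z) (ex \<tau>) / (qp (ex \<tau>) (ex \<tau>))\<^sup>2"

lemma ex_add: "ex (a + b) = ex a * ex b"
  and ex_diff: "ex (a - b) = ex a / ex b"
  and ex_minus: "ex (- a) = inverse (ex a)"
  and ex_nonzero [simp]: "ex a \<noteq> 0"
  by (simp_all add: ex_def ring_distribs exp_add exp_diff exp_minus)

lemma ex_0 [simp]: "ex 0 = 1" by (simp add: ex_def)

lemma ex_of_int [simp]: "ex (of_int n) = 1"
  unfolding ex_def exp_eq_1 by (auto intro!: exI[of _ n])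

lemma ex_1 [simp]: "ex 1 = 1" using ex_of_int[of 1] by simp

lemma ex_power: "ex a ^ n = ex (of_nat n * a)"
  by (simp add: ex_def exp_of_nat_mult[symmetric] mult_ac)

lemma ex_eq_1_iff: "ex a = 1 \<longleftrightarrow> (\<exists>n::int. a = of_int n)"
proof
  assume "ex a = 1"
  then obtain n :: int where "Re (2 * of_real pi * \<i> * a) = 0" "Im (2 * of_real pi * \<i> * a) = of_int (2 * n) * pi"
    by (auto simp: ex_def exp_eq_1)
  hence "a = of_int n" by (auto simp: complex_eq_iff)
  thus "\<exists>n::int. a = of_int n" ..
qed auto

lemma norm_ex: "norm (ex \<tau>) = exp (- (2 * pi * Im \<tau>))"
  by (simp add: ex_def norm_exp_eq_Re)

lemma norm_ex_less_1 [simp]: "Im \<tau> > 0 \<Longrightarrow> norm (ex \<tau>) < 1"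
  by (simp add: norm_ex)

lemma ex_holomorphic [holomorphic_intros]:
  "f holomorphic_on S \<Longrightarrow> (\<lambda>z. ex (f z)) holomorphic_on S"
  unfolding ex_def by (intro holomorphic_intros)

lemma qp_self_nonzero: "Im \<tau> > 0 \<Longrightarrow> qp (ex \<tau>) (ex \<tau>) \<noteq> 0"
proof
  assume *: "Im \<tau> > 0" and "qp (ex \<tau>) (ex \<tau>) = 0"
  then obtain n where "ex \<tau> ^ Suc n = 1" by (auto simp: qp_eq_0_iff)
  hence "norm (ex \<tau>) ^ Suc n = 1" by (metis norm_one norm_power)
  thus False using power_less_one_iff[of "norm (ex \<tau>)" "Suc n"] * by (auto simp del: power_Suc)
qed

lemma kappa_holomorphic:
  assumes "open S" "f holomorphic_on S" "g holomorphic_on S" "\<And>w. w \<in> S \<Longrightarrow> Im (g w) > 0"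
  shows "(\<lambda>w. kappa (f w) (g w)) holomorphic_on S"
  unfolding kappa_def
  using assms by (intro holomorphic_intros qp_holomorphic) (auto simp: qp_self_nonzero)

text \<open>The factors of \<open>qp (ex z) (ex \<tau>)\<close> vanish on Z - n\<tau> with n >= 0,
  those of \<open>qp (ex \<tau> / ex z) (ex \<tau>)\<close> on Z + n\<tau> with n >= 1; the two
  families exhaust the lattice.\<close>

lemma kappa_eq_0_iff:
  assumes "Im \<tau> > 0"
  shows "kappa z \<tau> = 0 \<longleftrightarrow> (\<exists>m n::int. z = of_int m * \<tau> + of_int n)"
proof -
  have "kappa z \<tau> = 0 \<longleftrightarrow> (\<exists>n. ex (z + of_nat n * \<tau>) = 1) \<or> (\<exists>n. ex (of_nat (Suc n) * \<tau> - z) = 1)"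
    using assms qp_self_nonzero[OF assms]
    by (simp add: kappa_def qp_eq_0_iff ex_power ex_add ex_diff ring_distribs)
  also have "\<dots> \<longleftrightarrow> (\<exists>m n::int. z = of_int m * \<tau> + of_int n)"
  proof safe
    fix n assume "ex (z + of_nat n * \<tau>) = 1"
    then obtain k :: int where "z + of_nat n * \<tau> = of_int k" by (auto simp: ex_eq_1_iff)
    hence "z = of_int (- int n) * \<tau> + of_int k" by (simp add: algebra_simps)
    thus "\<exists>m n::int. z = of_int m * \<tau> + of_int n" by blast
  next
    fix n assume "ex (of_nat (Suc n) * \<tau> - z) = 1"
    then obtain k :: int where "of_nat (Suc n) * \<tau> - z = of_int k" by (auto simp: ex_eq_1_iff)
    hence "z = of_nat (Suc n) * \<tau> - of_int k" by (metis diff_diff_eq2 add_diff_cancel_left')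
    hence "z = of_int (int (Suc n)) * \<tau> + of_int (-k)" by simp
    thus "\<exists>m n::int. z = of_int m * \<tau> + of_int n" by blast
  next
    fix m n :: int
    assume *: "\<nexists>k. ex (of_nat (Suc k) * \<tau> - (of_int m * \<tau> + of_int n)) = 1"
    show "\<exists>k. ex (of_int m * \<tau> + of_int n + of_nat k * \<tau>) = 1"
    proof (cases "m \<le> 0")
      case True
      then obtain k where "m = - int k" using nonpos_int_cases by blast
      hence "of_int m * \<tau> + of_int n + of_nat k * \<tau> = of_int n" by simp
      thus ?thesis by (metis ex_of_int)
    next
      case False
      hence "m = int (Suc (nat (m - 1)))" by simp
      then obtain k where "m = int (Suc k)" by blast
      hence "of_nat (Suc k) * \<tau> - (of_int m * \<tau> + of_int n) = of_int (-n)" by simp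
      thus ?thesis using * by (metis ex_of_int)
    qed
  qed
  finally show ?thesis .
qed

lemma exp_minus_pi_i: "exp (- (of_real pi * \<i>)) = -1"
  by (simp add: exp_minus exp_pi_i)

lemma kappa_plus_1: "kappa (z + 1) \<tau> = - kappa z \<tau>"
proof -
  have "exp (- (of_real pi * \<i> * (z + 1))) = - exp (- (of_real pi * \<i> * z))"
    by (simp add: ring_distribs exp_add exp_diff exp_minus_pi_i)
  thus ?thesis by (simp add: kappa_def ex_add)
qed

text \<open>The shift moves one factor from the first product to the second, at the price of
  \<open>(1 - 1/u) / (1 - u) = -1/u\<close> with \<open>u = ex z\<close>. For \<open>u = 1\<close>,
  where this division is impossible, both sides vanish.\<close>

lemma kappa_plus_tau:
  assumes "Im \<tau> > 0"
  shows "kappa (z + \<tau>) \<tau> = - exp (- (of_real pi * \<i> * (\<tau> + 2 * z))) * kappa z \<tau>"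
proof (cases "ex z = 1")
  case True
  then obtain n :: int where n: "z = of_int n" by (auto simp: ex_eq_1_iff)
  have "kappa z \<tau> = 0" unfolding kappa_eq_0_iff[OF assms] n by (rule exI[of _ 0]) auto
  moreover have "kappa (z + \<tau>) \<tau> = 0" unfolding kappa_eq_0_iff[OF assms] n by (rule exI[of _ 1]) auto
  ultimately show ?thesis by simp
next
  case False
  define u q where "u = ex z" and "q = ex \<tau>"
  have q: "norm q < 1" and [simp]: "u \<noteq> 0" "q \<noteq> 0" "u \<noteq> 1" using assms False by (auto simp: q_def u_def)
  have 1: "qp u q = (1 - u) * qp (u * q) q" by (rule qp_rec[OF q])
  have 2: "qp (1/u) q = (1 - 1/u) * qp (q / u) q" using qp_rec[OF q, of "1/u"] by simp
  have 3: "exp (- (of_real pi * \<i> * (z + \<tau>))) = exp (- (of_real pi * \<i> * (\<tau> + 2 * z))) * exp (- (of_real pi * \<i> * z)) * u"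
    unfolding u_def ex_def by (simp add: exp_add[symmetric] ring_distribs) (simp add: mult_ac)
  have "q / (u * q) = 1 / u" by simp
  hence "kappa (z + \<tau>) \<tau> = - exp (- (of_real pi * \<i> * (z + \<tau>))) / (2 * of_real pi * \<i>) *
      qp (u * q) q * qp (1 / u) q / (qp q q)\<^sup>2" by (simp add: kappa_def ex_add u_def q_def)
  also have "\<dots> = - exp (- (of_real pi * \<i> * (\<tau> + 2 * z))) *
      (- exp (- (of_real pi * \<i> * z)) / (2 * of_real pi * \<i>) * qp u q * qp (q / u) q / (qp q q)\<^sup>2)"
    unfolding 1 2 3 by (simp add: divide_simps) (simp add: algebra_simps)
  finally show ?thesis by (simp add: kappa_def u_def q_def)
qed

lemma kappa_minus_tau:
  assumes "Im \<tau> > 0"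
  shows "kappa (z - \<tau>) \<tau> = - exp (of_real pi * \<i> * (2 * z - \<tau>)) * kappa z \<tau>"
proof -
  have "exp (of_real pi * \<i> * (2 * z - \<tau>)) * exp (- (of_real pi * \<i> * (\<tau> + 2 * (z - \<tau>)))) = 1"
    by (simp add: exp_add[symmetric] ring_distribs)
  thus ?thesis using kappa_plus_tau[OF assms, of "z - \<tau>"] by simp
qed

text \<open>Splitting off \<open>1 - ex z\<close>, whose derivative at 0 is -2 pi i, leaves a
  cofactor with value -1 / (2 pi i) there. The constant and the squared denominator in
  \<open>kappa\<close> are chosen for this.\<close>

lemma kappa_deriv_0:
  assumes "Im \<tau> > 0"
  shows "((\<lambda>z. kappa z \<tau>) has_field_derivative 1) (at 0)"
proof -
  define q where "q = ex \<tau>"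
  have q: "norm q < 1" and [simp]: "qp q q \<noteq> 0" using assms by (auto simp: q_def qp_self_nonzero)
  define h where "h = (\<lambda>z. - exp (- (of_real pi * \<i> * z)) / (2 * of_real pi * \<i>) *
      qp (ex z * q) q * qp (q / ex z) q / (qp q q)\<^sup>2)"
  have kh: "kappa z \<tau> = (1 - ex z) * h z" for z
    using qp_rec[OF q, of "ex z"] by (simp add: kappa_def h_def q_def)
  have "h holomorphic_on UNIV" unfolding h_def
    by (intro holomorphic_intros qp_holomorphic) (auto simp: q)
  then obtain h' where h': "(h has_field_derivative h') (at 0)"
    by (auto simp: holomorphic_on_open)
  have h0: "h 0 = - 1 / (2 * of_real pi * \<i>)" by (simp add: h_def divide_simps power2_eq_square)
  have e: "(ex has_field_derivative 2 * of_real pi * \<i>) (at 0)"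
    unfolding ex_def by (auto intro!: derivative_eq_intros)
  show ?thesis unfolding kh
    by (rule derivative_eq_intros e h' refl | simp add: h0)+
qed

text \<open>Both sides have the same zeros and the same quasi-periods, so Liouville's theorem applies to
  their quotient.\<close>

lemma kappa_inversion:
  assumes \<tau>: "Im \<tau> > 0"
  shows "\<tau> * exp (- (of_real pi * \<i> * z\<^sup>2 / \<tau>)) * kappa (z / \<tau>) (- 1 / \<tau>) = kappa z \<tau>"
proof -
  define \<tau>' where "\<tau>' = - 1 / \<tau>"
  have [simp]: "\<tau> \<noteq> 0" using \<tau> by auto
  have \<tau>': "Im \<tau>' > 0"
    using \<tau> by (simp add: \<tau>'_def Im_divide divide_neg_pos sum_power2_gt_zero_iff)
  define g where "g = (\<lambda>z. \<tau> * exp (- (of_real pi * \<i> * z\<^sup>2 / \<tau>)) * kappa (z / \<tau>) \<tau>')"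
  define k where "k = (\<lambda>z. kappa z \<tau>)"
  have g_hol: "g holomorphic_on UNIV" unfolding g_def
    using \<tau>' by (intro holomorphic_intros kappa_holomorphic) auto
  have k_hol: "k holomorphic_on UNIV" unfolding k_def
    using \<tau> by (intro holomorphic_intros kappa_holomorphic) auto
  have g1: "g (z + 1) = - g z" for z
  proof -
    have "kappa ((z + 1) / \<tau>) \<tau>' = kappa (z / \<tau> - \<tau>') \<tau>'" by (simp add: \<tau>'_def field_simps)
    also have "\<dots> = - exp (of_real pi * \<i> * (2 * (z / \<tau>) - \<tau>')) * kappa (z / \<tau>) \<tau>'"
      by (rule kappa_minus_tau[OF \<tau>'])
    finally have *: "kappa ((z + 1) / \<tau>) \<tau>' = - exp (of_real pi * \<i> * (2 * (z / \<tau>) - \<tau>')) * kappa (z / \<tau>) \<tau>'" .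
    have "exp (- (of_real pi * \<i> * (z + 1)\<^sup>2 / \<tau>)) * exp (of_real pi * \<i> * (2 * (z / \<tau>) - \<tau>')) =
        exp (- (of_real pi * \<i> * z\<^sup>2 / \<tau>))"
      unfolding exp_add[symmetric] by (rule arg_cong[of _ _ exp]) (simp add: \<tau>'_def field_simps power2_eq_square)
    thus ?thesis unfolding g_def * by (simp add: mult_ac)
  qed
  have k1: "k (z + 1) = - k z" for z by (simp add: k_def kappa_plus_1)
  have g2: "g (z + \<tau>) = - exp (- (of_real pi * \<i> * (\<tau> + 2 * z))) * g z" for z
  proof -
    have "(z + \<tau>) / \<tau> = z / \<tau> + 1" by (simp add: field_simps)
    moreover have "exp (- (of_real pi * \<i> * (z + \<tau>)\<^sup>2 / \<tau>)) =
        exp (- (of_real pi * \<i> * (\<tau> + 2 * z))) * exp (- (of_real pi * \<i> * z\<^sup>2 / \<tau>))"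
      unfolding exp_add[symmetric] by (rule arg_cong[of _ _ exp]) (simp add: field_simps power2_eq_square)
    ultimately show ?thesis by (simp add: g_def kappa_plus_1)
  qed
  have k2: "k (z + \<tau>) = - exp (- (of_real pi * \<i> * (\<tau> + 2 * z))) * k z" for z
    unfolding k_def by (rule kappa_plus_tau[OF \<tau>])
  have g0_iff: "g z = 0 \<longleftrightarrow> k z = 0" for z
  proof -
    have "z / \<tau> = of_int m * \<tau>' + of_int n \<longleftrightarrow> z = of_int n * \<tau> + of_int (- m)" for m n :: int
      by (simp add: \<tau>'_def field_simps)
    hence "(\<exists>m n::int. z / \<tau> = of_int m * \<tau>' + of_int n) \<longleftrightarrow> (\<exists>m n::int. z = of_int m * \<tau> + of_int n)"
      by (metis minus_minus)
    thus ?thesis using kappa_eq_0_iff[OF \<tau>'] kappa_eq_0_iff[OF \<tau>] by (simp add: g_def k_def)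
  qed
  \<comment> \<open>Both functions have simple zeros, at 0 with the same derivative 1; by
    periodicity 1 is the value that makes the quotient continuous at every lattice point.\<close>
  define h where "h = (\<lambda>z. if k z = 0 then 1 else g z / k z)"
  have h1: "h (z + 1) = h z" and h2: "h (z + \<tau>) = h z" for z
    by (simp_all add: h_def g1 g2 k1 k2)
  have h1n: "h (z + of_nat n) = h z" for z n
    by (induction n) (simp_all add: h1 add.assoc[symmetric] add.commute[of 1])
  have h2n: "h (z + of_nat n * \<tau>) = h z" for z n
  proof (induction n)
    case (Suc n)
    have "z + of_nat (Suc n) * \<tau> = (z + of_nat n * \<tau>) + \<tau>" by (simp add: algebra_simps)
    thus ?case using Suc h2 by metis
  qed simp
  have h1i: "h (z + of_int n) = h z" for z n
    using h1n[of z "nat n"] h1n[of "z + of_int n" "nat (-n)"] by (cases "n \<ge> 0") auto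
  have h2i: "h (z + of_int n * \<tau>) = h z" for z n
    using h2n[of z "nat n"] h2n[of "z + of_int n * \<tau>" "nat (-n)"] by (cases "n \<ge> 0") auto
  have k0: "k 0 = 0" unfolding k_def using kappa_eq_0_iff[OF \<tau>, of 0] by (metis add_0 mult_zero_left of_int_0)
  hence g0: "g 0 = 0" using g0_iff by simp
  have kd: "(k has_field_derivative 1) (at 0)" unfolding k_def by (rule kappa_deriv_0[OF \<tau>])
  have gd: "(g has_field_derivative 1) (at 0)"
  proof -
    have "((\<lambda>z. kappa z \<tau>') has_field_derivative 1) (at (0 / \<tau>))" using kappa_deriv_0[OF \<tau>'] by simp
    hence "((\<lambda>z. kappa (z / \<tau>) \<tau>') has_field_derivative 1 * (1 / \<tau>)) (at 0)"
      by (rule DERIV_chain2) (auto intro!: derivative_eq_intros)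
    moreover have "kappa 0 \<tau>' = 0" using kappa_eq_0_iff[OF \<tau>', of 0] by (metis add_0 mult_zero_left of_int_0)
    ultimately show ?thesis unfolding g_def
      by (auto intro!: derivative_eq_intros)
  qed
  \<comment> \<open>\<open>G\<close> and \<open>K\<close> are \<open>g\<close> and \<open>k\<close>
    divided by z, so near 0 the quotient equals \<open>G / K\<close> with a nonvanishing
    denominator.\<close>
  define G K where "G = (\<lambda>z. if z = 0 then deriv g 0 else (g z - g 0) / (z - 0))"
    and "K = (\<lambda>z. if z = 0 then deriv k 0 else (k z - k 0) / (z - 0))"
  have GK: "G holomorphic_on UNIV" "K holomorphic_on UNIV"
    unfolding G_def K_def by (intro pole_lemma_open g_hol k_hol open_UNIV)+
  have GK0: "G 0 = 1" "K 0 = 1" using gd kd by (simp_all add: G_def K_def DERIV_imp_deriv)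
  have h_fd: "h field_differentiable (at z)" for z
  proof -
    have at0: "h field_differentiable (at 0)"
    proof -
      have "open {z. K z \<noteq> 0}"
        using open_Collect_neq holomorphic_on_imp_continuous_on[OF GK(2)] continuous_on_const by blast
      moreover have "(\<lambda>z. G z / K z) holomorphic_on {z. K z \<noteq> 0}"
        using GK by (intro holomorphic_intros) (auto intro: holomorphic_on_subset)
      ultimately have "(\<lambda>z. G z / K z) field_differentiable (at 0)"
        using GK0 holomorphic_on_imp_differentiable_at by fastforce
      moreover have "\<forall>\<^sub>F z in nhds 0. z \<in> {z. K z \<noteq> 0}"
        using \<open>open {z. K z \<noteq> 0}\<close> GK0 by (intro eventually_nhds_in_open) auto
      hence "\<forall>\<^sub>F z in nhds 0. G z / K z = h z"
        by eventually_elim (use GK0 in \<open>auto simp: h_def G_def K_def k0 g0\<close>)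
      ultimately show ?thesis
        unfolding field_differentiable_def
        using DERIV_cong_ev[OF refl _ refl, of "\<lambda>z. G z / K z" h 0] by auto
    qed
    show ?thesis
    proof (cases "k z = 0")
      case True
      then obtain m n :: int where z: "z = of_int m * \<tau> + of_int n"
        using kappa_eq_0_iff[OF \<tau>] by (auto simp: k_def)
      \<comment> \<open>Periodicity carries differentiability from 0 to the lattice point z.\<close>
      have "h = h \<circ> (\<lambda>w. w + (- z))"
      proof
        fix w
        have "w = (w - z) + of_int m * \<tau> + of_int n" by (simp add: z)
        thus "h w = (h \<circ> (\<lambda>w. w + (- z))) w" using h1i h2i by (metis comp_apply diff_conv_add_uminus)
      qed
      moreover have "h \<circ> (\<lambda>w. w + (- z)) field_differentiable (at z)"
        using at0 by (intro field_differentiable_compose field_differentiable_add field_differentiable_ident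
            field_differentiable_const) auto
      ultimately show ?thesis by simp
    next
      case False
      have "open {z. k z \<noteq> 0}"
        using open_Collect_neq holomorphic_on_imp_continuous_on[OF k_hol] continuous_on_const by blast
      moreover have "h holomorphic_on {z. k z \<noteq> 0} \<longleftrightarrow> (\<lambda>z. g z / k z) holomorphic_on {z. k z \<noteq> 0}"
        by (rule holomorphic_cong) (auto simp: h_def)
      moreover have "(\<lambda>z. g z / k z) holomorphic_on {z. k z \<noteq> 0}"
        using g_hol k_hol by (intro holomorphic_intros) (auto intro: holomorphic_on_subset)
      ultimately show ?thesis using False holomorphic_on_imp_differentiable_at by fastforce
    qed
  qed
  hence h_hol: "h holomorphic_on UNIV" by (simp add: holomorphic_on_def)
  \<comment> \<open>Every value is taken on the closed period parallelogram, which is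
    compact.\<close>
  have "range h \<subseteq> h ` ((\<lambda>p. of_real (fst p) + of_real (snd p) * \<tau>) ` (cbox 0 1 \<times> cbox 0 1 :: (real \<times> real) set))"
  proof safe
    fix z
    define t where "t = Im z / Im \<tau>"
    define s where "s = Re (z - of_real t * \<tau>)"
    have "z = of_real s + of_real t * \<tau>"
      using \<tau> by (simp add: s_def t_def complex_eq_iff)
    also have "\<dots> = (of_real (frac s) + of_real (frac t) * \<tau>) + of_int \<lfloor>s\<rfloor> + of_int \<lfloor>t\<rfloor> * \<tau>"
      by (simp add: frac_def algebra_simps)
    finally have "h z = h (of_real (frac s) + of_real (frac t) * \<tau>)" using h1i h2i by metis
    moreover have "(frac s, frac t) \<in> cbox 0 1 \<times> cbox 0 1"
      by (simp add: frac_ge_0 less_imp_le frac_lt_1)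
    ultimately show "h z \<in> h ` ((\<lambda>p. of_real (fst p) + of_real (snd p) * \<tau>) ` (cbox 0 1 \<times> cbox 0 1))"
      by (metis (no_types, lifting) fst_conv imageI snd_conv)
  qed
  moreover have "compact (h ` ((\<lambda>p. of_real (fst p) + of_real (snd p) * \<tau>) ` (cbox 0 1 \<times> cbox 0 1 :: (real \<times> real) set)))"
    using holomorphic_on_imp_continuous_on[OF h_hol]
    by (intro compact_continuous_image compact_Times continuous_intros) (auto intro: continuous_on_subset)
  ultimately have "bounded (range h)" using compact_imp_bounded bounded_subset by blast
  hence "h constant_on UNIV" using h_hol Liouville_theorem by blast
  hence "h z = h 0" by (auto simp: constant_on_def)
  hence "h z = 1" by (simp add: h_def k0)
  hence "g z = k z" using g0_iff by (auto simp: h_def split: if_splits)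
  thus ?thesis by (simp add: g_def k_def \<tau>'_def)
qed

no_notation fps_nth (infixl "$" 75)
no_notation Exact_Sequence.exact_seq_arrow ("(3_ / \<longlongrightarrow>\<index> _)" [1000, 60])

section \<open>The modular group and Klein forms\<close>

definition mat2 :: "int \<Rightarrow> int \<Rightarrow> int \<Rightarrow> int \<Rightarrow> int^2^2" where
  "mat2 a b c d = vector [vector [a, b], vector [c, d]]"

lemma mat2_nth [simp]:
  "mat2 a b c d $ 1 $ 1 = a" "mat2 a b c d $ 1 $ 2 = b"
  "mat2 a b c d $ 2 $ 1 = c" "mat2 a b c d $ 2 $ 2 = d"
  by (simp_all add: mat2_def)

lemma vec_eq_iff_2: "(x :: 'a^2) = y \<longleftrightarrow> x $ 1 = y $ 1 \<and> x $ 2 = y $ 2"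
  by (simp add: vec_eq_iff forall_2)

lemma mat2_eq_iff: "(A :: int^2^2) = B \<longleftrightarrow> A $ 1 $ 1 = B $ 1 $ 1 \<and> A $ 1 $ 2 = B $ 1 $ 2 \<and>
    A $ 2 $ 1 = B $ 2 $ 1 \<and> A $ 2 $ 2 = B $ 2 $ 2"
  by (simp only: vec_eq_iff_2 conj_assoc)

lemma mult_nth2:
  fixes A B :: "'a::comm_semiring_1^2^2"
  shows "(A ** B) $ i $ j = A $ i $ 1 * B $ 1 $ j + A $ i $ 2 * B $ 2 $ j"
  by (simp add: matrix_matrix_mult_def sum_2)

lemma mat_1_nth2 [simp]:
  "(mat 1 :: 'a::comm_semiring_1^2^2) $ 1 $ 1 = 1" "(mat 1 :: 'a^2^2) $ 1 $ 2 = 0"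
  "(mat 1 :: 'a^2^2) $ 2 $ 1 = 0" "(mat 1 :: 'a^2^2) $ 2 $ 2 = 1"
  by (simp_all add: mat_def)

definition Tm :: "int \<Rightarrow> int^2^2" where "Tm n = mat2 1 n 0 1"
definition Sm :: "int^2^2" where "Sm = mat2 0 (-1) 1 0"
definition inv2 :: "int^2^2 \<Rightarrow> int^2^2" where
  "inv2 \<gamma> = mat2 (\<gamma> $ 2 $ 2) (- \<gamma> $ 1 $ 2) (- \<gamma> $ 2 $ 1) (\<gamma> $ 1 $ 1)"

lemma SL2Z_iff: "\<gamma> \<in> SL2Z \<longleftrightarrow> \<gamma> $ 1 $ 1 * \<gamma> $ 2 $ 2 - \<gamma> $ 1 $ 2 * \<gamma> $ 2 $ 1 = 1"
  by (simp add: SL2Z_def det_2)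

lemma SL2Z_mult: "\<gamma> \<in> SL2Z \<Longrightarrow> \<delta> \<in> SL2Z \<Longrightarrow> \<gamma> ** \<delta> \<in> SL2Z"
  by (simp add: SL2Z_def det_mul)

lemma SL2Z_simps [simp]: "mat 1 \<in> SL2Z" "Tm n \<in> SL2Z" "Sm \<in> SL2Z" "inv2 \<gamma> \<in> SL2Z \<longleftrightarrow> \<gamma> \<in> SL2Z"
  "- \<gamma> \<in> SL2Z \<longleftrightarrow> \<gamma> \<in> SL2Z"
  by (auto simp: SL2Z_iff Tm_def Sm_def inv2_def mult_ac)

lemma inv2_mult: "\<gamma> \<in> SL2Z \<Longrightarrow> inv2 \<gamma> ** \<gamma> = mat 1" "\<gamma> \<in> SL2Z \<Longrightarrow> \<gamma> ** inv2 \<gamma> = mat 1"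
  by (auto simp: mat2_eq_iff mult_nth2 inv2_def SL2Z_iff algebra_simps)

text \<open>Euclid's algorithm on the first column: division with remainder followed by inversion
  decreases the lower left entry. Arbitrary integers are allowed in \<open>Tm n\<close>, and
  \<open>- mat 1\<close> is \<open>Sm ** Sm\<close>, so no inverses of generators occur. Generators
  stand on the left, the side on which \<open>t (modular_action \<gamma> \<tau>)\<close> can be
  unfolded by the laws of \<open>t\<close>.\<close>

lemma SL2Z_induct [consumes 1, case_names one T S]:
  assumes "\<gamma> \<in> SL2Z" and "P (mat 1)"
    and T: "\<And>n \<gamma>. \<gamma> \<in> SL2Z \<Longrightarrow> P \<gamma> \<Longrightarrow> P (Tm n ** \<gamma>)"
    and S: "\<And>\<gamma>. \<gamma> \<in> SL2Z \<Longrightarrow> P \<gamma> \<Longrightarrow> P (Sm ** \<gamma>)"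
  shows "P \<gamma>"
  using assms(1)
proof (induction "nat \<bar>\<gamma> $ 2 $ 1\<bar>" arbitrary: \<gamma> rule: less_induct)
  case less
  define a b c d where "a = \<gamma> $ 1 $ 1" "b = \<gamma> $ 1 $ 2" "c = \<gamma> $ 2 $ 1" "d = \<gamma> $ 2 $ 2"
  note abcd = this
  have det: "a * d - b * c = 1" using less.prems by (simp add: SL2Z_iff abcd)
  show ?case
  proof (cases "c = 0")
    case True
    hence "a * d = 1" using det by simp
    hence "a = 1 \<and> d = 1 \<or> a = -1 \<and> d = -1" by (simp add: zmult_eq_1_iff)
    thus ?thesis
    proof
      assume "a = 1 \<and> d = 1"
      hence "\<gamma> = Tm b ** mat 1" using True abcd by (simp add: mat2_eq_iff Tm_def)
      thus ?thesis using T[OF SL2Z_simps(1) assms(2), of b] by (simp only:)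
    next
      assume "a = -1 \<and> d = -1"
      hence "\<gamma> = Tm (- b) ** (Sm ** (Sm ** mat 1))"
        using True abcd by (simp add: mat2_eq_iff mult_nth2 Tm_def Sm_def)
      thus ?thesis using T S assms(2) SL2Z_mult SL2Z_simps by metis
    qed
  next
    case False
    define n r where "n = a div c" and "r = a mod c"
    \<comment> \<open>This is \<open>S^(-1) T^(-n) \<gamma>\<close>.\<close>
    define \<delta> where "\<delta> = mat2 c d (- r) (n * d - b)"
    have a: "a = n * c + r" by (simp add: n_def r_def)
    have "\<delta> \<in> SL2Z" using det by (simp add: \<delta>_def SL2Z_iff a algebra_simps)
    moreover have "\<bar>r\<bar> < \<bar>c\<bar>" using False by (simp add: r_def abs_mod_less)
    hence "nat \<bar>\<delta> $ 2 $ 1\<bar> < nat \<bar>\<gamma> $ 2 $ 1\<bar>" by (simp add: \<delta>_def abcd[symmetric])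
    ultimately have "P \<delta>" using less.hyps by blast
    moreover have "\<gamma> = Tm n ** (Sm ** \<delta>)"
      by (simp add: mat2_eq_iff mult_nth2 Tm_def Sm_def \<delta>_def abcd[symmetric] a)
    ultimately show ?thesis using T S \<open>\<delta> \<in> SL2Z\<close> SL2Z_mult SL2Z_simps by metis
  qed
qed

definition jf :: "int^2^2 \<Rightarrow> complex \<Rightarrow> complex" where
  "jf \<gamma> \<tau> = of_int (\<gamma> $ 2 $ 1) * \<tau> + of_int (\<gamma> $ 2 $ 2)"

abbreviation "\<H> \<equiv> upper_half_plane"

lemma UHP_iff: "\<tau> \<in> \<H> \<longleftrightarrow> Im \<tau> > 0"
  by (simp add: upper_half_plane_def)

lemma open_UHP [simp]: "open \<H>" and connected_UHP: "connected \<H>"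
  unfolding upper_half_plane_def
  by (auto simp: open_halfspace_Im_gt intro!: convex_connected convex_halfspace_Im_gt)

lemma jf_nonzero:
  assumes "\<gamma> \<in> SL2Z" "\<tau> \<in> \<H>"
  shows "jf \<gamma> \<tau> \<noteq> 0"
proof
  assume *: "jf \<gamma> \<tau> = 0"
  hence "Im (jf \<gamma> \<tau>) = 0" by simp
  hence c: "\<gamma> $ 2 $ 1 = 0" using assms(2) by (simp add: jf_def UHP_iff)
  hence "\<gamma> $ 2 $ 2 = 0" using * by (simp add: jf_def)
  thus False using c assms(1) by (simp add: SL2Z_iff)
qed

lemma modular_action_altdef:
  "modular_action \<gamma> \<tau> = (of_int (\<gamma> $ 1 $ 1) * \<tau> + of_int (\<gamma> $ 1 $ 2)) / jf \<gamma> \<tau>"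
  by (simp add: modular_action_def jf_def)

lemma Im_modular_action:
  assumes "\<gamma> \<in> SL2Z"
  shows "Im (modular_action \<gamma> \<tau>) = Im \<tau> / (cmod (jf \<gamma> \<tau>))\<^sup>2"
proof -
  have "Im (modular_action \<gamma> \<tau>) = of_int (\<gamma> $ 1 $ 1 * \<gamma> $ 2 $ 2 - \<gamma> $ 1 $ 2 * \<gamma> $ 2 $ 1) * Im \<tau> / (cmod (jf \<gamma> \<tau>))\<^sup>2"
    by (simp add: modular_action_altdef Im_divide cmod_power2)
       (simp add: jf_def algebra_simps add_divide_distrib diff_divide_distrib)
  also have "\<gamma> $ 1 $ 1 * \<gamma> $ 2 $ 2 - \<gamma> $ 1 $ 2 * \<gamma> $ 2 $ 1 = 1" using assms by (simp add: SL2Z_iff)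
  finally show ?thesis by simp
qed

lemma modular_action_UHP [simp]: "\<gamma> \<in> SL2Z \<Longrightarrow> \<tau> \<in> \<H> \<Longrightarrow> modular_action \<gamma> \<tau> \<in> \<H>"
  using jf_nonzero[of \<gamma> \<tau>] by (simp add: UHP_iff Im_modular_action)

lemma jf_mult:
  assumes "\<delta> \<in> SL2Z" "\<tau> \<in> \<H>"
  shows "jf (\<gamma> ** \<delta>) \<tau> = jf \<gamma> (modular_action \<delta> \<tau>) * jf \<delta> \<tau>"
proof -
  have "jf \<gamma> (modular_action \<delta> \<tau>) * jf \<delta> \<tau> =
      of_int (\<gamma> $ 2 $ 1) * (modular_action \<delta> \<tau> * jf \<delta> \<tau>) + of_int (\<gamma> $ 2 $ 2) * jf \<delta> \<tau>"
    by (simp add: jf_def[of \<gamma>] algebra_simps)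
  also have "modular_action \<delta> \<tau> * jf \<delta> \<tau> = of_int (\<delta> $ 1 $ 1) * \<tau> + of_int (\<delta> $ 1 $ 2)"
    using jf_nonzero[OF assms] by (simp add: modular_action_altdef)
  finally show ?thesis by (simp add: jf_def mult_nth2 algebra_simps)
qed

lemma modular_action_mult:
  assumes "\<gamma> \<in> SL2Z" "\<delta> \<in> SL2Z" "\<tau> \<in> \<H>"
  shows "modular_action (\<gamma> ** \<delta>) \<tau> = modular_action \<gamma> (modular_action \<delta> \<tau>)"
proof -
  define w where "w = modular_action \<delta> \<tau>"
  have nz: "jf \<delta> \<tau> \<noteq> 0" "jf \<gamma> w \<noteq> 0" using jf_nonzero assms by (simp_all add: w_def)
  have w: "w * jf \<delta> \<tau> = of_int (\<delta> $ 1 $ 1) * \<tau> + of_int (\<delta> $ 1 $ 2)"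
    using nz by (simp add: modular_action_altdef w_def)
  have "(of_int (\<gamma> $ 1 $ 1) * w + of_int (\<gamma> $ 1 $ 2)) * jf \<delta> \<tau> =
      of_int (\<gamma> $ 1 $ 1) * (w * jf \<delta> \<tau>) + of_int (\<gamma> $ 1 $ 2) * jf \<delta> \<tau>"
    by (simp add: algebra_simps)
  also have "\<dots> = of_int ((\<gamma> ** \<delta>) $ 1 $ 1) * \<tau> + of_int ((\<gamma> ** \<delta>) $ 1 $ 2)"
    unfolding w by (simp add: jf_def mult_nth2 algebra_simps)
  finally have "of_int ((\<gamma> ** \<delta>) $ 1 $ 1) * \<tau> + of_int ((\<gamma> ** \<delta>) $ 1 $ 2) =
      (of_int (\<gamma> $ 1 $ 1) * w + of_int (\<gamma> $ 1 $ 2)) * jf \<delta> \<tau>" by simp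
  hence "modular_action (\<gamma> ** \<delta>) \<tau> =
      (of_int (\<gamma> $ 1 $ 1) * w + of_int (\<gamma> $ 1 $ 2)) * jf \<delta> \<tau> / (jf \<gamma> w * jf \<delta> \<tau>)"
    unfolding modular_action_altdef[of "\<gamma> ** \<delta>"] jf_mult[OF assms(2,3)] w_def[symmetric] by simp
  also have "\<dots> = modular_action \<gamma> w" using nz by (simp add: modular_action_altdef)
  finally show ?thesis by (simp add: w_def)
qed

lemma modular_action_simps [simp]:
  "modular_action (mat 1) \<tau> = \<tau>" "modular_action (Tm n) \<tau> = \<tau> + of_int n"
  "modular_action Sm \<tau> = - 1 / \<tau>" "modular_action (- \<gamma>) \<tau> = modular_action \<gamma> \<tau>"
proof -
  show "modular_action (- \<gamma>) \<tau> = modular_action \<gamma> \<tau>"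
  proof -
    have "modular_action (- \<gamma>) \<tau> =
        (- (of_int (\<gamma> $ 1 $ 1) * \<tau> + of_int (\<gamma> $ 1 $ 2))) / (- (of_int (\<gamma> $ 2 $ 1) * \<tau> + of_int (\<gamma> $ 2 $ 2)))"
      by (simp add: modular_action_def)
    thus ?thesis by (simp only: minus_divide_divide modular_action_def)
  qed
qed (simp_all add: modular_action_def Tm_def Sm_def)

lemma modular_action_inv [simp]:
  assumes "\<gamma> \<in> SL2Z" "\<tau> \<in> \<H>"
  shows "modular_action (inv2 \<gamma>) (modular_action \<gamma> \<tau>) = \<tau>" "modular_action \<gamma> (modular_action (inv2 \<gamma>) \<tau>) = \<tau>"
  using modular_action_mult[of "inv2 \<gamma>" \<gamma> \<tau>] modular_action_mult[of \<gamma> "inv2 \<gamma>" \<tau>] assms inv2_mult by simp_all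

lemma modular_action_holomorphic: "\<gamma> \<in> SL2Z \<Longrightarrow> modular_action \<gamma> holomorphic_on \<H>"
  unfolding modular_action_altdef jf_def
  using jf_nonzero[of \<gamma>] by (intro holomorphic_intros) (auto simp: jf_def)

lemma holomorphic_compose_action:
  assumes "f holomorphic_on \<H>" "\<gamma> \<in> SL2Z"
  shows "(\<lambda>\<tau>. f (modular_action \<gamma> \<tau>)) holomorphic_on \<H>"
  using holomorphic_on_compose_gen[OF modular_action_holomorphic[OF assms(2)] assms(1)] assms(2)
  by (auto simp: o_def image_subset_iff)

section \<open>The Klein forms and their transformation laws\<close>

definition epx :: "complex \<Rightarrow> complex" where "epx z = exp (of_real pi * \<i> * z)"

lemma epx_add: "epx (a + b) = epx a * epx b"
  and epx_minus: "epx (- a) = inverse (epx a)"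
  and epx_diff: "epx (a - b) = epx a / epx b"
  and epx_nonzero [simp]: "epx a \<noteq> 0" and epx_0 [simp]: "epx 0 = 1" and epx_1 [simp]: "epx 1 = -1"
  by (simp_all add: epx_def ring_distribs exp_add exp_diff exp_minus exp_pi_i)

lemma epx_even [simp]: "epx (2 * of_int n) = 1"
  using ex_of_int[of n] by (simp add: epx_def ex_def mult_ac)

lemma epx_eq_1: "2 dvd n \<Longrightarrow> epx (of_int n) = 1"
  using epx_even by (auto elim!: dvdE)

lemma epx_1_minus: "epx (1 - w) = - exp (- (of_real pi * \<i> * w))"
proof -
  have "epx (1 - w) = - epx (- w)" using epx_add[of 1 "- w"] by simp
  thus ?thesis by (simp add: epx_def)
qed

lemma kappa_plus_int: "kappa (z + of_int n) \<tau> = epx (of_int n) * kappa z \<tau>"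
proof -
  have nat: "kappa (z + of_nat n) \<tau> = epx (of_nat n) * kappa z \<tau>" for z n
  proof (induction n)
    case (Suc n)
    have "kappa (z + of_nat (Suc n)) \<tau> = kappa ((z + of_nat n) + 1) \<tau>" by (simp add: add_ac)
    thus ?case unfolding kappa_plus_1 Suc by (simp add: epx_add)
  qed simp
  show ?thesis
  proof (cases "n \<ge> 0")
    case True thus ?thesis using nat[of z "nat n"] by simp
  next
    case False
    thus ?thesis using nat[of "z + of_int n" "nat (-n)"] by (simp add: epx_minus)
  qed
qed

text \<open>Iterating the single shift sums an arithmetic progression in the exponent, which
  produces the square of m. Negative m follows from the positive case applied at the shifted
  point.\<close>

lemma kappa_plus_int_tau:
  assumes "Im \<tau> > 0"
  shows "kappa (z + of_int m * \<tau>) \<tau> = epx (of_int m - of_int m ^ 2 * \<tau> - 2 * of_int m * z) * kappa z \<tau>"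
proof -
  have nat: "kappa (z + of_nat m * \<tau>) \<tau> = epx (of_nat m - of_nat m ^ 2 * \<tau> - 2 * of_nat m * z) * kappa z \<tau>" for z m
  proof (induction m)
    case (Suc m)
    have "kappa (z + of_nat (Suc m) * \<tau>) \<tau> = kappa ((z + of_nat m * \<tau>) + \<tau>) \<tau>" by (simp add: algebra_simps)
    also have "\<dots> = epx (1 - (\<tau> + 2 * (z + of_nat m * \<tau>))) * kappa (z + of_nat m * \<tau>) \<tau>"
      unfolding kappa_plus_tau[OF assms] epx_1_minus ..
    also have "\<dots> = (epx (1 - (\<tau> + 2 * (z + of_nat m * \<tau>))) * epx (of_nat m - of_nat m ^ 2 * \<tau> - 2 * of_nat m * z)) * kappa z \<tau>"
      unfolding Suc by simp
    also have "epx (1 - (\<tau> + 2 * (z + of_nat m * \<tau>))) * epx (of_nat m - of_nat m ^ 2 * \<tau> - 2 * of_nat m * z) =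
        epx (of_nat (Suc m) - of_nat (Suc m) ^ 2 * \<tau> - 2 * of_nat (Suc m) * z)"
      unfolding epx_add[symmetric] by (rule arg_cong[of _ _ epx]) (simp add: algebra_simps power2_eq_square)
    finally show ?case .
  qed simp
  show ?thesis
  proof (cases "m \<ge> 0")
    case True thus ?thesis using nat[of z "nat m"] by simp
  next
    case False
    define k where "k = nat (-m)"
    have m: "m = - int k" using False by (simp add: k_def)
    have "epx (of_int m - of_int m ^ 2 * \<tau> - 2 * of_int m * z) * epx (of_nat k - of_nat k ^ 2 * \<tau> - 2 * of_nat k * (z + of_int m * \<tau>)) = epx (2 * of_int 0)"
      unfolding epx_add[symmetric] by (rule arg_cong[of _ _ epx]) (simp add: m algebra_simps power2_eq_square)
    thus ?thesis using nat[of "z + of_int m * \<tau>" k] by (simp add: m)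
  qed
qed

text \<open>The Klein form \<open>k\<^sub>a\<close> with \<open>a = (r, s)\<close>.\<close>

definition kl :: "real \<Rightarrow> real \<Rightarrow> complex \<Rightarrow> complex" where
  "kl r s \<tau> = epx (of_real r * (of_real r * \<tau> + of_real s)) * kappa (of_real r * \<tau> + of_real s) \<tau>"

text \<open>Since \<open>kappa\<close> depends on \<tau> only through \<open>ex \<tau>\<close>, an
  integer shift acts through \<open>r \<tau> + s\<close> alone.\<close>

lemma kl_T: "kl r s (\<tau> + of_int n) = kl r (s + r * of_int n) \<tau>"
proof -
  have "kappa z (\<tau> + of_int n) = kappa z \<tau>" for z by (simp add: kappa_def ex_add)
  thus ?thesis by (simp add: kl_def algebra_simps)
qed

text \<open>The exponential prefactor of \<open>kl\<close> is there for this law: it completes the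
  square and absorbs the Gaussian of \<open>kappa_inversion\<close>, leaving only the factor
  1/\<tau>.\<close>

lemma kl_S:
  assumes "\<tau> \<in> \<H>"
  shows "kl r s (- 1 / \<tau>) = kl s (- r) \<tau> / \<tau>"
proof -
  have \<tau>: "Im \<tau> > 0" and [simp]: "\<tau> \<noteq> 0" using assms by (auto simp: UHP_iff)
  define z where "z = of_real s * \<tau> - of_real r"
  have z: "of_real r * (- 1 / \<tau>) + of_real s = z / \<tau>" by (simp add: z_def field_simps)
  have "kappa z \<tau> = \<tau> * epx (- (z\<^sup>2 / \<tau>)) * kappa (z / \<tau>) (- 1 / \<tau>)"
    using kappa_inversion[OF \<tau>, of z] by (simp add: epx_def mult_ac)
  hence "kl s (- r) \<tau> = \<tau> * (epx (of_real s * z) * epx (- (z\<^sup>2 / \<tau>))) * kappa (z / \<tau>) (- 1 / \<tau>)"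
    by (simp add: kl_def z_def)
  also have "epx (of_real s * z) * epx (- (z\<^sup>2 / \<tau>)) = epx (of_real r * (z / \<tau>))"
    unfolding epx_add[symmetric] by (rule arg_cong[of _ _ epx]) (simp add: z_def field_simps power2_eq_square)
  finally show ?thesis by (simp add: kl_def z[symmetric])
qed

text \<open>Verified on the generators: \<open>Tm n\<close> and \<open>Sm\<close> act on the row
  vector (r, s) by multiplication from the right, and the cocycle rule \<open>jf_mult\<close>
  collects the factors. The parameters stay arbitrary in the induction because each generator
  changes them.\<close>

lemma kl_action:
  assumes "\<gamma> \<in> SL2Z" "\<tau> \<in> \<H>"
  shows "kl r s (modular_action \<gamma> \<tau>) =
    kl (r * of_int (\<gamma> $ 1 $ 1) + s * of_int (\<gamma> $ 2 $ 1)) (r * of_int (\<gamma> $ 1 $ 2) + s * of_int (\<gamma> $ 2 $ 2)) \<tau> / jf \<gamma> \<tau>"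
  using assms(1)
proof (induction arbitrary: r s rule: SL2Z_induct)
  case one
  show ?case by (simp add: jf_def)
next
  case (T n \<gamma>)
  have "jf (Tm n ** \<gamma>) \<tau> = jf \<gamma> \<tau>" by (simp add: jf_mult T assms) (simp add: jf_def Tm_def)
  thus ?case
    by (simp add: modular_action_mult T assms(2) kl_T mult_nth2) (simp add: Tm_def algebra_simps)
next
  case (S \<gamma>)
  have "jf (Sm ** \<gamma>) \<tau> = modular_action \<gamma> \<tau> * jf \<gamma> \<tau>"
    by (simp add: jf_mult S assms) (simp add: jf_def Sm_def)
  thus ?case
    by (simp add: modular_action_mult S assms(2) kl_S[OF modular_action_UHP, simplified] mult_nth2)
       (simp add: Sm_def algebra_simps)
qed

text \<open>Combines the two quasi-periods. All terms in \<tau> cancel, and the surplus -2mn in the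
  exponent is invisible to \<open>epx\<close>; for rational r and s a root of unity remains.\<close>

lemma kl_shift:
  assumes "\<tau> \<in> \<H>"
  shows "kl (r + of_int m) (s + of_int n) \<tau> =
    epx (of_int (m + n + m * n) + of_real (r * of_int n - s * of_int m)) * kl r s \<tau>"
proof -
  define z where "z = of_real r * \<tau> + of_real s"
  have \<tau>: "Im \<tau> > 0" using assms by (simp add: UHP_iff)
  have "of_real (r + of_int m) * \<tau> + of_real (s + of_int n) = (z + of_int n) + of_int m * \<tau>"
    by (simp add: z_def algebra_simps)
  hence "kl (r + of_int m) (s + of_int n) \<tau> = epx (of_real (r + of_int m) * ((z + of_int n) + of_int m * \<tau>)) *
      (epx (of_int m - of_int m ^ 2 * \<tau> - 2 * of_int m * (z + of_int n)) * (epx (of_int n) * kappa z \<tau>))"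
    unfolding kl_def by (simp only: kappa_plus_int_tau[OF \<tau>] kappa_plus_int)
  also have "\<dots> = epx (of_real (r + of_int m) * ((z + of_int n) + of_int m * \<tau>) +
      (of_int m - of_int m ^ 2 * \<tau> - 2 * of_int m * (z + of_int n)) + of_int n) * kappa z \<tau>"
    by (simp add: epx_add)
  also have "of_real (r + of_int m) * ((z + of_int n) + of_int m * \<tau>) +
      (of_int m - of_int m ^ 2 * \<tau> - 2 * of_int m * (z + of_int n)) + of_int n =
      (of_int (m + n + m * n) + of_real (r * of_int n - s * of_int m)) + of_real r * z + 2 * of_int (- m * n)"
    by (simp add: z_def algebra_simps power2_eq_square)
  also have "epx \<dots> = epx (of_int (m + n + m * n) + of_real (r * of_int n - s * of_int m)) * epx (of_real r * z)"
    unfolding epx_add[of _ "2 * of_int (- m * n)"] epx_even by (simp add: epx_add)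
  finally show ?thesis by (simp add: kl_def z_def)
qed

lemma kl_nonzero:
  assumes "\<tau> \<in> \<H>" "\<not> (r \<in> \<int> \<and> s \<in> \<int>)"
  shows "kl r s \<tau> \<noteq> 0"
proof
  assume "kl r s \<tau> = 0"
  moreover have "Im \<tau> > 0" using assms by (simp add: UHP_iff)
  ultimately obtain m n :: int where mn: "of_real r * \<tau> + of_real s = of_int m * \<tau> + of_int n"
    using kappa_eq_0_iff[of \<tau>] by (auto simp: kl_def)
  hence "r * Im \<tau> = of_int m * Im \<tau>" by (auto simp: complex_eq_iff)
  hence "r = of_int m" using \<open>Im \<tau> > 0\<close> by simp
  moreover from this have "s = of_int n" using mn by (auto simp: complex_eq_iff)
  ultimately show False using assms(2) by simp
qed

lemma kl_holomorphic: "kl r s holomorphic_on \<H>"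
  unfolding kl_def epx_def by (intro holomorphic_intros kappa_holomorphic) (auto simp: UHP_iff)

section \<open>Products of Klein forms\<close>

text \<open>Neighbourhoods of the cusp infinity are whole half-planes, with no condition on the real
  part. The other cusps are reached by composing with elements of SL(2,Z).\<close>

definition cuspF :: "complex filter" where "cuspF = filtercomap Im at_top"

lemma eventually_cuspF: "eventually P cuspF \<longleftrightarrow> (\<exists>Y. \<forall>\<tau>. Im \<tau> > Y \<longrightarrow> P \<tau>)"
  unfolding cuspF_def eventually_filtercomap eventually_at_top_dense by blast

lemma eventually_cuspF_UHP: "eventually (\<lambda>\<tau>. \<tau> \<in> \<H>) cuspF"
  unfolding eventually_cuspF UHP_iff by auto

lemma cuspF_nontrivial [simp]: "cuspF \<noteq> bot"
proof
  assume "cuspF = bot"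
  hence "eventually (\<lambda>_. False) cuspF" by simp
  then obtain Y where "\<forall>\<tau>. Im \<tau> > Y \<longrightarrow> False" unfolding eventually_cuspF by blast
  from this[rule_format, of "Complex 0 (Y + 1)"] show False by simp
qed

lemma filterlim_Im_cuspF: "filterlim Im at_top cuspF"
  unfolding cuspF_def by (rule filterlim_filtercomap)

lemma filterlim_shift_cuspF: "filterlim (\<lambda>\<tau>. \<tau> + of_int n) cuspF cuspF"
  unfolding filterlim_iff eventually_cuspF
proof safe
  fix P Y assume "\<forall>\<tau>. Y < Im \<tau> \<longrightarrow> P \<tau>"
  thus "\<exists>Y. \<forall>\<tau>. Y < Im \<tau> \<longrightarrow> P (\<tau> + of_int n)" by (intro exI[of _ Y]) simp
qed

lemma ex_tendsto_0:
  assumes "\<alpha> > 0"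
  shows "((\<lambda>\<tau>. ex (of_real \<alpha> * \<tau> + \<beta>)) \<longlongrightarrow> 0) cuspF"
proof -
  have "filterlim (\<lambda>\<tau>. (2 * pi * \<alpha>) * Im \<tau>) at_top cuspF"
    using assms filterlim_Im_cuspF by (intro filterlim_tendsto_pos_mult_at_top[OF tendsto_const]) auto
  hence "filterlim (\<lambda>\<tau>. 2 * pi * Im \<beta> + (2 * pi * \<alpha>) * Im \<tau>) at_top cuspF"
    by (intro filterlim_tendsto_add_at_top[OF tendsto_const])
  hence "((\<lambda>\<tau>. exp (- (2 * pi * Im \<beta> + (2 * pi * \<alpha>) * Im \<tau>))) \<longlongrightarrow> 0) cuspF"
    by (intro filterlim_compose[OF exp_at_bot] filterlim_compose[OF filterlim_uminus_at_bot_at_top])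
  hence "((\<lambda>\<tau>. norm (ex (of_real \<alpha> * \<tau> + \<beta>))) \<longlongrightarrow> 0) cuspF"
    by (simp add: norm_ex algebra_simps)
  thus ?thesis by (rule tendsto_norm_zero_cancel)
qed

text \<open>The order is measured in powers of \<open>q = e\<^bsup>2\<pi>i\<tau>\<^esup>\<close>.\<close>

definition has_order :: "(complex \<Rightarrow> complex) \<Rightarrow> real \<Rightarrow> bool" where
  "has_order f \<alpha> \<longleftrightarrow> (\<exists>c. c \<noteq> 0 \<and> ((\<lambda>\<tau>. f \<tau> * ex (- (of_real \<alpha> * \<tau>))) \<longlongrightarrow> c) cuspF)"

lemma has_order_cong:
  "(\<And>\<tau>. \<tau> \<in> \<H> \<Longrightarrow> f \<tau> = g \<tau>) \<Longrightarrow> has_order f \<alpha> \<longleftrightarrow> has_order g \<alpha>"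
  unfolding has_order_def
  by (intro ex_cong1 conj_cong refl tendsto_cong eventually_mono[OF eventually_cuspF_UHP]) auto

lemma has_order_const: "c \<noteq> 0 \<Longrightarrow> has_order (\<lambda>_. c) 0"
  by (auto simp: has_order_def)

lemma has_order_mult:
  assumes "has_order f \<alpha>" "has_order g \<beta>"
  shows "has_order (\<lambda>\<tau>. f \<tau> * g \<tau>) (\<alpha> + \<beta>)"
proof -
  obtain c d where c: "c \<noteq> 0" "((\<lambda>\<tau>. f \<tau> * ex (- (of_real \<alpha> * \<tau>))) \<longlongrightarrow> c) cuspF"
    and d: "d \<noteq> 0" "((\<lambda>\<tau>. g \<tau> * ex (- (of_real \<beta> * \<tau>))) \<longlongrightarrow> d) cuspF"
    using assms by (auto simp: has_order_def)
  have "((\<lambda>\<tau>. (f \<tau> * ex (- (of_real \<alpha> * \<tau>))) * (g \<tau> * ex (- (of_real \<beta> * \<tau>)))) \<longlongrightarrow> c * d) cuspF"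
    by (intro tendsto_mult c d)
  moreover have "ex (- (of_real (\<alpha> + \<beta>) * \<tau>)) = ex (- (of_real \<alpha> * \<tau>)) * ex (- (of_real \<beta> * \<tau>))" for \<tau>
    by (simp add: ex_add[symmetric] algebra_simps)
  ultimately show ?thesis unfolding has_order_def using c d by (intro exI[of _ "c * d"]) (simp add: mult_ac)
qed

lemma ex_powi: "ex a powi n = ex (of_int n * a)"
  unfolding ex_def exp_power_int by (simp add: mult_ac)

lemma has_order_powi:
  assumes "has_order f \<alpha>"
  shows "has_order (\<lambda>\<tau>. f \<tau> powi n) (of_int n * \<alpha>)"
proof -
  obtain c where c: "c \<noteq> 0" "((\<lambda>\<tau>. f \<tau> * ex (- (of_real \<alpha> * \<tau>))) \<longlongrightarrow> c) cuspF"
    using assms by (auto simp: has_order_def)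
  have "((\<lambda>\<tau>. (f \<tau> * ex (- (of_real \<alpha> * \<tau>))) powi n) \<longlongrightarrow> c powi n) cuspF"
    by (intro tendsto_power_int c)
  moreover have "ex (- (of_real \<alpha> * \<tau>)) powi n = ex (- (of_real (of_int n * \<alpha>) * \<tau>))" for \<tau>
    by (simp add: ex_powi mult_ac)
  ultimately show ?thesis unfolding has_order_def using c
    by (intro exI[of _ "c powi n"]) (simp add: power_int_mult_distrib)
qed

lemma has_order_cmult:
  assumes "has_order f \<alpha>" "c \<noteq> 0"
  shows "has_order (\<lambda>\<tau>. c * f \<tau>) \<alpha>"
  using has_order_mult[OF has_order_const[OF assms(2)] assms(1)] by simp

text \<open>The exponentials combine to q to the power r^2/2 - r/2, and the infinite products tend
  to 1 because their arguments tend to 0. The exception is r = 0, where the factor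
  \<open>1 - ex s\<close> survives; it is nonzero as s is not an integer.\<close>

lemma kl_has_order_aux:
  assumes "0 \<le> r" "r < 1" "\<not> (r = 0 \<and> s \<in> \<int>)"
  shows "has_order (kl r s) (- (r * (1 - r) / 2))"
proof -
  define c where "c = - epx (of_real (r * s - s)) / (2 * of_real pi * \<i>)"
  have [simp]: "c \<noteq> 0" by (simp add: c_def)
  have eq: "kl r s \<tau> * ex (- (of_real (- (r * (1 - r) / 2)) * \<tau>)) =
     c * qp (ex (of_real r * \<tau> + of_real s)) (ex \<tau>) * qp (ex (of_real (1 - r) * \<tau> + (- of_real s))) (ex \<tau>) / (qp (ex \<tau>) (ex \<tau>))\<^sup>2"
    (is "?l = _") for \<tau>
  proof -
    have "epx (of_real r * (of_real r * \<tau> + of_real s)) * epx (- (of_real r * \<tau> + of_real s)) * ex (of_real (r * (1 - r) / 2) * \<tau>) = epx (of_real (r * s - s))"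
    proof -
      have "ex z = epx (2 * z)" for z by (simp add: ex_def epx_def mult_ac)
      thus ?thesis unfolding epx_add[symmetric]
        by (simp add: epx_add[symmetric]) (rule arg_cong[of _ _ epx], simp add: algebra_simps)
    qed
    moreover have "ex \<tau> / ex (of_real r * \<tau> + of_real s) = ex (of_real (1 - r) * \<tau> + (- of_real s))"
      unfolding ex_diff[symmetric] by (simp add: algebra_simps)
    moreover have "a * (- b / p * x * y / q) * e = - (a * b * e) / p * x * y / q" for a b p x y q e :: complex
      by (simp add: mult_ac)
    moreover have "kappa z \<tau> = - epx (- z) / (2 * of_real pi * \<i>) *
      qp (ex z) (ex \<tau>) * qp (ex \<tau> / ex z) (ex \<tau>) / (qp (ex \<tau>) (ex \<tau>))\<^sup>2" for z
      by (simp add: kappa_def epx_def)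
    moreover have "- (of_real (- (r * (1 - r) / 2)) * \<tau>) = of_real (r * (1 - r) / 2) * \<tau>" by simp
    ultimately show ?thesis unfolding kl_def c_def by (simp only:)
  qed
  have q: "((\<lambda>\<tau>. ex \<tau>) \<longlongrightarrow> 0) cuspF" using ex_tendsto_0[of 1 0] by simp
  have qq: "((\<lambda>\<tau>. qp (ex \<tau>) (ex \<tau>)) \<longlongrightarrow> 1) cuspF" by (rule qp_tendsto_1[OF q q])
  have q2: "((\<lambda>\<tau>. qp (ex (of_real (1 - r) * \<tau> + (- of_real s))) (ex \<tau>)) \<longlongrightarrow> 1) cuspF"
    using assms by (intro qp_tendsto_1 q ex_tendsto_0) auto
  obtain d where d: "d \<noteq> 0" "((\<lambda>\<tau>. qp (ex (of_real r * \<tau> + of_real s)) (ex \<tau>)) \<longlongrightarrow> d) cuspF"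
  proof (cases "r = 0")
    case False
    hence "((\<lambda>\<tau>. qp (ex (of_real r * \<tau> + of_real s)) (ex \<tau>)) \<longlongrightarrow> 1) cuspF"
      using assms by (intro qp_tendsto_1 q ex_tendsto_0) auto
    thus thesis using that[of 1] by simp
  next
    case True
    have "((\<lambda>\<tau>. (1 - ex (of_real s)) * qp (ex (of_real s) * ex \<tau>) (ex \<tau>)) \<longlongrightarrow> (1 - ex (of_real s)) * 1) cuspF"
      by (intro tendsto_mult tendsto_const qp_tendsto_1 q tendsto_mult_right_zero)
    moreover have "eventually (\<lambda>\<tau>. (1 - ex (of_real s)) * qp (ex (of_real s) * ex \<tau>) (ex \<tau>) =
        qp (ex (of_real r * \<tau> + of_real s)) (ex \<tau>)) cuspF"
      using eventually_cuspF_UHP by eventually_elim (simp add: True UHP_iff qp_rec[symmetric])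
    ultimately have "((\<lambda>\<tau>. qp (ex (of_real r * \<tau> + of_real s)) (ex \<tau>)) \<longlongrightarrow> (1 - ex (of_real s))) cuspF"
      using Lim_transform_eventually by fastforce
    moreover have "ex (of_real s) \<noteq> 1"
    proof
      assume "ex (of_real s) = 1"
      then obtain n :: int where "of_real s = (of_int n :: complex)" by (auto simp: ex_eq_1_iff)
      hence "s = of_int n" by (metis of_real_eq_iff of_real_of_int_eq)
      thus False using assms True by auto
    qed
    ultimately show thesis using that[of "1 - ex (of_real s)"] by simp
  qed
  have "((\<lambda>\<tau>. kl r s \<tau> * ex (- (of_real (- (r * (1 - r) / 2)) * \<tau>))) \<longlongrightarrow> c * d * 1 / 1\<^sup>2) cuspF"
    unfolding eq by (intro tendsto_intros d qq q2) auto
  thus ?thesis unfolding has_order_def using d by (intro exI[of _ "c * d"]) simp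
qed

lemma kl_has_order:
  assumes "\<not> (r \<in> \<int> \<and> s \<in> \<int>)"
  shows "has_order (kl r s) (- (frac r * (1 - frac r) / 2))"
proof -
  have 1: "has_order (\<lambda>\<tau>. epx (of_int (\<lfloor>r\<rfloor> + 0 + \<lfloor>r\<rfloor> * 0) + of_real (frac r * of_int 0 - s * of_int \<lfloor>r\<rfloor>)) * kl (frac r) s \<tau>)
      (- (frac r * (1 - frac r) / 2))"
    using assms by (intro has_order_cmult kl_has_order_aux) (auto simp: frac_ge_0 frac_lt_1 frac_eq_0_iff)
  have 2: "kl r s \<tau> = epx (of_int (\<lfloor>r\<rfloor> + 0 + \<lfloor>r\<rfloor> * 0) + of_real (frac r * of_int 0 - s * of_int \<lfloor>r\<rfloor>)) * kl (frac r) s \<tau>"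
    if "\<tau> \<in> \<H>" for \<tau>
    using kl_shift[OF that, of "frac r" "\<lfloor>r\<rfloor>" s 0] by (simp add: frac_def)
  show ?thesis using iffD2[OF has_order_cong[OF 2] 1] by simp
qed

section \<open>Orders, weights and multipliers of products of Klein forms\<close>

type_synonym kdata = "(int \<times> int \<times> int) list"

text \<open>The list records exponents: an entry \<open>(r, s, m)\<close> stands for the factor \<open>k\<^sub>a\<^sup>m\<close> with
  \<open>a = (r/N, s/N)\<close>.\<close>

definition kp :: "nat \<Rightarrow> kdata \<Rightarrow> complex \<Rightarrow> complex" where
  "kp N L \<tau> = (\<Prod>(r, s, m)\<leftarrow>L. kl (of_int r / of_nat N) (of_int s / of_nat N) \<tau> powi m)"

text \<open>A Klein form has weight -1, so this is minus the weight of the product.\<close>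

definition kwt :: "kdata \<Rightarrow> int" where "kwt L = (\<Sum>(r, s, m)\<leftarrow>L. m)"

definition kact :: "int^2^2 \<Rightarrow> kdata \<Rightarrow> kdata" where
  "kact \<gamma> L = map (\<lambda>(r, s, m). (r * \<gamma> $ 1 $ 1 + s * \<gamma> $ 2 $ 1, r * \<gamma> $ 1 $ 2 + s * \<gamma> $ 2 $ 2, m)) L"

text \<open>No parameter is integral, so no factor vanishes anywhere in the upper
  half-plane.\<close>

definition kgood :: "nat \<Rightarrow> kdata \<Rightarrow> bool" where
  "kgood N L \<longleftrightarrow> (\<forall>(r, s, m) \<in> set L. \<not> (int N dvd r \<and> int N dvd s))"

text \<open>An integer measure of the pole at infinity: the order of \<open>kp N L\<close> in q is
  \<open>- kord N L / (2 N^2)\<close>, because a Klein form has order -r(1 - r)/2 with r reduced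
  modulo 1.\<close>

definition kord :: "nat \<Rightarrow> kdata \<Rightarrow> int" where
  "kord N L = (\<Sum>(r, s, m)\<leftarrow>L. m * ((r mod int N) * (int N - r mod int N)))"

lemma kp_Nil [simp]: "kp N [] \<tau> = 1" and kp_Cons:
  "kp N ((r, s, m) # L) \<tau> = kl (of_int r / of_nat N) (of_int s / of_nat N) \<tau> powi m * kp N L \<tau>"
  by (simp_all add: kp_def)

lemma kact_simps [simp]: "kact \<gamma> [] = []" "kact \<gamma> ((r, s, m) # L) =
    (r * \<gamma> $ 1 $ 1 + s * \<gamma> $ 2 $ 1, r * \<gamma> $ 1 $ 2 + s * \<gamma> $ 2 $ 2, m) # kact \<gamma> L"
  by (simp_all add: kact_def)

lemma kgood_simps [simp]: "kgood N []" "kgood N ((r, s, m) # L) \<longleftrightarrow> \<not> (int N dvd r \<and> int N dvd s) \<and> kgood N L"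
  by (auto simp: kgood_def)

lemma kord_simps [simp]: "kord N [] = 0"
  "kord N ((r, s, m) # L) = m * ((r mod int N) * (int N - r mod int N)) + kord N L"
  by (simp_all add: kord_def)

lemma kwt_simps [simp]: "kwt [] = 0" "kwt ((r, s, m) # L) = m + kwt L"
  by (simp_all add: kwt_def)

lemma not_Ints_div:
  assumes "N > 0" "\<not> (int N dvd r \<and> int N dvd s)"
  shows "\<not> (real_of_int r / of_nat N \<in> \<int> \<and> real_of_int s / of_nat N \<in> \<int>)"
proof -
  have "int N dvd r" if "real_of_int r / of_nat N \<in> \<int>" for r
  proof -
    from that obtain k where "real_of_int r / of_nat N = of_int k" by (rule Ints_cases)
    hence "real_of_int r = of_int (int N * k)" using assms(1) by (simp add: field_simps)
    hence "r = int N * k" by (simp only: of_int_eq_iff)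
    thus ?thesis by simp
  qed
  thus ?thesis using assms by blast
qed

lemma kp_nonzero: "N > 0 \<Longrightarrow> kgood N L \<Longrightarrow> \<tau> \<in> \<H> \<Longrightarrow> kp N L \<tau> \<noteq> 0"
  by (induction L) (auto simp: kp_Cons not_Ints_div kl_nonzero)

lemma kp_holomorphic:
  assumes "N > 0" "kgood N L"
  shows "kp N L holomorphic_on \<H>"
  using assms(2)
proof (induction L)
  case Nil
  have "kp N [] = (\<lambda>_. 1)" by (rule ext) simp
  thus ?case by simp
next
  case (Cons x L)
  obtain r s m where x: "x = (r, s, m)" by (cases x) auto
  have "kp N (x # L) = (\<lambda>\<tau>. kl (of_int r / of_nat N) (of_int s / of_nat N) \<tau> powi m * kp N L \<tau>)"
    by (rule ext) (simp add: x kp_Cons)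
  moreover have "kl (of_int r / of_nat N) (of_int s / of_nat N) \<tau> \<noteq> 0" if "\<tau> \<in> \<H>" for \<tau>
    using Cons.prems by (intro kl_nonzero[OF that] not_Ints_div[OF assms(1)]) (simp add: x)
  ultimately show ?case using Cons
    by (auto simp: x intro!: holomorphic_intros kl_holomorphic)
qed

text \<open>An integral matrix of determinant 1 is invertible modulo N: its adjugate recovers r and
  s from the new parameter.\<close>

lemma kgood_kact:
  assumes "\<gamma> \<in> SL2Z" "kgood N L"
  shows "kgood N (kact \<gamma> L)"
proof -
  define a b c d where "a = \<gamma> $ 1 $ 1" "b = \<gamma> $ 1 $ 2" "c = \<gamma> $ 2 $ 1" "d = \<gamma> $ 2 $ 2"
  note abcd = this
  have det: "a * d - b * c = 1" using assms by (simp add: SL2Z_iff abcd)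
  have *: "int N dvd r \<and> int N dvd s"
    if "int N dvd r * a + s * c" "int N dvd r * b + s * d" for r s
  proof -
    have "r * (a * d - b * c) = (r * a + s * c) * d - (r * b + s * d) * c"
      "s * (a * d - b * c) = (r * b + s * d) * a - (r * a + s * c) * b" by (auto simp: algebra_simps)
    thus ?thesis using that unfolding det mult_1_right by (metis dvd_diff dvd_mult2)
  qed
  show ?thesis using assms(2) by (induction L) (auto simp: abcd[symmetric] dest: *)
qed

lemma kp_action:
  assumes "\<gamma> \<in> SL2Z" "\<tau> \<in> \<H>"
  shows "kp N L (modular_action \<gamma> \<tau>) = kp N (kact \<gamma> L) \<tau> * jf \<gamma> \<tau> powi (- kwt L)"
proof (induction L)
  case (Cons x L)
  obtain r s m where x: "x = (r, s, m)" by (cases x) auto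
  show ?case using jf_nonzero[OF assms]
    by (simp add: x kp_Cons Cons kl_action[OF assms] power_int_divide_distrib power_int_add power_int_minus add_divide_distrib divide_simps power_int_diff)
qed simp

lemma frac_div: "N > 0 \<Longrightarrow> frac (real_of_int k / of_nat N) = of_int (k mod int N) / of_nat N"
proof -
  assume N: "N > 0"
  have "real_of_int k = of_int (k div int N) * of_nat N + of_int (k mod int N)"
    by (metis div_mult_mod_eq of_int_add of_int_mult of_int_of_nat_eq)
  hence "real_of_int k / of_nat N = of_int (k div int N) + of_int (k mod int N) / of_nat N"
    using N by (simp add: add_divide_distrib)
  moreover have "0 \<le> real_of_int (k mod int N) / of_nat N" "real_of_int (k mod int N) / of_nat N < 1"
    using N pos_mod_bound[of "int N" k] pos_mod_sign[of "int N" k] by (auto simp del: pos_mod_bound simp: divide_simps)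
  ultimately show ?thesis by (simp add: frac_unique_iff)
qed

lemma kp_has_order:
  assumes "N > 0" "kgood N L"
  shows "has_order (kp N L) (- of_int (kord N L) / (2 * of_nat N ^ 2))"
  using assms(2)
proof (induction L)
  case Nil
  have "kp N [] = (\<lambda>_. 1)" by (rule ext) simp
  thus ?case using has_order_const[of 1] by simp
next
  case (Cons x L)
  obtain r s m where x: "x = (r, s, m)" by (cases x) auto
  have "kp N (x # L) = (\<lambda>\<tau>. kl (of_int r / of_nat N) (of_int s / of_nat N) \<tau> powi m * kp N L \<tau>)"
    by (rule ext) (simp add: x kp_Cons)
  moreover have "has_order (\<lambda>\<tau>. kl (of_int r / of_nat N) (of_int s / of_nat N) \<tau> powi m * kp N L \<tau>)
     (of_int m * (- (frac (of_int r / of_nat N) * (1 - frac (of_int r / of_nat N)) / 2)) + (- of_int (kord N L) / (2 * of_nat N ^ 2)))"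
    using Cons not_Ints_div[OF assms(1)] by (intro has_order_mult has_order_powi kl_has_order) (auto simp: x)
  moreover have "of_int m * (- (frac (of_int r / of_nat N) * (1 - frac (of_int r / of_nat N)) / 2)) + (- of_int (kord N L) / (2 * of_nat N ^ 2)) =
     - of_int (kord N (x # L)) / (2 * (of_nat N)\<^sup>2 :: real)"
    using assms(1) by (simp add: frac_div x field_simps power2_eq_square)
  ultimately show ?case by simp
qed

text \<open>The exponent of the factor \<open>e\<^bsup>\<pi>i/N\<^esup>\<close> that a product of Klein forms picks up under the element
  \<open>1 + N ((\<alpha>, \<beta>), (g, \<delta>))\<close> of \<open>\<Gamma>(N)\<close>.\<close>

definition kE :: "nat \<Rightarrow> int \<Rightarrow> int \<Rightarrow> int \<Rightarrow> int \<Rightarrow> kdata \<Rightarrow> int" where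
  "kE N \<alpha> \<beta> g \<delta> L = (\<Sum>(r, s, m)\<leftarrow>L. m * (int N * ((r * \<alpha> + s * g) + (r * \<beta> + s * \<delta>) + (r * \<alpha> + s * g) * (r * \<beta> + s * \<delta>))
      + r * (r * \<beta> + s * \<delta>) - s * (r * \<alpha> + s * g)))"

lemma kE_simps [simp]: "kE N \<alpha> \<beta> g \<delta> [] = 0"
  "kE N \<alpha> \<beta> g \<delta> ((r, s, m) # L) = m * (int N * ((r * \<alpha> + s * g) + (r * \<beta> + s * \<delta>) + (r * \<alpha> + s * g) * (r * \<beta> + s * \<delta>))
      + r * (r * \<beta> + s * \<delta>) - s * (r * \<alpha> + s * g)) + kE N \<alpha> \<beta> g \<delta> L"
  by (simp_all add: kE_def)

lemma Gamma_subset_SL2Z: "\<gamma> \<in> principal_congruence_subgroup N \<Longrightarrow> \<gamma> \<in> SL2Z"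
  by (simp add: principal_congruence_subgroup_def)

lemma Gamma_iff: "\<gamma> \<in> principal_congruence_subgroup N \<longleftrightarrow> \<gamma> \<in> SL2Z \<and>
    [\<gamma> $ 1 $ 1 = 1] (mod int N) \<and> [\<gamma> $ 1 $ 2 = 0] (mod int N) \<and>
    [\<gamma> $ 2 $ 1 = 0] (mod int N) \<and> [\<gamma> $ 2 $ 2 = 1] (mod int N)"
  by (auto simp: principal_congruence_subgroup_def forall_2)

text \<open>The last equation is the determinant condition divided by N; it is the relation among
  the four integers on which the divisibility proofs can draw.\<close>

lemma Gamma_decompose:
  assumes "\<gamma> \<in> principal_congruence_subgroup N" "N > 0"
  obtains \<alpha> \<beta> g \<delta> where "\<gamma> $ 1 $ 1 = 1 + int N * \<alpha>" "\<gamma> $ 1 $ 2 = int N * \<beta>"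
    "\<gamma> $ 2 $ 1 = int N * g" "\<gamma> $ 2 $ 2 = 1 + int N * \<delta>" "\<delta> = int N * (\<beta> * g - \<alpha> * \<delta>) - \<alpha>"
proof -
  have *: "\<exists>k. x = y + int N * k" if "[x = y] (mod int N)" for x y
    using that by (metis cong_iff_lin cong_sym mult.commute)
  obtain \<alpha> \<beta> g \<delta> where e: "\<gamma> $ 1 $ 1 = 1 + int N * \<alpha>" "\<gamma> $ 1 $ 2 = int N * \<beta>"
    "\<gamma> $ 2 $ 1 = int N * g" "\<gamma> $ 2 $ 2 = 1 + int N * \<delta>"
    using assms *[of "\<gamma> $ 1 $ 1" 1] *[of "\<gamma> $ 1 $ 2" 0] *[of "\<gamma> $ 2 $ 1" 0] *[of "\<gamma> $ 2 $ 2" 1]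
    unfolding Gamma_iff by auto
  have "(1 + int N * \<alpha>) * (1 + int N * \<delta>) - (int N * \<beta>) * (int N * g) = 1"
    using Gamma_subset_SL2Z[OF assms(1)] by (simp add: SL2Z_iff e)
  hence "int N * (\<delta> - (int N * (\<beta> * g - \<alpha> * \<delta>) - \<alpha>)) = 0" by (simp add: algebra_simps)
  hence "\<delta> = int N * (\<beta> * g - \<alpha> * \<delta>) - \<alpha>" using assms(2) by simp
  thus thesis using that e by blast
qed

lemma epx_powi: "epx a powi n = epx (of_int n * a)"
  unfolding epx_def exp_power_int by (simp add: mult_ac)

text \<open>A parameter with denominator N is fixed by \<Gamma>(N) up to integers, so
  \<open>kl_shift\<close> applies with the integral differences \<open>b1\<close> and
  \<open>b2\<close>.\<close>

lemma kp_kact_Gamma: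
  assumes "N > 0" "\<tau> \<in> \<H>" "\<gamma> $ 1 $ 1 = 1 + int N * \<alpha>" "\<gamma> $ 1 $ 2 = int N * \<beta>"
    "\<gamma> $ 2 $ 1 = int N * g" "\<gamma> $ 2 $ 2 = 1 + int N * \<delta>"
  shows "kp N (kact \<gamma> L) \<tau> = epx (of_int (kE N \<alpha> \<beta> g \<delta> L) / of_nat N) * kp N L \<tau>"
proof (induction L)
  case (Cons x L)
  obtain r s m where x: "x = (r, s, m)" by (cases x) auto
  define b1 b2 where "b1 = r * \<alpha> + s * g" and "b2 = r * \<beta> + s * \<delta>"
  have "real_of_int (r * \<gamma> $ 1 $ 1 + s * \<gamma> $ 2 $ 1) / real N = of_int r / of_nat N + of_int b1"
    "real_of_int (r * \<gamma> $ 1 $ 2 + s * \<gamma> $ 2 $ 2) / real N = of_int s / of_nat N + of_int b2"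
    using assms(1) by (simp_all add: assms b1_def b2_def field_simps)
  hence "kp N (kact \<gamma> (x # L)) \<tau> = (epx (of_int (b1 + b2 + b1 * b2) + of_real (of_int r / of_nat N * of_int b2 - of_int s / of_nat N * of_int b1))
      * kl (of_int r / of_nat N) (of_int s / of_nat N) \<tau>) powi m * kp N (kact \<gamma> L) \<tau>"
    by (simp only: x kact_simps kp_Cons kl_shift[OF assms(2)])
  also have "of_int (b1 + b2 + b1 * b2) + of_real (of_int r / of_nat N * of_int b2 - of_int s / of_nat N * of_int b1) =
     (of_int (int N * (b1 + b2 + b1 * b2) + r * b2 - s * b1) / of_nat N :: complex)"
    using assms(1) by (simp add: field_simps)
  finally show ?case
    by (simp add: x kp_Cons Cons power_int_mult_distrib epx_powi b1_def[symmetric] b2_def[symmetric]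
        add_divide_distrib epx_add)
qed simp

text \<open>The multiplier is \<open>epx (kE / N)\<close> and \<open>epx\<close> has period 2,
  whence the divisor \<open>2 * N\<close>.\<close>

lemma kp_Gamma_invariant:
  assumes "N > 0" "\<gamma> \<in> principal_congruence_subgroup N" "\<tau> \<in> \<H>"
    and kE: "\<And>\<alpha> \<beta> g \<delta>. \<delta> = int N * (\<beta> * g - \<alpha> * \<delta>) - \<alpha> \<Longrightarrow> 2 * int N dvd kE N \<alpha> \<beta> g \<delta> L"
  shows "kp N L (modular_action \<gamma> \<tau>) = jf \<gamma> \<tau> powi (- kwt L) * kp N L \<tau>"
proof -
  obtain \<alpha> \<beta> g \<delta> where *: "\<gamma> $ 1 $ 1 = 1 + int N * \<alpha>" "\<gamma> $ 1 $ 2 = int N * \<beta>"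
    "\<gamma> $ 2 $ 1 = int N * g" "\<gamma> $ 2 $ 2 = 1 + int N * \<delta>" "\<delta> = int N * (\<beta> * g - \<alpha> * \<delta>) - \<alpha>"
    using Gamma_decompose[OF assms(2,1)] by blast
  obtain k where "kE N \<alpha> \<beta> g \<delta> L = 2 * int N * k" using kE[OF *(5)] by (auto elim: dvdE)
  hence "epx (of_int (kE N \<alpha> \<beta> g \<delta> L) / of_nat N) = 1"
    using assms(1) epx_even[of k] by simp
  thus ?thesis
    using kp_kact_Gamma[OF assms(1,3) *(1-4), of L] kp_action[OF Gamma_subset_SL2Z[OF assms(2)] assms(3), of N L]
    by simp
qed

text \<open>That \<open>\<gamma>\<infinity>\<close> is \<open>\<Gamma>(N)\<close>-equivalent to \<open>\<infinity>\<close>.\<close>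

definition cusp_at_inf :: "nat \<Rightarrow> int^2^2 \<Rightarrow> bool" where
  "cusp_at_inf N \<gamma> \<longleftrightarrow> int N dvd \<gamma> $ 2 $ 1 \<and> (int N dvd \<gamma> $ 1 $ 1 - 1 \<or> int N dvd \<gamma> $ 1 $ 1 + 1)"

text \<open>Equals -2 N^2 times the order at infinity of a Klein form with first parameter
  x/N.\<close>

definition bq :: "int \<Rightarrow> int \<Rightarrow> int" where "bq N x = (x mod N) * (N - x mod N)"

text \<open>By periodicity of \<open>bq\<close> only the first column of \<gamma> modulo N matters,
  that is, the cusp \<gamma>\<infinity>. The orders at all cusps are therefore finitely many
  numbers.\<close>

lemma kord_kact: "kord N (kact \<gamma> L) =
    (\<Sum>(r, s, m)\<leftarrow>L. m * bq (int N) (r * (\<gamma> $ 1 $ 1 mod int N) + s * (\<gamma> $ 2 $ 1 mod int N)))"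
proof (induction L)
  case (Cons x L)
  obtain r s m where x: "x = (r, s, m)" by (cases x) auto
  have "bq (int N) (r * (\<gamma> $ 1 $ 1 mod int N) + s * (\<gamma> $ 2 $ 1 mod int N)) = bq (int N) (r * \<gamma> $ 1 $ 1 + s * \<gamma> $ 2 $ 1)"
  proof -
    have "(r * (\<gamma> $ 1 $ 1 mod int N) + s * (\<gamma> $ 2 $ 1 mod int N)) mod int N = (r * \<gamma> $ 1 $ 1 + s * \<gamma> $ 2 $ 1) mod int N"
      by (intro mod_add_cong mod_mult_right_eq)
    thus ?thesis by (simp add: bq_def)
  qed
  moreover have "kord N ((r', s', m) # L') = m * bq (int N) r' + kord N L'" for r' s' L'
    by (simp add: bq_def)
  ultimately show ?case using Cons by (simp only: x kact_simps list.map sum_list.Cons prod.case)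
qed simp

text \<open>Exponents of a function with a simple pole at \<open>\<infinity>\<close> and no other poles at cusps.\<close>

definition tdata :: "nat \<Rightarrow> kdata" where
  "tdata N = (if N = 2 then [(1,0,4),(0,1,-4)] else if N = 3 then [(2,0,3),(0,2,-3)]
     else if N = 4 then [(2,1,2),(0,1,-2)]
     else [(2,0,1),(2,2,1),(2,4,1),(2,6,1),(2,8,1),(4,0,-1),(4,2,-1),(4,4,-1),(4,6,-1),(4,8,-1)])"

text \<open>The value \<open>2 * N\<close> of \<open>kord\<close> means order -1/N in q, a simple
  pole in the local parameter at infinity. For odd N the entries of all parameters are even, which
  makes each contribution to \<open>kE\<close> even, so that divisibility by N is the real
  condition.\<close>

lemma tdata_props:
  assumes "N \<in> {2,3,4,5}"
  shows "kgood N (tdata N)" "kwt (tdata N) = 0" "kord N (tdata N) = 2 * int N"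
    "\<delta> = int N * (\<beta> * g - \<alpha> * \<delta>) - \<alpha> \<Longrightarrow> 2 * int N dvd kE N \<alpha> \<beta> g \<delta> (tdata N)"
    "\<gamma> \<in> SL2Z \<Longrightarrow> \<not> cusp_at_inf N \<gamma> \<Longrightarrow> kord N (kact \<gamma> (tdata N)) \<le> 0"
proof -
  show "kgood N (tdata N)" "kwt (tdata N) = 0" "kord N (tdata N) = 2 * int N"
    using assms by (auto simp: tdata_def)
  show "2 * int N dvd kE N \<alpha> \<beta> g \<delta> (tdata N)" if h: "\<delta> = int N * (\<beta> * g - \<alpha> * \<delta>) - \<alpha>"
  proof -
    consider "N = 2" | "N = 3" | "N = 4" | "N = 5" using assms by blast
    thus ?thesis
    proof cases
      case 1
      \<comment> \<open>In each case the witness is \<open>kE\<close> divided by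
        \<open>2 * N\<close> and written out in \<alpha>, \<beta>, g, \<delta>.\<close>
      show ?thesis unfolding 1
        by (intro dvdI[of _ _ "(2*(\<alpha>+\<beta>+\<alpha>*\<beta>)+\<beta>) - (2*(g+\<delta>+g*\<delta>) - g)"]) (simp add: tdata_def algebra_simps)
    next
      case 2
      show ?thesis unfolding 2
        by (intro dvdI[of _ _ "(3*(\<alpha>+\<beta>+2*\<alpha>*\<beta>)+2*\<beta>) - (3*(g+\<delta>+2*g*\<delta>)-2*g)"]) (simp add: tdata_def algebra_simps)
    next
      case 3
      \<comment> \<open>For N = 4 the remaining terms 4\<delta> - 4\<alpha> are not visibly
        divisible by 8; the determinant relation replaces \<delta>.\<close>
      have "4 * (\<beta> * g) = \<delta> + \<alpha> + 4 * (\<alpha> * \<delta>)" using h 3 by (simp add: right_diff_distrib)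
      hence h': "16 * (\<beta> * g) = 4 * \<delta> + 4 * \<alpha> + 16 * (\<alpha> * \<delta>)" by linarith
      show ?thesis unfolding 3
        apply (intro dvdI[of _ _ "(2*\<alpha>+2*\<beta>+(2*\<alpha>+g)*(2*\<beta>+\<delta>)-g*\<delta>) + \<beta> + 2*(\<beta>*g-\<alpha>*\<delta>) - \<alpha>"])
        apply (simp add: tdata_def algebra_simps)
        using h' by (simp add: mult_ac)
    next
      case 4
      show ?thesis unfolding 4
        by (intro dvdI[of _ _ "(5*\<alpha>+10*g+5*\<beta>+10*\<delta>+2*(5*\<alpha>*\<beta>+10*\<alpha>*\<delta>+10*g*\<beta>+30*g*\<delta>)) - (10*\<alpha>+10*g+10*\<beta>+10*\<delta>+2*(20*\<alpha>*\<beta>+20*\<alpha>*\<delta>+20*g*\<beta>+30*g*\<delta>)) + (2*\<beta>+4*\<delta>-4*\<alpha>-12*g) - (8*\<beta>+8*\<delta>-8*\<alpha>-12*g)"])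
          (simp add: tdata_def algebra_simps)
    qed
  qed
  show "kord N (kact \<gamma> (tdata N)) \<le> 0" if "\<gamma> \<in> SL2Z" and nc: "\<not> cusp_at_inf N \<gamma>"
  proof -
    define a b c d where "a = \<gamma> $ 1 $ 1" "b = \<gamma> $ 1 $ 2" "c = \<gamma> $ 2 $ 1" "d = \<gamma> $ 2 $ 2"
    note abcd = this
    have det: "a * d - b * c = 1" using that by (simp add: SL2Z_iff abcd)
    have dv: "x dvd 1" if "x dvd a" "x dvd c" for x
      using that unfolding det[symmetric] by simp
    have nc': "c mod N = 0 \<longrightarrow> a mod N \<noteq> 1 \<and> a mod N \<noteq> int N - 1" (is ?A)
    proof (intro impI conjI notI)
      assume c: "c mod N = 0" and "a mod N = 1"
      hence "(a - 1) mod N = 0" by (metis mod_diff_left_eq diff_self mod_0)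
      thus False using nc c by (auto simp: cusp_at_inf_def abcd mod_eq_0_iff_dvd)
    next
      assume c: "c mod N = 0" and "a mod N = int N - 1"
      hence "(a + 1) mod N = 0" by (metis mod_add_left_eq diff_add_cancel mod_self)
      thus False using nc c by (auto simp: cusp_at_inf_def abcd mod_eq_0_iff_dvd)
    qed
    \<comment> \<open>What remains is a check over finitely many pairs of residues: those without a
      common divisor p > 1 of N and different from plus or minus (1, 0).\<close>
    define x y where "x = a mod int N" and "y = c mod int N"
    have k: "kord N (kact \<gamma> (tdata N)) = (\<Sum>(r, s, m)\<leftarrow>tdata N. m * bq (int N) (r * x + s * y))"
      by (simp add: kord_kact x_def y_def abcd)
    have "int N > 0" using assms by auto
    hence xy: "x \<in> {0..int N - 1}" "y \<in> {0..int N - 1}"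
      using pos_mod_bound[of "int N" a] pos_mod_sign[of "int N" a] pos_mod_bound[of "int N" c] pos_mod_sign[of "int N" c]
      unfolding x_def y_def atLeastAtMost_iff by linarith+
    have nz: "\<not> (p dvd x \<and> p dvd y)" if "p dvd int N" "p > 1" for p
      using dv[of p] that(2) unfolding x_def y_def dvd_mod_iff[OF that(1)] by auto
    have nc'': "y = 0 \<longrightarrow> x \<noteq> 1 \<and> x \<noteq> int N - 1" using nc' by (simp add: x_def y_def)
    consider "N = 2" | "N = 3" | "N = 4" | "N = 5" using assms by blast
    thus ?thesis
    proof cases
      case 1
      have "x \<in> {0,1}" "y \<in> {0,1}" using xy by (auto simp: 1)
      thus ?thesis using nc'' nz[of 2] unfolding k by (auto simp: 1 tdata_def bq_def)
    next
      case 2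
      have "x \<in> {0,1,2}" "y \<in> {0,1,2}" using xy by (auto simp: 2)
      thus ?thesis using nc'' nz[of 3] unfolding k by (auto simp: 2 tdata_def bq_def)
    next
      case 3
      have "x \<in> {0,1,2,3}" "y \<in> {0,1,2,3}" using xy by (auto simp: 3)
      thus ?thesis using nc'' nz[of 2] unfolding k by (auto simp: 3 tdata_def bq_def)
    next
      case 4
      have "x \<in> {0,1,2,3,4}" "y \<in> {0,1,2,3,4}" using xy by (auto simp: 4)
      thus ?thesis using nc'' nz[of 5] unfolding k by (auto simp: 4 tdata_def bq_def)
    qed
  qed
qed

text \<open>Exponents of a form of weight 1, invariant up to sign if \<open>N = 2\<close>, where \<open>-1 \<in> \<Gamma>(N)\<close> rules out
  an invariant one.\<close>

definition fdata :: "nat \<Rightarrow> kdata" where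
  "fdata N = (if N = 2 then [(0,1,1),(1,0,-1),(1,1,-1)] else if N = 3 then [(0,2,2),(2,0,-1),(2,2,-1),(2,4,-1)]
     else if N = 4 then [(0,2,1),(2,0,-1),(2,2,-1)]
     else [(0,2,2),(0,4,-3)])"

text \<open>Orders at the cusps are left free; weight and multiplier are what count. Even entries
  again supply the factor 2 for N = 3 and N = 5. For N = 2 divisibility is claimed by N only, so a
  sign can remain.\<close>

lemma fdata_props:
  assumes "N \<in> {2,3,4,5}"
  shows "kgood N (fdata N)" "kwt (fdata N) = -1"
    "\<delta> = int N * (\<beta> * g - \<alpha> * \<delta>) - \<alpha> \<Longrightarrow> N \<noteq> 2 \<Longrightarrow> 2 * int N dvd kE N \<alpha> \<beta> g \<delta> (fdata N)"
    "\<delta> = int N * (\<beta> * g - \<alpha> * \<delta>) - \<alpha> \<Longrightarrow> N = 2 \<Longrightarrow> int N dvd kE N \<alpha> \<beta> g \<delta> (fdata N)"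
proof -
  show "kgood N (fdata N)" "kwt (fdata N) = -1"
    using assms by (auto simp: fdata_def)
  show "int N dvd kE N \<alpha> \<beta> g \<delta> (fdata N)" if h: "\<delta> = int N * (\<beta> * g - \<alpha> * \<delta>) - \<alpha>" and N: "N = 2"
  proof -
    have h': "2 * (\<beta> * g) = \<delta> + \<alpha> + 2 * (\<alpha> * \<delta>)" using h N by (simp add: right_diff_distrib)
    show ?thesis unfolding N
      apply (intro dvdI[of _ _ "(g+\<delta>+g*\<delta>)-(\<alpha>+\<beta>+\<alpha>*\<beta>)-(\<alpha>+g+\<beta>+\<delta>+(\<alpha>+g)*(\<beta>+\<delta>)) - \<beta> - (\<beta>*g-\<alpha>*\<delta>) + \<alpha>"])
      apply (simp add: fdata_def algebra_simps)
      using h' by (simp add: mult_ac)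
  qed
  show "2 * int N dvd kE N \<alpha> \<beta> g \<delta> (fdata N)" if h: "\<delta> = int N * (\<beta> * g - \<alpha> * \<delta>) - \<alpha>" and "N \<noteq> 2"
  proof -
    consider "N = 3" | "N = 4" | "N = 5" using assms \<open>N \<noteq> 2\<close> by auto
    thus ?thesis
    proof cases
      case 1
      show ?thesis unfolding 1
        by (intro dvdI[of _ _ "2*(g+\<delta>+2*g*\<delta>) - (\<alpha>+\<beta>+2*\<alpha>*\<beta>) - (\<alpha>+g+\<beta>+\<delta>+2*(\<alpha>+g)*(\<beta>+\<delta>)) - (\<alpha>+2*g+\<beta>+2*\<delta>+2*(\<alpha>+2*g)*(\<beta>+2*\<delta>)) + 2*(g-\<beta>-\<delta>+\<alpha>)"])
          (simp add: fdata_def algebra_simps)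
    next
      case 2
      have "4 * (\<beta> * g) = \<delta> + \<alpha> + 4 * (\<alpha> * \<delta>)" using h 2 by (simp add: right_diff_distrib)
      hence h': "16 * (\<beta> * g) = 4 * \<delta> + 4 * \<alpha> + 16 * (\<alpha> * \<delta>)" by linarith
      show ?thesis unfolding 2
        apply (intro dvdI[of _ _ "(g+\<delta>+2*g*\<delta>)-(\<alpha>+\<beta>+2*\<alpha>*\<beta>)-((\<alpha>+g)+(\<beta>+\<delta>)+2*(\<alpha>+g)*(\<beta>+\<delta>)) - \<beta> - 2*(\<beta>*g-\<alpha>*\<delta>) + \<alpha>"])
        apply (simp add: fdata_def algebra_simps)
        using h' by (simp add: mult_ac)
    next
      case 3
      show ?thesis unfolding 3
        by (intro dvdI[of _ _ "2*(g+\<delta>+2*g*\<delta>)-3*(2*g+2*\<delta>+8*g*\<delta>)+4*g"]) (simp add: fdata_def algebra_simps)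
    qed
  qed
qed

text \<open>The sign depends on \<gamma> alone, because \<open>kE\<close> does. This uniformity in
  \<tau> is essential, since the relation is differentiated in
  \<open>Fmat_equivariant\<close>.\<close>

lemma fdata_action_uniform:
  assumes "N \<in> {2,3,4,5}" "\<gamma> \<in> principal_congruence_subgroup N"
  obtains e :: complex where "e = 1 \<or> N = 2 \<and> e = -1"
    "\<And>\<tau>. \<tau> \<in> \<H> \<Longrightarrow> kp N (fdata N) (modular_action \<gamma> \<tau>) = e * jf \<gamma> \<tau> * kp N (fdata N) \<tau>"
proof (cases "N = 2")
  case False
  have "N > 0" using assms by auto
  hence "kp N (fdata N) (modular_action \<gamma> \<tau>) = 1 * jf \<gamma> \<tau> * kp N (fdata N) \<tau>" if "\<tau> \<in> \<H>" for \<tau>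
    using kp_Gamma_invariant[OF _ assms(2) that fdata_props(3)[OF assms(1)]] assms False
    by (auto simp: fdata_props(2))
  thus thesis using that by blast
next
  case True
  obtain \<alpha> \<beta> g \<delta> where *: "\<gamma> $ 1 $ 1 = 1 + int N * \<alpha>" "\<gamma> $ 1 $ 2 = int N * \<beta>"
    "\<gamma> $ 2 $ 1 = int N * g" "\<gamma> $ 2 $ 2 = 1 + int N * \<delta>" "\<delta> = int N * (\<beta> * g - \<alpha> * \<delta>) - \<alpha>"
    using Gamma_decompose[OF assms(2)] assms(1) by (metis True zero_less_numeral)
  have "int N dvd kE N \<alpha> \<beta> g \<delta> (fdata N)" by (rule fdata_props(4)[OF assms(1) *(5) True])
  then obtain k where k: "kE N \<alpha> \<beta> g \<delta> (fdata N) = int N * k" by (auto elim: dvdE)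
  define e where "e = epx (of_int k)"
  have e: "epx (of_int (kE N \<alpha> \<beta> g \<delta> (fdata N)) / of_nat N) = e"
    unfolding k e_def using True by simp
  have "e = 1 \<or> N = 2 \<and> e = -1"
  proof (cases "even k")
    case False
    then obtain l where "k = 2 * l + 1" by (auto elim: oddE)
    thus ?thesis using epx_even[of l] True by (simp add: epx_add e_def)
  qed (auto simp: epx_eq_1 e_def)
  moreover have "kp N (fdata N) (modular_action \<gamma> \<tau>) = e * jf \<gamma> \<tau> * kp N (fdata N) \<tau>" if "\<tau> \<in> \<H>" for \<tau>
    using kp_kact_Gamma[OF _ that *(1-4), of "fdata N"] kp_action[OF Gamma_subset_SL2Z[OF assms(2)] that, of N "fdata N"] e
    by (simp add: True fdata_props)
  ultimately show thesis using that by blast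
qed

section \<open>Invariant functions\<close>

definition mcong :: "nat \<Rightarrow> int^2^2 \<Rightarrow> int^2^2 \<Rightarrow> bool" where
  "mcong N A B \<longleftrightarrow> (\<forall>i j. [A $ i $ j = B $ i $ j] (mod int N))"

lemma mcong_iff: "mcong N A B \<longleftrightarrow>
    [A $ 1 $ 1 = B $ 1 $ 1] (mod int N) \<and> [A $ 1 $ 2 = B $ 1 $ 2] (mod int N) \<and>
    [A $ 2 $ 1 = B $ 2 $ 1] (mod int N) \<and> [A $ 2 $ 2 = B $ 2 $ 2] (mod int N)"
  by (auto simp: mcong_def forall_2)

lemma mcong_sym: "mcong N A B \<Longrightarrow> mcong N B A"
  and mcong_refl [simp]: "mcong N A A"
  by (auto simp: mcong_def cong_sym)

lemma mcong_mult: "mcong N A A' \<Longrightarrow> mcong N B B' \<Longrightarrow> mcong N (A ** B) (A' ** B')"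
  unfolding mcong_def mult_nth2 by (intro allI cong_add cong_mult) auto

lemma Gamma_iff_mcong: "\<gamma> \<in> principal_congruence_subgroup N \<longleftrightarrow> \<gamma> \<in> SL2Z \<and> mcong N \<gamma> (mat 1)"
  by (auto simp: principal_congruence_subgroup_def mcong_def)

definition invf :: "nat \<Rightarrow> (complex \<Rightarrow> complex) \<Rightarrow> bool" where
  "invf N g \<longleftrightarrow> (\<forall>\<gamma>\<in>principal_congruence_subgroup N. \<forall>\<tau>\<in>\<H>. g (modular_action \<gamma> \<tau>) = g \<tau>)"

text \<open>The quotient of two congruent matrices lies in \<Gamma>(N). Hence an invariant function
  has only finitely many transforms under SL(2,Z).\<close>

lemma invf_mcong:
  assumes "invf N g" "\<gamma> \<in> SL2Z" "\<delta> \<in> SL2Z" "mcong N \<gamma> \<delta>" "\<tau> \<in> \<H>"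
  shows "g (modular_action \<gamma> \<tau>) = g (modular_action \<delta> \<tau>)"
proof -
  have "mcong N (\<gamma> ** inv2 \<delta>) (\<delta> ** inv2 \<delta>)" using assms by (intro mcong_mult) auto
  hence "\<gamma> ** inv2 \<delta> \<in> principal_congruence_subgroup N"
    using assms by (simp add: Gamma_iff_mcong SL2Z_mult inv2_mult)
  hence "g (modular_action (\<gamma> ** inv2 \<delta>) (modular_action \<delta> \<tau>)) = g (modular_action \<delta> \<tau>)"
    using assms by (simp add: invf_def)
  moreover have "modular_action (\<gamma> ** inv2 \<delta>) (modular_action \<delta> \<tau>) = modular_action \<gamma> \<tau>"
    using assms by (simp add: modular_action_mult)
  ultimately show ?thesis by simp
qed

text \<open>Normality of \<Gamma>(N) in SL(2,Z), expressed by congruences.\<close>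

lemma invf_compose:
  assumes "invf N g" "\<gamma> \<in> SL2Z"
  shows "invf N (\<lambda>\<tau>. g (modular_action \<gamma> \<tau>))"
  unfolding invf_def
proof safe
  fix \<delta> \<tau> assume *: "\<delta> \<in> principal_congruence_subgroup N" "\<tau> \<in> \<H>"
  hence \<delta>: "\<delta> \<in> SL2Z" by (simp add: Gamma_subset_SL2Z)
  have "mcong N (\<gamma> ** \<delta>) (\<gamma> ** mat 1)" using * by (intro mcong_mult) (auto simp: Gamma_iff_mcong)
  hence "g (modular_action (\<gamma> ** \<delta>) \<tau>) = g (modular_action \<gamma> \<tau>)"
    using assms * \<delta> by (intro invf_mcong) (auto simp: SL2Z_mult)
  thus "g (modular_action \<gamma> (modular_action \<delta> \<tau>)) = g (modular_action \<gamma> \<tau>)"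
    using assms * \<delta> by (simp add: modular_action_mult)
qed

lemma invf_periodic:
  assumes "invf N g" "\<tau> \<in> \<H>"
  shows "g (\<tau> + of_int (int N * k)) = g \<tau>"
proof -
  have "Tm (int N * k) \<in> principal_congruence_subgroup N"
    by (simp add: Gamma_iff_mcong mcong_iff) (simp add: Tm_def cong_0_iff)
  thus ?thesis using assms by (auto simp: invf_def)
qed

text \<open>Modulo N the first column is plus or minus (1, 0), so the determinant makes \<gamma>
  congruent to plus or minus a translation, and the sign acts trivially.\<close>

lemma invf_cusp_at_inf:
  assumes "invf N g" "\<gamma> \<in> SL2Z" "cusp_at_inf N \<gamma>"
  obtains j :: int where "\<And>\<tau>. \<tau> \<in> \<H> \<Longrightarrow> g (modular_action \<gamma> \<tau>) = g (\<tau> + of_int j)"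
proof -
  define a b c d where "a = \<gamma> $ 1 $ 1" "b = \<gamma> $ 1 $ 2" "c = \<gamma> $ 2 $ 1" "d = \<gamma> $ 2 $ 2"
  note abcd = this
  have det: "a * d - b * c = 1" using assms by (simp add: SL2Z_iff abcd)
  have c: "[c = 0] (mod int N)" using assms by (simp add: cusp_at_inf_def cong_0_iff abcd)
  have ad: "[a * d = 1] (mod int N)"
    using det c by (metis cong_0_iff cong_iff_dvd_diff add_diff_cancel_left' diff_add_cancel dvd_mult)
  consider "[a = 1] (mod int N)" | "[a = -1] (mod int N)"
    using assms by (auto simp: cusp_at_inf_def cong_iff_dvd_diff abcd)
  thus thesis
  proof cases
    case 1
    have "[a * d = 1 * d] (mod int N)" using 1 by (rule cong_mult) simp
    hence "[d = 1] (mod int N)" using ad by (metis cong_trans cong_sym mult_1)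
    hence "mcong N \<gamma> (Tm b)" using 1 c by (simp add: mcong_iff abcd[symmetric]) (simp add: Tm_def)
    hence "g (modular_action \<gamma> \<tau>) = g (\<tau> + of_int b)" if "\<tau> \<in> \<H>" for \<tau>
      using invf_mcong[OF assms(1,2) _ _ that, of "Tm b"] by simp
    thus thesis using that by blast
  next
    case 2
    have "[a * d = (-1) * d] (mod int N)" using 2 by (rule cong_mult) simp
    hence "[- d = 1] (mod int N)" using ad by (metis cong_trans cong_sym mult_minus1)
    hence "[d = -1] (mod int N)" by (metis cong_minus_minus_iff minus_minus)
    hence "mcong N \<gamma> (- Tm (- b))" using 2 c by (simp add: mcong_iff abcd[symmetric]) (simp add: Tm_def)
    hence "g (modular_action \<gamma> \<tau>) = g (\<tau> + of_int (- b))" if "\<tau> \<in> \<H>" for \<tau>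
      using invf_mcong[OF assms(1,2) _ _ that, of "- Tm (-b)"] by simp
    thus thesis using that by blast
  qed
qed

section \<open>Boundedness at cusps, q-expansions and constancy\<close>

definition bddc :: "(complex \<Rightarrow> complex) \<Rightarrow> bool" where
  "bddc h \<longleftrightarrow> (\<exists>B. eventually (\<lambda>\<tau>. norm (h \<tau>) \<le> B) cuspF)"

lemma bddc_tendsto: "(h \<longlongrightarrow> L) cuspF \<Longrightarrow> bddc h"
  unfolding bddc_def using tendstoD[of h L cuspF 1]
  by (intro exI[of _ "norm L + 1"]) (auto elim!: eventually_mono simp: dist_norm dest: norm_triangle_sub[THEN order_trans] intro: order_trans[OF norm_triangle_sub[of _ L]])

lemma bddc_mult: "bddc f \<Longrightarrow> bddc g \<Longrightarrow> bddc (\<lambda>\<tau>. f \<tau> * g \<tau>)"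
proof -
  assume "bddc f" "bddc g"
  then obtain A B where "eventually (\<lambda>\<tau>. norm (f \<tau>) \<le> A) cuspF" "eventually (\<lambda>\<tau>. norm (g \<tau>) \<le> B) cuspF"
    by (auto simp: bddc_def)
  hence "eventually (\<lambda>\<tau>. norm (f \<tau> * g \<tau>) \<le> \<bar>A\<bar> * \<bar>B\<bar>) cuspF"
    by eventually_elim (auto simp: norm_mult intro!: mult_mono)
  thus ?thesis by (auto simp: bddc_def)
qed

lemma bddc_add: "bddc f \<Longrightarrow> bddc g \<Longrightarrow> bddc (\<lambda>\<tau>. f \<tau> + g \<tau>)"
proof -
  assume "bddc f" "bddc g"
  then obtain A B where "eventually (\<lambda>\<tau>. norm (f \<tau>) \<le> A) cuspF" "eventually (\<lambda>\<tau>. norm (g \<tau>) \<le> B) cuspF"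
    by (auto simp: bddc_def)
  hence "eventually (\<lambda>\<tau>. norm (f \<tau> + g \<tau>) \<le> A + B) cuspF"
    by eventually_elim (auto intro: norm_triangle_le)
  thus ?thesis by (auto simp: bddc_def)
qed

lemma bddc_const [simp]: "bddc (\<lambda>_. c)"
  by (auto simp: bddc_def)

lemma bddc_cong:
  assumes "\<And>\<tau>. \<tau> \<in> \<H> \<Longrightarrow> f \<tau> = g \<tau>" "bddc f"
  shows "bddc g"
proof -
  obtain A where "eventually (\<lambda>\<tau>. norm (f \<tau>) \<le> A) cuspF" using assms by (auto simp: bddc_def)
  hence "eventually (\<lambda>\<tau>. norm (g \<tau>) \<le> A) cuspF"
    using eventually_cuspF_UHP by eventually_elim (simp add: assms)
  thus ?thesis by (auto simp: bddc_def)
qed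

lemma bddc_shift: "bddc f \<Longrightarrow> bddc (\<lambda>\<tau>. f (\<tau> + of_int n))"
  unfolding bddc_def using filterlim_shift_cuspF[of n] by (auto simp: filterlim_iff)

lemma bddc_power: "bddc f \<Longrightarrow> bddc (\<lambda>\<tau>. f \<tau> ^ n)"
  by (induction n) (auto intro: bddc_mult)

text \<open>The local parameter at infinity for \<Gamma>(N), whose translations are those by
  multiples of N.\<close>

definition qN :: "nat \<Rightarrow> complex \<Rightarrow> complex" where "qN N \<tau> = ex (\<tau> / of_nat N)"

lemma norm_qN: "norm (qN N \<tau>) = exp (- (2 * pi * Im \<tau> / N))"
  by (simp add: qN_def norm_ex)

lemma qN_nonzero [simp]: "qN N \<tau> \<noteq> 0" by (simp add: qN_def)

lemma qN_in_ball: "N > 0 \<Longrightarrow> \<tau> \<in> \<H> \<Longrightarrow> qN N \<tau> \<in> ball 0 1"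
  by (simp add: norm_qN UHP_iff)

lemma qN_tendsto: "N > 0 \<Longrightarrow> (qN N \<longlongrightarrow> 0) cuspF"
  using ex_tendsto_0[of "1 / N" 0] by (simp add: qN_def[abs_def])

lemma qN_surj:
  assumes "N > 0" "z \<in> ball 0 1" "z \<noteq> 0"
  obtains \<tau> where "\<tau> \<in> \<H>" "qN N \<tau> = z"
proof
  define \<tau> where "\<tau> = of_nat N * Ln z / (2 * of_real pi * \<i>)"
  have "Im \<tau> = - (N * ln (norm z) / (2 * pi))"
    using assms by (simp add: \<tau>_def Im_divide power2_eq_square)
  moreover have "ln (norm z) < 0" using assms by simp
  ultimately show "\<tau> \<in> \<H>" using assms by (simp add: UHP_iff divide_neg_pos mult_pos_neg)
  show "qN N \<tau> = z" using assms by (simp add: qN_def \<tau>_def ex_def)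
qed

text \<open>\<open>G\<close> is \<open>h\<close> composed with a logarithm; periodicity makes it
  independent of the branch. The principal branch jumps on the negative axis, so there
  \<open>Ln (- q) + of_real pi * \<i>\<close> is used instead, and the two open sets cover the
  punctured disc.\<close>

lemma q_expansion_punctured:
  assumes "N > 0" "h holomorphic_on \<H>" and per: "\<And>\<tau> k::int. \<tau> \<in> \<H> \<Longrightarrow> h (\<tau> + of_int (int N * k)) = h \<tau>"
  obtains G where "G holomorphic_on (ball 0 1 - {0})" "\<And>\<tau>. \<tau> \<in> \<H> \<Longrightarrow> G (qN N \<tau>) = h \<tau>"
proof
  define \<phi> where "\<phi> = (\<lambda>w. of_nat N * w / (2 * of_real pi * \<i>) :: complex)"
  define G where "G = (\<lambda>q. h (\<phi> (Ln q)))"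
  have Im_\<phi>: "Im (\<phi> w) = - (N * Re w / (2 * pi))" for w by (simp add: \<phi>_def Im_divide power2_eq_square)
  have \<phi>_UHP: "\<phi> w \<in> \<H>" if "Re w < 0" for w
    using that assms by (simp add: UHP_iff Im_\<phi> divide_neg_pos mult_pos_neg)
  have G: "G (exp w) = h (\<phi> w)" if "Re w < 0" for w
  proof -
    have "exp (Ln (exp w)) = exp w" by simp
    then obtain n :: int where n: "w = Ln (exp w) + (of_int (2 * n) * pi) * \<i>" unfolding exp_eq by (metis of_int_mult of_int_minus add_diff_cancel exp_eq)
    hence "\<phi> w = \<phi> (Ln (exp w) + (of_int (2 * n) * pi) * \<i>)" by simp
    also have "\<dots> = \<phi> (Ln (exp w)) + of_int (int N * n)" by (simp add: \<phi>_def field_simps)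
    finally have "\<phi> w = \<phi> (Ln (exp w)) + of_int (int N * n)" .
    moreover have "\<phi> (Ln (exp w)) \<in> \<H>" using that by (intro \<phi>_UHP) simp
    ultimately show ?thesis using per by (simp add: G_def)
  qed
  show "G (qN N \<tau>) = h \<tau>" if "\<tau> \<in> \<H>" for \<tau>
  proof -
    have "\<phi> (2 * of_real pi * \<i> * (\<tau> / of_nat N)) = \<tau>" using assms by (simp add: \<phi>_def)
    thus ?thesis using G[of "2 * of_real pi * \<i> * (\<tau> / of_nat N)"] that assms
      by (simp add: qN_def ex_def UHP_iff)
  qed
  have \<phi>h: "(\<lambda>q. h (\<phi> (f q))) holomorphic_on S" if "f holomorphic_on S" "\<And>q. q \<in> S \<Longrightarrow> Re (f q) < 0" for f S
  proof -
    have "(\<lambda>q. \<phi> (f q)) holomorphic_on S" unfolding \<phi>_def by (intro holomorphic_intros that) auto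
    from holomorphic_on_compose_gen[OF this assms(2)] show ?thesis using that(2) \<phi>_UHP
      by (auto simp: o_def)
  qed
  define S1 S2 where "S1 = (ball 0 1 - {0}) - (\<real>\<^sub>\<le>\<^sub>0 :: complex set)" and "S2 = (ball 0 1 - {0}) \<inter> {q. Re q < 0}"
  have "open S1" "open S2" unfolding S1_def S2_def
    by (intro open_Diff open_Int open_halfspace_Re_lt open_ball closed_nonpos_Reals_complex closed_singleton)+
  have 1: "G holomorphic_on S1"
    unfolding G_def by (intro \<phi>h holomorphic_intros) (auto simp: S1_def)
  have "(\<lambda>q. h (\<phi> (Ln (- q) + of_real pi * \<i>))) holomorphic_on S2"
    by (intro \<phi>h holomorphic_intros) (auto simp: S2_def complex_nonpos_Reals_iff)
  moreover have "h (\<phi> (Ln (- q) + of_real pi * \<i>)) = G q" if "q \<in> S2" for q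
    using G[of "Ln (- q) + of_real pi * \<i>"] that by (simp add: S2_def exp_add)
  ultimately have 2: "G holomorphic_on S2" using holomorphic_transform by blast
  have "S1 \<union> S2 = ball 0 1 - {0}"
    by (auto simp: S1_def S2_def complex_nonpos_Reals_iff complex_eq_iff)
  thus "G holomorphic_on (ball 0 1 - {0})"
    using holomorphic_on_Un[OF 1 2 \<open>open S1\<close> \<open>open S2\<close>] by simp
qed

lemma q_expansion:
  assumes "N > 0" "h holomorphic_on \<H>" and per: "\<And>\<tau> k::int. \<tau> \<in> \<H> \<Longrightarrow> h (\<tau> + of_int (int N * k)) = h \<tau>"
    and "bddc h"
  obtains G where "G holomorphic_on (ball 0 1)" "\<And>\<tau>. \<tau> \<in> \<H> \<Longrightarrow> G (qN N \<tau>) = h \<tau>"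
proof -
  obtain G where G: "G holomorphic_on (ball 0 1 - {0})" "\<And>\<tau>. \<tau> \<in> \<H> \<Longrightarrow> G (qN N \<tau>) = h \<tau>"
    using q_expansion_punctured[OF assms(1-3)] by blast
  obtain B Y where Y: "\<And>\<tau>. Im \<tau> > Y \<Longrightarrow> norm (h \<tau>) \<le> B"
    using assms(4) unfolding bddc_def eventually_cuspF by blast
  \<comment> \<open>The absolute value keeps \<open>r\<close> at most 1, so that every z below has a
    preimage under \<open>qN N\<close>.\<close>
  define r where "r = exp (- (2 * pi * \<bar>Y\<bar> / N))"
  have "norm (G z) \<le> B" if "z \<noteq> 0" "norm z < r" for z
  proof -
    have "r \<le> 1" by (simp add: r_def)
    hence "z \<in> ball 0 1" using that by simp
    then obtain \<tau> where \<tau>: "\<tau> \<in> \<H>" "qN N \<tau> = z" using qN_surj[OF assms(1) _ \<open>z \<noteq> 0\<close>] by blast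
    hence "exp (- (2 * pi * Im \<tau> / N)) < exp (- (2 * pi * \<bar>Y\<bar> / N))" using that by (simp add: norm_qN[symmetric] r_def)
    hence "Im \<tau> > \<bar>Y\<bar>" using assms(1) by (simp add: divide_simps)
    thus ?thesis using Y[of \<tau>] G(2)[OF \<tau>(1)] \<tau>(2) by simp
  qed
  moreover have "r > 0" by (simp add: r_def)
  ultimately have "eventually (\<lambda>z. norm (G z) \<le> B) (at 0)"
    unfolding eventually_at by (intro exI[of _ r]) (auto simp: dist_norm)
  then obtain G' where G': "G' holomorphic_on (ball 0 1)" "\<And>z. z \<in> ball 0 1 - {0} \<Longrightarrow> G' z = G z"
    using holomorphic_on_extend_bounded[OF G(1), of ] by (auto simp: interior_open)
  have "G' (qN N \<tau>) = h \<tau>" if "\<tau> \<in> \<H>" for \<tau>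
    using G'(2)[of "qN N \<tau>"] qN_in_ball[OF assms(1) that] G(2)[OF that] by simp
  thus thesis using that G' by blast
qed

text \<open>\<open>L\<close> and \<open>M\<close> are the value and the derivative at q = 0 of the
  extended function. The second limit is how one power of q is split off once a leading term has
  been cancelled.\<close>

lemma q_expansion_limit:
  assumes "N > 0" "h holomorphic_on \<H>" and per: "\<And>\<tau> k::int. \<tau> \<in> \<H> \<Longrightarrow> h (\<tau> + of_int (int N * k)) = h \<tau>"
    and "bddc h"
  obtains L M where "(h \<longlongrightarrow> L) cuspF" "((\<lambda>\<tau>. (h \<tau> - L) / qN N \<tau>) \<longlongrightarrow> M) cuspF"
proof -
  obtain G where G: "G holomorphic_on (ball 0 1)" "\<And>\<tau>. \<tau> \<in> \<H> \<Longrightarrow> G (qN N \<tau>) = h \<tau>"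
    using q_expansion[OF assms] by blast
  obtain M where M: "(G has_field_derivative M) (at 0)"
    using G(1) holomorphic_on_open[of "ball 0 1" G] by (metis centre_in_ball open_ball zero_less_one)
  have q: "filterlim (qN N) (at 0) cuspF"
    using qN_tendsto[OF assms(1)] by (simp add: filterlim_at)
  have "((\<lambda>\<tau>. G (qN N \<tau>)) \<longlongrightarrow> G 0) cuspF"
    by (rule isCont_tendsto_compose[OF DERIV_isCont[OF M] qN_tendsto[OF assms(1)]])
  hence 1: "(h \<longlongrightarrow> G 0) cuspF"
    by (rule Lim_transform_eventually) (use eventually_cuspF_UHP in \<open>eventually_elim; simp add: G\<close>)
  have "((\<lambda>z. (G (0 + z) - G 0) / z) \<longlongrightarrow> M) (at 0)" using M by (simp add: DERIV_def)
  hence "((\<lambda>\<tau>. (G (0 + qN N \<tau>) - G 0) / qN N \<tau>) \<longlongrightarrow> M) cuspF"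
    using filterlim_compose[OF _ q] by blast
  hence 2: "((\<lambda>\<tau>. (h \<tau> - G 0) / qN N \<tau>) \<longlongrightarrow> M) cuspF"
    by (rule Lim_transform_eventually) (use eventually_cuspF_UHP in \<open>eventually_elim; simp add: G\<close>)
  show thesis using that[OF 1 2] .
qed

text \<open>A weak form of reduction theory that suffices for compactness. After a translation the
  real part is at most 1/2 in absolute value; if the imaginary part is below 1/2 as well, the
  squared modulus is at most 1/2 and inversion at least doubles the imaginary part.\<close>

lemma ex_action_Im_ge:
  assumes "\<tau> \<in> \<H>"
  obtains \<gamma> where "\<gamma> \<in> SL2Z" "Im (modular_action \<gamma> \<tau>) \<ge> 1 / 2"
proof -
  have *: "\<exists>\<gamma>\<in>SL2Z. Im (modular_action \<gamma> \<tau>) \<ge> 1 / 2" if "\<tau> \<in> \<H>" "Im \<tau> * 2 ^ n \<ge> 1 / 2" for n \<tau>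
    using that
  proof (induction n arbitrary: \<tau>)
    case 0
    thus ?case by (intro bexI[of _ "mat 1"]) auto
  next
    case (Suc n)
    show ?case
    proof (cases "Im \<tau> \<ge> 1 / 2")
      case True
      thus ?thesis by (intro bexI[of _ "mat 1"]) auto
    next
      case False
      define \<delta> where "\<delta> = Sm ** Tm (- round (Re \<tau>))"
      define w where "w = \<tau> + of_int (- round (Re \<tau>))"
      have \<delta>: "\<delta> \<in> SL2Z" by (simp add: \<delta>_def SL2Z_mult)
      have "w \<in> \<H>" using Suc.prems by (simp add: w_def UHP_iff)
      have Imw: "Im w = Im \<tau>" "Im \<tau> > 0" using Suc.prems by (simp_all add: w_def UHP_iff)
      have d: "modular_action \<delta> \<tau> = - 1 / w"
        using Suc.prems by (simp add: \<delta>_def modular_action_mult w_def)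
      have "\<bar>Re w\<bar> \<le> 1 / 2" using of_int_round_abs_le[of "Re \<tau>"] by (simp add: w_def abs_minus_commute)
      hence "(Re w)\<^sup>2 \<le> (1 / 2)\<^sup>2" by (metis abs_ge_zero power2_abs power_mono)
      moreover have "(Im w)\<^sup>2 \<le> (1 / 2)\<^sup>2" using False Imw by (intro power_mono) auto
      ultimately have n: "(Re w)\<^sup>2 + (Im w)\<^sup>2 \<le> 1 / 2" by (simp add: power2_eq_square)
      have pos: "(Re w)\<^sup>2 + (Im w)\<^sup>2 > 0" using Imw by (simp add: sum_power2_gt_zero_iff)
      have "Im (- 1 / w) = Im \<tau> / ((Re w)\<^sup>2 + (Im w)\<^sup>2)" by (simp add: Im_divide Imw)
      also have "\<dots> \<ge> Im \<tau> / (1 / 2)" using Imw n pos by (intro divide_left_mono) auto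
      finally have "Im (modular_action \<delta> \<tau>) \<ge> 2 * Im \<tau>" unfolding d by simp
      hence "Im (modular_action \<delta> \<tau>) * 2 ^ n \<ge> (2 * Im \<tau>) * 2 ^ n" by (intro mult_right_mono) auto
      moreover have "(2 * Im \<tau>) * 2 ^ n \<ge> 1 / 2" using Suc.prems by (simp add: mult_ac)
      ultimately have "Im (modular_action \<delta> \<tau>) * 2 ^ n \<ge> 1 / 2" by linarith
      then obtain \<gamma> where "\<gamma> \<in> SL2Z" "Im (modular_action \<gamma> (modular_action \<delta> \<tau>)) \<ge> 1 / 2"
        using Suc.IH[of "modular_action \<delta> \<tau>"] Suc.prems \<delta> by auto
      thus ?thesis using Suc.prems \<delta> by (intro bexI[of _ "\<gamma> ** \<delta>"]) (auto simp: modular_action_mult SL2Z_mult)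
    qed
  qed
  obtain n where "(1 / 2) / Im \<tau> < 2 ^ n" using real_arch_pow[of 2 "(1 / 2) / Im \<tau>"] by auto
  hence "Im \<tau> * 2 ^ n \<ge> 1 / 2" using assms by (simp add: UHP_iff field_simps)
  thus thesis using *[OF assms] that by blast
qed

lemma finite_mcong_representatives:
  assumes N: "N > 0"
  obtains R where "finite R" "R \<noteq> {}" "R \<subseteq> SL2Z" "\<And>\<gamma>. \<gamma> \<in> SL2Z \<Longrightarrow> \<exists>\<delta>\<in>R. mcong N \<gamma> \<delta>"
proof
  define key where "key = (\<lambda>\<gamma> :: int^2^2. (\<gamma> $ 1 $ 1 mod int N, \<gamma> $ 1 $ 2 mod int N, \<gamma> $ 2 $ 1 mod int N, \<gamma> $ 2 $ 2 mod int N))"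
  define rep where "rep = (\<lambda>k. SOME \<gamma>. \<gamma> \<in> SL2Z \<and> key \<gamma> = k)"
  have rep: "rep (key \<gamma>) \<in> SL2Z \<and> key (rep (key \<gamma>)) = key \<gamma>" if "\<gamma> \<in> SL2Z" for \<gamma>
    unfolding rep_def by (rule someI[of _ \<gamma>]) (use that in auto)
  have "key ` SL2Z \<subseteq> {0..<int N} \<times> {0..<int N} \<times> {0..<int N} \<times> {0..<int N}"
    using N by (auto simp: key_def)
  hence "finite (key ` SL2Z)" by (rule finite_subset) simp
  thus "finite (rep ` key ` SL2Z)" by (rule finite_imageI)
  show "rep ` key ` SL2Z \<noteq> {}" using SL2Z_simps(1) by blast
  show "rep ` key ` SL2Z \<subseteq> SL2Z" using rep by auto
  show "\<exists>\<delta>\<in>rep ` key ` SL2Z. mcong N \<gamma> \<delta>" if "\<gamma> \<in> SL2Z" for \<gamma>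
    using rep[OF that] that by (intro bexI[of _ "rep (key \<gamma>)"]) (auto simp: mcong_iff key_def cong_def)
qed

text \<open>By compactness \<open>\<bar>g\<bar>\<close> attains its maximum over all cusp charts \<open>\<bar>q\<bar> < 1\<close>, necessarily at an
  interior point.\<close>

lemma bounded_at_cusps_constant:
  assumes N: "N > 0" and hol: "g holomorphic_on \<H>" and inv: "invf N g"
    and bdd: "\<And>\<gamma>. \<gamma> \<in> SL2Z \<Longrightarrow> bddc (\<lambda>\<tau>. g (modular_action \<gamma> \<tau>))"
  obtains c where "\<And>\<tau>. \<tau> \<in> \<H> \<Longrightarrow> g \<tau> = c"
proof -
  have "\<exists>G. G holomorphic_on ball 0 1 \<and> (\<forall>\<tau>\<in>\<H>. G (qN N \<tau>) = g (modular_action \<gamma> \<tau>))" if "\<gamma> \<in> SL2Z" for \<gamma>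
    using q_expansion[OF N holomorphic_compose_action[OF hol that] invf_periodic[OF invf_compose[OF inv that]] bdd[OF that]]
    by metis
  then obtain G where G: "\<And>\<gamma>. \<gamma> \<in> SL2Z \<Longrightarrow> G \<gamma> holomorphic_on ball 0 1"
    "\<And>\<gamma> \<tau>. \<gamma> \<in> SL2Z \<Longrightarrow> \<tau> \<in> \<H> \<Longrightarrow> G \<gamma> (qN N \<tau>) = g (modular_action \<gamma> \<tau>)" by metis
  obtain R where R: "finite R" "R \<noteq> {}" "R \<subseteq> SL2Z" "\<And>\<gamma>. \<gamma> \<in> SL2Z \<Longrightarrow> \<exists>\<delta>\<in>R. mcong N \<gamma> \<delta>"
    using finite_mcong_representatives[OF N] by blast
  \<comment> \<open>Apart from 0, the disc of radius \<open>r\<close> is the image of the half-plane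
    Im >= 1/2. By \<open>ex_action_Im_ge\<close> the charts of the finitely many representatives,
    restricted to these discs, see every value of \<open>g\<close>.\<close>
  define r where "r = exp (- (2 * pi * (1 / 2) / N))"
  have r: "0 \<le> r" "r < 1" using N by (simp_all add: r_def)
  have sub: "cball (0::complex) r \<subseteq> ball 0 1" using r by (simp add: cball_subset_ball_iff)
  have "\<exists>v\<in>cball 0 r. \<forall>y\<in>cball 0 r. norm (G \<gamma> y) \<le> norm (G \<gamma> v)" if "\<gamma> \<in> SL2Z" for \<gamma>
    using r sub G(1)[OF that]
    by (intro continuous_attains_sup) (auto intro!: continuous_on_norm holomorphic_on_imp_continuous_on intro: holomorphic_on_subset)
  then obtain v where v: "\<And>\<gamma>. \<gamma> \<in> SL2Z \<Longrightarrow> v \<gamma> \<in> cball 0 r"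
      "\<And>\<gamma> y. \<gamma> \<in> SL2Z \<Longrightarrow> y \<in> cball 0 r \<Longrightarrow> norm (G \<gamma> y) \<le> norm (G \<gamma> (v \<gamma>))" by metis
  obtain \<gamma> where \<gamma>: "\<gamma> \<in> R" "\<And>\<delta>. \<delta> \<in> R \<Longrightarrow> norm (G \<delta> (v \<delta>)) \<le> norm (G \<gamma> (v \<gamma>))"
  proof -
    define A where "A = (\<lambda>\<delta>. norm (G \<delta> (v \<delta>))) ` R"
    have A: "finite A" "A \<noteq> {}" using R by (auto simp: A_def)
    have "x \<in> A \<Longrightarrow> \<exists>\<gamma>\<in>R. x = norm (G \<gamma> (v \<gamma>))" for x by (auto simp: A_def)
    from this[OF Max_in[OF A]] obtain \<gamma> where "\<gamma> \<in> R" "Max A = norm (G \<gamma> (v \<gamma>))" by blast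
    thus thesis using that[of \<gamma>] Max_ge[OF A(1)] by (auto simp: A_def)
  qed
  define m where "m = norm (G \<gamma> (v \<gamma>))"
  have \<gamma>SL: "\<gamma> \<in> SL2Z" using R \<gamma> by blast
  have g_le: "norm (g \<tau>) \<le> m" if \<tau>: "\<tau> \<in> \<H>" for \<tau>
  proof -
    obtain \<delta> where \<delta>: "\<delta> \<in> SL2Z" "Im (modular_action \<delta> \<tau>) \<ge> 1 / 2" using ex_action_Im_ge[OF \<tau>] by blast
    define w where "w = modular_action \<delta> \<tau>"
    have w: "w \<in> \<H>" using \<delta> \<tau> by (simp add: w_def)
    obtain \<epsilon> where \<epsilon>: "\<epsilon> \<in> SL2Z" "\<epsilon> \<in> R" "mcong N (inv2 \<delta>) \<epsilon>"
      using R(3) R(4)[of "inv2 \<delta>"] \<delta> by auto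
    hence "g (modular_action (inv2 \<delta>) w) = g (modular_action \<epsilon> w)"
      using \<delta> \<epsilon> w by (intro invf_mcong[OF inv]) auto
    hence "g \<tau> = G \<epsilon> (qN N w)" using \<delta> \<tau> G(2)[OF \<epsilon>(1) w] by (simp add: w_def)
    moreover have "qN N w \<in> cball 0 r"
      using \<delta> N by (simp add: w_def norm_qN r_def divide_right_mono mult_left_mono)
    ultimately show ?thesis using v(2)[OF \<epsilon>(1)] \<gamma>(2)[OF \<epsilon>(2)] by (auto simp: m_def intro: order_trans)
  qed
  have "norm (G \<gamma> z) \<le> m" if z: "z \<in> ball 0 1" for z
  proof (cases "z = 0")
    case True
    thus ?thesis using v(2)[OF \<gamma>SL, of 0] r by (simp add: m_def)
  next
    case False
    then obtain \<tau> where "\<tau> \<in> \<H>" "qN N \<tau> = z" using qN_surj[OF N z] by blast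
    thus ?thesis using G(2)[OF \<gamma>SL] g_le \<gamma>SL by (metis modular_action_UHP)
  qed
  hence "G \<gamma> constant_on ball 0 1"
    using maximum_modulus_principle[of "G \<gamma>" "ball 0 1" "ball 0 1" "v \<gamma>"] G(1)[OF \<gamma>SL] v(1)[OF \<gamma>SL] sub
    by (auto simp: m_def)
  then obtain c where c: "\<And>z. z \<in> ball 0 1 \<Longrightarrow> G \<gamma> z = c" by (auto simp: constant_on_def)
  have "g \<tau> = c" if \<tau>: "\<tau> \<in> \<H>" for \<tau>
    using G(2)[OF \<gamma>SL, of "modular_action (inv2 \<gamma>) \<tau>"] c[OF qN_in_ball[OF N]] \<gamma>SL \<tau> by simp
  thus thesis using that by blast
qed

section \<open>Hauptmoduln\<close>

text \<open>Degree one, stated without Riemann surfaces: a single pole, at the cusp infinity, which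
  is simple in the local parameter \<open>qN N\<close>.\<close>

locale hauptmodul =
  fixes N :: nat and t :: "complex \<Rightarrow> complex"
  assumes N_ge_2: "N \<ge> 2"
    and holo: "t holomorphic_on \<H>"
    and inv: "invf N t"
    and pole: "\<exists>c. c \<noteq> 0 \<and> ((\<lambda>\<tau>. t \<tau> * qN N \<tau>) \<longlongrightarrow> c) cuspF"
    and bdd: "\<gamma> \<in> SL2Z \<Longrightarrow> \<not> cusp_at_inf N \<gamma> \<Longrightarrow> bddc (\<lambda>\<tau>. t (modular_action \<gamma> \<tau>))"

text \<open>Everything is read off from the exponents: weight 0 and divisibility of
  \<open>kE\<close> give invariance, \<open>kord = 2 * N\<close> gives the pole, and
  \<open>kord \<le> 0\<close> at the other cusps means nonnegative order.\<close>

lemma hauptmodul_kp: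
  assumes "N \<in> {2,3,4,5}"
  shows "hauptmodul N (kp N (tdata N))"
proof
  have N: "N > 0" using assms by auto
  note td = tdata_props[OF assms]
  show "N \<ge> 2" using assms by auto
  show "kp N (tdata N) holomorphic_on \<H>" by (rule kp_holomorphic[OF N td(1)])
  show "invf N (kp N (tdata N))"
    unfolding invf_def using kp_Gamma_invariant[OF N _ _ td(4)] by (simp add: td(2))
  have "- of_int (kord N (tdata N)) / (2 * of_nat N ^ 2) = - (1 / real N)"
    using N by (simp add: td(3) power2_eq_square)
  hence "has_order (kp N (tdata N)) (- (1 / real N))" using kp_has_order[OF N td(1)] by simp
  thus "\<exists>c. c \<noteq> 0 \<and> ((\<lambda>\<tau>. kp N (tdata N) \<tau> * qN N \<tau>) \<longlongrightarrow> c) cuspF"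
    unfolding has_order_def qN_def by simp
  fix \<gamma> assume \<gamma>: "\<gamma> \<in> SL2Z" "\<not> cusp_at_inf N \<gamma>"
  define \<alpha> where "\<alpha> = - of_int (kord N (kact \<gamma> (tdata N))) / (2 * real N ^ 2)"
  have "\<alpha> \<ge> 0" using td(5)[OF \<gamma>] N unfolding \<alpha>_def by (intro divide_nonneg_pos) auto
  obtain c where "((\<lambda>\<tau>. kp N (kact \<gamma> (tdata N)) \<tau> * ex (- (of_real \<alpha> * \<tau>))) \<longlongrightarrow> c) cuspF"
    using kp_has_order[OF N kgood_kact[OF \<gamma>(1) td(1)]] unfolding has_order_def \<alpha>_def by blast
  hence "bddc (\<lambda>\<tau>. kp N (kact \<gamma> (tdata N)) \<tau> * ex (- (of_real \<alpha> * \<tau>)))" by (rule bddc_tendsto)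
  moreover have "bddc (\<lambda>\<tau>. ex (of_real \<alpha> * \<tau>))"
    unfolding bddc_def
    by (intro exI[of _ 1] eventually_mono[OF eventually_cuspF_UHP])
       (use \<open>\<alpha> \<ge> 0\<close> in \<open>simp add: norm_ex UHP_iff\<close>)
  ultimately have "bddc (\<lambda>\<tau>. (kp N (kact \<gamma> (tdata N)) \<tau> * ex (- (of_real \<alpha> * \<tau>))) * ex (of_real \<alpha> * \<tau>))"
    by (rule bddc_mult)
  thus "bddc (\<lambda>\<tau>. kp N (tdata N) (modular_action \<gamma> \<tau>))"
    by (rule bddc_cong[rotated]) (simp add: kp_action[OF \<gamma>(1)] td(2) ex_minus)
qed

context hauptmodul
begin

lemma N_pos: "N > 0" using N_ge_2 by simp

lemma at_inf: "filterlim t at_infinity cuspF"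
proof -
  obtain c where c: "c \<noteq> 0" "((\<lambda>\<tau>. t \<tau> * qN N \<tau>) \<longlongrightarrow> c) cuspF" using pole by blast
  have "filterlim (qN N) (at 0) cuspF"
    using qN_tendsto[OF N_pos] by (simp add: filterlim_at)
  from filterlim_divide_at_infinity[OF c(2) this c(1)] show ?thesis by simp
qed

lemma periodic: "\<tau> \<in> \<H> \<Longrightarrow> t (\<tau> + of_int (int N * k)) = t \<tau>"
  by (rule invf_periodic[OF inv])

lemma affine:
  assumes "a \<noteq> 0"
  shows "hauptmodul N (\<lambda>\<tau>. a * t \<tau> + b)"
proof
  show "N \<ge> 2" by (rule N_ge_2)
  show "(\<lambda>\<tau>. a * t \<tau> + b) holomorphic_on \<H>" by (intro holomorphic_intros holo)
  show "invf N (\<lambda>\<tau>. a * t \<tau> + b)" using inv by (simp add: invf_def)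
  obtain c where c: "c \<noteq> 0" "((\<lambda>\<tau>. t \<tau> * qN N \<tau>) \<longlongrightarrow> c) cuspF" using pole by blast
  have "((\<lambda>\<tau>. a * (t \<tau> * qN N \<tau>) + b * qN N \<tau>) \<longlongrightarrow> a * c + b * 0) cuspF"
    by (intro tendsto_intros c qN_tendsto N_pos)
  thus "\<exists>c. c \<noteq> 0 \<and> ((\<lambda>\<tau>. (a * t \<tau> + b) * qN N \<tau>) \<longlongrightarrow> c) cuspF"
    using assms c by (intro exI[of _ "a * c"]) (simp add: algebra_simps)
  show "bddc (\<lambda>\<tau>. a * t (modular_action \<gamma> \<tau>) + b)" if "\<gamma> \<in> SL2Z" "\<not> cusp_at_inf N \<gamma>" for \<gamma>
    by (intro bddc_add bddc_mult bddc_const bdd that)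
qed

text \<open>A cusp equivalent to infinity differs from it by a translation only, so boundedness
  there follows from boundedness at infinity.\<close>

lemma constantI:
  assumes "h holomorphic_on \<H>" "invf N h" "bddc h"
    and "\<And>\<gamma>. \<gamma> \<in> SL2Z \<Longrightarrow> \<not> cusp_at_inf N \<gamma> \<Longrightarrow> bddc (\<lambda>\<tau>. h (modular_action \<gamma> \<tau>))"
  obtains c where "\<And>\<tau>. \<tau> \<in> \<H> \<Longrightarrow> h \<tau> = c"
proof -
  have "bddc (\<lambda>\<tau>. h (modular_action \<gamma> \<tau>))" if \<gamma>: "\<gamma> \<in> SL2Z" for \<gamma>
  proof (cases "cusp_at_inf N \<gamma>")
    case True
    then obtain j :: int where "\<And>\<tau>. \<tau> \<in> \<H> \<Longrightarrow> h (modular_action \<gamma> \<tau>) = h (\<tau> + of_int j)"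
      using invf_cusp_at_inf[OF assms(2) \<gamma>] by blast
    thus ?thesis using bddc_cong[OF _ bddc_shift[OF assms(3)]] by metis
  qed (use assms \<gamma> in auto)
  thus thesis using bounded_at_cusps_constant[OF N_pos assms(1,2)] that by blast
qed

text \<open>The factor \<open>ex (- (1 / of_nat N))\<close> is the change of \<open>1 / qN N\<close>
  under translation by 1, so the combination \<open>h\<close> loses its pole at infinity. At cusps
  inequivalent to infinity both terms are bounded, and \<open>constantI\<close> applies.\<close>

lemma T_action:
  obtains k where "\<And>\<tau>. \<tau> \<in> \<H> \<Longrightarrow> t (\<tau> + 1) = ex (- (1 / of_nat N)) * t \<tau> + k"
proof -
  define z where "z = ex (- (1 / of_nat N))"
  define h where "h = (\<lambda>\<tau>. t (modular_action (Tm 1) \<tau>) + (- z) * t \<tau>)"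
  obtain c where c: "c \<noteq> 0" "((\<lambda>\<tau>. t \<tau> * qN N \<tau>) \<longlongrightarrow> c) cuspF" using pole by blast
  have h_hol: "h holomorphic_on \<H>" unfolding h_def by (intro holomorphic_intros holo holomorphic_compose_action) simp
  have h_inv: "invf N h" using invf_compose[OF inv, of "Tm 1"] inv unfolding h_def invf_def by simp
  have "((\<lambda>\<tau>. t (\<tau> + of_int 1) * qN N (\<tau> + of_int 1)) \<longlongrightarrow> c) cuspF"
    by (rule filterlim_compose[OF c(2) filterlim_shift_cuspF])
  hence "((\<lambda>\<tau>. z * (t (\<tau> + of_int 1) * qN N (\<tau> + of_int 1)) + (- z) * (t \<tau> * qN N \<tau>)) \<longlongrightarrow> z * c + (- z) * c) cuspF"
    by (intro tendsto_intros c)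
  moreover have "z * (t (\<tau> + of_int 1) * qN N (\<tau> + of_int 1)) + (- z) * (t \<tau> * qN N \<tau>) = h \<tau> * qN N \<tau>" for \<tau>
  proof -
    have "qN N (\<tau> + 1) = qN N \<tau> / z"
      by (simp add: qN_def z_def add_divide_distrib ex_diff[symmetric])
    thus ?thesis by (simp add: h_def z_def algebra_simps)
  qed
  ultimately have lim0: "((\<lambda>\<tau>. h \<tau> * qN N \<tau>) \<longlongrightarrow> 0) cuspF" by simp
  have per: "h (\<tau> + of_int (int N * k)) * qN N (\<tau> + of_int (int N * k)) = h \<tau> * qN N \<tau>" if "\<tau> \<in> \<H>" for \<tau> k
  proof -
    have "qN N (\<tau> + of_int (int N * k)) = qN N \<tau>"
      using N_pos by (simp add: qN_def add_divide_distrib ex_add)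
    thus ?thesis by (simp only: invf_periodic[OF h_inv that])
  qed
  have "(\<lambda>\<tau>. h \<tau> * qN N \<tau>) holomorphic_on \<H>"
    unfolding qN_def using N_pos by (intro holomorphic_intros h_hol) auto
  then obtain L M where "((\<lambda>\<tau>. h \<tau> * qN N \<tau>) \<longlongrightarrow> L) cuspF" and M: "((\<lambda>\<tau>. (h \<tau> * qN N \<tau> - L) / qN N \<tau>) \<longlongrightarrow> M) cuspF"
    using q_expansion_limit[OF N_pos _ per bddc_tendsto[OF lim0]] by blast
  \<comment> \<open>The product with q extends to q = 0 with value 0, so dividing by q again leaves
    a bounded function.\<close>
  hence "L = 0" using lim0 tendsto_unique[OF cuspF_nontrivial] by blast
  hence h_bdd: "bddc h" using bddc_tendsto[OF M] by simp
  have "bddc (\<lambda>\<tau>. h (modular_action \<gamma> \<tau>))" if \<gamma>: "\<gamma> \<in> SL2Z" "\<not> cusp_at_inf N \<gamma>" for \<gamma>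
  proof -
    have "\<not> cusp_at_inf N (Tm 1 ** \<gamma>)"
    proof
      assume *: "cusp_at_inf N (Tm 1 ** \<gamma>)"
      hence c: "int N dvd \<gamma> $ 2 $ 1" by (simp add: cusp_at_inf_def mult_nth2) (simp add: Tm_def)
      have "int N dvd (\<gamma> $ 1 $ 1 - 1) + \<gamma> $ 2 $ 1 \<or> int N dvd (\<gamma> $ 1 $ 1 + 1) + \<gamma> $ 2 $ 1"
        using * by (simp add: cusp_at_inf_def mult_nth2) (simp add: Tm_def algebra_simps)
      hence "cusp_at_inf N \<gamma>" using c by (simp add: cusp_at_inf_def dvd_add_left_iff)
      thus False using \<gamma> by simp
    qed
    hence "bddc (\<lambda>\<tau>. t (modular_action (Tm 1 ** \<gamma>) \<tau>) + (- z) * t (modular_action \<gamma> \<tau>))"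
      using \<gamma> by (intro bddc_add bddc_mult bddc_const bdd) (auto simp: SL2Z_mult)
    thus ?thesis by (rule bddc_cong[rotated]) (use \<gamma> in \<open>simp add: h_def modular_action_mult\<close>)
  qed
  then obtain k where "\<And>\<tau>. \<tau> \<in> \<H> \<Longrightarrow> h \<tau> = k"
    using constantI[OF h_hol h_inv h_bdd] by blast
  hence k: "t (\<tau> + 1) + (- z) * t \<tau> = k" if "\<tau> \<in> \<H>" for \<tau> using that by (simp add: h_def)
  have "t (\<tau> + 1) = z * t \<tau> + k" if "\<tau> \<in> \<H>" for \<tau> using k[OF that] by auto
  thus thesis using that unfolding z_def by blast
qed

text \<open>Let s be the value of \<open>t\<close> at the cusp 0. Near infinity
  \<open>t (-1/\<tau>) - s\<close> vanishes and cancels the simple pole of \<open>t - s\<close>; the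
  product is symmetric under inversion, so it is bounded at 0 too, and at the remaining cusps both
  factors are bounded. At this stage the constant may still be 0.\<close>

lemma S_action:
  obtains s C where "\<And>\<tau>. \<tau> \<in> \<H> \<Longrightarrow> (t (- 1 / \<tau>) - s) * (t \<tau> - s) = C"
proof -
  define u where "u = (\<lambda>\<tau>. t (modular_action Sm \<tau>))"
  obtain c where c: "c \<noteq> 0" "((\<lambda>\<tau>. t \<tau> * qN N \<tau>) \<longlongrightarrow> c) cuspF" using pole by blast
  have u_hol: "u holomorphic_on \<H>" unfolding u_def by (intro holomorphic_compose_action holo) simp
  have u_inv: "invf N u" unfolding u_def by (intro invf_compose inv) simp
  have "\<not> cusp_at_inf N Sm" using N_ge_2 by (simp add: cusp_at_inf_def Sm_def)
  hence "bddc u" unfolding u_def by (intro bdd) auto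
  then obtain s M where s: "(u \<longlongrightarrow> s) cuspF" and M: "((\<lambda>\<tau>. (u \<tau> - s) / qN N \<tau>) \<longlongrightarrow> M) cuspF"
    using q_expansion_limit[OF N_pos u_hol invf_periodic[OF u_inv]] by blast
  define h where "h = (\<lambda>\<tau>. (u \<tau> + (- s)) * (t \<tau> + (- s)))"
  have h_hol: "h holomorphic_on \<H>" unfolding h_def by (intro holomorphic_intros u_hol holo)
  have h_inv: "invf N h" using u_inv inv by (simp add: h_def invf_def)
  have "((\<lambda>\<tau>. ((u \<tau> - s) / qN N \<tau>) * (t \<tau> * qN N \<tau> + (- s) * qN N \<tau>)) \<longlongrightarrow> M * (c + (- s) * 0)) cuspF"
    by (intro tendsto_intros M c qN_tendsto N_pos)
  moreover have "((u \<tau> - s) / qN N \<tau>) * (t \<tau> * qN N \<tau> + (- s) * qN N \<tau>) = h \<tau>" for \<tau>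
    by (simp add: h_def divide_simps) (simp add: algebra_simps)
  ultimately have h_bdd: "bddc h" using bddc_tendsto by simp
  have uS: "u (modular_action Sm \<tau>) = t \<tau>" if "\<tau> \<in> \<H>" for \<tau> using that by (simp add: u_def)
  have "bddc (\<lambda>\<tau>. h (modular_action \<gamma> \<tau>))" if \<gamma>: "\<gamma> \<in> SL2Z" "\<not> cusp_at_inf N \<gamma>" for \<gamma>
  proof (cases "cusp_at_inf N (Sm ** \<gamma>)")
    case True
    have S\<gamma>: "Sm ** \<gamma> \<in> SL2Z" using \<gamma> by (simp add: SL2Z_mult)
    obtain j :: int where j: "\<And>\<tau>. \<tau> \<in> \<H> \<Longrightarrow> h (modular_action (Sm ** \<gamma>) \<tau>) = h (\<tau> + of_int j)"
      using invf_cusp_at_inf[OF h_inv S\<gamma> True] by blast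
    have "h (\<tau> + of_int j) = h (modular_action \<gamma> \<tau>)" if "\<tau> \<in> \<H>" for \<tau>
    proof -
      have w: "modular_action \<gamma> \<tau> \<in> \<H>" using \<gamma> that by simp
      have "h (\<tau> + of_int j) = h (modular_action Sm (modular_action \<gamma> \<tau>))"
        using j[OF that] modular_action_mult[OF _ \<gamma>(1) that, of Sm] by simp
      also have "\<dots> = h (modular_action \<gamma> \<tau>)"
        unfolding h_def uS[OF w] by (simp add: u_def mult_ac)
      finally show ?thesis .
    qed
    thus ?thesis by (intro bddc_cong[OF _ bddc_shift[OF h_bdd, of j]])
  next
    case False
    hence "bddc (\<lambda>\<tau>. (t (modular_action (Sm ** \<gamma>) \<tau>) + (- s)) * (t (modular_action \<gamma> \<tau>) + (- s)))"
      using \<gamma> by (intro bddc_add bddc_mult bddc_const bdd) (auto simp: SL2Z_mult)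
    thus ?thesis by (rule bddc_cong[rotated]) (use \<gamma> in \<open>simp add: h_def u_def modular_action_mult\<close>)
  qed
  then obtain C where "\<And>\<tau>. \<tau> \<in> \<H> \<Longrightarrow> h \<tau> = C"
    using constantI[OF h_hol h_inv h_bdd] by blast
  thus thesis using that[of s C] by (simp add: h_def u_def)
qed

lemma large_value: obtains \<tau> where "\<tau> \<in> \<H>" "norm (t \<tau>) > B"
proof -
  have "eventually (\<lambda>\<tau>. norm (t \<tau>) > B \<and> \<tau> \<in> \<H>) cuspF"
    using at_inf eventually_cuspF_UHP unfolding filterlim_at_infinity_conv_norm_at_top filterlim_at_top_dense
    by (auto intro: eventually_conj)
  thus thesis using eventually_happens'[OF cuspF_nontrivial] that by blast
qed

end

text \<open>The constant in the relation for \<open>S\<close> is forced by \<open>(ST)\<^sup>3 = -1\<close>.\<close>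

lemma normalised_hauptmodul:
  assumes "N \<in> {2,3,4,5}" "\<sigma> \<noteq> 0"
  defines "z \<equiv> ex (- (1 / of_nat N))"
  obtains t where "hauptmodul N t" "\<And>\<tau>. \<tau> \<in> \<H> \<Longrightarrow> t (\<tau> + 1) = z * t \<tau>"
    "\<And>\<tau>. \<tau> \<in> \<H> \<Longrightarrow> z * (t (- 1 / \<tau>) - \<sigma>) * (t \<tau> - \<sigma>) = - (\<sigma>\<^sup>2 * (z - 1)\<^sup>2)"
proof -
  interpret t0: hauptmodul N "kp N (tdata N)" by (rule hauptmodul_kp[OF assms(1)])
  have N: "N \<ge> 2" by (rule t0.N_ge_2)
  have "z \<noteq> 1"
  proof
    assume "z = 1"
    then obtain n :: int where "- (1 / of_nat N) = (of_int n :: complex)" by (auto simp: z_def ex_eq_1_iff)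
    hence "Re (- (1 / of_nat N)) = Re (of_int n :: complex)" by (rule arg_cong)
    hence "- (1 / real N) = of_int n" by simp
    hence "of_int (- n * int N) = (1::real)" using N by (simp add: field_simps)
    hence "(- n) * int N = 1" by (simp only: of_int_eq_1_iff)
    hence "int N dvd 1" by (metis dvd_triv_right)
    thus False using N by simp
  qed
  obtain k where k: "\<And>\<tau>. \<tau> \<in> \<H> \<Longrightarrow> kp N (tdata N) (\<tau> + 1) = z * kp N (tdata N) \<tau> + k"
    using t0.T_action unfolding z_def by blast
  \<comment> \<open>The affine map x to zx + k becomes linear once its fixed point k / (1 - z) is
    moved to 0.\<close>
  define t1 where "t1 = (\<lambda>\<tau>. 1 * kp N (tdata N) \<tau> + (- k / (1 - z)))"
  interpret t1: hauptmodul N t1 unfolding t1_def by (rule t0.affine) simp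
  have T: "t1 (\<tau> + 1) = z * t1 \<tau>" if "\<tau> \<in> \<H>" for \<tau>
    using k[OF that] \<open>z \<noteq> 1\<close> by (simp add: t1_def divide_simps) (simp add: algebra_simps)
  obtain s C where S: "\<And>\<tau>. \<tau> \<in> \<H> \<Longrightarrow> (t1 (- 1 / \<tau>) - s) * (t1 \<tau> - s) = C"
    using t1.S_action by blast
  have "z \<noteq> 0" by (simp add: z_def)
  \<comment> \<open>Otherwise \<open>t1 (-1/\<tau>)\<close> would equal s on a half-plane, hence
    everywhere by the identity theorem, and \<open>t1\<close> would be constant.\<close>
  have "C \<noteq> 0"
  proof
    assume "C = 0"
    have "eventually (\<lambda>\<tau>. norm (t1 \<tau>) > norm s) cuspF"
      using t1.at_inf unfolding filterlim_at_infinity_conv_norm_at_top filterlim_at_top_dense by blast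
    then obtain Y where Y: "\<And>\<tau>. Im \<tau> > Y \<Longrightarrow> norm (t1 \<tau>) > norm s" unfolding eventually_cuspF by blast
    define U where "U = {\<tau>. Im \<tau> > max 0 Y}"
    have "t1 (- 1 / \<tau>) = s" if "\<tau> \<in> U" for \<tau>
      using S[of \<tau>] Y[of \<tau>] that \<open>C = 0\<close> by (auto simp: U_def UHP_iff)
    moreover have "open U" unfolding U_def by (rule open_halfspace_Im_gt)
    moreover have "U \<subseteq> \<H>" by (auto simp: U_def UHP_iff)
    moreover have "Complex 0 (max 0 Y + 1) \<in> U" by (auto simp: U_def max_def)
    moreover have "(\<lambda>\<tau>. t1 (modular_action Sm \<tau>)) holomorphic_on \<H>"
      by (intro holomorphic_compose_action t1.holo) simp
    ultimately have const: "t1 (- 1 / \<tau>) = s" if "\<tau> \<in> \<H>" for \<tau>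
      using analytic_continuation_open[of U \<H> "\<lambda>\<tau>. t1 (- 1 / \<tau>)" "\<lambda>_. s" \<tau>] that connected_UHP by force
    obtain \<tau> where \<tau>: "\<tau> \<in> \<H>" "norm (t1 \<tau>) > norm s" using t1.large_value by blast
    have "t1 \<tau> = s" using const[of "modular_action Sm \<tau>"] \<tau> modular_action_UHP[of Sm \<tau>] by simp
    thus False using \<tau> by simp
  qed
  \<comment> \<open>With a = ST\<tau> and b = STa, the third application of ST returns to \<tau>.
    Eliminating the values at a and b from the three instances of the relation leaves a product of
    two factors, only one of which depends on \<tau>.\<close>
  have rel: "(s\<^sup>2 * (z - 1)\<^sup>2 + z * C) * (C - (t1 \<tau> - s) * (z * t1 \<tau> - s)) = 0" if \<tau>: "\<tau> \<in> \<H>" for \<tau>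
  proof -
    define a b where "a = - 1 / (\<tau> + 1)" and "b = - 1 / (a + 1)"
    have nz: "\<tau> \<noteq> 0" "\<tau> + 1 \<noteq> 0" using \<tau> by (auto simp: UHP_iff complex_eq_iff)
    have sh: "w + 1 \<in> \<H>" if "w \<in> \<H>" for w using that by (simp add: UHP_iff)
    have inv: "- 1 / w \<in> \<H>" if "w \<in> \<H>" for w using modular_action_UHP[of Sm w] that by simp
    have ab1: "a \<in> \<H>" unfolding a_def by (intro inv sh \<tau>)
    have ab: "a \<in> \<H>" "b \<in> \<H>" using ab1 inv[OF sh[OF ab1]] by (auto simp only: b_def)
    have "a + 1 = \<tau> / (\<tau> + 1)" using nz by (simp add: a_def field_simps)
    hence b: "b = - (\<tau> + 1) / \<tau>" using nz by (simp add: b_def)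
    have c: "- 1 / (b + 1) = \<tau>" using nz by (simp add: b field_simps)
    define p q r where "p = t1 \<tau>" and "q = t1 a" and "r = t1 b"
    have 1: "(q - s) * (z * p - s) = C" using S[OF sh[OF \<tau>]] T[OF \<tau>] by (simp add: p_def q_def a_def)
    have 2: "(r - s) * (z * q - s) = C" using S[OF sh[OF ab(1)]] T[OF ab(1)] by (simp add: r_def q_def b_def)
    have 3: "(p - s) * (z * r - s) = C" using S[OF sh[OF ab(2)]] T[OF ab(2)] c by (simp add: p_def r_def)
    have "z * C = (z * r - z * s) * (z * q - s)" unfolding 2[symmetric] by (simp add: algebra_simps)
    hence "z * C * ((p - s) * (z * p - s)) = ((z * r - z * s) * (p - s)) * ((z * q - s) * (z * p - s))" by simp
    also have "(z * r - z * s) * (p - s) = s * (1 - z) * (p - s) + C" unfolding 3[symmetric] by (simp add: algebra_simps)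
    also have "(z * q - s) * (z * p - s) = s * (z - 1) * (z * p - s) + z * C" unfolding 1[symmetric] by (simp add: algebra_simps)
    finally have "z * C * ((p - s) * (z * p - s)) = (s * (1 - z) * (p - s) + C) * (s * (z - 1) * (z * p - s) + z * C)" .
    moreover have "(s\<^sup>2 * (z - 1)\<^sup>2 + z * C) * (C - (p - s) * (z * p - s)) =
        (s * (1 - z) * (p - s) + C) * (s * (z - 1) * (z * p - s) + z * C) - z * C * ((p - s) * (z * p - s))"
      by (simp add: algebra_simps power2_eq_square)
    ultimately have "(s\<^sup>2 * (z - 1)\<^sup>2 + z * C) * (C - (p - s) * (z * p - s)) = 0" by simp
    thus ?thesis by (simp add: p_def)
  qed
  \<comment> \<open>At a point where \<open>t1\<close> is large the second factor in
    \<open>rel\<close> does not vanish.\<close>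
  have zC: "z * C = - (s\<^sup>2 * (z - 1)\<^sup>2)"
  proof -
    have nz: "norm z = 1" by (simp add: z_def norm_ex)
    obtain \<tau> where \<tau>: "\<tau> \<in> \<H>" "norm (t1 \<tau>) > norm s + 1 + norm C" using t1.large_value by blast
    have "norm (t1 \<tau> - s) > 1 + norm C" using \<tau> norm_triangle_ineq2[of "t1 \<tau>" s] by linarith
    moreover have "norm (z * t1 \<tau> - s) > 1" using \<tau> norm_triangle_ineq2[of "z * t1 \<tau>" s, unfolded norm_mult nz mult_1] norm_ge_zero[of C] by linarith
    moreover have "0 < 1 + norm C" by (simp add: add_pos_nonneg)
    ultimately have "norm ((t1 \<tau> - s) * (z * t1 \<tau> - s)) > (1 + norm C) * 1"
      unfolding norm_mult by (intro mult_strict_mono) linarith+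
    hence "C - (t1 \<tau> - s) * (z * t1 \<tau> - s) \<noteq> 0" by auto
    hence "s\<^sup>2 * (z - 1)\<^sup>2 + z * C = 0" using rel[OF \<tau>(1)] by (metis mult_eq_0_iff)
    thus ?thesis by (simp add: add_eq_0_iff)
  qed
  hence "s \<noteq> 0" using \<open>C \<noteq> 0\<close> \<open>z \<noteq> 0\<close> by auto
  define t where "t = (\<lambda>\<tau>. (\<sigma> / s) * t1 \<tau> + 0)"
  show thesis
  proof (rule that)
    show "hauptmodul N t" unfolding t_def using assms(2) \<open>s \<noteq> 0\<close> by (intro t1.affine) simp
    show "t (\<tau> + 1) = z * t \<tau>" if "\<tau> \<in> \<H>" for \<tau> using T[OF that] by (simp add: t_def)
    show "z * (t (- 1 / \<tau>) - \<sigma>) * (t \<tau> - \<sigma>) = - (\<sigma>\<^sup>2 * (z - 1)\<^sup>2)" if "\<tau> \<in> \<H>" for \<tau>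
    proof -
      have "t w - \<sigma> = (\<sigma> / s) * (t1 w - s)" for w using \<open>s \<noteq> 0\<close> by (simp add: t_def field_simps)
      hence "z * (t (- 1 / \<tau>) - \<sigma>) * (t \<tau> - \<sigma>) = (\<sigma> / s)\<^sup>2 * (z * ((t1 (- 1 / \<tau>) - s) * (t1 \<tau> - s)))"
        by (simp add: power2_eq_square)
      also have "\<dots> = (\<sigma> / s)\<^sup>2 * (- (s\<^sup>2 * (z - 1)\<^sup>2))" unfolding S[OF that] zC ..
      finally show ?thesis using \<open>s \<noteq> 0\<close> by (simp add: power_divide)
    qed
  qed
qed

text \<open>The orbit of \<open>\<infinity>\<close> under the two Moebius maps \<open>x \<mapsto> z x\<close> and
  \<open>x \<mapsto> \<sigma> - \<sigma>\<^sup>2 (z - 1)\<^sup>2 / (z (x - \<sigma>))\<close>, without \<open>\<infinity>\<close> itself.\<close>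

inductive_set mobius_orbit :: "complex \<Rightarrow> complex \<Rightarrow> complex set" for z \<sigma> where
  base: "\<sigma> \<in> mobius_orbit z \<sigma>"
| rot: "s \<in> mobius_orbit z \<sigma> \<Longrightarrow> z * s \<in> mobius_orbit z \<sigma>"
| invol: "s \<in> mobius_orbit z \<sigma> \<Longrightarrow> s \<noteq> \<sigma> \<Longrightarrow> z * (s' - \<sigma>) * (s - \<sigma>) = - (\<sigma>\<^sup>2 * (z - 1)\<^sup>2) \<Longrightarrow>
    s' \<in> mobius_orbit z \<sigma>"

text \<open>The two conditions serve two purposes: since \<open>t\<close> omits P, each 1/(t - s) is
  holomorphic; and since \<open>t\<close> tends to a point of P at each cusp inequivalent to
  infinity, powers of the product of all t - s remove poles there.\<close>

definition punctured_hauptmodul :: "nat \<Rightarrow> (complex \<Rightarrow> complex) \<Rightarrow> complex set \<Rightarrow> bool" where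
  "punctured_hauptmodul N t P \<longleftrightarrow> hauptmodul N t \<and> (\<forall>\<tau>\<in>\<H>. t \<tau> \<notin> P) \<and>
    (\<forall>\<gamma>\<in>SL2Z. \<not> cusp_at_inf N \<gamma> \<longrightarrow> (\<exists>s\<in>P. ((\<lambda>\<tau>. t (modular_action \<gamma> \<tau>)) \<longlongrightarrow> s) cuspF))"

lemma not_bddc_at_infinity: "filterlim f at_infinity cuspF \<Longrightarrow> \<not> bddc f"
proof
  assume f: "filterlim f at_infinity cuspF" and "bddc f"
  then obtain B where B: "eventually (\<lambda>\<tau>. norm (f \<tau>) \<le> B) cuspF" by (auto simp: bddc_def)
  have "eventually (\<lambda>\<tau>. norm (f \<tau>) > B) cuspF"
    using f unfolding filterlim_at_infinity_conv_norm_at_top filterlim_at_top_dense by blast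
  with B have "eventually (\<lambda>\<tau>. False) cuspF" by eventually_elim auto
  thus False by simp
qed

lemma tendsto_cuspF_cong:
  assumes "\<And>\<tau>. \<tau> \<in> \<H> \<Longrightarrow> f \<tau> = g \<tau>"
  shows "filterlim f F cuspF \<longleftrightarrow> filterlim g F cuspF"
  by (intro filterlim_cong refl eventually_mono[OF eventually_cuspF_UHP] assms)

text \<open>Along words in the generators the limit of \<open>t\<close> at \<gamma>\<infinity> moves
  by the two Moebius maps, which keeps it in the orbit or at infinity. The same relations transport
  omission of values: \<sigma> is omitted because the right side of the relation for S is nonzero,
  and an orbit point can be a value of \<open>t\<close> only if its predecessor is one.\<close>

lemma punctured_hauptmodul_orbit:
  assumes "hauptmodul N t" "\<sigma> \<noteq> 0" "z \<noteq> 0" "z \<noteq> 1"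
    and T: "\<And>\<tau>. \<tau> \<in> \<H> \<Longrightarrow> t (\<tau> + 1) = z * t \<tau>"
    and S: "\<And>\<tau>. \<tau> \<in> \<H> \<Longrightarrow> z * (t (- 1 / \<tau>) - \<sigma>) * (t \<tau> - \<sigma>) = - (\<sigma>\<^sup>2 * (z - 1)\<^sup>2)"
  shows "punctured_hauptmodul N t (mobius_orbit z \<sigma>)"
proof -
  interpret hauptmodul N t by fact
  define K where "K = - (\<sigma>\<^sup>2 * (z - 1)\<^sup>2)"
  have K: "K \<noteq> 0" using assms by (simp add: K_def)
  have avoid: "t \<tau> \<noteq> s" if "s \<in> mobius_orbit z \<sigma>" "\<tau> \<in> \<H>" for s \<tau>
    using that
  proof (induction arbitrary: \<tau>)
    case base
    thus ?case using S[of \<tau>] K by (auto simp: K_def)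
  next
    case (rot s)
    have "\<tau> - 1 \<in> \<H>" using rot by (simp add: UHP_iff)
    thus ?case using T[of "\<tau> - 1"] rot.IH[of "\<tau> - 1"] assms(3) by auto
  next
    case (invol s s')
    show ?case
    proof
      assume "t \<tau> = s'"
      moreover have "s' \<noteq> \<sigma>" using invol K by (auto simp: K_def)
      ultimately have "t (- 1 / \<tau>) - \<sigma> = s - \<sigma>"
        using S[OF invol.prems] invol.hyps(3) assms(3) by (metis (no_types, lifting) eq_iff_diff_eq_0 mult.assoc mult.commute mult_cancel_left)
      moreover have "- 1 / \<tau> \<in> \<H>" using modular_action_UHP[of Sm \<tau>] invol.prems by simp
      ultimately show False using invol.IH by force
    qed
  qed
  have Tn: "t (\<tau> + of_nat n) = z ^ n * t \<tau>" if "\<tau> \<in> \<H>" for \<tau> n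
  proof (induction n)
    case (Suc n)
    have "\<tau> + of_nat n \<in> \<H>" using that by (simp add: UHP_iff)
    thus ?case using T[of "\<tau> + of_nat n"] Suc by (simp add: add_ac mult_ac)
  qed simp
  have orbn: "z ^ n * s \<in> mobius_orbit z \<sigma>" if "s \<in> mobius_orbit z \<sigma>" for s n
    by (induction n) (use that mobius_orbit.rot[of _ z \<sigma>] in \<open>auto simp: mult.assoc\<close>)
  have Q: "filterlim (\<lambda>\<tau>. t (modular_action \<gamma> \<tau>)) at_infinity cuspF \<or>
      (\<exists>s\<in>mobius_orbit z \<sigma>. ((\<lambda>\<tau>. t (modular_action \<gamma> \<tau>)) \<longlongrightarrow> s) cuspF)" if "\<gamma> \<in> SL2Z" for \<gamma>
    using that
  proof (induction rule: SL2Z_induct)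
    case one
    show ?case using at_inf by simp
  next
    case (T n \<gamma>)
    \<comment> \<open>By periodicity modulo N a nonnegative power of z is enough.\<close>
    define k where "k = nat (n mod int N)"
    have "t (modular_action (Tm n ** \<gamma>) \<tau>) = z ^ k * t (modular_action \<gamma> \<tau>)" if "\<tau> \<in> \<H>" for \<tau>
    proof -
      define w where "w = modular_action \<gamma> \<tau>"
      have w: "w \<in> \<H>" "w + of_nat k \<in> \<H>" using T that by (auto simp: w_def UHP_iff dest: modular_action_UHP)
      have "n = int k + int N * (n div int N)" using N_pos by (simp add: k_def)
      hence "t (w + of_int n) = t ((w + of_nat k) + of_int (int N * (n div int N)))" by (metis add.assoc of_int_add of_int_of_nat_eq)
      also have "\<dots> = z ^ k * t w" using periodic[OF w(2)] Tn[OF w(1)] by simp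
      finally show ?thesis using T that by (simp add: modular_action_mult w_def)
    qed
    hence eq: "filterlim (\<lambda>\<tau>. t (modular_action (Tm n ** \<gamma>) \<tau>)) F cuspF \<longleftrightarrow>
        filterlim (\<lambda>\<tau>. z ^ k * t (modular_action \<gamma> \<tau>)) F cuspF" for F
      by (rule tendsto_cuspF_cong)
    from T.IH show ?case
    proof
      assume "filterlim (\<lambda>\<tau>. t (modular_action \<gamma> \<tau>)) at_infinity cuspF"
      hence "filterlim (\<lambda>\<tau>. z ^ k * t (modular_action \<gamma> \<tau>)) at_infinity cuspF"
        using assms(3) by (intro tendsto_mult_filterlim_at_infinity[of _ "z ^ k"] tendsto_const) auto
      thus ?case unfolding eq by blast
    next
      assume "\<exists>s\<in>mobius_orbit z \<sigma>. ((\<lambda>\<tau>. t (modular_action \<gamma> \<tau>)) \<longlongrightarrow> s) cuspF"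
      then obtain s where s: "s \<in> mobius_orbit z \<sigma>" "((\<lambda>\<tau>. t (modular_action \<gamma> \<tau>)) \<longlongrightarrow> s) cuspF" by blast
      have "((\<lambda>\<tau>. z ^ k * t (modular_action \<gamma> \<tau>)) \<longlongrightarrow> z ^ k * s) cuspF" by (intro tendsto_intros s)
      thus ?case using orbn[OF s(1)] unfolding eq by blast
    qed
  next
    case (S \<gamma>)
    define tg where "tg = (\<lambda>\<tau>. t (modular_action \<gamma> \<tau>))"
    have tg\<sigma>: "tg \<tau> \<noteq> \<sigma>" if "\<tau> \<in> \<H>" for \<tau>
      using avoid[OF mobius_orbit.base] S that by (simp add: tg_def)
    have "t (modular_action (Sm ** \<gamma>) \<tau>) = \<sigma> + (K / z) / (tg \<tau> - \<sigma>)" if "\<tau> \<in> \<H>" for \<tau>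
      using assms(6)[of "modular_action \<gamma> \<tau>"] S that tg\<sigma>[OF that] assms(3)
      by (simp add: modular_action_mult tg_def[symmetric] K_def[symmetric] field_simps)
         (simp add: tg_def)
    hence eq: "filterlim (\<lambda>\<tau>. t (modular_action (Sm ** \<gamma>) \<tau>)) F cuspF \<longleftrightarrow>
        filterlim (\<lambda>\<tau>. \<sigma> + (K / z) / (tg \<tau> - \<sigma>)) F cuspF" for F
      by (rule tendsto_cuspF_cong)
    from S.IH show ?case unfolding tg_def[symmetric]
    proof
      assume "filterlim tg at_infinity cuspF"
      hence "filterlim (\<lambda>\<tau>. - \<sigma> + tg \<tau>) at_infinity cuspF"
        by (intro tendsto_add_filterlim_at_infinity[OF tendsto_const])
      hence "filterlim (\<lambda>\<tau>. tg \<tau> - \<sigma>) at_infinity cuspF" by simp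
      hence "((\<lambda>\<tau>. \<sigma> + (K / z) / (tg \<tau> - \<sigma>)) \<longlongrightarrow> \<sigma> + 0) cuspF"
        by (intro tendsto_intros tendsto_divide_0[OF tendsto_const])
      thus ?case unfolding eq using mobius_orbit.base by force
    next
      assume "\<exists>s\<in>mobius_orbit z \<sigma>. (tg \<longlongrightarrow> s) cuspF"
      then obtain s where s: "s \<in> mobius_orbit z \<sigma>" "(tg \<longlongrightarrow> s) cuspF" by blast
      have lim: "((\<lambda>\<tau>. tg \<tau> - \<sigma>) \<longlongrightarrow> s - \<sigma>) cuspF" by (intro tendsto_intros s)
      show ?case
      proof (cases "s = \<sigma>")
        case True
        have "eventually (\<lambda>\<tau>. tg \<tau> - \<sigma> \<noteq> 0) cuspF"
          using eventually_cuspF_UHP by eventually_elim (use tg\<sigma> in auto)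
        hence "filterlim (\<lambda>\<tau>. tg \<tau> - \<sigma>) (at 0) cuspF" using lim True by (simp add: filterlim_at)
        hence "filterlim (\<lambda>\<tau>. (K / z) / (tg \<tau> - \<sigma>)) at_infinity cuspF"
          using K assms(3) by (intro filterlim_divide_at_infinity[OF tendsto_const]) auto
        hence "filterlim (\<lambda>\<tau>. \<sigma> + (K / z) / (tg \<tau> - \<sigma>)) at_infinity cuspF"
          by (intro tendsto_add_filterlim_at_infinity[OF tendsto_const])
        thus ?thesis unfolding eq by blast
      next
        case False
        define s' where "s' = \<sigma> + (K / z) / (s - \<sigma>)"
        have "z * (s' - \<sigma>) * (s - \<sigma>) = K" using False assms(3) by (simp add: s'_def)
        hence "s' \<in> mobius_orbit z \<sigma>" using mobius_orbit.invol[OF s(1) False] by (simp add: K_def)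
        moreover have "((\<lambda>\<tau>. \<sigma> + (K / z) / (tg \<tau> - \<sigma>)) \<longlongrightarrow> s') cuspF"
          unfolding s'_def using False by (intro tendsto_intros lim) auto
        ultimately show ?thesis unfolding eq by blast
      qed
    qed
  qed
  \<comment> \<open>An infinite limit is excluded by \<open>bdd\<close> when the cusp is not
    equivalent to infinity.\<close>
  show ?thesis unfolding punctured_hauptmodul_def
    using assms(1) avoid Q bdd not_bddc_at_infinity by blast
qed

lemma punctured_hauptmodul_affine:
  assumes "punctured_hauptmodul N t P" "a \<noteq> 0"
  shows "punctured_hauptmodul N (\<lambda>\<tau>. a * t \<tau> + b) ((\<lambda>s. a * s + b) ` P)"
proof -
  have "hauptmodul N (\<lambda>\<tau>. a * t \<tau> + b)"
    using assms by (intro hauptmodul.affine) (auto simp: punctured_hauptmodul_def)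
  moreover have "\<exists>s\<in>(\<lambda>s. a * s + b) ` P. ((\<lambda>\<tau>. a * t (modular_action \<gamma> \<tau>) + b) \<longlongrightarrow> s) cuspF"
    if \<gamma>: "\<gamma> \<in> SL2Z" "\<not> cusp_at_inf N \<gamma>" for \<gamma>
  proof -
    obtain s where s: "s \<in> P" "((\<lambda>\<tau>. t (modular_action \<gamma> \<tau>)) \<longlongrightarrow> s) cuspF"
      using assms \<gamma> unfolding punctured_hauptmodul_def by blast
    have "((\<lambda>\<tau>. a * t (modular_action \<gamma> \<tau>) + b) \<longlongrightarrow> a * s + b) cuspF" by (intro tendsto_intros s)
    thus ?thesis using s by blast
  qed
  ultimately show ?thesis using assms by (auto simp: punctured_hauptmodul_def)
qed

section \<open>Invariant functions of exponential growth as rational functions of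
  \<open>t\<close>\<close>

definition exp_growth_rel :: "(complex \<Rightarrow> complex) \<Rightarrow> bool" where
  "exp_growth_rel h \<longleftrightarrow> (\<exists>C M Y. \<forall>\<tau>. Im \<tau> > Y \<longrightarrow> norm (h \<tau>) \<le> C * exp (M * norm \<tau>))"

text \<open>The bound is in the modulus of \<tau>, not in its imaginary part; periodicity allows a
  translation to |Re| <= N, where the two differ by at most a constant. A power k with 2 pi k / N >=
  |M| then outweighs the exponential.\<close>

lemma exp_growth_pole_order:
  assumes "N > 0" and per: "\<And>\<tau> k::int. \<tau> \<in> \<H> \<Longrightarrow> h (\<tau> + of_int (int N * k)) = h \<tau>"
    and "exp_growth_rel h"
  obtains k where "bddc (\<lambda>\<tau>. h \<tau> * qN N \<tau> ^ k)"
proof -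
  obtain C M Y where CM: "\<And>\<tau>. Im \<tau> > Y \<Longrightarrow> norm (h \<tau>) \<le> C * exp (M * norm \<tau>)"
    using assms(3) unfolding exp_growth_rel_def by blast
  obtain k :: nat where k: "\<bar>M\<bar> * N / (2 * pi) \<le> k" using real_arch_simple by blast
  hence k': "\<bar>M\<bar> * N \<le> k * (2 * pi)" by (simp add: field_simps)
  have "norm (h \<tau> * qN N \<tau> ^ k) \<le> \<bar>C\<bar> * exp (\<bar>M\<bar> * N)" if Im: "Im \<tau> > max 0 Y" for \<tau>
  proof -
    define j where "j = - \<lfloor>Re \<tau> / N\<rfloor>"
    define w where "w = \<tau> + of_int (int N * j)"
    have "Re w = N * frac (Re \<tau> / N)" using assms(1) by (simp add: w_def j_def frac_def field_simps)
    hence "\<bar>Re w\<bar> \<le> N" using frac_ge_0[of "Re \<tau> / N"] frac_lt_1[of "Re \<tau> / N"] by (simp add: mult_left_le)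
    moreover have Imw: "Im w = Im \<tau>" by (simp add: w_def)
    ultimately have "norm w \<le> N + Im \<tau>" using cmod_le[of w] Im by simp
    hence "\<bar>M\<bar> * norm w \<le> \<bar>M\<bar> * (N + Im \<tau>)" by (intro mult_left_mono) auto
    hence "M * norm w \<le> \<bar>M\<bar> * N + \<bar>M\<bar> * Im \<tau>" by (smt (verit) abs_ge_self mult_right_mono norm_ge_zero distrib_left)
    have "norm (h \<tau>) = norm (h w)" using per[of \<tau> j] Im by (simp add: w_def UHP_iff)
    also have "\<dots> \<le> C * exp (M * norm w)" using CM[of w] Im Imw by simp
    also have "\<dots> \<le> \<bar>C\<bar> * exp (\<bar>M\<bar> * N + \<bar>M\<bar> * Im \<tau>)"
      using \<open>M * norm w \<le> \<bar>M\<bar> * N + \<bar>M\<bar> * Im \<tau>\<close> by (intro mult_mono) auto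
    finally have 1: "norm (h \<tau>) \<le> \<bar>C\<bar> * exp (\<bar>M\<bar> * N + \<bar>M\<bar> * Im \<tau>)" .
    have "\<bar>M\<bar> * N * Im \<tau> \<le> k * (2 * pi) * Im \<tau>" using k' Im by (intro mult_right_mono) auto
    hence "\<bar>M\<bar> * Im \<tau> \<le> k * (2 * pi * Im \<tau> / N)" using assms(1) by (simp add: field_simps)
    hence "norm (qN N \<tau> ^ k) \<le> exp (- (\<bar>M\<bar> * Im \<tau>))"
      by (simp add: norm_power norm_qN exp_of_nat_mult[symmetric])
    hence "norm (h \<tau>) * norm (qN N \<tau> ^ k) \<le> (\<bar>C\<bar> * exp (\<bar>M\<bar> * N + \<bar>M\<bar> * Im \<tau>)) * exp (- (\<bar>M\<bar> * Im \<tau>))"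
      by (intro mult_mono 1) auto
    also have "\<dots> = \<bar>C\<bar> * exp (\<bar>M\<bar> * N)" by (simp add: exp_add exp_minus)
    finally show ?thesis by (simp add: norm_mult)
  qed
  hence "bddc (\<lambda>\<tau>. h \<tau> * qN N \<tau> ^ k)" unfolding bddc_def eventually_cuspF by blast
  thus thesis by (rule that)
qed

lemma bddc_qN: "N > 0 \<Longrightarrow> bddc (qN N)"
  using bddc_tendsto qN_tendsto by blast

text \<open>Induction on the pole order: subtracting the multiple of \<open>t ^ Suc m\<close> with
  the same leading coefficient lowers the order by one. Since \<open>t\<close> is bounded at the
  other cusps, nothing is spoilt there.\<close>

lemma (in hauptmodul) pole_at_inf_imp_poly:
  assumes "f holomorphic_on \<H>" "invf N f" "bddc (\<lambda>\<tau>. f \<tau> * qN N \<tau> ^ m)"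
    and "\<And>\<gamma>. \<gamma> \<in> SL2Z \<Longrightarrow> \<not> cusp_at_inf N \<gamma> \<Longrightarrow> bddc (\<lambda>\<tau>. f (modular_action \<gamma> \<tau>))"
  shows "\<exists>p. \<forall>\<tau>\<in>\<H>. f \<tau> = poly p (t \<tau>)"
  using assms
proof (induction m arbitrary: f)
  case 0
  then obtain c where "\<And>\<tau>. \<tau> \<in> \<H> \<Longrightarrow> f \<tau> = c" using constantI[of f] by auto
  thus ?case by (intro exI[of _ "[:c:]"]) simp
next
  case (Suc m)
  obtain c where c: "c \<noteq> 0" "((\<lambda>\<tau>. t \<tau> * qN N \<tau>) \<longlongrightarrow> c) cuspF" using pole by blast
  have qper: "qN N (\<tau> + of_int (int N * k)) = qN N \<tau>" for \<tau> k
    using N_pos by (simp add: qN_def add_divide_distrib ex_add)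
  have qhol: "qN N holomorphic_on \<H>"
    unfolding qN_def[abs_def] using N_pos by (intro holomorphic_intros) auto
  obtain L M where L: "((\<lambda>\<tau>. f \<tau> * qN N \<tau> ^ Suc m) \<longlongrightarrow> L) cuspF"
  proof (rule q_expansion_limit[OF N_pos _ _ Suc.prems(3)])
    show "(\<lambda>\<tau>. f \<tau> * qN N \<tau> ^ Suc m) holomorphic_on \<H>" by (intro holomorphic_intros Suc.prems qhol)
    show "f (\<tau> + of_int (int N * k)) * qN N (\<tau> + of_int (int N * k)) ^ Suc m = f \<tau> * qN N \<tau> ^ Suc m"
      if "\<tau> \<in> \<H>" for \<tau> k by (simp only: qper invf_periodic[OF Suc.prems(2) that])
  qed blast
  define g where "g = (\<lambda>\<tau>. f \<tau> + (- L / c ^ Suc m) * t \<tau> ^ Suc m)"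
  have g_hol: "g holomorphic_on \<H>" unfolding g_def by (intro holomorphic_intros Suc.prems holo)
  have g_inv: "invf N g" using Suc.prems(2) inv by (simp add: g_def invf_def)
  have "((\<lambda>\<tau>. f \<tau> * qN N \<tau> ^ Suc m + (- L / c ^ Suc m) * (t \<tau> * qN N \<tau>) ^ Suc m) \<longlongrightarrow> L + (- L / c ^ Suc m) * c ^ Suc m) cuspF"
    by (intro tendsto_add tendsto_mult tendsto_power tendsto_const L c)
  hence lim0: "((\<lambda>\<tau>. g \<tau> * qN N \<tau> ^ Suc m) \<longlongrightarrow> 0) cuspF"
    using c(1) by (simp add: g_def power_mult_distrib ring_distribs mult_ac)
  obtain L' M' where L': "((\<lambda>\<tau>. g \<tau> * qN N \<tau> ^ Suc m) \<longlongrightarrow> L') cuspF"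
     "((\<lambda>\<tau>. (g \<tau> * qN N \<tau> ^ Suc m - L') / qN N \<tau>) \<longlongrightarrow> M') cuspF"
  proof (rule q_expansion_limit[OF N_pos _ _ bddc_tendsto[OF lim0]])
    show "(\<lambda>\<tau>. g \<tau> * qN N \<tau> ^ Suc m) holomorphic_on \<H>" by (intro holomorphic_intros g_hol qhol)
    show "g (\<tau> + of_int (int N * k)) * qN N (\<tau> + of_int (int N * k)) ^ Suc m = g \<tau> * qN N \<tau> ^ Suc m"
      if "\<tau> \<in> \<H>" for \<tau> k by (simp only: qper invf_periodic[OF g_inv that])
  qed blast
  have "L' = 0" using L'(1) lim0 tendsto_unique[OF cuspF_nontrivial] by blast
  hence "bddc (\<lambda>\<tau>. g \<tau> * qN N \<tau> ^ m)" using bddc_tendsto[OF L'(2)] by simp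
  moreover have "bddc (\<lambda>\<tau>. g (modular_action \<gamma> \<tau>))" if "\<gamma> \<in> SL2Z" "\<not> cusp_at_inf N \<gamma>" for \<gamma>
    unfolding g_def by (intro bddc_add bddc_mult bddc_const bddc_power bdd Suc.prems that)
  ultimately obtain p where p: "\<forall>\<tau>\<in>\<H>. g \<tau> = poly p (t \<tau>)" using Suc.IH[OF g_hol g_inv] by blast
  have "f \<tau> = poly (p + Polynomial.monom (L / c ^ Suc m) (Suc m)) (t \<tau>)" if "\<tau> \<in> \<H>" for \<tau>
  proof -
    have "f \<tau> = g \<tau> + (L / c ^ Suc m) * t \<tau> ^ Suc m" by (simp add: g_def)
    thus ?thesis using p that by (simp add: poly_monom)
  qed
  thus ?case by blast
qed

text \<open>Multiplying by a high power of \<open>\<Prod>\<^sub>s (t - s)\<close> removes all poles except the one at \<open>\<infinity>\<close>.\<close>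

lemma rational_in_hauptmodul:
  assumes ph: "punctured_hauptmodul N t P" and "finite P"
    and g: "g holomorphic_on \<H>" "invf N g" "\<And>\<gamma>. \<gamma> \<in> SL2Z \<Longrightarrow> exp_growth_rel (\<lambda>\<tau>. g (modular_action \<gamma> \<tau>))"
  obtains p k where "\<And>\<tau>. \<tau> \<in> \<H> \<Longrightarrow> g \<tau> * (\<Prod>s\<in>P. t \<tau> - s) ^ k = poly p (t \<tau>)"
proof -
  interpret hauptmodul N t using ph by (simp add: punctured_hauptmodul_def)
  have "\<exists>k. bddc (\<lambda>\<tau>. g (modular_action \<gamma> \<tau>) * qN N \<tau> ^ k)" if "\<gamma> \<in> SL2Z" for \<gamma>
    using exp_growth_pole_order[OF N_pos invf_periodic[OF invf_compose[OF g(2) that]] g(3)[OF that]] by blast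
  then obtain k where k: "\<And>\<gamma>. \<gamma> \<in> SL2Z \<Longrightarrow> bddc (\<lambda>\<tau>. g (modular_action \<gamma> \<tau>) * qN N \<tau> ^ k \<gamma>)" by metis
  obtain R where R: "finite R" "R \<noteq> {}" "R \<subseteq> SL2Z" "\<And>\<gamma>. \<gamma> \<in> SL2Z \<Longrightarrow> \<exists>\<delta>\<in>R. mcong N \<gamma> \<delta>"
    using finite_mcong_representatives[OF N_pos] by blast
  \<comment> \<open>One exponent for all cusps, available because only finitely many transforms of
    \<open>g\<close> occur.\<close>
  define K where "K = Max (k ` R)"
  have K: "bddc (\<lambda>\<tau>. g (modular_action \<gamma> \<tau>) * qN N \<tau> ^ K)" if \<gamma>: "\<gamma> \<in> SL2Z" for \<gamma>
  proof -
    obtain \<delta> where \<delta>: "\<delta> \<in> R" "\<delta> \<in> SL2Z" "mcong N \<gamma> \<delta>" using R \<gamma> by blast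
    have "k \<delta> \<le> K" using R \<delta> by (simp add: K_def)
    hence "qN N \<tau> ^ k \<delta> * qN N \<tau> ^ (K - k \<delta>) = qN N \<tau> ^ K" for \<tau> by (simp add: power_add[symmetric])
    moreover have "bddc (\<lambda>\<tau>. (g (modular_action \<delta> \<tau>) * qN N \<tau> ^ k \<delta>) * qN N \<tau> ^ (K - k \<delta>))"
      by (intro bddc_mult[OF k[OF \<delta>(2)]] bddc_power bddc_qN N_pos)
    ultimately have "bddc (\<lambda>\<tau>. g (modular_action \<delta> \<tau>) * qN N \<tau> ^ K)" by (simp add: mult.assoc)
    thus ?thesis by (rule bddc_cong[rotated]) (simp add: invf_mcong[OF g(2) \<gamma> \<delta>(2,3)])
  qed
  define D where "D = (\<lambda>\<tau>. \<Prod>s\<in>P. t \<tau> + (- s))"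
  define f where "f = (\<lambda>\<tau>. g \<tau> * D \<tau> ^ K)"
  have prod_bdd: "bddc (\<lambda>\<tau>. \<Prod>s\<in>A. h s \<tau>)" if "\<And>s. s \<in> A \<Longrightarrow> bddc (h s)" for h :: "complex \<Rightarrow> complex \<Rightarrow> complex" and A
    using that by (induction A rule: infinite_finite_induct) (auto intro!: bddc_mult)
  have f_hol: "f holomorphic_on \<H>" unfolding f_def D_def by (intro holomorphic_intros g holo)
  have f_inv: "invf N f" using g(2) inv by (simp add: f_def D_def invf_def)
  have f_bdd: "bddc (\<lambda>\<tau>. f (modular_action \<gamma> \<tau>))" if \<gamma>: "\<gamma> \<in> SL2Z" "\<not> cusp_at_inf N \<gamma>" for \<gamma>
  proof -
    define u where "u = (\<lambda>\<tau>. t (modular_action \<gamma> \<tau>))"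
    obtain s where s: "s \<in> P" "(u \<longlongrightarrow> s) cuspF" using ph \<gamma> by (auto simp: punctured_hauptmodul_def u_def)
    have u_hol: "u holomorphic_on \<H>" unfolding u_def by (intro holomorphic_compose_action holo \<gamma>)
    have u_inv: "invf N u" unfolding u_def by (intro invf_compose inv \<gamma>)
    obtain s' M where s': "(u \<longlongrightarrow> s') cuspF" "((\<lambda>\<tau>. (u \<tau> - s') / qN N \<tau>) \<longlongrightarrow> M) cuspF"
      using q_expansion_limit[OF N_pos u_hol invf_periodic[OF u_inv] bddc_tendsto[OF s(2)]] by blast
    have "s' = s" using s(2) s'(1) tendsto_unique[OF cuspF_nontrivial] by blast
    \<comment> \<open>The factor \<open>u - s\<close> vanishes at least to first order in q, so its
      K-th power absorbs a pole of order K.\<close>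
    hence 1: "bddc (\<lambda>\<tau>. (u \<tau> - s) / qN N \<tau>)" using bddc_tendsto[OF s'(2)] by simp
    have "bddc u" using bddc_tendsto[OF s(2)] .
    hence 2: "bddc (\<lambda>\<tau>. \<Prod>x\<in>P - {s}. u \<tau> + (- x))" by (intro prod_bdd bddc_add bddc_const)
    have "bddc (\<lambda>\<tau>. (g (modular_action \<gamma> \<tau>) * qN N \<tau> ^ K) * (((u \<tau> - s) / qN N \<tau>) * (\<Prod>x\<in>P - {s}. u \<tau> + (- x))) ^ K)"
      by (intro bddc_mult bddc_power K 1 2 \<gamma>)
    moreover have "(g (modular_action \<gamma> \<tau>) * qN N \<tau> ^ K) * (((u \<tau> - s) / qN N \<tau>) * (\<Prod>x\<in>P - {s}. u \<tau> + (- x))) ^ K = f (modular_action \<gamma> \<tau>)" for \<tau>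
    proof -
      have "D (modular_action \<gamma> \<tau>) = (u \<tau> - s) * (\<Prod>x\<in>P - {s}. u \<tau> + (- x))"
        unfolding D_def u_def by (subst prod.remove[OF assms(2) s(1)]) simp
      hence "qN N \<tau> * (((u \<tau> - s) / qN N \<tau>) * (\<Prod>x\<in>P - {s}. u \<tau> + (- x))) = D (modular_action \<gamma> \<tau>)" by simp
      thus ?thesis unfolding f_def by (metis mult.assoc power_mult_distrib)
    qed
    ultimately show ?thesis by simp
  qed
  obtain c where c: "((\<lambda>\<tau>. t \<tau> * qN N \<tau>) \<longlongrightarrow> c) cuspF" using pole by blast
  \<comment> \<open>At infinity each factor t - s brings in a simple pole, whence the exponent
    \<open>K + card P * K\<close> below.\<close>
  have "bddc (\<lambda>\<tau>. (g (modular_action (mat 1) \<tau>) * qN N \<tau> ^ K) * (\<Prod>s\<in>P. t \<tau> * qN N \<tau> + (- s) * qN N \<tau>) ^ K)"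
    by (intro bddc_mult bddc_power prod_bdd bddc_add bddc_const bddc_qN N_pos K bddc_tendsto[OF c]) auto
  moreover have "(g (modular_action (mat 1) \<tau>) * qN N \<tau> ^ K) * (\<Prod>s\<in>P. t \<tau> * qN N \<tau> + (- s) * qN N \<tau>) ^ K =
      f \<tau> * qN N \<tau> ^ (K + card P * K)" for \<tau>
  proof -
    have "(\<Prod>s\<in>P. t \<tau> * qN N \<tau> + (- s) * qN N \<tau>) = D \<tau> * qN N \<tau> ^ card P"
      unfolding D_def by (simp only: distrib_right[symmetric] prod.distrib prod_constant)
    thus ?thesis by (simp add: f_def power_mult_distrib power_add power_mult[symmetric] mult_ac)
  qed
  ultimately have "bddc (\<lambda>\<tau>. f \<tau> * qN N \<tau> ^ (K + card P * K))" by simp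
  then obtain p where "\<forall>\<tau>\<in>\<H>. f \<tau> = poly p (t \<tau>)"
    using pole_at_inf_imp_poly[OF f_hol f_inv _ f_bdd] by blast
  thus thesis using that[of K p] by (simp add: f_def D_def)
qed

section \<open>Matching the orbits with the prescribed punctures\<close>

lemma mobius_orbit_subset:
  assumes "\<sigma> \<in> P" "\<And>s. s \<in> P \<Longrightarrow> z * s \<in> P" "z \<noteq> 0"
    and "\<And>s. s \<in> P \<Longrightarrow> s \<noteq> \<sigma> \<Longrightarrow> \<exists>s'\<in>P. z * (s' - \<sigma>) * (s - \<sigma>) = - (\<sigma>\<^sup>2 * (z - 1)\<^sup>2)"
  shows "mobius_orbit z \<sigma> \<subseteq> P"
proof
  fix s assume "s \<in> mobius_orbit z \<sigma>"
  thus "s \<in> P"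
  proof induction
    case (invol s s')
    obtain s'' where s'': "s'' \<in> P" "z * (s'' - \<sigma>) * (s - \<sigma>) = - (\<sigma>\<^sup>2 * (z - 1)\<^sup>2)"
      using assms(4) invol by blast
    hence "z * (s' - \<sigma>) * (s - \<sigma>) = z * (s'' - \<sigma>) * (s - \<sigma>)" using invol by simp
    \<comment> \<open>The relation is linear in the new point, so one solution found in P is the
      only one.\<close>
    hence "s' = s''" using invol assms(3) by simp
    thus ?case using s'' by simp
  qed (use assms in auto)
qed

lemma ex_root_of_unity_neq:
  assumes "0 < k" "k < n"
  shows "ex (of_nat k / of_nat n) \<noteq> 1"
proof
  assume "ex (of_nat k / of_nat n) = 1"
  then obtain m :: int where "of_nat k / of_nat n = (of_int m :: complex)" by (auto simp: ex_eq_1_iff)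
  hence "Re (of_nat k / of_nat n) = Re (of_int m :: complex)" by (rule arg_cong)
  hence "real k / real n = of_int m" by simp
  hence "real_of_int (int k) = of_int (m * int n)" using assms by (simp add: field_simps)
  hence "int k = m * int n" by (simp only: of_int_eq_iff)
  hence "int n dvd int k" by simp
  thus False using assms zdvd_not_zless[of "int k" "int n"] by simp
qed

lemma punctured_hauptmodul_exists:
  assumes "N \<in> {2,3,4,5}" "\<sigma> \<noteq> 0"
  obtains t where "punctured_hauptmodul N t (mobius_orbit (ex (- (1 / of_nat N))) \<sigma>)"
proof -
  have "ex (- (1 / of_nat N)) \<noteq> 1"
    using assms ex_root_of_unity_neq[of 1 N] by (auto simp: ex_minus)
  then show thesis
    using normalised_hauptmodul[OF assms] punctured_hauptmodul_orbit[of N _ \<sigma> "ex (- (1 / of_nat N))"] that assms(2)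
    by (metis ex_nonzero)
qed

lemma ex_half: "ex (1 / 2) = -1"
  by (simp add: ex_def exp_pi_i)

text \<open>Here z = -1 and S fixes -1, so the orbit of 1 is {1, -1}; the map x to (x + 1)/2 carries
  it to {1, 0}.\<close>

lemma dihedral_hauptmodul: "\<exists>t. punctured_hauptmodul 2 t dihedral_punctures"
proof -
  have z: "ex (- (1 / of_nat 2)) = -1" by (simp add: ex_minus ex_half)
  have "mobius_orbit (-1) 1 \<subseteq> {1, -1}"
    by (rule mobius_orbit_subset) auto
  moreover have "{1, -1} \<subseteq> mobius_orbit (-1) (1 :: complex)"
    using mobius_orbit.base[of 1 "-1"] mobius_orbit.rot[OF mobius_orbit.base, of "-1" 1] by simp
  ultimately have "mobius_orbit (-1) 1 = {1, -1}" by blast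
  then obtain t where "punctured_hauptmodul 2 t {1, -1}"
    using punctured_hauptmodul_exists[of 2 1] z by auto
  from punctured_hauptmodul_affine[OF this, of "1/2" "1/2"]
  have "punctured_hauptmodul 2 (\<lambda>\<tau>. 1/2 * t \<tau> + 1/2) dihedral_punctures"
    by (simp add: dihedral_punctures_def insert_commute)
  thus ?thesis by blast
qed

text \<open>With \<sigma> = 1 the orbit consists of the cube roots of unity: S exchanges infinity
  with 1 and the two primitive roots with each other. Together with infinity these are the vertices
  of a tetrahedron.\<close>

lemma tetrahedral_hauptmodul: "\<exists>t. punctured_hauptmodul 3 t tetrahedral_punctures"
proof -
  define \<omega> z where "\<omega> = ex (1 / 3)" and "z = ex (- (1 / of_nat 3))"
  have "\<omega> ^ 3 = 1" using ex_power[of "1/3" 3] by (simp add: \<omega>_def)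
  have z\<omega>: "z = inverse \<omega>" by (simp add: z_def \<omega>_def ex_minus)
  hence "z ^ 3 = 1" using \<open>\<omega> ^ 3 = 1\<close> by (simp add: power_inverse)
  have "\<omega> \<noteq> 1" using ex_root_of_unity_neq[of 1 3] by (simp add: \<omega>_def)
  hence "z \<noteq> 1" by (simp add: z\<omega>)
  hence z2: "1 + z + z\<^sup>2 = 0"
  proof -
    have "(z - 1) * (1 + z + z\<^sup>2) = z ^ 3 - 1" by (simp add: algebra_simps power2_eq_square power3_eq_cube)
    thus ?thesis using \<open>z ^ 3 = 1\<close> \<open>z \<noteq> 1\<close> by simp
  qed
  have "z * \<omega> = 1" by (simp add: z\<omega> \<omega>_def)
  have z\<omega>2: "\<omega> = z\<^sup>2"
  proof -
    have "\<omega> = z ^ 3 * \<omega>" using \<open>z ^ 3 = 1\<close> by simp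
    also have "\<dots> = z\<^sup>2 * (z * \<omega>)" by (simp add: power2_eq_square power3_eq_cube)
    finally show ?thesis by (simp add: \<open>z * \<omega> = 1\<close>)
  qed
  have "cnj \<omega> = inverse \<omega>" by (simp add: \<omega>_def ex_def exp_cnj exp_minus)
  hence "cnj \<omega> = z" by (simp add: z\<omega>)
  hence P: "tetrahedral_punctures = {1, z, z\<^sup>2}"
    unfolding tetrahedral_punctures_def Let_def
    using z\<omega>2 by (auto simp: \<omega>_def ex_def)
  have "mobius_orbit z 1 \<subseteq> {1, z, z\<^sup>2}"
  proof (rule mobius_orbit_subset)
    show "z * s \<in> {1, z, z\<^sup>2}" if "s \<in> {1, z, z\<^sup>2}" for s
      using that \<open>z ^ 3 = 1\<close> by (auto simp: power2_eq_square power3_eq_cube mult.assoc)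
    have "z * (z - 1) * (z\<^sup>2 - 1) = - ((z - 1)\<^sup>2)" using z2 by Groebner_Basis.algebra
    hence 1: "z * (z - 1) * (z\<^sup>2 - 1) = - (1\<^sup>2 * (z - 1)\<^sup>2)" by (simp only: power_one mult_1_left)
    hence 2: "z * (z\<^sup>2 - 1) * (z - 1) = - (1\<^sup>2 * (z - 1)\<^sup>2)" by (simp add: mult_ac)
    show "\<exists>s'\<in>{1, z, z\<^sup>2}. z * (s' - 1) * (s - 1) = - (1\<^sup>2 * (z - 1)\<^sup>2)" if "s \<in> {1, z, z\<^sup>2}" "s \<noteq> 1" for s
      using that 1 2 by blast
  qed (auto simp: z_def)
  moreover have "{1, z, z\<^sup>2} \<subseteq> mobius_orbit z 1"
  proof -
    have 1: "1 \<in> mobius_orbit z 1" by (rule mobius_orbit.base)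
    have 2: "z \<in> mobius_orbit z 1" using mobius_orbit.rot[OF 1] by simp
    have "z\<^sup>2 \<in> mobius_orbit z 1" using mobius_orbit.rot[OF 2] by (simp add: power2_eq_square)
    thus ?thesis using 1 2 by simp
  qed
  ultimately have "mobius_orbit z 1 = tetrahedral_punctures" using P by blast
  thus ?thesis using punctured_hauptmodul_exists[of 3 1] by (auto simp: z_def)
qed

text \<open>With \<sigma> = 1 and z = -i the rotations give the fourth roots of unity, while S
  exchanges -1 with 0 and i with -i. Together with infinity these are the vertices of an
  octahedron.\<close>

lemma octahedral_hauptmodul: "\<exists>t. punctured_hauptmodul 4 t octahedral_punctures"
proof -
  have z: "ex (- (1 / of_nat 4)) = - \<i>"
  proof -
    have "ex (1 / 4) = exp (\<i> * of_real (pi / 2))" by (simp add: ex_def mult_ac)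
    also have "\<dots> = \<i>" by (simp only: cis_conv_exp[symmetric] cis_pi_half)
    finally show ?thesis by (simp add: ex_minus)
  qed
  have "mobius_orbit (- \<i>) 1 \<subseteq> octahedral_punctures"
    unfolding octahedral_punctures_def
    by (rule mobius_orbit_subset)
       (auto simp: power2_eq_square algebra_simps)
  moreover have "octahedral_punctures \<subseteq> mobius_orbit (- \<i>) 1"
  proof -
    have 1: "1 \<in> mobius_orbit (- \<i>) 1" by (rule mobius_orbit.base)
    have 2: "- \<i> \<in> mobius_orbit (- \<i>) 1" using mobius_orbit.rot[OF 1] by simp
    have 3: "-1 \<in> mobius_orbit (- \<i>) 1" using mobius_orbit.rot[OF 2] by simp
    have 4: "\<i> \<in> mobius_orbit (- \<i>) 1" using mobius_orbit.rot[OF 3] by simp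
    have "0 \<in> mobius_orbit (- \<i>) 1" by (rule mobius_orbit.invol[OF 3]) (auto simp: power2_eq_square algebra_simps)
    thus ?thesis using 1 2 3 4 by (simp add: octahedral_punctures_def)
  qed
  ultimately have "mobius_orbit (- \<i>) 1 = octahedral_punctures" by blast
  thus ?thesis using punctured_hauptmodul_exists[of 4 1] z by auto
qed

lemma Collect_le_4: "{f j | j::nat. j \<le> 4} = {f 0, f 1, f 2, f 3, f 4}"
proof -
  have "{j::nat. j \<le> 4} = {0, 1, 2, 3, 4}" by auto
  moreover have "{f j | j::nat. j \<le> 4} = f ` {j. j \<le> 4}" by auto
  ultimately show ?thesis by simp
qed

text \<open>The base point is e^2 + e^3 instead of 1, so that the orbit has the prescribed scale.
  The involution interchanges infinity with \<sigma> and the other ten vertices of the icosahedron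
  in the five pairs listed in \<open>rel\<close>; these identities follow from the vanishing of 1 +
  e + e^2 + e^3 + e^4.\<close>

lemma icosahedral_hauptmodul: "\<exists>t. punctured_hauptmodul 5 t icosahedral_punctures"
proof -
  define e z where "e = ex (1 / 5)" and "z = ex (- (1 / of_nat 5))"
  define \<sigma> \<rho> where "\<sigma> = e ^ 2 + e ^ 3" and "\<rho> = e + e ^ 4"
  have e5: "e ^ 5 = 1" using ex_power[of "1/5" 5] by (simp add: e_def)
  have [simp]: "e \<noteq> 0" by (simp add: e_def)
  have "e \<noteq> 1" using ex_root_of_unity_neq[of 1 5] by (simp add: e_def)
  moreover have "(e - 1) * (1 + e + e^2 + e^3 + e^4) = e ^ 5 - 1"
    by (simp add: algebra_simps power_Suc[symmetric] numeral_eq_Suc)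
  ultimately have h: "1 + e + e^2 + e^3 + e^4 = 0" using e5 by simp
  have "z * e = 1" by (simp add: z_def e_def ex_minus)
  have z: "z = e ^ 4"
  proof -
    have "z = z * (e * e ^ 4)" using e5 by (simp add: power_Suc[symmetric])
    also have "\<dots> = (z * e) * e ^ 4" by simp
    finally show ?thesis by (simp add: \<open>z * e = 1\<close>)
  qed
  have P: "icosahedral_punctures = {0, \<sigma>, e * \<sigma>, e^2 * \<sigma>, e^3 * \<sigma>, e^4 * \<sigma>, \<rho>, e * \<rho>, e^2 * \<rho>, e^3 * \<rho>, e^4 * \<rho>}"
  proof -
    have "e = exp (2 * of_real pi * \<i> / 5)" by (simp add: e_def ex_def)
    thus ?thesis unfolding icosahedral_punctures_def Let_def Collect_le_4
      by (auto simp: \<sigma>_def \<rho>_def)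
  qed
  have zmult: "z * x = e ^ 4 * x" "z * (e * x) = x" "z * (e^2 * x) = e * x" "z * (e^3 * x) = e^2 * x" "z * (e^4 * x) = e^3 * x" for x
    unfolding z using e5 by - (rule refl, Groebner_Basis.algebra+)
  have rel: "z * (e^4 * \<sigma> - \<sigma>) * (e * \<sigma> - \<sigma>) = - (\<sigma>\<^sup>2 * (z - 1)\<^sup>2)"
    "z * (e^2 * \<rho> - \<sigma>) * (e^2 * \<sigma> - \<sigma>) = - (\<sigma>\<^sup>2 * (z - 1)\<^sup>2)"
    "z * (e^3 * \<rho> - \<sigma>) * (e^3 * \<sigma> - \<sigma>) = - (\<sigma>\<^sup>2 * (z - 1)\<^sup>2)"
    "z * (0 - \<sigma>) * (\<rho> - \<sigma>) = - (\<sigma>\<^sup>2 * (z - 1)\<^sup>2)"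
    "z * (e^4 * \<rho> - \<sigma>) * (e * \<rho> - \<sigma>) = - (\<sigma>\<^sup>2 * (z - 1)\<^sup>2)"
    unfolding z \<sigma>_def \<rho>_def using h by - (Groebner_Basis.algebra+)
  have rel': "z * (e * \<sigma> - \<sigma>) * (e^4 * \<sigma> - \<sigma>) = - (\<sigma>\<^sup>2 * (z - 1)\<^sup>2)"
    "z * (e^2 * \<sigma> - \<sigma>) * (e^2 * \<rho> - \<sigma>) = - (\<sigma>\<^sup>2 * (z - 1)\<^sup>2)"
    "z * (e^3 * \<sigma> - \<sigma>) * (e^3 * \<rho> - \<sigma>) = - (\<sigma>\<^sup>2 * (z - 1)\<^sup>2)"
    "z * (\<rho> - \<sigma>) * (0 - \<sigma>) = - (\<sigma>\<^sup>2 * (z - 1)\<^sup>2)"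
    "z * (e * \<rho> - \<sigma>) * (e^4 * \<rho> - \<sigma>) = - (\<sigma>\<^sup>2 * (z - 1)\<^sup>2)"
    using rel by (simp_all only: mult.assoc mult.commute mult.left_commute)
  have sub: "mobius_orbit z \<sigma> \<subseteq> icosahedral_punctures"
    unfolding P
  proof (rule mobius_orbit_subset)
    show "z * s \<in> {0, \<sigma>, e * \<sigma>, e^2 * \<sigma>, e^3 * \<sigma>, e^4 * \<sigma>, \<rho>, e * \<rho>, e^2 * \<rho>, e^3 * \<rho>, e^4 * \<rho>}"
      if "s \<in> {0, \<sigma>, e * \<sigma>, e^2 * \<sigma>, e^3 * \<sigma>, e^4 * \<sigma>, \<rho>, e * \<rho>, e^2 * \<rho>, e^3 * \<rho>, e^4 * \<rho>}" for s
    proof -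
      have "s = 0 \<or> s = \<sigma> \<or> s = \<rho> \<or> s = e * \<sigma> \<or> s = e^2 * \<sigma> \<or> s = e^3 * \<sigma> \<or> s = e^4 * \<sigma> \<or> s = e * \<rho> \<or> s = e^2 * \<rho> \<or> s = e^3 * \<rho> \<or> s = e^4 * \<rho>"
        using that by blast
      thus ?thesis using zmult[of \<sigma>] zmult[of \<rho>] by (elim disjE) simp_all
    qed
    show "\<exists>s'\<in>{0, \<sigma>, e * \<sigma>, e^2 * \<sigma>, e^3 * \<sigma>, e^4 * \<sigma>, \<rho>, e * \<rho>, e^2 * \<rho>, e^3 * \<rho>, e^4 * \<rho>}.
        z * (s' - \<sigma>) * (s - \<sigma>) = - (\<sigma>\<^sup>2 * (z - 1)\<^sup>2)"
      if "s \<in> {0, \<sigma>, e * \<sigma>, e^2 * \<sigma>, e^3 * \<sigma>, e^4 * \<sigma>, \<rho>, e * \<rho>, e^2 * \<rho>, e^3 * \<rho>, e^4 * \<rho>}" "s \<noteq> \<sigma>" for s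
      using that rel rel' by blast
  qed (auto simp: z_def)
  have "icosahedral_punctures \<subseteq> mobius_orbit z \<sigma>"
  proof -
    have "e ^ 4 * \<sigma> \<noteq> \<sigma> \<and> e^2 * \<sigma> \<noteq> \<sigma>"
    proof -
      have "\<sigma> \<noteq> 0"
      proof
        assume "\<sigma> = 0"
        hence "e ^ 2 * (1 + e) = 0" by (simp add: \<sigma>_def algebra_simps numeral_eq_Suc)
        hence "e = -1" by (simp add: add_eq_0_iff)
        thus False using e5 by simp
      qed
      moreover have "e ^ 4 \<noteq> 1" "e ^ 2 \<noteq> 1"
        using ex_root_of_unity_neq[of 4 5] ex_root_of_unity_neq[of 2 5] ex_power[of "1/5" 4] ex_power[of "1/5" 2] by (simp_all add: e_def)
      ultimately show ?thesis by simp
    qed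
    note ne = this
    let ?O = "mobius_orbit z \<sigma>"
    have rot: "e * x \<in> ?O" if "x \<in> ?O" for x
    proof -
      \<comment> \<open>Four rotations by \<open>z = e ^ 4\<close> amount to one by e, as 16 is 1
        modulo 5.\<close>
      have "z * (z * (z * (z * x))) \<in> ?O" using that by (intro mobius_orbit.rot)
      moreover have "z * (z * (z * (z * x))) = e * x" unfolding z using e5 by Groebner_Basis.algebra
      ultimately show ?thesis by simp
    qed
    have rots: "e * x \<in> ?O \<and> e^2 * x \<in> ?O \<and> e^3 * x \<in> ?O \<and> e^4 * x \<in> ?O" if "x \<in> ?O" for x
      using rot[OF that] rot[OF rot[OF that]] rot[OF rot[OF rot[OF that]]] rot[OF rot[OF rot[OF rot[OF that]]]]
      by (simp add: numeral_eq_Suc mult.assoc)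
    have \<sigma>O: "\<sigma> \<in> ?O" by (rule mobius_orbit.base)
    have "e^2 * \<rho> \<in> ?O" using mobius_orbit.invol[of "e^2 * \<sigma>", OF _ _ rel(2)] rots[OF \<sigma>O] ne by blast
    hence "e^3 * (e^2 * \<rho>) \<in> ?O" using rots by blast
    moreover have "e^3 * (e^2 * \<rho>) = \<rho>" using e5 by Groebner_Basis.algebra
    ultimately have \<rho>O: "\<rho> \<in> ?O" by (simp only:)
    have "\<rho> \<noteq> \<sigma>"
    proof
      assume "\<rho> = \<sigma>"
      hence "\<sigma>\<^sup>2 * (z - 1)\<^sup>2 = 0" using rel(4) by simp
      thus False using ne by (auto simp: z)
    qed
    hence "0 \<in> ?O" using mobius_orbit.invol[OF \<rho>O _ rel(4)] by blast
    thus ?thesis unfolding P using \<sigma>O \<rho>O rots[OF \<sigma>O] rots[OF \<rho>O] by blast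
  qed
  with sub have "mobius_orbit z \<sigma> = icosahedral_punctures" by blast
  moreover have "\<sigma> \<noteq> 0"
  proof
    assume "\<sigma> = 0"
    hence "e ^ 2 * (1 + e) = 0" by (simp add: \<sigma>_def algebra_simps numeral_eq_Suc)
    hence "e = -1" by (simp add: add_eq_0_iff)
    thus False using e5 by simp
  qed
  ultimately show ?thesis using punctured_hauptmodul_exists[of 5 \<sigma>] by (auto simp: z_def)
qed

section \<open>A trivialisation of the standard representation\<close>

definition egr :: "(complex \<Rightarrow> real) \<Rightarrow> bool" where
  "egr h \<longleftrightarrow> (\<exists>C M Y. C \<ge> 0 \<and> M \<ge> 0 \<and> Y \<ge> 0 \<and> (\<forall>\<tau>. Im \<tau> > Y \<longrightarrow> h \<tau> \<le> C * exp (M * norm \<tau>)))"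

lemma egrI:
  assumes "\<And>\<tau>. Im \<tau> > Y \<Longrightarrow> h \<tau> \<le> C * exp (M * norm \<tau>)"
  shows "egr h"
  unfolding egr_def
proof (intro exI conjI allI impI)
  fix \<tau> assume "Im \<tau> > \<bar>Y\<bar>"
  hence "h \<tau> \<le> C * exp (M * norm \<tau>)" using assms by simp
  also have "\<dots> \<le> \<bar>C\<bar> * exp (\<bar>M\<bar> * norm \<tau>)" by (intro mult_mono) (auto intro: mult_right_mono)
  finally show "h \<tau> \<le> \<bar>C\<bar> * exp (\<bar>M\<bar> * norm \<tau>)" .
qed auto

lemma egrE:
  assumes "egr h"
  obtains C M Y where "C \<ge> 0" "M \<ge> 0" "Y \<ge> 0" "\<And>\<tau>. Im \<tau> > Y \<Longrightarrow> h \<tau> \<le> C * exp (M * norm \<tau>)"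
  using assms unfolding egr_def by blast

lemma exp_growth_rel_iff_egr: "exp_growth_rel h \<longleftrightarrow> egr (\<lambda>\<tau>. norm (h \<tau>))"
  unfolding exp_growth_rel_def using egrI[of _ "\<lambda>\<tau>. norm (h \<tau>)"] egrE[of "\<lambda>\<tau>. norm (h \<tau>)"] by metis

lemma egr_mono:
  assumes "egr g" "\<And>\<tau>. \<tau> \<in> \<H> \<Longrightarrow> f \<tau> \<le> g \<tau>"
  shows "egr f"
proof -
  obtain C M Y where g: "C \<ge> 0" "M \<ge> 0" "Y \<ge> 0" "\<And>\<tau>. Im \<tau> > Y \<Longrightarrow> g \<tau> \<le> C * exp (M * norm \<tau>)"
    using egrE[OF assms(1)] by metis
  show ?thesis
  proof (rule egrI)
    fix \<tau> assume "Im \<tau> > Y"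
    thus "f \<tau> \<le> C * exp (M * norm \<tau>)" using g assms(2)[of \<tau>] by (force simp: UHP_iff)
  qed
qed

lemma egr_add:
  assumes "egr f" "egr g"
  shows "egr (\<lambda>\<tau>. f \<tau> + g \<tau>)"
proof -
  obtain C M Y where f: "C \<ge> 0" "M \<ge> 0" "Y \<ge> 0" "\<And>\<tau>. Im \<tau> > Y \<Longrightarrow> f \<tau> \<le> C * exp (M * norm \<tau>)"
    using egrE[OF assms(1)] by metis
  obtain C' M' Y' where g: "C' \<ge> 0" "M' \<ge> 0" "Y' \<ge> 0" "\<And>\<tau>. Im \<tau> > Y' \<Longrightarrow> g \<tau> \<le> C' * exp (M' * norm \<tau>)"
    using egrE[OF assms(2)] by metis
  show ?thesis
  proof (rule egrI)
    fix \<tau> assume \<tau>: "Im \<tau> > max Y Y'"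
    have "f \<tau> + g \<tau> \<le> C * exp (M * norm \<tau>) + C' * exp (M' * norm \<tau>)"
      using f(4)[of \<tau>] g(4)[of \<tau>] \<tau> by simp
    also have "\<dots> \<le> C * exp (max M M' * norm \<tau>) + C' * exp (max M M' * norm \<tau>)"
      using f g by (intro add_mono mult_left_mono) (auto intro: mult_right_mono)
    finally show "f \<tau> + g \<tau> \<le> (C + C') * exp (max M M' * norm \<tau>)" by (simp add: ring_distribs)
  qed
qed

lemma egr_mult:
  assumes "egr f" "egr g" "\<And>\<tau>. f \<tau> \<ge> 0" "\<And>\<tau>. g \<tau> \<ge> 0"
  shows "egr (\<lambda>\<tau>. f \<tau> * g \<tau>)"
proof -
  obtain C M Y where f: "C \<ge> 0" "M \<ge> 0" "Y \<ge> 0" "\<And>\<tau>. Im \<tau> > Y \<Longrightarrow> f \<tau> \<le> C * exp (M * norm \<tau>)"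
    using egrE[OF assms(1)] by metis
  obtain C' M' Y' where g: "C' \<ge> 0" "M' \<ge> 0" "Y' \<ge> 0" "\<And>\<tau>. Im \<tau> > Y' \<Longrightarrow> g \<tau> \<le> C' * exp (M' * norm \<tau>)"
    using egrE[OF assms(2)] by metis
  show ?thesis
  proof (rule egrI)
    fix \<tau> assume \<tau>: "Im \<tau> > max Y Y'"
    have "f \<tau> * g \<tau> \<le> (C * exp (M * norm \<tau>)) * (C' * exp (M' * norm \<tau>))"
      using f(1) f(4)[of \<tau>] g(4)[of \<tau>] \<tau> assms(3,4) by (intro mult_mono) auto
    thus "f \<tau> * g \<tau> \<le> (C * C') * exp ((M + M') * norm \<tau>)" by (simp add: ring_distribs exp_add mult_ac)
  qed
qed

lemma egr_const [simp]: "egr (\<lambda>_. c)"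
  by (rule egrI[of 0 _ c 0]) simp

lemma egr_power: "egr f \<Longrightarrow> (\<And>\<tau>. f \<tau> \<ge> 0) \<Longrightarrow> egr (\<lambda>\<tau>. f \<tau> ^ n)"
  by (induction n) (auto intro!: egr_mult)

lemma egr_sum: "(\<And>i. i \<in> I \<Longrightarrow> egr (f i)) \<Longrightarrow> egr (\<lambda>\<tau>. \<Sum>i\<in>I. f i \<tau>)"
  by (induction I rule: infinite_finite_induct) (auto intro!: egr_add)

lemma egr_norm: "egr norm"
proof (rule egrI[of 0 _ 1 1])
  show "norm \<tau> \<le> 1 * exp (1 * norm \<tau>)" for \<tau> :: complex
    using exp_ge_add_one_self[of "norm \<tau>"] unfolding mult_1 by linarith
qed

lemma has_order_egr:
  assumes "has_order f \<alpha>"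
  shows "egr (\<lambda>\<tau>. norm (f \<tau>))"
proof -
  obtain c where "((\<lambda>\<tau>. f \<tau> * ex (- (of_real \<alpha> * \<tau>))) \<longlongrightarrow> c) cuspF"
    using assms by (auto simp: has_order_def)
  then obtain B Y where B: "\<And>\<tau>. Im \<tau> > Y \<Longrightarrow> norm (f \<tau> * ex (- (of_real \<alpha> * \<tau>))) \<le> B"
    using bddc_tendsto unfolding bddc_def eventually_cuspF by blast
  show ?thesis
  proof (rule egrI)
    fix \<tau> assume "Im \<tau> > Y"
    have "norm (f \<tau>) = norm (f \<tau> * ex (- (of_real \<alpha> * \<tau>))) * norm (ex (of_real \<alpha> * \<tau>))"
      by (simp add: norm_mult[symmetric] mult.assoc ex_add[symmetric])
    also have "\<dots> \<le> B * norm (ex (of_real \<alpha> * \<tau>))"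
      using B[OF \<open>Im \<tau> > Y\<close>] by (rule mult_right_mono) simp
    also have "\<dots> \<le> \<bar>B\<bar> * exp ((2 * pi * \<bar>\<alpha>\<bar>) * norm \<tau>)"
    proof (intro mult_mono)
      have "- (\<alpha> * Im \<tau>) \<le> \<bar>\<alpha>\<bar> * norm \<tau>"
      proof -
        have "- (\<alpha> * Im \<tau>) \<le> \<bar>\<alpha> * Im \<tau>\<bar>" by simp
        also have "\<dots> \<le> \<bar>\<alpha>\<bar> * norm \<tau>" unfolding abs_mult by (intro mult_left_mono abs_Im_le_cmod) auto
        finally show ?thesis .
      qed
      hence "(2 * pi) * - (\<alpha> * Im \<tau>) \<le> (2 * pi) * (\<bar>\<alpha>\<bar> * norm \<tau>)" by (intro mult_left_mono) auto
      thus "norm (ex (of_real \<alpha> * \<tau>)) \<le> exp ((2 * pi * \<bar>\<alpha>\<bar>) * norm \<tau>)"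
        by (simp add: norm_ex mult_ac)
    qed auto
    finally show "norm (f \<tau>) \<le> \<bar>B\<bar> * exp ((2 * pi * \<bar>\<alpha>\<bar>) * norm \<tau>)" .
  qed
qed

text \<open>Cauchy's estimate on unit discs: they stay in the region of the bound when the imaginary
  part exceeds Y + 1, and moving off the centre costs only the factor \<open>exp M\<close>.\<close>

lemma egr_deriv:
  assumes "f holomorphic_on \<H>" "egr (\<lambda>\<tau>. norm (f \<tau>))"
  shows "egr (\<lambda>\<tau>. norm (deriv f \<tau>))"
proof -
  obtain C M Y where f: "C \<ge> 0" "M \<ge> 0" "Y \<ge> 0" "\<And>\<tau>. Im \<tau> > Y \<Longrightarrow> norm (f \<tau>) \<le> C * exp (M * norm \<tau>)"
    using egrE[OF assms(2)] by metis
  show ?thesis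
  proof (rule egrI)
    fix \<tau> :: complex assume \<tau>: "Im \<tau> > Y + 1"
    have Im: "Im w > Y" if "w \<in> cball \<tau> 1" for w
    proof -
      have "\<bar>Im (\<tau> - w)\<bar> \<le> norm (\<tau> - w)" by (rule abs_Im_le_cmod)
      thus ?thesis using that \<tau> by (simp add: dist_norm)
    qed
    have sub: "cball \<tau> 1 \<subseteq> \<H>" using Im f(3) by (force simp: UHP_iff)
    have "norm ((deriv ^^ 1) f \<tau>) \<le> fact 1 * (C * exp (M * (norm \<tau> + 1))) / 1 ^ 1"
    proof (rule Cauchy_inequality)
      show "f holomorphic_on ball \<tau> 1" using assms(1) sub ball_subset_cball holomorphic_on_subset by blast
      show "continuous_on (cball \<tau> 1) f" using assms(1) sub holomorphic_on_imp_continuous_on holomorphic_on_subset by blast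
      fix w assume w: "norm (\<tau> - w) = 1"
      hence "w \<in> cball \<tau> 1" by (simp add: dist_norm)
      hence "norm (f w) \<le> C * exp (M * norm w)" using f(4) Im by blast
      also have "norm w \<le> norm \<tau> + 1" using w norm_triangle_ineq4[of \<tau> "\<tau> - w"] by simp
      hence "C * exp (M * norm w) \<le> C * exp (M * (norm \<tau> + 1))"
        using f by (intro mult_left_mono) (auto intro: mult_left_mono)
      finally show "norm (f w) \<le> C * exp (M * (norm \<tau> + 1))" .
    qed auto
    thus "norm (deriv f \<tau>) \<le> (C * exp M) * exp (M * norm \<tau>)" by (simp add: ring_distribs exp_add mult_ac)
  qed
qed

text \<open>The columns of the matrix are the vector valued form \<open>\<phi> v\<close>, \<open>v = (\<tau>, 1)\<close>, of weight 0 and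
  its derivative divided by \<open>- \<phi>\<^sup>2\<close>.\<close>

definition Fmat :: "(complex \<Rightarrow> complex) \<Rightarrow> complex \<Rightarrow> complex^2^2" where
  "Fmat \<phi> \<tau> = vector [vector [\<phi> \<tau> * \<tau>, - (deriv \<phi> \<tau> * \<tau> + \<phi> \<tau>) / (\<phi> \<tau>)\<^sup>2],
                   vector [\<phi> \<tau>, - deriv \<phi> \<tau> / (\<phi> \<tau>)\<^sup>2]]"

lemma Fmat_nth [simp]:
  "Fmat \<phi> \<tau> $ 1 $ 1 = \<phi> \<tau> * \<tau>" "Fmat \<phi> \<tau> $ 1 $ 2 = - (deriv \<phi> \<tau> * \<tau> + \<phi> \<tau>) / (\<phi> \<tau>)\<^sup>2"
  "Fmat \<phi> \<tau> $ 2 $ 1 = \<phi> \<tau>" "Fmat \<phi> \<tau> $ 2 $ 2 = - deriv \<phi> \<tau> / (\<phi> \<tau>)\<^sup>2"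
  by (simp_all add: Fmat_def)

text \<open>Up to the factor \<phi>^2 in the denominator the determinant is the Wronskian of
  \<phi>\<tau> and \<phi>, which equals \<phi>^2.\<close>

lemma det_Fmat: "\<phi> \<tau> \<noteq> 0 \<Longrightarrow> det (Fmat \<phi> \<tau>) = 1"
  by (simp add: det_2 field_simps power2_eq_square)

abbreviation cmat :: "int^2^2 \<Rightarrow> complex^2^2" where "cmat \<equiv> map_matrix of_int"

lemma deriv_modular_action:
  assumes "\<gamma> \<in> SL2Z" "\<tau> \<in> \<H>"
  shows "(modular_action \<gamma> has_field_derivative 1 / (jf \<gamma> \<tau>)\<^sup>2) (at \<tau>)"
proof -
  have nz: "of_int (\<gamma> $ 2 $ 1) * \<tau> + of_int (\<gamma> $ 2 $ 2) \<noteq> (0::complex)"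
    using jf_nonzero[OF assms] by (simp add: jf_def)
  have "(of_int (\<gamma> $ 1 $ 1 * \<gamma> $ 2 $ 2 - \<gamma> $ 1 $ 2 * \<gamma> $ 2 $ 1) :: complex) = 1"
    using assms by (simp only: SL2Z_iff of_int_1)
  hence "(of_int (\<gamma> $ 1 $ 1) * (of_int (\<gamma> $ 2 $ 1) * \<tau> + of_int (\<gamma> $ 2 $ 2)) -
      (of_int (\<gamma> $ 1 $ 1) * \<tau> + of_int (\<gamma> $ 1 $ 2)) * of_int (\<gamma> $ 2 $ 1) :: complex) = 1"
    by (simp add: algebra_simps)
  thus ?thesis unfolding modular_action_def[abs_def] jf_def
    using nz by (auto intro!: derivative_eq_intros simp: power2_eq_square)
qed

lemma Fmat_equivariant:
  assumes \<gamma>: "\<gamma> \<in> SL2Z" and \<tau>: "\<tau> \<in> \<H>" and \<phi>: "\<phi> holomorphic_on \<H>" and \<psi>: "\<psi> holomorphic_on \<H>"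
    and nz: "\<psi> \<tau> \<noteq> 0" and e: "e * e = 1"
    and eq: "\<And>\<tau>. \<tau> \<in> \<H> \<Longrightarrow> \<phi> (modular_action \<gamma> \<tau>) = e * jf \<gamma> \<tau> * \<psi> \<tau>"
  shows "Fmat \<phi> (modular_action \<gamma> \<tau>) $ i $ j = e * (cmat \<gamma> ** Fmat \<psi> \<tau>) $ i $ j"
proof -
  define a b c d :: complex where "a = of_int (\<gamma> $ 1 $ 1)" "b = of_int (\<gamma> $ 1 $ 2)" "c = of_int (\<gamma> $ 2 $ 1)" "d = of_int (\<gamma> $ 2 $ 2)"
  note abcd = this
  define J where "J = jf \<gamma> \<tau>"
  have J: "J \<noteq> 0" "J = c * \<tau> + d" using jf_nonzero[OF \<gamma> \<tau>] by (simp_all add: J_def jf_def abcd)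
  have "(of_int (\<gamma> $ 1 $ 1 * \<gamma> $ 2 $ 2 - \<gamma> $ 1 $ 2 * \<gamma> $ 2 $ 1) :: complex) = 1"
    using \<gamma> by (simp only: SL2Z_iff of_int_1)
  hence det: "a * d - b * c = 1" by (simp add: abcd)
  have e0: "e \<noteq> 0" using e by auto
  define w where "w = modular_action \<gamma> \<tau>"
  have "w \<in> \<H>" unfolding w_def using \<gamma> \<tau> by simp
  moreover have "w = (a * \<tau> + b) / J" by (simp add: w_def modular_action_altdef J_def abcd)
  ultimately have w: "w \<in> \<H>" "w = (a * \<tau> + b) / J" by auto
  have d\<phi>: "(\<phi> has_field_derivative deriv \<phi> w) (at w)" and d\<psi>: "(\<psi> has_field_derivative deriv \<psi> \<tau>) (at \<tau>)"
    using \<phi> \<psi> w \<tau> by (auto intro!: holomorphic_derivI[of _ \<H>])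
  have "((\<lambda>\<tau>. \<phi> (modular_action \<gamma> \<tau>)) has_field_derivative deriv \<phi> w * (1 / J\<^sup>2)) (at \<tau>)"
    using DERIV_chain2[OF _ deriv_modular_action[OF \<gamma> \<tau>]] d\<phi> by (simp add: w_def J_def)
  hence D1: "((\<lambda>x. e * (c * x + d) * \<psi> x) has_field_derivative deriv \<phi> w * (1 / J\<^sup>2)) (at \<tau>)" if "\<forall>\<^sub>F x in nhds \<tau>. \<phi> (modular_action \<gamma> x) = e * (c * x + d) * \<psi> x"
    using DERIV_cong_ev[OF refl that refl] by blast
  have D2: "((\<lambda>\<tau>. e * (c * \<tau> + d) * \<psi> \<tau>) has_field_derivative e * (c * \<psi> \<tau> + J * deriv \<psi> \<tau>)) (at \<tau>)"
    by (auto intro!: derivative_eq_intros d\<psi> simp: J algebra_simps)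
  have "\<forall>\<^sub>F x in nhds \<tau>. \<phi> (modular_action \<gamma> x) = e * (c * x + d) * \<psi> x"
    using eventually_nhds_in_open[OF open_UHP \<tau>] by eventually_elim (simp add: eq jf_def abcd)
  hence "deriv \<phi> w * (1 / J\<^sup>2) = e * (c * \<psi> \<tau> + J * deriv \<psi> \<tau>)"
    using D1 D2 DERIV_unique by blast
  hence d: "deriv \<phi> w = e * J\<^sup>2 * (c * \<psi> \<tau> + J * deriv \<psi> \<tau>)" using J by (simp add: field_simps)
  have p: "\<phi> w = e * J * \<psi> \<tau>" using eq[OF \<tau>] by (simp add: w_def J_def)
  have p2: "(\<phi> w)\<^sup>2 = J\<^sup>2 * (\<psi> \<tau>)\<^sup>2" unfolding p using e by (simp add: power2_eq_square)
  define q q' where "q = \<psi> \<tau>" and "q' = deriv \<psi> \<tau>"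
  \<comment> \<open>The determinant condition, in the form that lets one factor J cancel in the
    upper right entry.\<close>
  have Jc: "1 + c * (a * \<tau> + b) = a * J" using det by (simp add: J algebra_simps)
  have e11: "\<phi> w * w = e * (a * (q * \<tau>) + b * q)"
  proof -
    have "\<phi> w * w = e * J * q * ((a * \<tau> + b) / J)" by (simp only: p q_def w(2)[symmetric])
    thus ?thesis using J(1) by (simp add: field_simps)
  qed
  have e21: "\<phi> w = e * (c * (q * \<tau>) + d * q)" by (simp add: p J q_def algebra_simps)
  have e22: "- deriv \<phi> w / (\<phi> w)\<^sup>2 = e * (c * (- (q' * \<tau> + q) / q\<^sup>2) + d * (- q' / q\<^sup>2))"
  proof -
    have "- deriv \<phi> w / (\<phi> w)\<^sup>2 = e * (- (c * q + J * q') / q\<^sup>2)"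
      unfolding p2 d using J(1) nz by (simp add: q_def q'_def field_simps)
    also have "- (c * q + J * q') = c * (- (q' * \<tau> + q)) + d * (- q')" by (simp add: J algebra_simps)
    finally show ?thesis by (simp only: add_divide_distrib times_divide_eq_right)
  qed
  have e12: "- (deriv \<phi> w * w + \<phi> w) / (\<phi> w)\<^sup>2 = e * (a * (- (q' * \<tau> + q) / q\<^sup>2) + b * (- q' / q\<^sup>2))"
  proof -
    have "deriv \<phi> w * w + \<phi> w = e * J * ((c * q + J * q') * (a * \<tau> + b) + q)"
    proof -
      have "deriv \<phi> w * w + \<phi> w = e * J\<^sup>2 * (c * q + J * q') * ((a * \<tau> + b) / J) + e * J * q"
        by (simp only: p d q_def q'_def w(2)[symmetric])
      thus ?thesis using J(1) by (simp add: field_simps power2_eq_square)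
    qed
    also have "(c * q + J * q') * (a * \<tau> + b) + q = (1 + c * (a * \<tau> + b)) * q + J * q' * (a * \<tau> + b)"
      by (simp add: algebra_simps)
    also have "\<dots> = J * (a * (q' * \<tau> + q) + b * q')" unfolding Jc by (simp add: algebra_simps)
    finally have "- (deriv \<phi> w * w + \<phi> w) / (\<phi> w)\<^sup>2 = e * ((a * (- (q' * \<tau> + q)) + b * (- q')) / q\<^sup>2)"
      unfolding p2 using J(1) nz by (simp add: q_def[symmetric] field_simps power2_eq_square)
    thus ?thesis by (simp only: add_divide_distrib times_divide_eq_right)
  qed
  show ?thesis
    using exhaust_2[of i] exhaust_2[of j] e11 e12 e21 e22
    unfolding w_def[symmetric] by (auto simp: mult_nth2 abcd[symmetric] q_def[symmetric] q'_def[symmetric])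
qed

lemma Fmat_holomorphic:
  assumes "\<phi> holomorphic_on \<H>" "\<And>\<tau>. \<tau> \<in> \<H> \<Longrightarrow> \<phi> \<tau> \<noteq> 0"
  shows "(\<lambda>\<tau>. Fmat \<phi> \<tau> $ i $ j) holomorphic_on \<H>"
proof -
  have "deriv \<phi> holomorphic_on \<H>" by (intro holomorphic_deriv assms open_UHP)
  thus ?thesis using exhaust_2[of i] exhaust_2[of j] assms
    by (auto intro!: holomorphic_intros)
qed

definition mnorm :: "complex^2^2 \<Rightarrow> real" where
  "mnorm A = norm (A $ 1 $ 1) + norm (A $ 1 $ 2) + norm (A $ 2 $ 1) + norm (A $ 2 $ 2)"

lemma egr_mnorm:
  assumes "\<And>i j. egr (\<lambda>\<tau>. norm (A \<tau> $ i $ j))"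
  shows "egr (\<lambda>\<tau>. mnorm (A \<tau>))"
  unfolding mnorm_def by (intro egr_add assms)

text \<open>The denominators are harmless: \<psi> has an exact order at infinity, so its power -2
  has one too.\<close>

lemma Fmat_egr:
  assumes "\<psi> holomorphic_on \<H>" "has_order \<psi> \<alpha>"
  shows "egr (\<lambda>\<tau>. norm (Fmat \<psi> \<tau> $ i $ j))"
proof -
  have 1: "egr (\<lambda>\<tau>. norm (\<psi> \<tau>))" by (rule has_order_egr[OF assms(2)])
  have 2: "egr (\<lambda>\<tau>. norm (deriv \<psi> \<tau>))" by (rule egr_deriv[OF assms(1) 1])
  have "has_order (\<lambda>\<tau>. \<psi> \<tau> powi (-2)) (of_int (-2) * \<alpha>)" by (rule has_order_powi[OF assms(2)])
  hence "egr (\<lambda>\<tau>. norm (\<psi> \<tau> powi (-2)))" by (rule has_order_egr)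
  hence 3: "egr (\<lambda>\<tau>. 1 / norm (\<psi> \<tau>) ^ 2)"
    by (simp add: power_int_minus norm_inverse norm_power inverse_eq_divide norm_divide)
  have 12: "egr (\<lambda>\<tau>. (norm (deriv \<psi> \<tau>) * norm \<tau> + norm (\<psi> \<tau>)) * (1 / norm (\<psi> \<tau>) ^ 2))"
    by (intro egr_mult egr_add egr_norm 1 2 3) auto
  have e12: "egr (\<lambda>\<tau>. norm (Fmat \<psi> \<tau> $ 1 $ 2))"
  proof (rule egr_mono[OF 12])
    fix \<tau>
    have "norm (Fmat \<psi> \<tau> $ 1 $ 2) = norm (deriv \<psi> \<tau> * \<tau> + \<psi> \<tau>) * (1 / norm (\<psi> \<tau>) ^ 2)"
      unfolding Fmat_nth norm_divide norm_minus_cancel norm_power by simp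
    also have "\<dots> \<le> (norm (deriv \<psi> \<tau>) * norm \<tau> + norm (\<psi> \<tau>)) * (1 / norm (\<psi> \<tau>) ^ 2)"
      by (intro mult_right_mono order_trans[OF norm_triangle_ineq]) (auto simp: norm_mult)
    finally show "norm (Fmat \<psi> \<tau> $ 1 $ 2) \<le> (norm (deriv \<psi> \<tau>) * norm \<tau> + norm (\<psi> \<tau>)) * (1 / norm (\<psi> \<tau>) ^ 2)" .
  qed
  have e22: "egr (\<lambda>\<tau>. norm (Fmat \<psi> \<tau> $ 2 $ 2))"
    using egr_mult[OF 2 3] by (simp add: norm_divide norm_power)
  have e11: "egr (\<lambda>\<tau>. norm (Fmat \<psi> \<tau> $ 1 $ 1))"
    using egr_mult[OF 1 egr_norm] by (simp add: norm_mult)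
  show ?thesis using exhaust_2[of i] exhaust_2[of j] e11 e12 e22 1 by auto
qed

text \<open>At another cusp the transformed form is \<open>jf\<close> times a product of Klein forms
  again, so there F is the constant matrix \<gamma> times the same construction for that product.
  Growth at every cusp thus reduces to growth at infinity.\<close>

lemma SL2_trivialisation:
  assumes N: "N \<in> {2,3,4,5}"
  obtains F :: "complex \<Rightarrow> complex^2^2" where
    "\<And>\<tau>. \<tau> \<in> \<H> \<Longrightarrow> det (F \<tau>) = 1" "\<And>i j. (\<lambda>\<tau>. F \<tau> $ i $ j) holomorphic_on \<H>"
    "\<And>\<gamma> \<tau>. \<gamma> \<in> principal_congruence_subgroup N \<Longrightarrow> \<tau> \<in> \<H> \<Longrightarrow>
       F (modular_action \<gamma> \<tau>) = cmat \<gamma> ** F \<tau> \<or> N = 2 \<and> F (modular_action \<gamma> \<tau>) = - (cmat \<gamma> ** F \<tau>)"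
    "\<And>\<gamma>. \<gamma> \<in> SL2Z \<Longrightarrow> egr (\<lambda>\<tau>. mnorm (F (modular_action \<gamma> \<tau>)))"
proof -
  have N0: "N > 0" using N by auto
  define \<phi> where "\<phi> = kp N (fdata N)"
  note fd = fdata_props[OF N]
  have \<phi>_hol: "\<phi> holomorphic_on \<H>" unfolding \<phi>_def by (rule kp_holomorphic[OF N0 fd(1)])
  have \<phi>_nz: "\<phi> \<tau> \<noteq> 0" if "\<tau> \<in> \<H>" for \<tau> unfolding \<phi>_def by (rule kp_nonzero[OF N0 fd(1) that])
  have eqv: "Fmat \<phi> (modular_action \<gamma> \<tau>) = cmat \<gamma> ** Fmat \<phi> \<tau> \<or> N = 2 \<and> Fmat \<phi> (modular_action \<gamma> \<tau>) = - (cmat \<gamma> ** Fmat \<phi> \<tau>)"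
    if \<gamma>: "\<gamma> \<in> principal_congruence_subgroup N" and \<tau>: "\<tau> \<in> \<H>" for \<gamma> \<tau>
  proof -
    have \<gamma>': "\<gamma> \<in> SL2Z" using \<gamma> by (rule Gamma_subset_SL2Z)
    obtain e :: complex where e: "e = 1 \<or> N = 2 \<and> e = -1"
      "\<And>\<tau>. \<tau> \<in> \<H> \<Longrightarrow> \<phi> (modular_action \<gamma> \<tau>) = e * jf \<gamma> \<tau> * \<phi> \<tau>"
      using fdata_action_uniform[OF N \<gamma>] unfolding \<phi>_def by blast
    have "e * e = 1" using e by auto
    note * = Fmat_equivariant[OF \<gamma>' \<tau> \<phi>_hol \<phi>_hol \<phi>_nz[OF \<tau>] this e(2)]
    from e(1) show ?thesis
    proof
      assume "e = 1"
      thus ?thesis using * by (simp add: vec_eq_iff)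
    next
      assume "N = 2 \<and> e = -1"
      thus ?thesis using * by (simp add: vec_eq_iff)
    qed
  qed
  have gr: "egr (\<lambda>\<tau>. mnorm (Fmat \<phi> (modular_action \<gamma> \<tau>)))" if \<gamma>: "\<gamma> \<in> SL2Z" for \<gamma>
  proof (rule egr_mnorm)
    fix i j
    define \<psi> where "\<psi> = kp N (kact \<gamma> (fdata N))"
    have good: "kgood N (kact \<gamma> (fdata N))" by (rule kgood_kact[OF \<gamma> fd(1)])
    have \<psi>: "\<psi> holomorphic_on \<H>" unfolding \<psi>_def by (rule kp_holomorphic[OF N0 good])
    have "egr (\<lambda>\<tau>. norm (cmat \<gamma> $ i $ 1) * norm (Fmat \<psi> \<tau> $ 1 $ j) + norm (cmat \<gamma> $ i $ 2) * norm (Fmat \<psi> \<tau> $ 2 $ j))"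
      unfolding \<psi>_def
      by (intro egr_add egr_mult egr_const Fmat_egr[OF kp_holomorphic kp_has_order] N0 good) auto
    thus "egr (\<lambda>\<tau>. norm (Fmat \<phi> (modular_action \<gamma> \<tau>) $ i $ j))"
    proof (rule egr_mono)
      fix \<tau> assume \<tau>: "\<tau> \<in> \<H>"
      have "\<psi> \<tau> \<noteq> 0" unfolding \<psi>_def by (rule kp_nonzero[OF N0 good \<tau>])
      moreover have "\<phi> (modular_action \<gamma> \<tau>) = 1 * jf \<gamma> \<tau> * \<psi> \<tau>" if "\<tau> \<in> \<H>" for \<tau>
        using kp_action[OF \<gamma> that, of N "fdata N"] by (simp add: \<phi>_def \<psi>_def fd)
      ultimately have "Fmat \<phi> (modular_action \<gamma> \<tau>) $ i $ j = 1 * (cmat \<gamma> ** Fmat \<psi> \<tau>) $ i $ j"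
        by (intro Fmat_equivariant[OF \<gamma> \<tau> \<phi>_hol \<psi>]) auto
      also have "norm \<dots> \<le> norm (cmat \<gamma> $ i $ 1) * norm (Fmat \<psi> \<tau> $ 1 $ j) + norm (cmat \<gamma> $ i $ 2) * norm (Fmat \<psi> \<tau> $ 2 $ j)"
        unfolding mult_nth2 mult_1 by (rule order_trans[OF norm_triangle_ineq]) (simp only: norm_mult order_refl)
      finally show "norm (Fmat \<phi> (modular_action \<gamma> \<tau>) $ i $ j) \<le>
        norm (cmat \<gamma> $ i $ 1) * norm (Fmat \<psi> \<tau> $ 1 $ j) + norm (cmat \<gamma> $ i $ 2) * norm (Fmat \<psi> \<tau> $ 2 $ j)" .
    qed
  qed
  show thesis
    by (rule that[of "Fmat \<phi>"]) (use det_Fmat \<phi>_nz Fmat_holomorphic[OF \<phi>_hol] eqv gr in auto)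
qed

section \<open>Growth of representations of SL(2,C)\<close>

definition cm2 :: "complex \<Rightarrow> complex \<Rightarrow> complex \<Rightarrow> complex \<Rightarrow> complex^2^2" where
  "cm2 a b c d = (\<chi> i j. if i = 1 then (if j = 1 then a else b) else (if j = 1 then c else d))"

lemma cm2_nth [simp]: "cm2 a b c d $ 1 $ 1 = a" "cm2 a b c d $ 1 $ 2 = b"
    "cm2 a b c d $ 2 $ 1 = c" "cm2 a b c d $ 2 $ 2 = d"
  by (simp_all add: cm2_def)

lemma cm2_eq_iff: "(A :: complex^2^2) = B \<longleftrightarrow> A $ 1 $ 1 = B $ 1 $ 1 \<and> A $ 1 $ 2 = B $ 1 $ 2 \<and>
    A $ 2 $ 1 = B $ 2 $ 1 \<and> A $ 2 $ 2 = B $ 2 $ 2"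
  by (simp only: vec_eq_iff_2 conj_assoc)

lemma det_cm2 [simp]: "det (cm2 a b c d) = a * d - b * c"
  by (simp add: det_2)

lemma continuous_on_cm2 [continuous_intros]:
  assumes "continuous_on S a" "continuous_on S b" "continuous_on S c" "continuous_on S d"
  shows "continuous_on S (\<lambda>z. cm2 (a z) (b z) (c z) (d z))"
  unfolding cm2_def
proof (intro continuous_on_vec_lambda)
  fix i j :: 2
  show "continuous_on S (\<lambda>z. if i = 1 then (if j = 1 then a z else b z) else (if j = 1 then c z else d z))"
    using assms by (cases "i = 1"; cases "j = 1") simp_all
qed

text \<open>Isolates what the growth argument uses of the norm of a representing matrix: continuity
  and submultiplicativity.\<close>

locale sl2_submult =
  fixes R :: "complex^2^2 \<Rightarrow> real"
  assumes cont: "continuous_on {A. det A = 1} R"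
    and nonneg: "det A = 1 \<Longrightarrow> R A \<ge> 0"
    and submult: "det A = 1 \<Longrightarrow> det B = 1 \<Longrightarrow> R (A ** B) \<le> R A * R B"
begin

lemma bound_curve:
  assumes "continuous_on UNIV f" "\<And>z. det (f z) = 1"
  shows "\<exists>K. \<forall>z. norm (z::complex) \<le> 1 \<longrightarrow> R (f z) \<le> K"
proof -
  have "compact ((\<lambda>z. R (f z)) ` cball 0 1)"
    using assms by (intro compact_continuous_image continuous_on_compose2[OF cont]) (auto intro: continuous_on_subset)
  hence "bounded ((\<lambda>z. R (f z)) ` cball 0 1)" by (rule compact_imp_bounded)
  then obtain K where "\<And>z. z \<in> cball 0 1 \<Longrightarrow> norm (R (f z)) \<le> K" unfolding bounded_iff by blast
  hence "\<And>z. norm z \<le> 1 \<Longrightarrow> R (f z) \<le> K" by fastforce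
  thus ?thesis by blast
qed

text \<open>Conjugation by \<open>diag(2, 1/2)\<close> multiplies the entry of a unipotent matrix by 4.\<close>

lemma unipotent_growth:
  fixes f :: "complex \<Rightarrow> complex^2^2"
  assumes f: "continuous_on UNIV f" "\<And>z. det (f z) = 1"
    and D: "det D = 1" "det D' = 1" "\<And>z. f (4 * z) = D ** (f z ** D')"
  obtains C p where "C \<ge> 0" "\<And>z. R (f z) \<le> C * (1 + norm z) ^ p"
proof -
  obtain K0 where K0: "\<And>z. norm z \<le> 1 \<Longrightarrow> R (f z) \<le> K0" using bound_curve[OF f] by blast
  \<comment> \<open>One power of 4 dominates both the values on the unit disc and the cost of one
    conjugation; n divisions by 4 bring z into the unit disc.\<close>
  obtain p where p: "max K0 (R D * R D') < 4 ^ p" using real_arch_pow[of 4 "max K0 (R D * R D')"] by auto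
  have pow: "R (f z) \<le> 4 ^ p * (4 ^ p) ^ n" if "norm z \<le> 4 ^ n" for n z
    using that
  proof (induction n arbitrary: z)
    case 0
    thus ?case using K0[of z] p by simp
  next
    case (Suc n)
    define w where "w = z / 4"
    have z: "z = 4 * w" by (simp add: w_def)
    have "R (f z) = R (D ** (f w ** D'))" unfolding z D(3) ..
    also have "\<dots> \<le> R D * R (f w ** D')" using D f by (intro submult) (auto simp: det_mul)
    also have "\<dots> \<le> R D * (R (f w) * R D')" using D f by (intro mult_left_mono submult nonneg) auto
    also have "\<dots> = (R D * R D') * R (f w)" by simp
    also have "\<dots> \<le> 4 ^ p * (4 ^ p * (4 ^ p) ^ n)"
      using Suc p nonneg D f by (intro mult_mono) (auto simp: w_def norm_divide)
    finally show ?case by (simp add: mult_ac)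
  qed
  have "R (f z) \<le> 4 ^ p * 4 ^ p * (1 + norm z) ^ p" for z
  proof -
    obtain n where n: "norm z \<le> 4 ^ n" "(4::real) ^ n \<le> 4 * (1 + norm z)"
    proof -
      have ex: "\<exists>n. norm z \<le> 4 ^ n" using real_arch_pow[of 4 "norm z"] by (auto intro: less_imp_le)
      define n where "n = (LEAST n. norm z \<le> 4 ^ n)"
      have 1: "norm z \<le> 4 ^ n" unfolding n_def using ex by (rule LeastI_ex)
      have "(4::real) ^ n \<le> 4 * (1 + norm z)"
      proof (cases n)
        case (Suc m)
        hence "\<not> norm z \<le> 4 ^ m" using not_less_Least[of m "\<lambda>n. norm z \<le> 4 ^ n"] by (simp add: n_def[symmetric])
        thus ?thesis using Suc by simp
      qed simp
      thus thesis using 1 that by blast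
    qed
    have "R (f z) \<le> 4 ^ p * (4 ^ p) ^ n" by (rule pow[OF n(1)])
    also have "\<dots> = 4 ^ p * ((4 ^ n) ^ p)" by (simp add: power_mult[symmetric] mult.commute)
    also have "\<dots> \<le> 4 ^ p * ((4 * (1 + norm z)) ^ p)" using n(2) by (intro mult_left_mono power_mono) auto
    also have "\<dots> = 4 ^ p * 4 ^ p * (1 + norm z) ^ p" unfolding power_mult_distrib by simp
    finally show ?thesis .
  qed
  thus thesis using that[of "4 ^ p * 4 ^ p" p] by simp
qed

text \<open>For nonzero c, A is a product of three unipotent matrices with entries (a - 1)/c, c and
  (d - 1)/c, polynomially bounded as long as c is not too small. As the determinant is 1, c and d
  cannot both be below 1 / (2 (1 + mnorm A)) in modulus; if d is the large one, multiplication by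
  the Weyl element \<open>w\<close> moves it to the place of c.\<close>

theorem poly_growth:
  obtains C k where "C \<ge> 0" "\<And>A. det A = 1 \<Longrightarrow> R A \<le> C * (1 + mnorm A) ^ k"
proof -
  define u l where "u = (\<lambda>z. cm2 1 z 0 1)" and "l = (\<lambda>z. cm2 1 0 z 1)"
  have du: "det (u z) = 1" "det (l z) = 1" for z by (simp_all add: u_def l_def)
  obtain C1 p1 where u: "C1 \<ge> 0" "\<And>z. R (u z) \<le> C1 * (1 + norm z) ^ p1"
  proof (rule unipotent_growth[of u "cm2 2 0 0 (1/2)" "cm2 (1/2) 0 0 2"])
    show "continuous_on UNIV u" unfolding u_def by (intro continuous_intros)
    show "u (4 * z) = cm2 2 0 0 (1/2) ** (u z ** cm2 (1/2) 0 0 2)" for z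
      by (simp add: cm2_eq_iff mult_nth2 u_def)
  qed (auto simp: du)
  obtain C2 p2 where l: "C2 \<ge> 0" "\<And>z. R (l z) \<le> C2 * (1 + norm z) ^ p2"
  proof (rule unipotent_growth[of l "cm2 (1/2) 0 0 2" "cm2 2 0 0 (1/2)"])
    show "continuous_on UNIV l" unfolding l_def by (intro continuous_intros)
    show "l (4 * z) = cm2 (1/2) 0 0 2 ** (l z ** cm2 2 0 0 (1/2))" for z
      by (simp add: cm2_eq_iff mult_nth2 l_def)
  qed (auto simp: du)
  define k where "k = 3 * p1 + p2 + 3 * p1"
  define C where "C = C1 * 3 ^ p1 * (C2 * (C1 * 3 ^ p1))"
  have C: "C \<ge> 0" using u l by (simp add: C_def)
  have main: "R A \<le> C * (1 + mnorm A) ^ k" if A: "det A = 1" and c: "norm (A $ 2 $ 1) * (2 * (1 + mnorm A)) \<ge> 1" for A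
  proof -
    define a b c d where "a = A $ 1 $ 1" "b = A $ 1 $ 2" "c = A $ 2 $ 1" "d = A $ 2 $ 2"
    note abcd = this
    define B where "B = 1 + mnorm A"
    have B: "B \<ge> 1" "norm a \<le> B - 1" "norm c \<le> B - 1" "norm d \<le> B - 1"
      by (auto simp: B_def mnorm_def abcd)
    have det: "a * d - b * c = 1" using A by (simp add: det_2 abcd)
    have c0: "c \<noteq> 0" using c by (auto simp: abcd)
    have A_eq: "A = u ((a - 1) / c) ** (l c ** u ((d - 1) / c))"
    proof -
      have "b = (d - 1) / c + (a * d - d) / c" using c0 det by (simp add: field_simps)
      thus ?thesis using c0 by (simp add: cm2_eq_iff mult_nth2 u_def l_def abcd[symmetric] algebra_simps)
    qed
    have cinv: "1 / norm c \<le> 2 * B" using c c0 by (simp add: abcd[symmetric] B_def[symmetric] field_simps)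
    have q: "1 + norm ((x - 1) / c) \<le> 3 * B ^ 3" if "norm x \<le> B - 1" for x
    proof -
      have "norm (x - 1) \<le> B" using that norm_triangle_ineq4[of x 1] by simp
      hence "norm (x - 1) * (1 / norm c) \<le> B * (2 * B)" using cinv B by (intro mult_mono) auto
      hence "1 + norm ((x - 1) / c) \<le> 1 + 2 * B ^ 2" by (simp add: norm_divide power2_eq_square)
      also have "\<dots> \<le> 3 * B ^ 2" using B by (simp add: one_le_power)
      also have "\<dots> \<le> 3 * B ^ 3" using B by (intro mult_left_mono power_increasing) auto
      finally show ?thesis .
    qed
    have Ru: "R (u ((x - 1) / c)) \<le> C1 * 3 ^ p1 * B ^ (3 * p1)" if "norm x \<le> B - 1" for x
    proof -
      have "R (u ((x - 1) / c)) \<le> C1 * (1 + norm ((x - 1) / c)) ^ p1" by (rule u)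
      also have "\<dots> \<le> C1 * (3 * B ^ 3) ^ p1" using u q[OF that] by (intro mult_left_mono power_mono) auto
      also have "\<dots> = C1 * 3 ^ p1 * B ^ (3 * p1)" unfolding power_mult_distrib power_mult by simp
      finally show ?thesis .
    qed
    have Rl: "R (l c) \<le> C2 * B ^ p2"
    proof -
      have "R (l c) \<le> C2 * (1 + norm c) ^ p2" by (rule l)
      also have "\<dots> \<le> C2 * B ^ p2" using l B by (intro mult_left_mono power_mono) auto
      finally show ?thesis .
    qed
    have "R A \<le> R (u ((a - 1) / c)) * R (l c ** u ((d - 1) / c))"
      by (subst A_eq) (intro submult, auto simp: du det_mul)
    also have "\<dots> \<le> R (u ((a - 1) / c)) * (R (l c) * R (u ((d - 1) / c)))"
      by (intro mult_left_mono submult nonneg du)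
    also have "\<dots> \<le> (C1 * 3 ^ p1 * B ^ (3 * p1)) * ((C2 * B ^ p2) * (C1 * 3 ^ p1 * B ^ (3 * p1)))"
      using u l B by (intro mult_mono Ru Rl) (auto intro!: mult_nonneg_nonneg nonneg du)
    also have "\<dots> = C * B ^ k" unfolding C_def k_def power_add by (simp only: mult_ac)
    finally show ?thesis by (simp add: B_def)
  qed
  define w w' where "w = cm2 0 (-1) 1 0" and "w' = cm2 0 1 (-1) 0"
  have dw: "det w = 1" "det w' = 1" by (simp_all add: w_def w'_def)
  have "R A \<le> (C * (1 + R w')) * (1 + mnorm A) ^ k" if A: "det A = 1" for A
  proof -
    have B: "1 + mnorm A \<ge> 1" by (simp add: mnorm_def)
    have Rw: "R w' \<ge> 0" by (rule nonneg[OF dw(2)])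
    consider "norm (A $ 2 $ 1) * (2 * (1 + mnorm A)) \<ge> 1" | "norm (A $ 2 $ 2) * (2 * (1 + mnorm A)) \<ge> 1"
    proof -
      have "1 = norm (A $ 1 $ 1 * A $ 2 $ 2 - A $ 1 $ 2 * A $ 2 $ 1)" using A by (simp add: det_2)
      also have "\<dots> \<le> norm (A $ 1 $ 1) * norm (A $ 2 $ 2) + norm (A $ 1 $ 2) * norm (A $ 2 $ 1)"
        by (rule order_trans[OF norm_triangle_ineq4]) (simp add: norm_mult)
      also have "\<dots> \<le> (1 + mnorm A) * norm (A $ 2 $ 2) + (1 + mnorm A) * norm (A $ 2 $ 1)"
        by (intro add_mono mult_right_mono) (auto simp: mnorm_def)
      finally show thesis using that by (simp add: algebra_simps) linarith
    qed
    thus ?thesis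
    proof cases
      case 1
      have "C * (1 + mnorm A) ^ k * 1 \<le> C * (1 + mnorm A) ^ k * (1 + R w')"
        using C B Rw by (intro mult_left_mono) auto
      thus ?thesis using main[OF A 1] by (simp add: mult_ac)
    next
      case 2
      have m: "mnorm (A ** w) = mnorm A" by (simp add: mnorm_def mult_nth2 w_def)
      have "(A ** w) $ 2 $ 1 = A $ 2 $ 2" by (simp add: mult_nth2 w_def)
      hence "R (A ** w) \<le> C * (1 + mnorm A) ^ k" using main[of "A ** w"] A dw 2 by (simp add: m det_mul)
      moreover have "A = (A ** w) ** w'" by (simp add: cm2_eq_iff mult_nth2 w_def w'_def)
      hence "R A \<le> R (A ** w) * R w'" using submult[of "A ** w" w'] A dw by (simp add: det_mul)
      ultimately have "R A \<le> (C * (1 + mnorm A) ^ k) * R w'" using Rw by (meson mult_right_mono order_trans)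
      also have "\<dots> \<le> (C * (1 + mnorm A) ^ k) * (1 + R w')" using C B by (intro mult_left_mono) auto
      finally show ?thesis by (simp add: mult_ac)
    qed
  qed
  moreover have "C * (1 + R w') \<ge> 0" using C nonneg[OF dw(2)] by simp
  ultimately show thesis using that by blast
qed

end

section \<open>Finite-dimensional complex Lie algebras\<close>

lemma complex_field_simps [simp]:
  "carrier complex_field = UNIV" "x \<oplus>\<^bsub>complex_field\<^esub> y = x + y" "x \<otimes>\<^bsub>complex_field\<^esub> y = x * y"
  "\<one>\<^bsub>complex_field\<^esub> = 1" "\<zero>\<^bsub>complex_field\<^esub> = 0"
  by (simp_all add: ring_of_type_algebra_def)

locale complex_lie_algebra = lie_algebra complex_field \<gg> for \<gg> :: "(complex, 'a) lie_algebra" (structure)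
begin

definition lc :: "'a set \<Rightarrow> ('a \<Rightarrow> complex) \<Rightarrow> 'a" where
  "lc A c = (\<Oplus>\<^bsub>\<gg>\<^esub> b\<in>A. c b \<odot> b)"

lemma smult_cl [simp, intro]: "x \<in> carrier \<gg> \<Longrightarrow> k \<odot> x \<in> carrier \<gg>"
  using smult_closed by simp

lemma smult_l: "x \<in> carrier \<gg> \<Longrightarrow> (a + b) \<odot> x = a \<odot> x \<oplus> b \<odot> x"
  using smult_l_distr[of a b x] by simp

lemma smult_r: "x \<in> carrier \<gg> \<Longrightarrow> y \<in> carrier \<gg> \<Longrightarrow> a \<odot> (x \<oplus> y) = a \<odot> x \<oplus> a \<odot> y"
  using smult_r_distr[of a x y] by simp

lemma smult_assoc: "x \<in> carrier \<gg> \<Longrightarrow> (a * b) \<odot> x = a \<odot> (b \<odot> x)"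
  using smult_assoc1[of a b x] by simp

lemma smult_1 [simp]: "x \<in> carrier \<gg> \<Longrightarrow> 1 \<odot> x = x"
  using smult_one by simp

lemma smult_0 [simp]: "x \<in> carrier \<gg> \<Longrightarrow> 0 \<odot> x = \<zero>"
  using smult_l_null by simp

lemma lc_empty [simp]: "lc {} c = \<zero>"
  by (simp add: lc_def)

lemma lc_insert:
  "finite A \<Longrightarrow> A \<subseteq> carrier \<gg> \<Longrightarrow> b \<in> carrier \<gg> \<Longrightarrow> b \<notin> A \<Longrightarrow> lc (insert b A) c = c b \<odot> b \<oplus> lc A c"
  unfolding lc_def by (subst finsum_insert) auto

lemma lc_closed [simp]: "A \<subseteq> carrier \<gg> \<Longrightarrow> lc A c \<in> carrier \<gg>"
  unfolding lc_def by (intro finsum_closed) auto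

lemma lc_add:
  assumes "finite A" "A \<subseteq> carrier \<gg>"
  shows "lc A (\<lambda>b. c b + d b) = lc A c \<oplus> lc A d"
proof -
  have "lc A (\<lambda>b. c b + d b) = (\<Oplus>\<^bsub>\<gg>\<^esub> b\<in>A. c b \<odot> b \<oplus> d b \<odot> b)"
    unfolding lc_def using assms by (intro finsum_cong') (auto simp: smult_l)
  also have "\<dots> = lc A c \<oplus> lc A d" unfolding lc_def using assms by (intro finsum_addf) auto
  finally show ?thesis .
qed

lemma lc_smult:
  assumes "finite A" "A \<subseteq> carrier \<gg>"
  shows "lc A (\<lambda>b. k * c b) = k \<odot> lc A c"
  using assms
proof (induction A rule: finite_induct)
  case empty
  have "k \<odot> \<zero> = \<zero>" using smult_r_null[of k] by simp
  thus ?case by simp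
qed (auto simp: lc_insert smult_r smult_assoc)

lemma lc_cong: "A \<subseteq> carrier \<gg> \<Longrightarrow> (\<And>b. b \<in> A \<Longrightarrow> c b = d b) \<Longrightarrow> lc A c = lc A d"
  unfolding lc_def by (intro finsum_cong') auto

lemma lc_0: "finite A \<Longrightarrow> A \<subseteq> carrier \<gg> \<Longrightarrow> (\<And>b. b \<in> A \<Longrightarrow> c b = 0) \<Longrightarrow> lc A c = \<zero>"
  by (induction A rule: finite_induct) (auto simp: lc_insert)

lemma lc_remove:
  assumes "finite A" "A \<subseteq> carrier \<gg>" "b \<in> A"
  shows "lc A c = c b \<odot> b \<oplus> lc (A - {b}) c"
  using lc_insert[of "A - {b}" b c] assms by (auto simp: insert_absorb)

lemma lc_single:
  assumes "finite A" "A \<subseteq> carrier \<gg>" "b \<in> A"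
  shows "lc A (\<lambda>x. if x = b then 1 else 0) = b"
proof -
  have "lc (A - {b}) (\<lambda>x. if x = b then 1 else 0) = \<zero>" using assms by (intro lc_0) auto
  thus ?thesis using lc_remove[OF assms, of "\<lambda>x. if x = b then 1 else 0"] assms by auto
qed

lemma dual_lc:
  assumes "\<phi> \<in> dual_space \<gg>" "finite A" "A \<subseteq> carrier \<gg>"
  shows "\<phi> (lc A c) = (\<Sum>b\<in>A. c b * \<phi> b)"
  using assms(2,3)
proof (induction A rule: finite_induct)
  case empty
  have "\<phi> (0 \<odot> \<zero>) = 0 * \<phi> \<zero>" using assms(1) zero_closed unfolding dual_space_def by blast
  thus ?case by simp
next
  case (insert b A)
  thus ?case using assms(1) by (simp add: lc_insert dual_space_def)
qed

end

text \<open>A basis with its dual basis, indexed by the basis vectors themselves. Through it,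
  analysis and linear algebra on the abstract carrier become statements about the scalar functions
  \<open>\<xi> b\<close>.\<close>

locale framed_lie_algebra = complex_lie_algebra +
  fixes B :: "'a set" and \<xi> :: "'a \<Rightarrow> 'a \<Rightarrow> complex"
  assumes finite_B: "finite B" and B_sub: "B \<subseteq> carrier \<gg>"
    and \<xi>_dual: "b \<in> B \<Longrightarrow> \<xi> b \<in> dual_space \<gg>"
    and repr: "x \<in> carrier \<gg> \<Longrightarrow> x = lc B (\<lambda>b. \<xi> b x)"
    and \<xi>_delta: "b \<in> B \<Longrightarrow> b' \<in> B \<Longrightarrow> \<xi> b b' = (if b = b' then 1 else 0)"

text \<open>A spanning set of least cardinality is a basis. Finite generation is given in terms of
  submodules, so the linear combinations have to be recognised as one.\<close>

lemma (in complex_lie_algebra) frame_exists: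
  assumes "finitely_spanned complex_field \<gg>"
  obtains B \<xi> where "framed_lie_algebra \<gg> B \<xi>"
proof -
  define spans where "spans = (\<lambda>B. finite B \<and> B \<subseteq> carrier \<gg> \<and> (\<forall>x\<in>carrier \<gg>. \<exists>c. x = lc B c))"
  obtain B0 where B0: "finite B0" "B0 \<subseteq> carrier \<gg>" "\<And>H. submodule H complex_field \<gg> \<Longrightarrow> B0 \<subseteq> H \<Longrightarrow> H = carrier \<gg>"
    using assms unfolding finitely_spanned_def by blast
  have "submodule (range (lc B0)) complex_field \<gg>"
  proof (rule submoduleI)
    show "range (lc B0) \<subseteq> carrier \<gg>" using B0 by auto
    show "\<zero> \<in> range (lc B0)" using lc_0[OF B0(1,2), of "\<lambda>_. 0"] by (metis rangeI)
    show "\<ominus> a \<in> range (lc B0)" if a: "a \<in> range (lc B0)" for a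
    proof -
      obtain c where c: "a = lc B0 c" using a by auto
      have "lc B0 (\<lambda>b. (- 1) * c b) \<oplus> a = lc B0 (\<lambda>b. (- 1) * c b + c b)"
        by (simp only: lc_add[OF B0(1,2)] c)
      also have "\<dots> = \<zero>" using B0 by (intro lc_0) auto
      finally have "\<ominus> a = lc B0 (\<lambda>b. (- 1) * c b)" using B0 c by (intro minus_equality) auto
      thus ?thesis by simp
    qed
    show "a \<oplus> b \<in> range (lc B0)" if "a \<in> range (lc B0)" "b \<in> range (lc B0)" for a b
    proof -
      obtain c d where "a = lc B0 c" "b = lc B0 d" using \<open>a \<in> _\<close> \<open>b \<in> _\<close> by blast
      hence "a \<oplus> b = lc B0 (\<lambda>x. c x + d x)" by (simp only: lc_add[OF B0(1,2)])
      thus ?thesis by (simp only: rangeI)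
    qed
    show "k \<odot> a \<in> range (lc B0)" if "a \<in> range (lc B0)" for k a
    proof -
      obtain c where "a = lc B0 c" using \<open>a \<in> _\<close> by blast
      hence "k \<odot> a = lc B0 (\<lambda>x. k * c x)" by (simp only: lc_smult[OF B0(1,2)])
      thus ?thesis by (simp only: rangeI)
    qed
  qed
  moreover have "B0 \<subseteq> range (lc B0)" using lc_single[OF B0(1,2)] by (metis rangeI subsetI)
  ultimately have "range (lc B0) = carrier \<gg>" using B0(3) by blast
  hence "spans B0" unfolding spans_def using B0 by blast
  then obtain B where B: "spans B" "\<And>B'. spans B' \<Longrightarrow> card B \<le> card B'"
    using ex_has_least_nat[of spans B0 card] by blast
  have fin: "finite B" and sub: "B \<subseteq> carrier \<gg>" using B(1) by (auto simp: spans_def)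
  have indep: "c b = 0" if c: "lc B c = \<zero>" and b: "b \<in> B" for c b
  proof (rule ccontr)
    assume nz: "c b \<noteq> 0"
    have "spans (B - {b})" unfolding spans_def
    proof (intro conjI ballI)
      fix x assume "x \<in> carrier \<gg>"
      then obtain d where d: "x = lc B d" using B(1) by (auto simp: spans_def)
      define d' where "d' = (\<lambda>y. d y + (- (d b / c b)) * c y)"
      have "lc B d' = lc B d \<oplus> (- (d b / c b)) \<odot> lc B c"
        by (simp only: d'_def lc_add[OF fin sub] lc_smult[OF fin sub])
      also have "\<dots> = x" using smult_r_null[of "- (d b / c b)"] sub by (simp add: c d)
      finally have "x = lc B d'" by simp
      also have "\<dots> = d' b \<odot> b \<oplus> lc (B - {b}) d'" by (rule lc_remove[OF fin sub b])
      also have "d' b = 0" using nz by (simp add: d'_def)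
      finally have "x = lc (B - {b}) d'" using b sub by (auto simp: subset_iff)
      thus "\<exists>c. x = lc (B - {b}) c" by blast
    qed (use fin sub in auto)
    hence "card B \<le> card (B - {b})" by (rule B(2))
    thus False using card_Diff1_less[OF fin b] by simp
  qed
  have uniq: "c b = d b" if cd: "lc B c = lc B d" and b: "b \<in> B" for c d b
  proof -
    have "lc B (\<lambda>b. c b + (- 1) * d b) = lc B c \<oplus> (- 1) \<odot> lc B d" using fin sub by (simp only: lc_add lc_smult)
    also have "\<dots> = lc B (\<lambda>b. d b + (- 1) * d b)" unfolding cd using fin sub by (simp only: lc_add lc_smult)
    also have "\<dots> = \<zero>" using fin sub by (intro lc_0) auto
    finally show ?thesis using indep[of "\<lambda>b. c b + (- 1) * d b" b] b by simp
  qed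
  define \<xi> where "\<xi> = (\<lambda>b x. (SOME c. x = lc B c) b)"
  have repr: "x = lc B (\<lambda>b. \<xi> b x)" if "x \<in> carrier \<gg>" for x
  proof -
    have "\<exists>c. x = lc B c" using B(1) that unfolding spans_def by blast
    hence "x = lc B (SOME c. x = lc B c)" by (rule someI_ex)
    thus ?thesis by (simp only: \<xi>_def)
  qed
  have \<xi>I: "\<xi> b x = c b" if "x = lc B c" "b \<in> B" for b x c
  proof -
    have "x \<in> carrier \<gg>" using that sub by simp
    thus ?thesis using uniq[of "\<lambda>b. \<xi> b x" c b] repr[of x] that by simp
  qed
  have "framed_lie_algebra \<gg> B \<xi>"
  proof
    show "finite B" "B \<subseteq> carrier \<gg>" by (fact fin sub)+
    show "x = lc B (\<lambda>b. \<xi> b x)" if "x \<in> carrier \<gg>" for x by (rule repr[OF that])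
    show "\<xi> b b' = (if b = b' then 1 else 0)" if "b \<in> B" "b' \<in> B" for b b'
      using \<xi>I[OF lc_single[OF fin sub that(2), symmetric] that(1)] by simp
    show "\<xi> b \<in> dual_space \<gg>" if b: "b \<in> B" for b
      unfolding dual_space_def
    proof (intro CollectI conjI ballI allI)
      fix x y assume xy: "x \<in> carrier \<gg>" "y \<in> carrier \<gg>"
      have "x \<oplus> y = lc B (\<lambda>b. \<xi> b x + \<xi> b y)"
        by (simp only: lc_add[OF fin sub] repr[OF xy(1), symmetric] repr[OF xy(2), symmetric])
      thus "\<xi> b (x \<oplus> y) = \<xi> b x + \<xi> b y" using \<xi>I b by blast
    next
      fix k x assume x: "x \<in> carrier \<gg>"
      have "k \<odot> x = lc B (\<lambda>b. k * \<xi> b x)"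
        by (simp only: lc_smult[OF fin sub] repr[OF x, symmetric])
      thus "\<xi> b (k \<odot> x) = k * \<xi> b x" using \<xi>I b by blast
    qed
  qed
  thus thesis by (rule that)
qed

context framed_lie_algebra
begin

lemma \<xi>_add: "b \<in> B \<Longrightarrow> x \<in> carrier \<gg> \<Longrightarrow> y \<in> carrier \<gg> \<Longrightarrow> \<xi> b (x \<oplus> y) = \<xi> b x + \<xi> b y"
  and \<xi>_smult: "b \<in> B \<Longrightarrow> x \<in> carrier \<gg> \<Longrightarrow> \<xi> b (k \<odot> x) = k * \<xi> b x"
  using \<xi>_dual by (auto simp: dual_space_def)

lemma \<xi>_lc: "b \<in> B \<Longrightarrow> \<xi> b (lc B c) = c b"
proof -
  assume b: "b \<in> B"
  have "\<xi> b (lc B c) = (\<Sum>b'\<in>B. c b' * \<xi> b b')" by (rule dual_lc[OF \<xi>_dual[OF b] finite_B B_sub])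
  also have "\<dots> = (\<Sum>b'\<in>B. if b' = b then c b' else 0)" using b by (intro sum.cong) (auto simp: \<xi>_delta)
  finally show ?thesis using b finite_B by simp
qed

lemma \<xi>_eqI:
  assumes "x \<in> carrier \<gg>" "y \<in> carrier \<gg>" "\<And>b. b \<in> B \<Longrightarrow> \<xi> b x = \<xi> b y"
  shows "x = y"
proof -
  have "x = lc B (\<lambda>b. \<xi> b x)" by (rule repr[OF assms(1)])
  also have "\<dots> = lc B (\<lambda>b. \<xi> b y)" using assms(3) by (intro lc_cong B_sub)
  also have "\<dots> = y" by (rule repr[OF assms(2), symmetric])
  finally show ?thesis .
qed

lemma dual_expand:
  assumes "\<phi> \<in> dual_space \<gg>" "x \<in> carrier \<gg>"
  shows "\<phi> x = (\<Sum>b\<in>B. \<xi> b x * \<phi> b)"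
  using dual_lc[OF assms(1) finite_B B_sub, of "\<lambda>b. \<xi> b x"] repr[OF assms(2)] by simp

lemma vholomorphic_iff:
  assumes "\<And>z. z \<in> S \<Longrightarrow> f z \<in> carrier \<gg>"
  shows "vholomorphic_on \<gg> f S \<longleftrightarrow> (\<forall>b\<in>B. (\<lambda>z. \<xi> b (f z)) holomorphic_on S)"
proof
  assume *: "\<forall>b\<in>B. (\<lambda>z. \<xi> b (f z)) holomorphic_on S"
  show "vholomorphic_on \<gg> f S" unfolding vholomorphic_on_def
  proof
    fix \<phi> assume \<phi>: "\<phi> \<in> dual_space \<gg>"
    have "(\<lambda>z. \<Sum>b\<in>B. \<xi> b (f z) * \<phi> b) holomorphic_on S" using * by (intro holomorphic_intros) auto
    thus "(\<lambda>z. \<phi> (f z)) holomorphic_on S"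
      by (rule holomorphic_transform) (simp add: dual_expand[OF \<phi> assms])
  qed
qed (auto simp: vholomorphic_on_def \<xi>_dual)

lemma norm_le_coords:
  assumes "is_norm \<gg> \<nu>" "x \<in> carrier \<gg>"
  shows "\<nu> x \<le> (\<Sum>b\<in>B. cmod (\<xi> b x) * \<nu> b)"
proof -
  have "\<nu> (lc A c) \<le> (\<Sum>b\<in>A. cmod (c b) * \<nu> b)" if "finite A" "A \<subseteq> carrier \<gg>" for A c
    using that
  proof (induction A rule: finite_induct)
    case empty
    have "\<nu> \<zero> = 0" using assms(1) zero_closed unfolding is_norm_def by blast
    thus ?case by simp
  next
    case (insert b A)
    have "\<nu> (lc (insert b A) c) \<le> \<nu> (c b \<odot> b) + \<nu> (lc A c)"
    proof -
      have "c b \<odot> b \<in> carrier \<gg>" "lc A c \<in> carrier \<gg>" using insert by auto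
      moreover have "lc (insert b A) c = c b \<odot> b \<oplus> lc A c" using insert by (intro lc_insert) auto
      ultimately show ?thesis using assms(1) unfolding is_norm_def by metis
    qed
    also have "\<nu> (c b \<odot> b) = cmod (c b) * \<nu> b" using insert assms(1) unfolding is_norm_def by blast
    finally show ?case using insert by simp
  qed
  from this[OF finite_B B_sub, of "\<lambda>b. \<xi> b x"] show ?thesis using repr[OF assms(2)] by simp
qed

text \<open>Equivalence of norms, by induction on the number of nonvanishing coordinates; completeness of
  the span obtained so far shows that the next basis vector has positive distance from it.\<close>

lemma coords_le_norm_aux:
  assumes \<nu>: "is_norm \<gg> \<nu>" and "finite A" "A \<subseteq> B"
  shows "\<exists>C\<ge>0. \<forall>x\<in>carrier \<gg>. (\<forall>b\<in>B - A. \<xi> b x = 0) \<longrightarrow> (\<forall>b\<in>A. cmod (\<xi> b x) \<le> C * \<nu> x)"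
  using assms(2,3)
proof (induction A rule: finite_induct)
  case empty
  show ?case by (intro exI[of _ 0]) auto
next
  case (insert b0 A)
  define V where "V = {x \<in> carrier \<gg>. \<forall>b\<in>B - A. \<xi> b x = 0}"
  obtain C where C: "C \<ge> 0" "\<And>x b. x \<in> V \<Longrightarrow> b \<in> A \<Longrightarrow> cmod (\<xi> b x) \<le> C * \<nu> x"
    using insert unfolding V_def by auto
  have b0: "b0 \<in> B" "b0 \<in> carrier \<gg>" "b0 \<notin> A" using insert B_sub by auto
  have AB: "A \<subseteq> B" "A \<subseteq> carrier \<gg>" "finite A" using insert B_sub by auto
  have \<nu>0: "\<nu> x \<ge> 0" "\<nu> x = 0 \<longleftrightarrow> x = \<zero>" "\<nu> (k \<odot> x) = cmod k * \<nu> x" if "x \<in> carrier \<gg>" for x k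
    using \<nu> that by (auto simp: is_norm_def)
  have \<nu>tri: "\<nu> (x \<oplus> y) \<le> \<nu> x + \<nu> y" if "x \<in> carrier \<gg>" "y \<in> carrier \<gg>" for x y
    using \<nu> that by (auto simp: is_norm_def)
  have VE: "y \<in> carrier \<gg>" if "y \<in> V" for y using that by (simp add: V_def)
  have "\<exists>\<delta>>0. \<forall>y\<in>V. \<nu> (b0 \<oplus> y) \<ge> \<delta>"
  proof (rule ccontr)
    assume "\<not> ?thesis"
    \<comment> \<open>A sequence in V approaching the negative of \<open>b0\<close> is, by the bound
      for \<open>A\<close>, Cauchy in each coordinate. Its coordinatewise limit z satisfies
      \<open>b0 \<oplus> z = \<zero>\<close>, although z has no component along
      \<open>b0\<close>.\<close>
    hence "\<forall>n. \<exists>y\<in>V. \<nu> (b0 \<oplus> y) < 1 / real (Suc n)" by (metis not_le zero_less_divide_1_iff of_nat_0_less_iff zero_less_Suc)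
    then obtain y where y: "\<And>n. y n \<in> V" "\<And>n. \<nu> (b0 \<oplus> y n) < 1 / real (Suc n)" by metis
    have yc: "y n \<in> carrier \<gg>" for n using y(1) VE by blast
    have diff: "cmod (\<xi> b (y n) - \<xi> b (y m)) \<le> C * (1 / real (Suc n) + 1 / real (Suc m))" if b: "b \<in> A" for b n m
    proof -
      define d where "d = y n \<oplus> (- 1) \<odot> y m"
      have bB: "b \<in> B" using b AB by auto
      have d: "d \<in> V" using y(1)[of n] y(1)[of m] yc by (auto simp: V_def d_def \<xi>_add \<xi>_smult)
      have "d = (b0 \<oplus> y n) \<oplus> (- 1) \<odot> (b0 \<oplus> y m)"
        by (rule \<xi>_eqI) (use d VE yc b0 in \<open>auto simp: d_def \<xi>_add \<xi>_smult\<close>)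
      hence "\<nu> d \<le> \<nu> (b0 \<oplus> y n) + \<nu> ((- 1) \<odot> (b0 \<oplus> y m))" using \<nu>tri yc b0 by simp
      also have "\<dots> \<le> 1 / real (Suc n) + 1 / real (Suc m)"
        using y(2)[of n] y(2)[of m] \<nu>0(3)[of "b0 \<oplus> y m" "- 1"] yc b0 by simp
      finally have "C * \<nu> d \<le> C * (1 / real (Suc n) + 1 / real (Suc m))" using C(1) by (rule mult_left_mono)
      moreover have "\<xi> b d = \<xi> b (y n) - \<xi> b (y m)" using yc bB by (simp add: d_def \<xi>_add \<xi>_smult)
      ultimately show ?thesis using C(2)[OF d b] by simp
    qed
    have "convergent (\<lambda>n. \<xi> b (y n))" if b: "b \<in> A" for b
    proof (rule Cauchy_convergent, rule CauchyI)
      fix e :: real assume e: "e > 0"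
      obtain M where M: "(2 * C + 1) / e < real M" using reals_Archimedean2 by blast
      have "cmod (\<xi> b (y m) - \<xi> b (y n)) < e" if "m \<ge> M" "n \<ge> M" for m n
      proof -
        have Mpos: "real M > 0" using M e C(1) by (smt (verit) divide_pos_pos)
        have "cmod (\<xi> b (y m) - \<xi> b (y n)) \<le> C * (1 / real (Suc m) + 1 / real (Suc n))" by (rule diff[OF b])
        also have "\<dots> \<le> C * (1 / real M + 1 / real M)"
          using that Mpos C(1) by (intro mult_left_mono add_mono divide_left_mono) auto
        also have "\<dots> < e" using M e Mpos by (simp add: field_simps)
        finally show ?thesis .
      qed
      thus "\<exists>M. \<forall>m\<ge>M. \<forall>n\<ge>M. norm (\<xi> b (y m) - \<xi> b (y n)) < e" by blast
    qed
    then obtain c where c: "\<And>b. b \<in> A \<Longrightarrow> (\<lambda>n. \<xi> b (y n)) \<longlonglongrightarrow> c b"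
      unfolding convergent_def by metis
    define z where "z = lc B (\<lambda>b. if b \<in> A then c b else 0)"
    have z: "z \<in> carrier \<gg>" using B_sub by (simp add: z_def)
    have \<xi>z: "\<xi> b z = (if b \<in> A then c b else 0)" if "b \<in> B" for b
      using that by (simp add: z_def \<xi>_lc)
    have bound: "\<nu> (b0 \<oplus> z) \<le> 1 / real (Suc n) + (\<Sum>b\<in>B. cmod ((if b \<in> A then c b else 0) - \<xi> b (y n)) * \<nu> b)" for n
    proof -
      define d where "d = z \<oplus> (- 1) \<odot> y n"
      have d: "d \<in> carrier \<gg>" using z yc by (simp add: d_def)
      have "b0 \<oplus> z = (b0 \<oplus> y n) \<oplus> d"
        by (rule \<xi>_eqI) (use z yc b0 in \<open>auto simp: d_def \<xi>_add \<xi>_smult\<close>)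
      hence "\<nu> (b0 \<oplus> z) \<le> \<nu> (b0 \<oplus> y n) + \<nu> d" using \<nu>tri yc b0 d by simp
      also have "\<nu> d \<le> (\<Sum>b\<in>B. cmod (\<xi> b d) * \<nu> b)" by (rule norm_le_coords[OF \<nu> d])
      also have "\<dots> = (\<Sum>b\<in>B. cmod ((if b \<in> A then c b else 0) - \<xi> b (y n)) * \<nu> b)"
        using z yc by (intro sum.cong) (auto simp: d_def \<xi>_add \<xi>_smult \<xi>z)
      finally show ?thesis using y(2)[of n] by simp
    qed
    have "(\<lambda>n. 1 / real (Suc n) + (\<Sum>b\<in>B. cmod ((if b \<in> A then c b else 0) - \<xi> b (y n)) * \<nu> b))
        \<longlonglongrightarrow> 0 + (\<Sum>b\<in>B. 0 * \<nu> b)"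
    proof (intro tendsto_add tendsto_sum tendsto_mult tendsto_const)
      show "(\<lambda>n. 1 / real (Suc n)) \<longlonglongrightarrow> 0" using LIMSEQ_inverse_real_of_nat by (simp add: inverse_eq_divide)
      fix b assume b: "b \<in> B"
      show "(\<lambda>n. cmod ((if b \<in> A then c b else 0) - \<xi> b (y n))) \<longlonglongrightarrow> 0"
      proof (cases "b \<in> A")
        case True
        have "(\<lambda>n. cmod (c b - \<xi> b (y n))) \<longlonglongrightarrow> cmod (c b - c b)" by (intro tendsto_intros c[OF True])
        thus ?thesis using True by simp
      next
        case False
        hence "\<xi> b (y n) = 0" for n using y(1)[of n] b by (auto simp: V_def)
        thus ?thesis using False by simp
      qed
    qed
    hence "\<nu> (b0 \<oplus> z) \<le> 0" using bound by (intro LIMSEQ_le_const) auto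
    hence "b0 \<oplus> z = \<zero>" using \<nu>0 z b0 by (metis add.m_closed antisym)
    hence "\<xi> b0 b0 + \<xi> b0 z = \<xi> b0 (0 \<odot> b0)" using \<xi>_add[OF b0(1,2) z] b0 by simp
    thus False using b0 \<xi>_smult[of b0 b0 0] by (simp add: \<xi>_delta \<xi>z)
  qed
  then obtain \<delta> where \<delta>: "\<delta> > 0" "\<And>y. y \<in> V \<Longrightarrow> \<nu> (b0 \<oplus> y) \<ge> \<delta>" by blast
  \<comment> \<open>The coordinate at \<open>b0\<close> costs 1/\<delta>. For the others x is
    replaced by x - k b0, whose norm is at most (1 + \<nu>(b0)/\<delta>) \<nu>(x).\<close>
  define D where "D = C * (1 + \<nu> b0 / \<delta>) + 1 / \<delta>"
  have D: "D \<ge> 0" "1 / \<delta> \<le> D" "C * (1 + \<nu> b0 / \<delta>) \<le> D" using C(1) \<delta>(1) \<nu>0(1)[OF b0(2)] by (auto simp: D_def)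
  have "cmod (\<xi> b x) \<le> D * \<nu> x" if x: "x \<in> carrier \<gg>" "\<forall>b\<in>B - insert b0 A. \<xi> b x = 0" and b: "b \<in> insert b0 A" for x b
  proof -
    define k where "k = \<xi> b0 x"
    have k: "cmod k \<le> \<nu> x / \<delta>"
    proof (cases "k = 0")
      case False
      define y where "y = (1 / k) \<odot> x \<oplus> (- 1) \<odot> b0"
      have y: "y \<in> V" using x b0 False by (auto simp: V_def y_def \<xi>_add \<xi>_smult \<xi>_delta k_def)
      have "x = k \<odot> (b0 \<oplus> y)"
        by (rule \<xi>_eqI) (use x b0 False VE[OF y] in \<open>auto simp: y_def \<xi>_add \<xi>_smult\<close>)
      hence "\<nu> x = cmod k * \<nu> (b0 \<oplus> y)" using \<nu>0(3)[of "b0 \<oplus> y" k] b0 VE[OF y] by simp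
      also have "\<dots> \<ge> cmod k * \<delta>" using \<delta>(2)[OF y] by (intro mult_left_mono) auto
      finally show ?thesis using \<delta>(1) by (simp add: field_simps)
    qed (use \<nu>0(1)[OF x(1)] \<delta>(1) in auto)
    show ?thesis
    proof (cases "b = b0")
      case True
      have "cmod k \<le> (1 / \<delta>) * \<nu> x" using k by simp
      also have "\<dots> \<le> D * \<nu> x" using D(2) \<nu>0(1)[OF x(1)] by (rule mult_right_mono)
      finally show ?thesis by (simp add: True k_def)
    next
      case False
      hence bA: "b \<in> A" and bB: "b \<in> B" using b AB by auto
      define y where "y = x \<oplus> (- k) \<odot> b0"
      have y: "y \<in> V" using x b0 by (auto simp: V_def y_def \<xi>_add \<xi>_smult \<xi>_delta k_def)
      have "\<xi> b x = \<xi> b y" using False bB b0 x by (simp add: y_def \<xi>_add \<xi>_smult \<xi>_delta)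
      hence 1: "cmod (\<xi> b x) \<le> C * \<nu> y" using C(2)[OF y bA] by simp
      have "\<nu> y \<le> \<nu> x + cmod k * \<nu> b0"
        using \<nu>tri[of x "(- k) \<odot> b0"] \<nu>0(3)[OF b0(2), of "- k"] x b0 by (simp add: y_def)
      also have "\<dots> \<le> \<nu> x + (\<nu> x / \<delta>) * \<nu> b0"
        using mult_right_mono[OF k \<nu>0(1)[OF b0(2)]] by simp
      finally have 2: "C * \<nu> y \<le> C * (\<nu> x + (\<nu> x / \<delta>) * \<nu> b0)"
        using C(1) by (rule mult_left_mono)
      note 1
      also note 2
      also have "C * (\<nu> x + (\<nu> x / \<delta>) * \<nu> b0) = C * (1 + \<nu> b0 / \<delta>) * \<nu> x" by (simp add: algebra_simps)
      also have "\<dots> \<le> D * \<nu> x" using D(3) \<nu>0(1)[OF x(1)] by (rule mult_right_mono)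
      finally show ?thesis .
    qed
  qed
  thus ?case using D(1) by blast
qed

lemma coords_le_norm:
  assumes "is_norm \<gg> \<nu>"
  obtains C where "C \<ge> 0" "\<And>x b. x \<in> carrier \<gg> \<Longrightarrow> b \<in> B \<Longrightarrow> cmod (\<xi> b x) \<le> C * \<nu> x"
  using coords_le_norm_aux[OF assms finite_B order_refl] by auto

end

section \<open>Regular functions on the punctured line\<close>

type_synonym ratfun = "complex poly fract"

lemma a_inv_ring_of_type_algebra [simp]:
  fixes x :: "'a::comm_ring_1"
  shows "\<ominus>\<^bsub>ring_of_type_algebra\<^esub> x = - x"
proof -
  interpret ring "ring_of_type_algebra :: 'a ring" by (rule ring_from_type_algebra)
  show ?thesis by (rule minus_equality) (simp_all add: ring_of_type_algebra_def)
qed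

definition reg :: "complex \<Rightarrow> ratfun \<Rightarrow> bool" where
  "reg z p \<longleftrightarrow> (\<exists>a b. p = Fract a b \<and> poly b z \<noteq> 0)"

text \<open>Unspecified at the poles of \<open>p\<close>.\<close>

definition ev :: "complex \<Rightarrow> ratfun \<Rightarrow> complex" where
  "ev z p = (THE c. \<exists>a b. p = Fract a b \<and> poly b z \<noteq> 0 \<and> c = poly a z / poly b z)"

lemma ev_Fract:
  assumes "poly b z \<noteq> 0"
  shows "ev z (Fract a b) = poly a z / poly b z"
  unfolding ev_def
proof (rule the_equality)
  fix c assume "\<exists>a' b'. Fract a b = Fract a' b' \<and> poly b' z \<noteq> 0 \<and> c = poly a' z / poly b' z"
  then obtain a' b' where *: "Fract a b = Fract a' b'" "poly b' z \<noteq> 0" "c = poly a' z / poly b' z" by blast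
  have "b \<noteq> 0" "b' \<noteq> 0" using assms * by auto
  hence "a * b' = a' * b" using *(1) by (simp add: eq_fract)
  hence "poly a z * poly b' z = poly a' z * poly b z" by (metis poly_mult)
  thus "c = poly a z / poly b z" using * assms by (simp add: frac_eq_eq)
qed (use assms in blast)

lemma reg_Fract: "poly b z \<noteq> 0 \<Longrightarrow> reg z (Fract a b)"
  by (auto simp: reg_def)

lemma regE:
  assumes "reg z p"
  obtains a b where "p = Fract a b" "poly b z \<noteq> 0" "b \<noteq> 0" "ev z p = poly a z / poly b z"
  using assms ev_Fract unfolding reg_def by (metis poly_0)

lemma reg_add: "reg z p \<Longrightarrow> reg z q \<Longrightarrow> reg z (p + q) \<and> ev z (p + q) = ev z p + ev z q"
  by (elim regE) (simp add: reg_Fract ev_Fract add_frac_eq)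

lemma reg_mult: "reg z p \<Longrightarrow> reg z q \<Longrightarrow> reg z (p * q) \<and> ev z (p * q) = ev z p * ev z q"
  by (elim regE) (simp add: reg_Fract ev_Fract)

lemma reg_1: "reg z 1 \<and> ev z 1 = 1"
  by (simp add: One_fract_def reg_Fract ev_Fract)

lemma reg_const: "reg z (ratfun_const c) \<and> ev z (ratfun_const c) = c"
  by (simp add: ratfun_const_def reg_Fract ev_Fract)

lemma reg_t: "reg z ratfun_t \<and> ev z ratfun_t = z"
  by (simp add: ratfun_t_def reg_Fract ev_Fract)

lemma inverse_t_minus: "inverse (ratfun_t - ratfun_const a) = Fract 1 [:- a, 1:]"
  by (simp add: ratfun_t_def ratfun_const_def)

lemma reg_inverse: "z \<noteq> a \<Longrightarrow> reg z (inverse (ratfun_t - ratfun_const a)) \<and>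
    ev z (inverse (ratfun_t - ratfun_const a)) = 1 / (z - a)"
  unfolding inverse_t_minus by (simp add: reg_Fract ev_Fract)

abbreviation pla_carrier :: "complex set \<Rightarrow> ratfun set" where
  "pla_carrier S \<equiv> carrier (punctured_line_algebra S)"

lemma pla_simps [simp]:
  "p \<oplus>\<^bsub>punctured_line_algebra S\<^esub> q = p + q" "p \<otimes>\<^bsub>punctured_line_algebra S\<^esub> q = p * q"
  "c \<odot>\<^bsub>punctured_line_algebra S\<^esub> p = ratfun_const c * p"
  by (simp_all add: punctured_line_algebra_def)

text \<open>Negation is multiplication by the constant -1 and the unit is a constant, so the cases
  are just the three kinds of generators and the two operations.\<close>

lemma pla_induct [consumes 1, case_names const t inverse add mult]:
  assumes "p \<in> pla_carrier S"
    and const: "\<And>c. P (ratfun_const c)" and t: "P ratfun_t"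
    and inverse: "\<And>a. a \<in> S \<Longrightarrow> P (inverse (ratfun_t - ratfun_const a))"
    and add: "\<And>p q. p \<in> pla_carrier S \<Longrightarrow> q \<in> pla_carrier S \<Longrightarrow> P p \<Longrightarrow> P q \<Longrightarrow> P (p + q)"
    and mult: "\<And>p q. p \<in> pla_carrier S \<Longrightarrow> q \<in> pla_carrier S \<Longrightarrow> P p \<Longrightarrow> P q \<Longrightarrow> P (p * q)"
  shows "P p"
proof -
  define H where "H = range ratfun_const \<union> {ratfun_t} \<union> (\<lambda>a. inverse (ratfun_t - ratfun_const a)) ` S"
  have C: "pla_carrier S = generate_ring ring_of_type_algebra H"
    by (simp add: punctured_line_algebra_def H_def)
  have "p \<in> generate_ring ring_of_type_algebra H" using assms(1) C by simp
  thus ?thesis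
  proof induction
    case one
    have "1 = ratfun_const 1" by (simp add: ratfun_const_def One_fract_def one_pCons)
    thus ?case using const[of 1] by (simp add: ring_of_type_algebra_def)
  next
    case (incl h)
    thus ?case using const t inverse by (auto simp: H_def)
  next
    case (a_inv h)
    have "- h = ratfun_const (-1) * h"
      by (cases h) (simp add: ratfun_const_def)
    moreover have "ratfun_const (-1) \<in> pla_carrier S" unfolding C by (rule generate_ring.incl) (simp add: H_def)
    ultimately show ?case using mult[of "ratfun_const (-1)" h] const a_inv C by simp
  next
    case (eng_add h1 h2)
    thus ?case using add C by (simp add: ring_of_type_algebra_def)
  next
    case (eng_mult h1 h2)
    thus ?case using mult C by (simp add: ring_of_type_algebra_def)
  qed
qed

lemma pla_closed:
  shows pla_const: "ratfun_const c \<in> pla_carrier S" and pla_t: "ratfun_t \<in> pla_carrier S"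
    and pla_inverse: "a \<in> S \<Longrightarrow> inverse (ratfun_t - ratfun_const a) \<in> pla_carrier S"
    and pla_add: "p \<in> pla_carrier S \<Longrightarrow> q \<in> pla_carrier S \<Longrightarrow> p + q \<in> pla_carrier S"
    and pla_mult: "p \<in> pla_carrier S \<Longrightarrow> q \<in> pla_carrier S \<Longrightarrow> p * q \<in> pla_carrier S"
  using generate_ring.eng_add[of p ring_of_type_algebra _ q] generate_ring.eng_mult[of p ring_of_type_algebra _ q]
  by (auto simp: punctured_line_algebra_def ring_of_type_algebra_def intro!: generate_ring.incl)

lemma pla_zero: "0 \<in> pla_carrier S"
proof -
  have "0 = ratfun_const 0" by (simp add: ratfun_const_def Zero_fract_def)
  thus ?thesis using pla_const by metis
qed

lemma pla_one: "1 \<in> pla_carrier S"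
proof -
  have "1 = ratfun_const 1" by (simp add: ratfun_const_def One_fract_def one_pCons)
  thus ?thesis using pla_const by metis
qed

lemma pla_power: "p \<in> pla_carrier S \<Longrightarrow> p ^ k \<in> pla_carrier S"
  by (induction k) (auto intro: pla_one pla_mult)

lemma pla_sum: "(\<And>i. i \<in> I \<Longrightarrow> f i \<in> pla_carrier S) \<Longrightarrow> sum f I \<in> pla_carrier S"
  by (induction I rule: infinite_finite_induct) (auto intro: pla_zero pla_add)

lemma pla_prod: "(\<And>i. i \<in> I \<Longrightarrow> f i \<in> pla_carrier S) \<Longrightarrow> prod f I \<in> pla_carrier S"
  by (induction I rule: infinite_finite_induct) (auto intro: pla_one pla_mult)

lemma pla_poly: "Fract p 1 \<in> pla_carrier S"
proof (induction p)
  case 0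
  thus ?case using pla_zero by (simp add: Zero_fract_def)
next
  case (pCons a p)
  have "Fract (pCons a p) 1 = ratfun_const a + ratfun_t * Fract p 1"
    by (simp add: ratfun_const_def ratfun_t_def)
  thus ?case using pCons by (auto intro: pla_add pla_const pla_mult pla_t)
qed

lemma pla_reg: "p \<in> pla_carrier S \<Longrightarrow> z \<notin> S \<Longrightarrow> reg z p"
  by (induction rule: pla_induct) (auto simp: reg_const reg_t reg_add reg_mult intro!: reg_inverse[THEN conjunct1])

lemma ev_add: "p \<in> pla_carrier S \<Longrightarrow> q \<in> pla_carrier S \<Longrightarrow> z \<notin> S \<Longrightarrow> ev z (p + q) = ev z p + ev z q"
  and ev_mult: "p \<in> pla_carrier S \<Longrightarrow> q \<in> pla_carrier S \<Longrightarrow> z \<notin> S \<Longrightarrow> ev z (p * q) = ev z p * ev z q"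
  and ev_const [simp]: "ev z (ratfun_const c) = c"
  using reg_add[OF pla_reg[of p S z] pla_reg[of q S z]] reg_mult[OF pla_reg[of p S z] pla_reg[of q S z]]
    reg_const[of z c] by simp_all

lemma ev_sum: "finite I \<Longrightarrow> (\<And>i. i \<in> I \<Longrightarrow> f i \<in> pla_carrier S) \<Longrightarrow> z \<notin> S \<Longrightarrow> ev z (sum f I) = (\<Sum>i\<in>I. ev z (f i))"
proof (induction I rule: finite_induct)
  case empty
  have "0 = ratfun_const 0" by (simp add: ratfun_const_def Zero_fract_def)
  hence "ev z 0 = 0" using ev_const[of z 0] by metis
  thus ?case by simp
next
  case (insert i I)
  thus ?case using ev_add[of "f i" S "sum f I" z] by (auto intro: pla_sum)
qed

lemma pla_quotient:
  assumes "finite S"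
  obtains q where "q \<in> pla_carrier S" "\<And>z. z \<notin> S \<Longrightarrow> ev z q = poly p z / (\<Prod>s\<in>S. z - s) ^ k"
proof
  define I where "I = (\<Prod>s\<in>S. inverse (ratfun_t - ratfun_const s))"
  have I: "I \<in> pla_carrier S" unfolding I_def by (intro pla_prod pla_inverse)
  have evI: "reg z I \<and> ev z I = 1 / (\<Prod>s\<in>S. z - s)" if "z \<notin> S" for z
    unfolding I_def using assms that
  proof (induction S rule: finite_induct)
    case empty
    thus ?case by (simp add: reg_1)
  next
    case (insert s S)
    thus ?case using reg_mult[of z "inverse (ratfun_t - ratfun_const s)"] reg_inverse[of z s] by auto
  qed
  have evp: "ev z (I ^ k) = 1 / (\<Prod>s\<in>S. z - s) ^ k" if "z \<notin> S" for z
    by (induction k) (use evI[OF that] ev_mult[OF I pla_power[OF I] that] in \<open>auto simp: reg_1\<close>)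
  show "Fract p 1 * I ^ k \<in> pla_carrier S" by (intro pla_mult pla_poly pla_power I)
  show "ev z (Fract p 1 * I ^ k) = poly p z / (\<Prod>s\<in>S. z - s) ^ k" if "z \<notin> S" for z
    using ev_mult[OF pla_poly pla_power[OF I] that] evp[OF that] by (simp add: ev_Fract)
qed

text \<open>Off the roots of the denominator a zero of the evaluation is a root of the numerator,
  which therefore has infinitely many.\<close>

lemma ratfun_eq_0:
  assumes "infinite Z" "\<And>z. z \<in> Z \<Longrightarrow> ev z p = 0"
  shows "p = 0"
proof -
  obtain a b where p: "p = Fract a b" "b \<noteq> 0" by (cases p)
  have "finite {z. poly b z = 0}" using p(2) by (simp add: poly_roots_finite)
  hence "infinite (Z - {z. poly b z = 0})" using assms(1) by (rule Diff_infinite_finite)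
  moreover have "Z - {z. poly b z = 0} \<subseteq> {z. poly a z = 0}"
  proof safe
    fix z assume z: "z \<in> Z" "poly b z \<noteq> 0"
    thus "poly a z = 0" using assms(2)[OF z(1)] ev_Fract[OF z(2), of a] by (simp add: p(1))
  qed
  ultimately have "infinite {z. poly a z = 0}" using infinite_super by blast
  hence "a = 0" using poly_roots_finite by blast
  thus ?thesis by (simp add: p(1) Zero_fract_def eq_fract p(2))
qed

lemma ev_holomorphic:
  assumes "p \<in> pla_carrier S" "t holomorphic_on A" "\<And>z. z \<in> A \<Longrightarrow> t z \<notin> S"
  shows "(\<lambda>z. ev (t z) p) holomorphic_on A"
  using assms(1)
proof (induction rule: pla_induct)
  case t
  have "ev (t z) ratfun_t = t z" for z by (simp add: reg_t)
  thus ?case using assms by simp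
next
  case (inverse a)
  have "(\<lambda>z. 1 / (t z - a)) holomorphic_on A" using assms inverse by (intro holomorphic_intros) auto
  moreover have "t z \<noteq> a" if "z \<in> A" for z using assms inverse that by blast
  ultimately show ?case by (elim holomorphic_transform) (simp add: reg_inverse)
next
  case (add p q)
  have "(\<lambda>z. ev (t z) p + ev (t z) q) holomorphic_on A" using add by (intro holomorphic_intros)
  thus ?case by (rule holomorphic_transform) (use assms add ev_add in auto)
next
  case (mult p q)
  have "(\<lambda>z. ev (t z) p * ev (t z) q) holomorphic_on A" using mult by (intro holomorphic_intros)
  thus ?case by (rule holomorphic_transform) (use assms mult ev_mult in auto)
qed simp

section \<open>Growth of regular functions of the Hauptmodul\<close>

lemma bddc_imp_egr:
  assumes "bddc h"
  shows "egr (\<lambda>\<tau>. norm (h \<tau>))"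
proof -
  obtain C Y where "\<And>\<tau>. Im \<tau> > Y \<Longrightarrow> norm (h \<tau>) \<le> C"
    using assms unfolding bddc_def eventually_cuspF by blast
  thus ?thesis by (intro egrI[of Y _ C 0]) simp
qed

lemma egr_inverse_qN:
  assumes "N > 0"
  shows "egr (\<lambda>\<tau>. norm (1 / qN N \<tau> ^ k))"
proof (rule egrI[of 0 _ 1 "k * (2 * pi / N)"])
  fix \<tau> :: complex assume "Im \<tau> > 0"
  have "norm (1 / qN N \<tau> ^ k) = exp (k * (2 * pi * Im \<tau> / N))"
  proof -
    have "norm (qN N \<tau> ^ k) = exp (- (k * (2 * pi * Im \<tau> / N)))"
      by (simp add: norm_power norm_qN exp_of_nat_mult[symmetric])
    thus ?thesis by (simp only: norm_divide norm_one exp_minus inverse_eq_divide) simp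
  qed
  also have "k * (2 * pi * Im \<tau> / N) \<le> k * (2 * pi * norm \<tau> / N)"
    using abs_Im_le_cmod[of \<tau>] by (intro mult_left_mono divide_right_mono) auto
  finally show "norm (1 / qN N \<tau> ^ k) \<le> 1 * exp (k * (2 * pi / N) * norm \<tau>)" by (simp add: mult_ac)
qed

lemma egr_mult_norm:
  assumes "egr (\<lambda>\<tau>. norm (f \<tau> :: complex))" "egr (\<lambda>\<tau>. norm (g \<tau> :: complex))"
  shows "egr (\<lambda>\<tau>. norm (f \<tau> * g \<tau>))"
  using egr_mult[OF assms] by (simp add: norm_mult)

lemma egr_add_norm:
  assumes "egr (\<lambda>\<tau>. norm (f \<tau> :: complex))" "egr (\<lambda>\<tau>. norm (g \<tau> :: complex))"
  shows "egr (\<lambda>\<tau>. norm (f \<tau> + g \<tau>))"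
  by (rule egr_mono[OF egr_add[OF assms]]) (rule norm_triangle_ineq)

text \<open>A nonvanishing function that is meromorphic at the cusp has a Laurent expansion in \<open>q\<close> with
  a nonzero leading term, so its inverse grows at most exponentially as well.\<close>

lemma egr_inverse:
  assumes "N > 0" "h holomorphic_on \<H>" and per: "\<And>\<tau> k::int. \<tau> \<in> \<H> \<Longrightarrow> h (\<tau> + of_int (int N * k)) = h \<tau>"
    and egr: "egr (\<lambda>\<tau>. norm (h \<tau>))" and nz: "\<And>\<tau>. \<tau> \<in> \<H> \<Longrightarrow> h \<tau> \<noteq> 0"
  shows "egr (\<lambda>\<tau>. norm (1 / h \<tau>))"
proof -
  obtain k where k: "bddc (\<lambda>\<tau>. h \<tau> * qN N \<tau> ^ k)"
    using exp_growth_pole_order[OF assms(1) per] egr by (auto simp: exp_growth_rel_iff_egr)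
  have qper: "qN N (\<tau> + of_int (int N * j)) = qN N \<tau>" for \<tau> j
    using assms(1) by (simp add: qN_def add_divide_distrib ex_add)
  have qhol: "qN N holomorphic_on \<H>"
    unfolding qN_def[abs_def] using assms(1) by (intro holomorphic_intros) auto
  have "(\<lambda>\<tau>. h \<tau> * qN N \<tau> ^ k) holomorphic_on \<H>" by (intro holomorphic_intros qhol assms(2))
  then obtain G where G: "G holomorphic_on ball 0 1" "\<And>\<tau>. \<tau> \<in> \<H> \<Longrightarrow> G (qN N \<tau>) = h \<tau> * qN N \<tau> ^ k"
    using q_expansion[OF assms(1) _ _ k] per qper by (metis (no_types, lifting))
  have Gnz: "G z \<noteq> 0" if z: "z \<in> ball 0 1" "z \<noteq> 0" for z
  proof -
    obtain \<tau> where "\<tau> \<in> \<H>" "qN N \<tau> = z" using qN_surj[OF assms(1) z] by blast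
    thus ?thesis using G(2)[of \<tau>] nz by (metis mult_eq_0_iff power_not_zero qN_nonzero)
  qed
  \<comment> \<open>The zero at q = 0 is split off with its order n; if \<open>G 0\<close> is
    nonzero, the order is 0 and \<open>g\<close> is \<open>G\<close> itself.\<close>
  obtain g n r where g: "r > 0" "g holomorphic_on ball 0 r"
    "\<And>w. w \<in> ball 0 r \<Longrightarrow> G w = w ^ n * g w" "\<And>w. w \<in> ball 0 r \<Longrightarrow> g w \<noteq> 0"
  proof (cases "G 0 = 0")
    case True
    have nc: "\<not> G constant_on ball 0 1"
    proof
      assume "G constant_on ball 0 1"
      then obtain c where "\<And>z. z \<in> ball 0 1 \<Longrightarrow> G z = c" by (auto simp: constant_on_def)
      hence "G (1/2) = G 0" by simp
      thus False using Gnz[of "1/2"] True by simp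
    qed
    have z0: "(0::complex) \<in> ball 0 1" by simp
    show thesis
    proof (rule holomorphic_factor_zero_nonconstant[OF G(1) open_ball connected_ball z0 True nc])
      fix g r n
      assume 1: "0 < r" and 2: "ball 0 r \<subseteq> ball (0::complex) 1" and 3: "g holomorphic_on ball 0 r"
        and 4: "\<And>w. w \<in> ball 0 r \<Longrightarrow> G w = (w - 0) ^ n * g w" and 5: "\<And>w. w \<in> ball 0 r \<Longrightarrow> g w \<noteq> 0"
      show thesis
      proof (rule that[of r g n])
        show "G w = w ^ n * g w" if "w \<in> ball 0 r" for w using 4[OF that] by simp
        show "0 < r" by (rule 1)
        show "g holomorphic_on ball 0 r" by (rule 3)
        show "g w \<noteq> 0" if "w \<in> ball 0 r" for w using that by (rule 5)
      qed
    qed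
  next
    case False
    hence "G z \<noteq> 0" if "z \<in> ball 0 1" for z using Gnz that by (cases "z = 0") auto
    thus thesis using that[of 1 G 0] G(1) by auto
  qed
  have "((\<lambda>\<tau>. 1 / g (qN N \<tau>)) \<longlongrightarrow> 1 / g 0) cuspF"
  proof (intro tendsto_intros)
    have "isCont g 0" using g(1,2) holomorphic_on_imp_continuous_on continuous_on_interior
      by (metis centre_in_ball interior_ball)
    thus "((\<lambda>\<tau>. g (qN N \<tau>)) \<longlongrightarrow> g 0) cuspF" by (rule isCont_tendsto_compose[OF _ qN_tendsto[OF assms(1)]])
    show "g 0 \<noteq> 0" using g(1,4) by simp
  qed
  hence 1: "egr (\<lambda>\<tau>. norm (1 / g (qN N \<tau>)))" by (intro bddc_imp_egr bddc_tendsto)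
  have 2: "egr (\<lambda>\<tau>. norm ((1 / g (qN N \<tau>)) * (1 / qN N \<tau> ^ n)))"
    by (rule egr_mult_norm[OF 1 egr_inverse_qN[OF assms(1)]])
  have 3: "egr (\<lambda>\<tau>. norm (((1 / g (qN N \<tau>)) * (1 / qN N \<tau> ^ n)) * qN N \<tau> ^ k))"
    by (rule egr_mult_norm[OF 2 bddc_imp_egr]) (intro bddc_power bddc_qN assms(1))
  have "eventually (\<lambda>\<tau>. norm (qN N \<tau>) < r) cuspF"
    using tendstoD[OF qN_tendsto[OF assms(1)] g(1)] by simp
  then obtain Y where Y: "\<And>\<tau>. Im \<tau> > Y \<Longrightarrow> norm (qN N \<tau>) < r" unfolding eventually_cuspF by blast
  obtain C M Y' where C: "C \<ge> 0" "M \<ge> 0" "Y' \<ge> 0" "\<And>\<tau>. Im \<tau> > Y' \<Longrightarrow> norm (((1 / g (qN N \<tau>)) * (1 / qN N \<tau> ^ n)) * qN N \<tau> ^ k) \<le> C * exp (M * norm \<tau>)"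
    using egrE[OF 3] by metis
  show ?thesis
  proof (rule egrI)
    fix \<tau> assume \<tau>: "Im \<tau> > max Y Y'"
    hence "\<tau> \<in> \<H>" using C(3) by (simp add: UHP_iff)
    have "qN N \<tau> \<in> ball 0 r" using Y[of \<tau>] \<tau> by simp
    hence eq: "h \<tau> * qN N \<tau> ^ k = qN N \<tau> ^ n * g (qN N \<tau>)" "g (qN N \<tau>) \<noteq> 0" using G(2)[OF \<open>\<tau> \<in> \<H>\<close>] g by auto
    have "1 / h \<tau> = ((1 / g (qN N \<tau>)) * (1 / qN N \<tau> ^ n)) * qN N \<tau> ^ k"
      using eq nz[OF \<open>\<tau> \<in> \<H>\<close>] by (simp add: field_simps)
    thus "norm (1 / h \<tau>) \<le> C * exp (M * norm \<tau>)" using C(4)[of \<tau>] \<tau> by simp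
  qed
qed

lemma egr_shift:
  assumes "egr h"
  shows "egr (\<lambda>\<tau>. h (\<tau> + of_int j))"
proof -
  obtain C M Y where C: "C \<ge> 0" "M \<ge> 0" "Y \<ge> 0" "\<And>\<tau>. Im \<tau> > Y \<Longrightarrow> h \<tau> \<le> C * exp (M * norm \<tau>)"
    using egrE[OF assms] by metis
  show ?thesis
  proof (rule egrI)
    fix \<tau> :: complex assume \<tau>: "Im \<tau> > Y"
    have "h (\<tau> + of_int j) \<le> C * exp (M * norm (\<tau> + of_int j))" using C(4)[of "\<tau> + of_int j"] \<tau> by simp
    also have "\<dots> \<le> C * exp (M * (norm \<tau> + norm (of_int j :: complex)))"
      using C(1,2) norm_triangle_ineq[of \<tau> "of_int j"] by (intro mult_left_mono) (auto intro: mult_left_mono)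
    finally show "h (\<tau> + of_int j) \<le> (C * exp (M * norm (of_int j :: complex))) * exp (M * norm \<tau>)"
      by (simp add: ring_distribs exp_add mult_ac)
  qed
qed

lemma (in hauptmodul) egr_t:
  assumes \<gamma>: "\<gamma> \<in> SL2Z"
  shows "egr (\<lambda>\<tau>. norm (t (modular_action \<gamma> \<tau>)))"
proof (cases "cusp_at_inf N \<gamma>")
  case False
  thus ?thesis using bdd[OF \<gamma>] bddc_imp_egr by blast
next
  case True
  obtain c where "((\<lambda>\<tau>. t \<tau> * qN N \<tau>) \<longlongrightarrow> c) cuspF" using pole by blast
  hence "egr (\<lambda>\<tau>. norm (t \<tau> * qN N \<tau>))" by (intro bddc_imp_egr bddc_tendsto)
  hence "egr (\<lambda>\<tau>. norm (t \<tau> * qN N \<tau> * (1 / qN N \<tau> ^ 1)))"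
    by (rule egr_mult_norm[OF _ egr_inverse_qN[OF N_pos]])
  hence "egr (\<lambda>\<tau>. norm (t \<tau>))" by simp
  moreover obtain j :: int where j: "\<And>\<tau>. \<tau> \<in> \<H> \<Longrightarrow> t (modular_action \<gamma> \<tau>) = t (\<tau> + of_int j)"
    using invf_cusp_at_inf[OF inv \<gamma> True] by blast
  ultimately have "egr (\<lambda>\<tau>. norm (t (\<tau> + of_int j)))" using egr_shift[of "\<lambda>\<tau>. norm (t \<tau>)" j] by blast
  thus ?thesis by (rule egr_mono) (simp add: j)
qed

text \<open>Induction over the generators of the algebra; the inverses of t - a are covered by
  \<open>egr_inverse\<close>, since \<open>t\<close> omits a.\<close>

lemma egr_ev:
  assumes ph: "punctured_hauptmodul N t P" and p: "p \<in> pla_carrier P" and \<gamma>: "\<gamma> \<in> SL2Z"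
  shows "egr (\<lambda>\<tau>. norm (ev (t (modular_action \<gamma> \<tau>)) p))"
proof -
  interpret hauptmodul N t using ph by (simp add: punctured_hauptmodul_def)
  have nP: "t (modular_action \<gamma> \<tau>) \<notin> P" if "\<tau> \<in> \<H>" for \<tau>
    using ph \<gamma> that by (simp add: punctured_hauptmodul_def)
  show ?thesis using p
  proof (induction rule: pla_induct)
    case (const c)
    show ?case by simp
  next
    case t
    have "ev z ratfun_t = z" for z by (simp add: reg_t)
    thus ?case using egr_t[OF \<gamma>] by simp
  next
    case (inverse a)
    define h where "h = (\<lambda>\<tau>. t (modular_action \<gamma> \<tau>) + (- a))"
    have "invf N h" using invf_compose[OF inv \<gamma>] by (simp add: h_def invf_def)
    have "egr (\<lambda>\<tau>. norm (1 / h \<tau>))"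
    proof (rule egr_inverse[OF N_pos])
      show "h holomorphic_on \<H>" unfolding h_def by (intro holomorphic_intros holomorphic_compose_action holo \<gamma>)
      show "h (\<tau> + of_int (int N * k)) = h \<tau>" if "\<tau> \<in> \<H>" for \<tau> k by (rule invf_periodic[OF \<open>invf N h\<close> that])
      show "egr (\<lambda>\<tau>. norm (h \<tau>))" unfolding h_def by (intro egr_add_norm egr_t \<gamma> egr_const)
      show "h \<tau> \<noteq> 0" if "\<tau> \<in> \<H>" for \<tau> using nP[OF that] inverse by (auto simp: h_def)
    qed
    moreover have "t (modular_action \<gamma> \<tau>) \<noteq> a" if "\<tau> \<in> \<H>" for \<tau> using nP[OF that] inverse by blast
    ultimately show ?case by (elim egr_mono) (simp add: reg_inverse h_def)
  next
    case (add p q)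
    show ?case by (rule egr_mono[OF egr_add_norm[OF add(3,4)]]) (use nP add ev_add in auto)
  next
    case (mult p q)
    show ?case by (rule egr_mono[OF egr_mult_norm[OF mult(3,4)]]) (use nP mult ev_mult in auto)
  qed
qed

section \<open>Holomorphic representations of SL(2,C)\<close>

lemma bounded_linear_cm2:
  "bounded_linear (\<lambda>z. cm2 z 0 0 0)" "bounded_linear (\<lambda>z. cm2 0 z 0 0)"
  "bounded_linear (\<lambda>z. cm2 0 0 z 0)" "bounded_linear (\<lambda>z. cm2 0 0 0 z)"
  by (auto simp: linear_conv_bounded_linear[symmetric] linear_iff cm2_eq_iff)

lemma has_derivative_cm2:
  assumes "(a has_derivative a') F" "(b has_derivative b') F" "(c has_derivative c') F" "(d has_derivative d') F"
  shows "((\<lambda>z. cm2 (a z) (b z) (c z) (d z)) has_derivative (\<lambda>z. cm2 (a' z) (b' z) (c' z) (d' z))) F"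
proof -
  have split: "cm2 w x y z = cm2 w 0 0 0 + cm2 0 x 0 0 + cm2 0 0 y 0 + cm2 0 0 0 z" for w x y z
    by (simp add: cm2_eq_iff)
  have "((\<lambda>z. cm2 (a z) 0 0 0 + cm2 0 (b z) 0 0 + cm2 0 0 (c z) 0 + cm2 0 0 0 (d z)) has_derivative
     (\<lambda>z. cm2 (a' z) 0 0 0 + cm2 0 (b' z) 0 0 + cm2 0 0 (c' z) 0 + cm2 0 0 0 (d' z))) F"
    by (intro has_derivative_add bounded_linear.has_derivative[OF bounded_linear_cm2(1)] assms
        bounded_linear.has_derivative[OF bounded_linear_cm2(2)]
        bounded_linear.has_derivative[OF bounded_linear_cm2(3)] bounded_linear.has_derivative[OF bounded_linear_cm2(4)])
  thus ?thesis by (simp only: split[symmetric])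
qed

lemma cm2_collapse: "cm2 (A $ 1 $ 1) (A $ 1 $ 2) (A $ 2 $ 1) (A $ 2 $ 2) = A"
  by (simp add: cm2_eq_iff)

text \<open>Locally G extends to a holomorphic function H of matrices, and the chain rule gives a
  real derivative of the composite. Complex linearity of the derivative of H turns it into
  multiplication by \<open>H' A\<close>, where A is the entrywise derivative of F.\<close>

lemma SL2C_holomorphic_compose:
  assumes G: "SL2C_holomorphic G" and S: "open S"
    and F: "\<And>i j. (\<lambda>\<tau>. F \<tau> $ i $ j) holomorphic_on S" and det: "\<And>\<tau>. \<tau> \<in> S \<Longrightarrow> det (F \<tau>) = 1"
  shows "(\<lambda>\<tau>. G (F \<tau>)) holomorphic_on S"
  unfolding holomorphic_on_open[OF S]
proof
  fix \<tau> assume \<tau>: "\<tau> \<in> S"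
  have "F \<tau> \<in> carrier SL2C" using det[OF \<tau>] by (simp add: SL2C_def)
  then obtain U H where U: "open U" "F \<tau> \<in> U" "matrix_holomorphic_on H U"
    "\<And>B. B \<in> U \<Longrightarrow> B \<in> carrier SL2C \<Longrightarrow> G B = H B"
    using G unfolding SL2C_holomorphic_def by (metis IntI)
  obtain H' where H': "(H has_derivative H') (at (F \<tau>))" "\<And>c B. H' (map_matrix ((*) c) B) = c * H' B"
    using U unfolding matrix_holomorphic_on_def by blast
  define f where "f = (\<lambda>i j. deriv (\<lambda>\<tau>. F \<tau> $ i $ j) \<tau>)"
  have d: "((\<lambda>\<tau>. F \<tau> $ i $ j) has_derivative (\<lambda>h. f i j * h)) (at \<tau>)" for i j
    using holomorphic_derivI[OF F S \<tau>, of i j] by (simp add: has_field_derivative_def f_def)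
  have dF: "(F has_derivative (\<lambda>h. cm2 (f 1 1 * h) (f 1 2 * h) (f 2 1 * h) (f 2 2 * h))) (at \<tau>)"
    using has_derivative_cm2[OF d[of 1 1] d[of 1 2] d[of 2 1] d[of 2 2]] by (simp only: cm2_collapse)
  define A where "A = cm2 (f 1 1) (f 1 2) (f 2 1) (f 2 2)"
  have "cm2 (f 1 1 * h) (f 1 2 * h) (f 2 1 * h) (f 2 2 * h) = map_matrix ((*) h) A" for h
    by (simp add: cm2_eq_iff A_def map_matrix_def)
  hence dF': "(F has_derivative (\<lambda>h. map_matrix ((*) h) A)) (at \<tau>)" using dF by simp
  have "((\<lambda>\<tau>. H (F \<tau>)) has_derivative (\<lambda>h. H' (map_matrix ((*) h) A))) (at \<tau>)"
    using has_derivative_compose[OF dF' H'(1)] .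
  hence "((\<lambda>\<tau>. H (F \<tau>)) has_field_derivative H' A) (at \<tau>)"
    unfolding has_field_derivative_def H'(2) mult.commute[of _ "H' A"] .
  moreover have "eventually (\<lambda>w. G (F w) = H (F w)) (nhds \<tau>)"
  proof -
    have "isCont F \<tau>" using dF has_derivative_continuous by blast
    hence "eventually (\<lambda>w. F w \<in> U) (at \<tau>)" using U(1,2) unfolding isCont_def by (rule topological_tendstoD)
    hence "eventually (\<lambda>w. F w \<in> U) (nhds \<tau>)" using U(2) by (simp add: eventually_nhds_conv_at)
    thus ?thesis using eventually_nhds_in_open[OF S \<tau>]
      by eventually_elim (use U(4) det in \<open>simp add: SL2C_def\<close>)
  qed
  ultimately have "((\<lambda>\<tau>. G (F \<tau>)) has_field_derivative H' A) (at \<tau>)"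
    using DERIV_cong_ev[OF refl _ refl, of "\<lambda>\<tau>. G (F \<tau>)" "\<lambda>\<tau>. H (F \<tau>)" \<tau>] by simp
  thus "\<exists>f'. ((\<lambda>\<tau>. G (F \<tau>)) has_field_derivative f') (at \<tau>)" by blast
qed

lemma SL2C_holomorphic_continuous:
  assumes "SL2C_holomorphic G"
  shows "continuous_on {A. det A = 1} G"
  unfolding continuous_on_eq_continuous_within
proof
  fix A :: "complex^2^2" assume "A \<in> {A. det A = 1}"
  hence A: "A \<in> carrier SL2C" by (simp add: SL2C_def)
  then obtain U H where U: "open U" "A \<in> U" "matrix_holomorphic_on H U"
    "\<And>B. B \<in> U \<Longrightarrow> B \<in> carrier SL2C \<Longrightarrow> G B = H B"
    using assms unfolding SL2C_holomorphic_def by (metis IntI)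
  obtain H' where "(H has_derivative H') (at A)"
    using U unfolding matrix_holomorphic_on_def by blast
  hence "isCont H A" by (rule has_derivative_continuous)
  hence "(H \<longlongrightarrow> H A) (at A within {A. det A = 1})"
    unfolding isCont_def by (rule tendsto_mono[rotated]) (simp add: at_le)
  moreover have "eventually (\<lambda>B. H B = G B) (at A within {A. det A = 1})"
    unfolding eventually_at_topological using U by (intro exI[of _ U]) (auto simp: SL2C_def)
  ultimately have "(G \<longlongrightarrow> H A) (at A within {A. det A = 1})"
    by (rule Lim_transform_eventually)
  thus "continuous (at A within {A. det A = 1}) G" using U(4)[OF U(2) A] by (simp add: continuous_within)
qed

definition adj2 :: "complex^2^2 \<Rightarrow> complex^2^2" where
  "adj2 A = cm2 (A $ 2 $ 2) (- A $ 1 $ 2) (- A $ 2 $ 1) (A $ 1 $ 1)"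

lemma adj2_nth [simp]: "adj2 A $ 1 $ 1 = A $ 2 $ 2" "adj2 A $ 1 $ 2 = - A $ 1 $ 2"
  "adj2 A $ 2 $ 1 = - A $ 2 $ 1" "adj2 A $ 2 $ 2 = A $ 1 $ 1"
  by (simp_all add: adj2_def)

lemma det_adj2 [simp]: "det (adj2 A) = det A"
  by (simp add: det_2 mult_ac)

lemma adj2_mult: "det A = 1 \<Longrightarrow> A ** adj2 A = mat 1" "det A = 1 \<Longrightarrow> adj2 A ** A = mat 1"
  by (auto simp: cm2_eq_iff mult_nth2 det_2 algebra_simps)

lemma mnorm_adj2 [simp]: "mnorm (adj2 A) = mnorm A"
  by (simp add: mnorm_def)

locale sl2_representation = framed_lie_algebra \<gg> B \<xi> for \<gg> :: "(complex, 'a) lie_algebra" (structure) and B \<xi> +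
  fixes \<sigma> :: "complex^2^2 \<Rightarrow> 'a \<Rightarrow> 'a"
  assumes hom: "SL2C_complex_lie_hom \<gg> \<sigma>"
begin

lemma \<sigma>_iso: "det A = 1 \<Longrightarrow> \<sigma> A \<in> lie_iso complex_field \<gg> \<gg> \<inter> Bij (carrier \<gg>)"
  using hom unfolding SL2C_complex_lie_hom_def hom_def lie_AutoGroup_def SL2C_def by auto

lemma \<sigma>_closed [simp]: "det A = 1 \<Longrightarrow> x \<in> carrier \<gg> \<Longrightarrow> \<sigma> A x \<in> carrier \<gg>"
  using \<sigma>_iso Bij_imp_funcset by blast

lemma \<sigma>_add: "det A = 1 \<Longrightarrow> x \<in> carrier \<gg> \<Longrightarrow> y \<in> carrier \<gg> \<Longrightarrow> \<sigma> A (x \<oplus> y) = \<sigma> A x \<oplus> \<sigma> A y"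
  and \<sigma>_smult: "det A = 1 \<Longrightarrow> x \<in> carrier \<gg> \<Longrightarrow> \<sigma> A (k \<odot> x) = k \<odot> \<sigma> A x"
  and \<sigma>_bracket: "det A = 1 \<Longrightarrow> x \<in> carrier \<gg> \<Longrightarrow> y \<in> carrier \<gg> \<Longrightarrow>
    \<sigma> A (lie_bracket \<gg> x y) = lie_bracket \<gg> (\<sigma> A x) (\<sigma> A y)"
  using \<sigma>_iso[of A] unfolding lie_iso_def lie_hom_def by auto

lemma \<sigma>_mult:
  assumes "det A = 1" "det A' = 1" "x \<in> carrier \<gg>"
  shows "\<sigma> (A ** A') x = \<sigma> A (\<sigma> A' x)"
proof -
  have "\<sigma> (A \<otimes>\<^bsub>SL2C\<^esub> A') = \<sigma> A \<otimes>\<^bsub>lie_AutoGroup complex_field \<gg>\<^esub> \<sigma> A'"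
    using hom assms unfolding SL2C_complex_lie_hom_def by (intro hom_mult) (auto simp: SL2C_def)
  also have "\<dots> = compose (carrier \<gg>) (\<sigma> A) (\<sigma> A')"
    using \<sigma>_iso assms by (simp add: lie_AutoGroup_def BijGroup_def)
  finally have "\<sigma> (A ** A') = compose (carrier \<gg>) (\<sigma> A) (\<sigma> A')" by (simp add: SL2C_def)
  thus ?thesis using assms by (simp add: compose_def)
qed

lemma \<sigma>_inj: "det A = 1 \<Longrightarrow> x \<in> carrier \<gg> \<Longrightarrow> y \<in> carrier \<gg> \<Longrightarrow> \<sigma> A x = \<sigma> A y \<Longrightarrow> x = y"
  using \<sigma>_iso[of A] by (auto simp: Bij_def bij_betw_def dest: inj_onD)

text \<open>The image of the unit matrix is idempotent, and an injective idempotent map is the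
  identity.\<close>

lemma \<sigma>_1: "x \<in> carrier \<gg> \<Longrightarrow> \<sigma> (mat 1) x = x"
  using \<sigma>_mult[of "mat 1" "mat 1" x] \<sigma>_inj[of "mat 1" "\<sigma> (mat 1) x" x] by simp

lemma \<sigma>_adj2:
  assumes "det A = 1" "x \<in> carrier \<gg>"
  shows "\<sigma> A (\<sigma> (adj2 A) x) = x" "\<sigma> (adj2 A) (\<sigma> A x) = x"
  using \<sigma>_mult[of A "adj2 A" x] \<sigma>_mult[of "adj2 A" A x] assms by (simp_all add: adj2_mult \<sigma>_1)

definition coef :: "'a \<Rightarrow> 'a \<Rightarrow> complex^2^2 \<Rightarrow> complex" where
  "coef b b' A = \<xi> b (\<sigma> A b')"

lemma B_carrier: "b \<in> B \<Longrightarrow> b \<in> carrier \<gg>"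
  using B_sub by blast

lemma \<xi>_\<sigma>:
  assumes "det A = 1" "x \<in> carrier \<gg>" "b \<in> B"
  shows "\<xi> b (\<sigma> A x) = (\<Sum>b'\<in>B. \<xi> b' x * coef b b' A)"
proof -
  have "(\<lambda>x. \<xi> b (\<sigma> A x)) \<in> dual_space \<gg>"
    using assms by (auto simp: dual_space_def \<sigma>_add \<sigma>_smult \<xi>_add \<xi>_smult)
  from dual_expand[OF this assms(2)] show ?thesis by (simp add: coef_def)
qed

lemma coef_holomorphic:
  assumes "open S" "\<And>i j. (\<lambda>\<tau>. F \<tau> $ i $ j) holomorphic_on S" "\<And>\<tau>. \<tau> \<in> S \<Longrightarrow> det (F \<tau>) = 1" "b \<in> B" "b' \<in> B"
  shows "(\<lambda>\<tau>. coef b b' (F \<tau>)) holomorphic_on S"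
proof (rule SL2C_holomorphic_compose[OF _ assms(1-3)])
  show "SL2C_holomorphic (coef b b')"
    using hom \<xi>_dual[OF assms(4)] B_carrier[OF assms(5)] unfolding SL2C_complex_lie_hom_def coef_def by blast
qed

text \<open>The sum of the moduli of all entries is chosen because this matrix norm is
  submultiplicative.\<close>

definition Rn :: "complex^2^2 \<Rightarrow> real" where
  "Rn A = (\<Sum>b\<in>B. \<Sum>b'\<in>B. norm (coef b b' A))"

lemma coef_le_Rn: "b \<in> B \<Longrightarrow> b' \<in> B \<Longrightarrow> norm (coef b b' A) \<le> Rn A"
  unfolding Rn_def
  by (rule order_trans[OF member_le_sum[of b' B "\<lambda>b'. norm (coef b b' A)"] member_le_sum[of b B "\<lambda>b. \<Sum>b'\<in>B. norm (coef b b' A)"]])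
     (auto simp: finite_B intro!: sum_nonneg)

sublocale sl2_submult Rn
proof
  show "continuous_on {A. det A = 1} Rn"
    unfolding Rn_def
  proof (intro continuous_on_sum continuous_on_norm)
    fix b b' assume "b \<in> B" "b' \<in> B"
    thus "continuous_on {A. det A = 1} (coef b b')"
      using hom \<xi>_dual B_carrier unfolding SL2C_complex_lie_hom_def coef_def
      by (intro SL2C_holomorphic_continuous) blast
  qed
  show "Rn A \<ge> 0" for A unfolding Rn_def by (intro sum_nonneg) auto
  show "Rn (A ** A') \<le> Rn A * Rn A'" if A: "det A = 1" "det A' = 1" for A A'
  proof -
    have "norm (coef b b' (A ** A')) \<le> (\<Sum>b''\<in>B. norm (coef b'' b' A') * norm (coef b b'' A))" if "b \<in> B" "b' \<in> B" for b b'
    proof -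
      have "coef b b' (A ** A') = (\<Sum>b''\<in>B. coef b'' b' A' * coef b b'' A)"
        using that A B_carrier by (simp add: coef_def[of _ b'] \<sigma>_mult \<xi>_\<sigma>)
      thus ?thesis by (auto intro: order_trans[OF norm_sum] simp: norm_mult)
    qed
    hence "Rn (A ** A') \<le> (\<Sum>b\<in>B. \<Sum>b'\<in>B. \<Sum>b''\<in>B. norm (coef b'' b' A') * norm (coef b b'' A))"
      unfolding Rn_def by (intro sum_mono)
    also have "\<dots> = (\<Sum>b\<in>B. \<Sum>b''\<in>B. norm (coef b b'' A) * (\<Sum>b'\<in>B. norm (coef b'' b' A')))"
    proof (rule sum.cong[OF refl])
      fix b
      show "(\<Sum>b'\<in>B. \<Sum>b''\<in>B. norm (coef b'' b' A') * norm (coef b b'' A)) =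
          (\<Sum>b''\<in>B. norm (coef b b'' A) * (\<Sum>b'\<in>B. norm (coef b'' b' A')))"
        by (subst sum.swap) (simp add: sum_distrib_left mult_ac)
    qed
    also have "\<dots> \<le> (\<Sum>b\<in>B. \<Sum>b''\<in>B. norm (coef b b'' A) * Rn A')"
      unfolding Rn_def
      by (intro sum_mono mult_left_mono member_le_sum[where f = "\<lambda>b. \<Sum>b'\<in>B. norm (coef b b' A')"])
         (auto simp: finite_B intro!: sum_nonneg)
    also have "\<dots> = Rn A * Rn A'" by (simp add: Rn_def[of A] sum_distrib_right)
    finally show ?thesis .
  qed
qed

text \<open>The polynomial bound in the entries turns exponential growth of F into exponential
  growth of the representing matrix.\<close>

lemma coef_egr:
  assumes "egr (\<lambda>\<tau>. mnorm (F \<tau>))" "\<And>\<tau>. \<tau> \<in> \<H> \<Longrightarrow> det (F \<tau>) = 1" "b \<in> B" "b' \<in> B"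
  shows "egr (\<lambda>\<tau>. norm (coef b b' (F \<tau>)))"
proof -
  obtain C k where C: "C \<ge> 0" "\<And>A. det A = 1 \<Longrightarrow> Rn A \<le> C * (1 + mnorm A) ^ k" using poly_growth by blast
  have "egr (\<lambda>\<tau>. C * (1 + mnorm (F \<tau>)) ^ k)"
    by (intro egr_mult egr_const egr_power egr_add assms(1)) (auto simp: mnorm_def C(1))
  thus ?thesis
    by (rule egr_mono) (use C(2) assms coef_le_Rn[OF assms(3,4)] in \<open>blast intro: order_trans\<close>)
qed

end

section \<open>Loop algebras\<close>

lemma lookup_free_smult [simp]: "Poly_Mapping.lookup (free_smult c u) k = c * Poly_Mapping.lookup u k"
  by (simp add: free_smult_def Poly_Mapping.map.rep_eq when_def)

interpretation free: Modules.module free_smult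
  by standard (auto intro!: poly_mapping_eqI simp: lookup_add algebra_simps)

lemma ratfun_const_hom:
  "ratfun_const (a + b) = ratfun_const a + ratfun_const b"
  "ratfun_const (a * b) = ratfun_const a * ratfun_const b"
  "ratfun_const 0 = 0" "ratfun_const 1 = 1"
  by (simp_all add: ratfun_const_def Zero_fract_def One_fract_def one_pCons mult.commute)

lemma poly_mapping_decompose:
  fixes u :: "'k \<Rightarrow>\<^sub>0 complex"
  shows "u = (\<Sum>k\<in>Poly_Mapping.keys u. Poly_Mapping.single k (Poly_Mapping.lookup u k))"
proof (rule poly_mapping_eqI)
  fix k
  have "Poly_Mapping.lookup (\<Sum>k\<in>Poly_Mapping.keys u. Poly_Mapping.single k (Poly_Mapping.lookup u k)) k =
      (\<Sum>j\<in>Poly_Mapping.keys u. if j = k then Poly_Mapping.lookup u j else 0)"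
    by (simp add: lookup_sum lookup_single when_def)
  also have "\<dots> = Poly_Mapping.lookup u k" by (simp add: in_keys_iff)
  finally show "Poly_Mapping.lookup u k =
      Poly_Mapping.lookup (\<Sum>k\<in>Poly_Mapping.keys u. Poly_Mapping.single k (Poly_Mapping.lookup u k)) k" by simp
qed

section \<open>Coordinates on the free vector space and on the tensor product\<close>

context framed_lie_algebra
begin

text \<open>The map \<open>\<xi> b \<otimes> id\<close> lifted to the free vector space.\<close>

definition crd :: "'a \<Rightarrow> ('a \<times> ratfun \<Rightarrow>\<^sub>0 complex) \<Rightarrow> ratfun" where
  "crd b u = (\<Sum>k\<in>Poly_Mapping.keys u. ratfun_const (Poly_Mapping.lookup u k * \<xi> b (fst k)) * snd k)"

lemma crd_superset:
  assumes "finite A" "Poly_Mapping.keys u \<subseteq> A"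
  shows "crd b u = (\<Sum>k\<in>A. ratfun_const (Poly_Mapping.lookup u k * \<xi> b (fst k)) * snd k)"
  unfolding crd_def using assms
  by (intro sum.mono_neutral_left) (auto simp: in_keys_iff ratfun_const_hom)

lemma crd_add: "crd b (u + v) = crd b u + crd b v"
proof -
  let ?A = "Poly_Mapping.keys u \<union> Poly_Mapping.keys v"
  have f: "finite ?A" by simp
  show ?thesis
    unfolding crd_superset[OF f Poly_Mapping.keys_add, of b] crd_superset[OF f Un_upper1, of b] crd_superset[OF f Un_upper2, of b]
    by (simp add: lookup_add ring_distribs ratfun_const_hom sum.distrib)
qed

lemma crd_free_smult: "crd b (free_smult c u) = ratfun_const c * crd b u"
proof -
  have s: "Poly_Mapping.keys (free_smult c u) \<subseteq> Poly_Mapping.keys u" by (auto simp: in_keys_iff)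
  have "crd b (free_smult c u) =
      (\<Sum>k\<in>Poly_Mapping.keys u. ratfun_const (Poly_Mapping.lookup (free_smult c u) k * \<xi> b (fst k)) * snd k)"
    by (rule crd_superset[OF finite_keys s])
  thus ?thesis unfolding crd_def by (simp add: sum_distrib_left ratfun_const_hom mult_ac)
qed

lemma crd_0 [simp]: "crd b 0 = 0"
  by (simp add: crd_def)

lemma crd_single: "crd b (Poly_Mapping.single (x, p) c) = ratfun_const (c * \<xi> b x) * p"
proof -
  have "Poly_Mapping.keys (Poly_Mapping.single (x, p) c) \<subseteq> {(x, p)}" by (simp add: keys_single)
  from crd_superset[OF _ this, of b] show ?thesis by (simp add: lookup_single)
qed

lemma crd_uminus: "crd b (- u) = - crd b u"
proof -
  have "crd b (- u) + crd b u = 0" unfolding crd_add[symmetric] by simp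
  thus ?thesis by (simp add: eq_neg_iff_add_eq_0)
qed

lemma crd_diff: "crd b (u - v) = crd b u - crd b v"
  using crd_add[of b u "- v"] by (simp add: crd_uminus)

lemma crd_sum: "crd b (sum f I) = (\<Sum>i\<in>I. crd b (f i))"
  by (induction I rule: infinite_finite_induct) (auto simp: crd_add)

end

locale loop_setting = framed_lie_algebra \<gg> B \<xi> for \<gg> :: "(complex, 'a) lie_algebra" (structure) and B \<xi> +
  fixes S :: "complex set"
begin

abbreviation "A \<equiv> punctured_line_algebra S"

definition Rl where "Rl = tensor_relations \<gg> A"

definition K :: "('a \<times> ratfun \<Rightarrow>\<^sub>0 complex) set" where "K = {u. Poly_Mapping.keys u \<subseteq> carrier \<gg> \<times> carrier A}"

abbreviation sg where "sg \<equiv> Poly_Mapping.single"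

lemma Rl_closed: "0 \<in> Rl" "u \<in> Rl \<Longrightarrow> v \<in> Rl \<Longrightarrow> u + v \<in> Rl" "u \<in> Rl \<Longrightarrow> v \<in> Rl \<Longrightarrow> u - v \<in> Rl"
  "u \<in> Rl \<Longrightarrow> free_smult c u \<in> Rl" "u \<in> Rl \<Longrightarrow> - u \<in> Rl"
  unfolding Rl_def tensor_relations_def
  by (intro free.span_zero free.span_add free.span_diff free.span_scale free.span_neg; assumption)+

lemma Rl_sum: "(\<And>i. i \<in> I \<Longrightarrow> f i \<in> Rl) \<Longrightarrow> sum f I \<in> Rl"
  by (induction I rule: infinite_finite_induct) (auto intro: Rl_closed)

lemma Rl_gen:
  "x \<in> carrier \<gg> \<Longrightarrow> x' \<in> carrier \<gg> \<Longrightarrow> p \<in> carrier A \<Longrightarrow> sg (x \<oplus> x', p) 1 - sg (x, p) 1 - sg (x', p) 1 \<in> Rl"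
  "x \<in> carrier \<gg> \<Longrightarrow> p \<in> carrier A \<Longrightarrow> q \<in> carrier A \<Longrightarrow> sg (x, p + q) 1 - sg (x, p) 1 - sg (x, q) 1 \<in> Rl"
  "x \<in> carrier \<gg> \<Longrightarrow> p \<in> carrier A \<Longrightarrow> sg (c \<odot> x, p) 1 - sg (x, p) c \<in> Rl"
  "x \<in> carrier \<gg> \<Longrightarrow> p \<in> carrier A \<Longrightarrow> sg (x, ratfun_const c * p) 1 - sg (x, p) c \<in> Rl"
  unfolding Rl_def tensor_relations_def pla_simps
  by (rule free.span_base, blast)+

lemma Rl_induct [consumes 1]:
  assumes "u \<in> Rl" and "P 0" "\<And>u v. P u \<Longrightarrow> P v \<Longrightarrow> P (u + v)" "\<And>c u. P u \<Longrightarrow> P (free_smult c u)"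
    and "\<And>x x' p. x \<in> carrier \<gg> \<Longrightarrow> x' \<in> carrier \<gg> \<Longrightarrow> p \<in> carrier A \<Longrightarrow> P (sg (x \<oplus> x', p) 1 - sg (x, p) 1 - sg (x', p) 1)"
    and "\<And>x p q. x \<in> carrier \<gg> \<Longrightarrow> p \<in> carrier A \<Longrightarrow> q \<in> carrier A \<Longrightarrow> P (sg (x, p + q) 1 - sg (x, p) 1 - sg (x, q) 1)"
    and "\<And>x p c. x \<in> carrier \<gg> \<Longrightarrow> p \<in> carrier A \<Longrightarrow> P (sg (c \<odot> x, p) 1 - sg (x, p) c)"
    and "\<And>x p c. x \<in> carrier \<gg> \<Longrightarrow> p \<in> carrier A \<Longrightarrow> P (sg (x, ratfun_const c * p) 1 - sg (x, p) c)"
  shows "P u"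
  using assms(1) unfolding Rl_def tensor_relations_def pla_simps
proof (rule free.span_induct)
  show "free.subspace {u. P u}" unfolding free.subspace_def using assms by blast
qed (elim UnE CollectE exE conjE; simp only:; rule assms; assumption)

lemma Rl_crd:
  assumes "b \<in> B" "u \<in> Rl"
  shows "crd b u = 0"
  using assms(2)
  by (induction rule: Rl_induct)
     (simp_all add: assms(1) crd_add crd_diff crd_free_smult crd_single \<xi>_add \<xi>_smult ratfun_const_hom algebra_simps)

lemma K_closed: "0 \<in> K" "u \<in> K \<Longrightarrow> v \<in> K \<Longrightarrow> u + v \<in> K" "u \<in> K \<Longrightarrow> v \<in> K \<Longrightarrow> u - v \<in> K"
  "u \<in> K \<Longrightarrow> free_smult c u \<in> K"
  "x \<in> carrier \<gg> \<Longrightarrow> p \<in> carrier A \<Longrightarrow> sg (x, p) c \<in> K"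
proof -
  show "0 \<in> K" by (simp add: K_def)
  show "u + v \<in> K" if "u \<in> K" "v \<in> K"
    using that Poly_Mapping.keys_add[of u v] by (auto simp: K_def)
  show "u - v \<in> K" if "u \<in> K" "v \<in> K"
    using that keys_diff[of u v] by (auto simp: K_def)
  show "free_smult c u \<in> K" if "u \<in> K"
    using that by (auto simp: K_def in_keys_iff)
  show "sg (x, p) c \<in> K" if "x \<in> carrier \<gg>" "p \<in> carrier A"
    using that by (simp add: K_def keys_single)
qed

lemma K_sum: "(\<And>i. i \<in> I \<Longrightarrow> f i \<in> K) \<Longrightarrow> sum f I \<in> K"
  by (induction I rule: infinite_finite_induct) (auto intro: K_closed(1,2))

lemma Rl_subset_K: "u \<in> Rl \<Longrightarrow> u \<in> K"
  by (induction rule: Rl_induct) (blast intro: K_closed pla_add pla_mult pla_const add.m_closed smult_cl)+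

lemma crd_in_A: "u \<in> K \<Longrightarrow> crd b u \<in> carrier A"
  unfolding crd_def K_def by (intro pla_sum pla_mult pla_const) auto

lemma Rl_trans: "u - v \<in> Rl \<Longrightarrow> v - w \<in> Rl \<Longrightarrow> u - w \<in> Rl"
  using Rl_closed(2)[of "u - v" "v - w"] by simp

lemma Rl_sum_diff: "(\<And>i. i \<in> I \<Longrightarrow> f i - g i \<in> Rl) \<Longrightarrow> sum f I - sum g I \<in> Rl"
  unfolding sum_subtractf[symmetric] by (rule Rl_sum)

lemma single_scale:
  assumes "x \<in> carrier \<gg>" "p \<in> carrier A"
  shows "sg (x, p) c - sg (x, ratfun_const c * p) 1 \<in> Rl"
  using Rl_closed(5)[OF Rl_gen(4)[OF assms, of c]] by simp

lemma single_lc: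
  assumes "finite C" "C \<subseteq> carrier \<gg>" "p \<in> carrier A"
  shows "sg (lc C d, p) 1 - (\<Sum>b\<in>C. sg (b, ratfun_const (d b) * p) 1) \<in> Rl"
  using assms(1,2)
proof (induction C rule: finite_induct)
  case empty
  have "sg (0 \<odot> \<zero>, p) 1 - sg (\<zero>, p) 0 \<in> Rl" using assms(3) by (intro Rl_gen) auto
  thus ?case by simp
next
  case (insert b C)
  have b: "b \<in> carrier \<gg>" and C: "C \<subseteq> carrier \<gg>" using insert by auto
  have 1: "sg (d b \<odot> b \<oplus> lc C d, p) 1 - sg (d b \<odot> b, p) 1 - sg (lc C d, p) 1 \<in> Rl"
    using b C assms(3) by (intro Rl_gen) auto
  have 2: "sg (d b \<odot> b, p) 1 - sg (b, ratfun_const (d b) * p) 1 \<in> Rl"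
    by (rule Rl_trans[OF Rl_gen(3)[OF b assms(3)] single_scale[OF b assms(3)]])
  have 3: "sg (lc C d, p) 1 - (\<Sum>b\<in>C. sg (b, ratfun_const (d b) * p) 1) \<in> Rl" using insert by simp
  have "(sg (d b \<odot> b \<oplus> lc C d, p) 1 - sg (d b \<odot> b, p) 1 - sg (lc C d, p) 1) +
      ((sg (d b \<odot> b, p) 1 - sg (b, ratfun_const (d b) * p) 1) +
       (sg (lc C d, p) 1 - (\<Sum>b\<in>C. sg (b, ratfun_const (d b) * p) 1))) \<in> Rl"
    by (intro Rl_closed 1 2 3)
  thus ?case using insert b C by (simp add: lc_insert algebra_simps)
qed

lemma single_sum:
  assumes "finite I" "x \<in> carrier \<gg>" "\<And>i. i \<in> I \<Longrightarrow> f i \<in> carrier A"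
  shows "(\<Sum>i\<in>I. sg (x, f i) 1) - sg (x, \<Sum>i\<in>I. f i) 1 \<in> Rl"
  using assms(1,3)
proof (induction I rule: finite_induct)
  case empty
  have "sg (x, ratfun_const 0 * 0) 1 - sg (x, 0) 0 \<in> Rl" using assms(2) pla_zero by (intro Rl_gen)
  hence "sg (x, 0) 1 \<in> Rl" by simp
  hence "- sg (x, 0) 1 \<in> Rl" by (rule Rl_closed)
  thus ?case by simp
next
  case (insert i I)
  have 1: "sg (x, f i + sum f I) 1 - sg (x, f i) 1 - sg (x, sum f I) 1 \<in> Rl"
    using insert assms(2) by (intro Rl_gen pla_sum) auto
  have 2: "(\<Sum>i\<in>I. sg (x, f i) 1) - sg (x, \<Sum>i\<in>I. f i) 1 \<in> Rl" using insert by simp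
  have "((\<Sum>i\<in>I. sg (x, f i) 1) - sg (x, \<Sum>i\<in>I. f i) 1) -
      (sg (x, f i + sum f I) 1 - sg (x, f i) 1 - sg (x, sum f I) 1) \<in> Rl"
    by (intro Rl_closed 1 2)
  thus ?case using insert by (simp add: algebra_simps)
qed

text \<open>Modulo the relations a generator (x, p) expands along the basis, scalars move into the
  second entry, and terms with the same b are collected. This exhibits the tensor product as a free
  module over the algebra with basis B.\<close>

lemma tensor_normal_form:
  assumes "u \<in> K"
  shows "u - (\<Sum>b\<in>B. sg (b, crd b u) 1) \<in> Rl"
proof -
  let ?c = "Poly_Mapping.lookup u"
  define f where "f = (\<lambda>k b. ratfun_const (?c k * \<xi> b (fst k)) * snd k)"
  have k: "fst k \<in> carrier \<gg>" "snd k \<in> carrier A" if "k \<in> Poly_Mapping.keys u" for k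
    using assms that by (auto simp: K_def)
  have "(\<Sum>k\<in>Poly_Mapping.keys u. sg k (?c k)) - (\<Sum>k\<in>Poly_Mapping.keys u. \<Sum>b\<in>B. sg (b, f k b) 1) \<in> Rl"
  proof (rule Rl_sum_diff)
    fix k assume kk: "k \<in> Poly_Mapping.keys u"
    define x p where "x = fst k" and "p = snd k"
    have xp: "x \<in> carrier \<gg>" "p \<in> carrier A" using k[OF kk] by (auto simp: x_def p_def)
    have cp: "ratfun_const (?c k) * p \<in> carrier A" using xp by (intro pla_mult pla_const)
    have "sg (x, p) (?c k) - sg (x, ratfun_const (?c k) * p) 1 \<in> Rl" by (rule single_scale[OF xp])
    moreover have "sg (x, ratfun_const (?c k) * p) 1 - (\<Sum>b\<in>B. sg (b, ratfun_const (\<xi> b x) * (ratfun_const (?c k) * p)) 1) \<in> Rl"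
      using single_lc[OF finite_B B_sub cp, of "\<lambda>b. \<xi> b x"] by (simp only: repr[OF xp(1), symmetric])
    ultimately have "sg (x, p) (?c k) - (\<Sum>b\<in>B. sg (b, ratfun_const (\<xi> b x) * (ratfun_const (?c k) * p)) 1) \<in> Rl"
      by (rule Rl_trans)
    moreover have "ratfun_const (\<xi> b x) * (ratfun_const (?c k) * p) = f k b" for b
      by (simp add: f_def x_def p_def ratfun_const_hom mult_ac)
    ultimately show "sg k (?c k) - (\<Sum>b\<in>B. sg (b, f k b) 1) \<in> Rl" by (simp add: x_def p_def)
  qed
  hence "u - (\<Sum>k\<in>Poly_Mapping.keys u. \<Sum>b\<in>B. sg (b, f k b) 1) \<in> Rl"
    by (simp only: poly_mapping_decompose[symmetric])
  hence 1: "u - (\<Sum>b\<in>B. \<Sum>k\<in>Poly_Mapping.keys u. sg (b, f k b) 1) \<in> Rl" by (subst (asm) sum.swap)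
  have 2: "(\<Sum>b\<in>B. \<Sum>k\<in>Poly_Mapping.keys u. sg (b, f k b) 1) - (\<Sum>b\<in>B. sg (b, crd b u) 1) \<in> Rl"
  proof (rule Rl_sum_diff)
    fix b assume "b \<in> B"
    thus "(\<Sum>k\<in>Poly_Mapping.keys u. sg (b, f k b) 1) - sg (b, crd b u) 1 \<in> Rl"
      unfolding crd_def f_def using B_sub k by (intro single_sum pla_mult pla_const) auto
  qed
  show ?thesis by (rule Rl_trans[OF 1 2])
qed

text \<open>Membership in a span becomes an equality of rational functions, the form in which
  questions about cosets are decided from here on.\<close>

lemma Rl_iff:
  assumes "u \<in> K" "v \<in> K"
  shows "u - v \<in> Rl \<longleftrightarrow> (\<forall>b\<in>B. crd b u = crd b v)"
proof
  assume "u - v \<in> Rl"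
  thus "\<forall>b\<in>B. crd b u = crd b v" using Rl_crd[of _ "u - v"] by (simp add: crd_diff)
next
  assume *: "\<forall>b\<in>B. crd b u = crd b v"
  hence "(\<Sum>b\<in>B. sg (b, crd b u) 1) = (\<Sum>b\<in>B. sg (b, crd b v) (1::complex))" by simp
  moreover have "(u - (\<Sum>b\<in>B. sg (b, crd b u) 1)) - (v - (\<Sum>b\<in>B. sg (b, crd b v) 1)) \<in> Rl"
    by (intro Rl_closed(3) tensor_normal_form assms)
  ultimately show "u - v \<in> Rl" by simp
qed

definition coset where "coset u = (+) u ` Rl"

lemma mem_coset: "w \<in> coset u \<longleftrightarrow> w - u \<in> Rl"
  unfolding coset_def by (auto simp: image_iff) (metis add_diff_cancel_left' diff_add_cancel add.commute)

lemma coset_eq_iff: "u \<in> K \<Longrightarrow> v \<in> K \<Longrightarrow> coset u = coset v \<longleftrightarrow> (\<forall>b\<in>B. crd b u = crd b v)"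
proof -
  assume uv: "u \<in> K" "v \<in> K"
  have "coset u = coset v \<longleftrightarrow> u - v \<in> Rl"
  proof
    assume "coset u = coset v"
    moreover have "u \<in> coset u" by (simp add: mem_coset Rl_closed)
    ultimately show "u - v \<in> Rl" by (simp add: mem_coset)
  next
    assume *: "u - v \<in> Rl"
    show "coset u = coset v"
    proof (rule Set.set_eqI)
      fix w
      show "w \<in> coset u \<longleftrightarrow> w \<in> coset v"
        using Rl_trans[of w u v] Rl_trans[of w v u] * Rl_closed(5)[OF *] by (auto simp: mem_coset)
    qed
  qed
  thus ?thesis using Rl_iff[OF uv] by simp
qed

abbreviation "LA \<equiv> loop_algebra \<gg> A"

lemma LA_carrier: "carrier LA = coset ` K"
  by (auto simp: loop_algebra_def tensor_product_def module.defs coset_def K_def Rl_def)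

lemma LA_add: "coset u \<oplus>\<^bsub>LA\<^esub> coset v = coset (u + v)"
proof -
  have "coset u \<oplus>\<^bsub>LA\<^esub> coset v = {a + b | a b. a \<in> coset u \<and> b \<in> coset v}"
    by (simp add: loop_algebra_def tensor_product_def module.defs)
  also have "\<dots> = coset (u + v)"
  proof (rule Set.set_eqI, rule iffI)
    fix w assume "w \<in> {a + b | a b. a \<in> coset u \<and> b \<in> coset v}"
    then obtain a b where "w = a + b" "a - u \<in> Rl" "b - v \<in> Rl" by (auto simp: mem_coset)
    thus "w \<in> coset (u + v)" using Rl_closed(2)[of "a - u" "b - v"] by (simp add: mem_coset algebra_simps)
  next
    fix w assume "w \<in> coset (u + v)"
    hence "w - v \<in> coset u" "v \<in> coset v" by (auto simp: mem_coset algebra_simps Rl_closed)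
    moreover have "w = (w - v) + v" by simp
    ultimately show "w \<in> {a + b | a b. a \<in> coset u \<and> b \<in> coset v}" by blast
  qed
  finally show ?thesis .
qed

lemma LA_smult: "c \<odot>\<^bsub>LA\<^esub> coset u = coset (free_smult c u)"
proof -
  have "c \<odot>\<^bsub>LA\<^esub> coset u = {free_smult c a + n | a n. a \<in> coset u \<and> n \<in> Rl}"
    by (simp add: loop_algebra_def tensor_product_def module.defs Rl_def)
  also have "\<dots> = coset (free_smult c u)"
  proof (rule Set.set_eqI, rule iffI)
    fix w assume "w \<in> {free_smult c a + n | a n. a \<in> coset u \<and> n \<in> Rl}"
    then obtain a n where w: "w = free_smult c a + n" "a - u \<in> Rl" "n \<in> Rl" by (auto simp: mem_coset)
    have "free_smult c (a - u) + n \<in> Rl" by (intro Rl_closed w)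
    thus "w \<in> coset (free_smult c u)" by (simp add: w mem_coset free.scale_right_diff_distrib algebra_simps)
  next
    fix w assume "w \<in> coset (free_smult c u)"
    moreover have "w = free_smult c u + (w - free_smult c u)" by simp
    moreover have "u \<in> coset u" by (simp add: mem_coset Rl_closed)
    ultimately show "w \<in> {free_smult c a + n | a n. a \<in> coset u \<and> n \<in> Rl}" unfolding mem_coset by blast
  qed
  finally show ?thesis .
qed

lemma free_loop_bracket_K:
  assumes "u \<in> K" "v \<in> K"
  shows "free_loop_bracket \<gg> A u v \<in> K"
  unfolding free_loop_bracket_def case_prod_unfold pla_simps
proof (intro K_sum K_closed(5) pla_mult bracket_closed)
qed (use assms in \<open>auto simp: K_def\<close>)

definition str :: "'a \<Rightarrow> 'a \<Rightarrow> 'a \<Rightarrow> complex" where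
  "str b b' b'' = \<xi> b (lie_bracket \<gg> b' b'')"

lemma \<xi>_bracket:
  assumes "b \<in> B" "x \<in> carrier \<gg>" "y \<in> carrier \<gg>"
  shows "\<xi> b (lie_bracket \<gg> x y) = (\<Sum>b'\<in>B. \<Sum>b''\<in>B. \<xi> b' x * \<xi> b'' y * str b b' b'')"
proof -
  have 1: "(\<lambda>x. \<xi> b (lie_bracket \<gg> x y)) \<in> dual_space \<gg>" if "y \<in> carrier \<gg>" for y
    using that assms(1) bracket_smult_left by (auto simp: dual_space_def bracket_add_left \<xi>_add \<xi>_smult bracket_closed)
  have 2: "(\<lambda>y. \<xi> b (lie_bracket \<gg> x y)) \<in> dual_space \<gg>" if "x \<in> carrier \<gg>" for x
    using that assms(1) bracket_smult_right by (auto simp: dual_space_def bracket_add_right \<xi>_add \<xi>_smult bracket_closed)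
  have "\<xi> b (lie_bracket \<gg> x y) = (\<Sum>b'\<in>B. \<xi> b' x * \<xi> b (lie_bracket \<gg> b' y))"
    by (rule dual_expand[OF 1[OF assms(3)] assms(2)])
  also have "\<dots> = (\<Sum>b'\<in>B. \<xi> b' x * (\<Sum>b''\<in>B. \<xi> b'' y * \<xi> b (lie_bracket \<gg> b' b'')))"
    using B_sub by (intro sum.cong refl arg_cong2[where f = "(*)"] dual_expand[OF 2 assms(3)]) auto
  finally show ?thesis by (simp add: sum_distrib_left mult.assoc str_def)
qed

lemma ratfun_const_sum: "ratfun_const (sum f I) = (\<Sum>i\<in>I. ratfun_const (f i))"
  by (induction I rule: infinite_finite_induct) (auto simp: ratfun_const_hom)

text \<open>In coordinates the bracket is bilinear over the rational functions, with the structure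
  constants \<open>str\<close>. The coordinates of the result depend only on those of u and v, which
  is why the bracket descends to cosets.\<close>

lemma crd_bracket:
  assumes "u \<in> K" "v \<in> K" "b \<in> B"
  shows "crd b (free_loop_bracket \<gg> A u v) = (\<Sum>b'\<in>B. \<Sum>b''\<in>B. ratfun_const (str b b' b'') * (crd b' u * crd b'' v))"
proof -
  let ?U = "Poly_Mapping.keys u" and ?V = "Poly_Mapping.keys v" and ?u = "Poly_Mapping.lookup u" and ?v = "Poly_Mapping.lookup v"
  have k: "fst k \<in> carrier \<gg>" if "k \<in> ?U" for k using assms that by (auto simp: K_def)
  have l: "fst l \<in> carrier \<gg>" if "l \<in> ?V" for l using assms that by (auto simp: K_def)
  have "crd b (free_loop_bracket \<gg> A u v) =
     (\<Sum>k\<in>?U. \<Sum>l\<in>?V. ratfun_const ((?u k * ?v l) * \<xi> b (lie_bracket \<gg> (fst k) (fst l))) * (snd k * snd l))"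
    unfolding free_loop_bracket_def by (simp add: crd_sum crd_single case_prod_unfold)
  also have "\<dots> = (\<Sum>k\<in>?U. \<Sum>l\<in>?V. \<Sum>b'\<in>B. \<Sum>b''\<in>B. ratfun_const (str b b' b'') *
      ((ratfun_const (?u k * \<xi> b' (fst k)) * snd k) * (ratfun_const (?v l * \<xi> b'' (fst l)) * snd l)))"
    using k l assms(3)
    by (intro sum.cong refl)
       (simp add: \<xi>_bracket ratfun_const_hom ratfun_const_sum sum_distrib_left sum_distrib_right mult_ac)
  also have "\<dots> = (\<Sum>b'\<in>B. \<Sum>b''\<in>B. \<Sum>k\<in>?U. \<Sum>l\<in>?V. ratfun_const (str b b' b'') *
      ((ratfun_const (?u k * \<xi> b' (fst k)) * snd k) * (ratfun_const (?v l * \<xi> b'' (fst l)) * snd l)))"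
  proof -
    have swap4: "(\<Sum>k\<in>U. \<Sum>l\<in>V. \<Sum>b'\<in>W. \<Sum>b''\<in>W. g k l b' b'') = (\<Sum>b'\<in>W. \<Sum>b''\<in>W. \<Sum>k\<in>U. \<Sum>l\<in>V. g k l b' b'')"
      for g :: "'a \<times> ratfun \<Rightarrow> 'a \<times> ratfun \<Rightarrow> 'a \<Rightarrow> 'a \<Rightarrow> ratfun" and U V W
    proof -
      have "(\<Sum>k\<in>U. \<Sum>l\<in>V. \<Sum>b'\<in>W. \<Sum>b''\<in>W. g k l b' b'') = (\<Sum>k\<in>U. \<Sum>b'\<in>W. \<Sum>l\<in>V. \<Sum>b''\<in>W. g k l b' b'')"
        by (rule sum.cong[OF refl]) (rule sum.swap)
      also have "\<dots> = (\<Sum>b'\<in>W. \<Sum>k\<in>U. \<Sum>l\<in>V. \<Sum>b''\<in>W. g k l b' b'')" by (rule sum.swap)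
      also have "\<dots> = (\<Sum>b'\<in>W. \<Sum>k\<in>U. \<Sum>b''\<in>W. \<Sum>l\<in>V. g k l b' b'')"
        by (intro sum.cong[OF refl]) (rule sum.swap)
      also have "\<dots> = (\<Sum>b'\<in>W. \<Sum>b''\<in>W. \<Sum>k\<in>U. \<Sum>l\<in>V. g k l b' b'')"
        by (intro sum.cong[OF refl]) (rule sum.swap)
      finally show ?thesis .
    qed
    show ?thesis by (rule swap4)
  qed
  also have "\<dots> = (\<Sum>b'\<in>B. \<Sum>b''\<in>B. ratfun_const (str b b' b'') * (crd b' u * crd b'' v))"
    unfolding crd_def sum_product by (simp only: sum_distrib_left)
  finally show ?thesis .
qed

text \<open>The defining set ranges over all representatives; \<open>crd_bracket\<close> and
  \<open>Rl_iff\<close> show that they give one and the same coset.\<close>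

lemma LA_bracket:
  assumes "u \<in> K" "v \<in> K"
  shows "lie_bracket LA (coset u) (coset v) = coset (free_loop_bracket \<gg> A u v)"
proof -
  have "lie_bracket LA (coset u) (coset v) = {free_loop_bracket \<gg> A a b + n | a b n. a \<in> coset u \<and> b \<in> coset v \<and> n \<in> Rl}"
    by (simp add: loop_algebra_def tensor_product_def module.defs Rl_def)
  also have "\<dots> = coset (free_loop_bracket \<gg> A u v)"
  proof (rule Set.set_eqI, rule iffI)
    fix w assume "w \<in> {free_loop_bracket \<gg> A a b + n | a b n. a \<in> coset u \<and> b \<in> coset v \<and> n \<in> Rl}"
    then obtain a b n where w: "w = free_loop_bracket \<gg> A a b + n" "a - u \<in> Rl" "b - v \<in> Rl" "n \<in> Rl" by (auto simp: mem_coset)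
    have ab: "a \<in> K" "b \<in> K"
      using K_closed(2)[OF Rl_subset_K[OF w(2)] assms(1)] K_closed(2)[OF Rl_subset_K[OF w(3)] assms(2)] by simp_all
    have e: "\<forall>b\<in>B. crd b a = crd b u" "\<forall>c\<in>B. crd c b = crd c v"
      using Rl_iff[OF ab(1) assms(1)] Rl_iff[OF ab(2) assms(2)] w by auto
    have "free_loop_bracket \<gg> A a b - free_loop_bracket \<gg> A u v \<in> Rl"
      unfolding Rl_iff[OF free_loop_bracket_K[OF ab] free_loop_bracket_K[OF assms]]
      using e by (auto simp: crd_bracket ab assms)
    hence "(free_loop_bracket \<gg> A a b - free_loop_bracket \<gg> A u v) + n \<in> Rl" by (intro Rl_closed(2) w)
    thus "w \<in> coset (free_loop_bracket \<gg> A u v)" by (simp add: w mem_coset algebra_simps)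
  next
    fix w assume "w \<in> coset (free_loop_bracket \<gg> A u v)"
    moreover have "w = free_loop_bracket \<gg> A u v + (w - free_loop_bracket \<gg> A u v)" by simp
    moreover have "u \<in> coset u" "v \<in> coset v" by (auto simp: mem_coset Rl_closed)
    ultimately show "w \<in> {free_loop_bracket \<gg> A a b + n | a b n. a \<in> coset u \<and> b \<in> coset v \<and> n \<in> Rl}"
      unfolding mem_coset by blast
  qed
  finally show ?thesis .
qed

text \<open>An isomorphism onto a quotient is described by a surjection \<Phi> from the free space
  \<open>K\<close> whose fibres correspond to the cosets; the isomorphism sends f to the coset of a
  chosen preimage.\<close>

lemma loop_algebra_isomorphicI:
  fixes M :: "(complex, 'c) lie_algebra"
  assumes cl: "\<And>u. u \<in> K \<Longrightarrow> \<Phi> u \<in> carrier M"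
    and surj: "\<And>f. f \<in> carrier M \<Longrightarrow> \<exists>u\<in>K. \<Phi> u = f"
    and ker: "\<And>u v. u \<in> K \<Longrightarrow> v \<in> K \<Longrightarrow> \<Phi> u = \<Phi> v \<longleftrightarrow> (\<forall>b\<in>B. crd b u = crd b v)"
    and add: "\<And>u v. u \<in> K \<Longrightarrow> v \<in> K \<Longrightarrow> \<Phi> (u + v) = \<Phi> u \<oplus>\<^bsub>M\<^esub> \<Phi> v"
    and smult: "\<And>c u. u \<in> K \<Longrightarrow> \<Phi> (free_smult c u) = c \<odot>\<^bsub>M\<^esub> \<Phi> u"
    and bracket: "\<And>u v. u \<in> K \<Longrightarrow> v \<in> K \<Longrightarrow> \<Phi> (free_loop_bracket \<gg> A u v) = lie_bracket M (\<Phi> u) (\<Phi> v)"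
  shows "lie_isomorphic complex_field M LA"
proof -
  define h where "h = (\<lambda>f. coset (SOME u. u \<in> K \<and> \<Phi> u = f))"
  have h: "h (\<Phi> u) = coset u" if u: "u \<in> K" for u
  proof -
    define w where "w = (SOME w. w \<in> K \<and> \<Phi> w = \<Phi> u)"
    have w: "w \<in> K \<and> \<Phi> w = \<Phi> u" unfolding w_def by (rule someI[of _ u]) (use u in simp)
    hence "coset w = coset u" using ker[of w u] coset_eq_iff[of w u] u by blast
    thus ?thesis by (simp add: h_def w_def)
  qed
  have "h \<in> lie_hom complex_field M LA"
    unfolding lie_hom_def
  proof (intro CollectI conjI ballI funcsetI)
    fix f assume "f \<in> carrier M"
    then obtain u where u: "u \<in> K" "f = \<Phi> u" using surj by metis
    thus "h f \<in> carrier LA" by (simp add: h LA_carrier)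
    fix c assume "c \<in> carrier complex_field"
    show "h (c \<odot>\<^bsub>M\<^esub> f) = c \<odot>\<^bsub>LA\<^esub> h f"
      using u h[of "free_smult c u"] by (simp add: smult h LA_smult K_closed)
  next
    fix f g assume "f \<in> carrier M" "g \<in> carrier M"
    then obtain u v where u: "u \<in> K" "f = \<Phi> u" and v: "v \<in> K" "g = \<Phi> v" using surj by metis
    show "h (f \<oplus>\<^bsub>M\<^esub> g) = h f \<oplus>\<^bsub>LA\<^esub> h g"
      using u v h[of "u + v"] by (simp add: add h LA_add K_closed)
    show "h (lie_bracket M f g) = lie_bracket LA (h f) (h g)"
      using u v h[OF free_loop_bracket_K[OF u(1) v(1)]] by (simp add: bracket h LA_bracket)
  qed
  moreover have "bij_betw h (carrier M) (carrier LA)"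
    unfolding bij_betw_def
  proof
    show "inj_on h (carrier M)"
    proof (rule inj_onI)
      fix f g assume "f \<in> carrier M" "g \<in> carrier M" and eq: "h f = h g"
      then obtain u v where u: "u \<in> K" "f = \<Phi> u" and v: "v \<in> K" "g = \<Phi> v" using surj by metis
      hence "coset u = coset v" using eq by (simp add: h)
      thus "f = g" using u v ker coset_eq_iff by simp
    qed
    show "h ` carrier M = carrier LA"
    proof
      show "h ` carrier M \<subseteq> carrier LA" using \<open>h \<in> lie_hom complex_field M LA\<close> by (auto simp: lie_hom_def)
      show "carrier LA \<subseteq> h ` carrier M" using cl h by (force simp: LA_carrier)
    qed
  qed
  ultimately show ?thesis unfolding lie_isomorphic_def lie_iso_def by blast
qed

end

section \<open>The isomorphism\<close>

lemma cusp_action_eq_Infinity: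
  fixes h :: "int^2^2"
  obtains s where "cusp_action h s = Infinity_Cusp"
proof (cases "h $ 2 $ 1 = 0")
  case True
  thus thesis using that[of Infinity_Cusp] by simp
next
  case False
  hence "cusp_action h (Finite_Cusp (- of_int (h $ 2 $ 2) / of_int (h $ 2 $ 1))) = Infinity_Cusp" by simp
  thus thesis by (rule that)
qed

text \<open>Each g carries some cusp to infinity, so the condition runs over all of SL(2,Z). In the
  variable g\<tau> it bounds f composed with the inverse of g near infinity.\<close>

lemma exp_growth_at_cusps_iff:
  "exp_growth_at_cusps \<nu> f \<longleftrightarrow> (\<forall>\<gamma>\<in>SL2Z. egr (\<lambda>\<tau>. \<nu> (f (modular_action \<gamma> \<tau>))))"
proof
  assume *: "exp_growth_at_cusps \<nu> f"
  show "\<forall>\<gamma>\<in>SL2Z. egr (\<lambda>\<tau>. \<nu> (f (modular_action \<gamma> \<tau>)))"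
  proof
    fix \<gamma> assume \<gamma>: "\<gamma> \<in> SL2Z"
    obtain s where "cusp_action (inv2 \<gamma>) s = Infinity_Cusp" by (rule cusp_action_eq_Infinity)
    moreover have "inv2 \<gamma> \<in> SL2Z" using \<gamma> by simp
    ultimately obtain C M Y where CM: "\<forall>\<tau>\<in>\<H>. Im (modular_action (inv2 \<gamma>) \<tau>) > Y \<longrightarrow>
        \<nu> (f \<tau>) < C * exp (M * cmod (modular_action (inv2 \<gamma>) \<tau>))"
      using * unfolding exp_growth_at_cusps_def by metis
    show "egr (\<lambda>\<tau>. \<nu> (f (modular_action \<gamma> \<tau>)))"
    proof (rule egrI[of "max Y 0" _ C M])
      fix \<tau> :: complex assume "Im \<tau> > max Y 0"
      hence "\<tau> \<in> \<H>" "Im \<tau> > Y" by (auto simp: UHP_iff)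
      thus "\<nu> (f (modular_action \<gamma> \<tau>)) \<le> C * exp (M * cmod \<tau>)"
        using CM[rule_format, of "modular_action \<gamma> \<tau>"] \<gamma> by simp
    qed
  qed
next
  assume *: "\<forall>\<gamma>\<in>SL2Z. egr (\<lambda>\<tau>. \<nu> (f (modular_action \<gamma> \<tau>)))"
  show "exp_growth_at_cusps \<nu> f" unfolding exp_growth_at_cusps_def
  proof (intro allI ballI impI)
    fix s g assume g: "g \<in> SL2Z"
    hence "egr (\<lambda>\<tau>. \<nu> (f (modular_action (inv2 g) \<tau>)))" using * by simp
    then obtain C M Y where CM: "\<And>\<tau>. Im \<tau> > Y \<Longrightarrow> \<nu> (f (modular_action (inv2 g) \<tau>)) \<le> C * exp (M * norm \<tau>)"
      using egrE[of "\<lambda>\<tau>. \<nu> (f (modular_action (inv2 g) \<tau>))"] by metis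
    \<comment> \<open>Raising the constant by 1 makes the inequality strict.\<close>
    have "\<nu> (f \<tau>) < (C + 1) * exp (M * cmod (modular_action g \<tau>))"
      if "\<tau> \<in> \<H>" "Im (modular_action g \<tau>) > Y" for \<tau>
    proof -
      have "\<nu> (f \<tau>) \<le> C * exp (M * cmod (modular_action g \<tau>))" using CM[OF that(2)] that(1) g by simp
      also have "\<dots> < (C + 1) * exp (M * cmod (modular_action g \<tau>))" by (intro mult_strict_right_mono) auto
      finally show ?thesis .
    qed
    thus "\<exists>C M Y. \<forall>\<tau>\<in>\<H>. Im (modular_action g \<tau>) > Y \<longrightarrow> \<nu> (f \<tau>) < C * exp (M * cmod (modular_action g \<tau>))"
      by blast
  qed
qed

text \<open>Equivariance is required after applying \<sigma> rather than of F itself, because for N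
  = 2 the map F is equivariant only up to sign.\<close>

locale trivialised_loop_setting = sl2_representation \<gg> B \<xi> \<sigma> + loop_setting \<gg> B \<xi> S
  for \<gg> :: "(complex, 'a) lie_algebra" (structure) and B \<xi> \<sigma> S +
  fixes \<nu> :: "'a \<Rightarrow> real" and N :: nat and t :: "complex \<Rightarrow> complex" and F :: "complex \<Rightarrow> complex^2^2"
    and \<rho> :: "int^2^2 \<Rightarrow> 'a \<Rightarrow> 'a"
  assumes norm: "is_norm \<gg> \<nu>" and finite_S: "finite S" and ph: "punctured_hauptmodul N t S"
    and F_det: "\<tau> \<in> \<H> \<Longrightarrow> det (F \<tau>) = 1" and F_holo: "(\<lambda>\<tau>. F \<tau> $ i $ j) holomorphic_on \<H>"
    and F_egr: "\<gamma> \<in> SL2Z \<Longrightarrow> egr (\<lambda>\<tau>. mnorm (F (modular_action \<gamma> \<tau>)))"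
    and F_eqv: "\<gamma> \<in> principal_congruence_subgroup N \<Longrightarrow> \<tau> \<in> \<H> \<Longrightarrow> x \<in> carrier \<gg> \<Longrightarrow>
      \<sigma> (F (modular_action \<gamma> \<tau>)) x = \<rho> \<gamma> (\<sigma> (F \<tau>) x)"
begin

sublocale hauptmodul N t using ph by (simp add: punctured_hauptmodul_def)

lemma t_notin: "\<tau> \<in> \<H> \<Longrightarrow> t \<tau> \<notin> S"
  using ph by (simp add: punctured_hauptmodul_def)

lemma \<nu>_nonneg: "x \<in> carrier \<gg> \<Longrightarrow> \<nu> x \<ge> 0"
  using norm by (simp add: is_norm_def)

abbreviation "M \<equiv> zero_weight_automorphic \<gg> \<nu> (principal_congruence_subgroup N) \<rho>"

lemma M_iff: "f \<in> carrier M \<longleftrightarrow> f \<in> \<H> \<rightarrow>\<^sub>E carrier \<gg> \<and> (\<forall>b\<in>B. (\<lambda>\<tau>. \<xi> b (f \<tau>)) holomorphic_on \<H>) \<and>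
    (\<forall>\<gamma>\<in>principal_congruence_subgroup N. \<forall>\<tau>\<in>\<H>. f (modular_action \<gamma> \<tau>) = \<rho> \<gamma> (f \<tau>)) \<and>
    (\<forall>\<gamma>\<in>SL2Z. egr (\<lambda>\<tau>. \<nu> (f (modular_action \<gamma> \<tau>))))"
proof (cases "f \<in> \<H> \<rightarrow>\<^sub>E carrier \<gg>")
  case True
  hence "vholomorphic_on \<gg> f \<H> \<longleftrightarrow> (\<forall>b\<in>B. (\<lambda>\<tau>. \<xi> b (f \<tau>)) holomorphic_on \<H>)"
    by (intro vholomorphic_iff) auto
  thus ?thesis by (simp add: zero_weight_automorphic_def exp_growth_at_cusps_iff)
qed (simp add: zero_weight_automorphic_def)

text \<open>The element u with its variable evaluated at \<open>t \<tau>\<close>, a vector of the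
  Lie algebra; being a function of \<open>t \<tau>\<close>, it is invariant under
  \<Gamma>(N).\<close>

definition val where "val u \<tau> = lc B (\<lambda>b. ev (t \<tau>) (crd b u))"

definition \<Phi> where "\<Phi> u = (\<lambda>\<tau>\<in>\<H>. \<sigma> (F \<tau>) (val u \<tau>))"

lemma val_closed [simp]: "val u \<tau> \<in> carrier \<gg>"
  by (simp add: val_def B_sub)

lemma \<xi>_val: "b \<in> B \<Longrightarrow> \<xi> b (val u \<tau>) = ev (t \<tau>) (crd b u)"
  by (simp add: val_def \<xi>_lc)

text \<open>The coordinates are finite sums of an evaluation times a matrix coefficient, and both
  kinds of factor are holomorphic and of exponential growth at all cusps. Equivariance comes from F
  alone.\<close>

lemma \<Phi>_closed:
  assumes u: "u \<in> K"
  shows "\<Phi> u \<in> carrier M"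
  unfolding M_iff
proof (intro conjI ballI)
  show "\<Phi> u \<in> \<H> \<rightarrow>\<^sub>E carrier \<gg>" by (auto simp: \<Phi>_def F_det)
  have \<xi>\<Phi>: "\<xi> b (\<Phi> u \<tau>) = (\<Sum>b'\<in>B. ev (t \<tau>) (crd b' u) * coef b b' (F \<tau>))" if "b \<in> B" "\<tau> \<in> \<H>" for b \<tau>
    using that by (simp add: \<Phi>_def \<xi>_\<sigma> F_det \<xi>_val)
  show "(\<lambda>\<tau>. \<xi> b (\<Phi> u \<tau>)) holomorphic_on \<H>" if b: "b \<in> B" for b
  proof -
    have "(\<lambda>\<tau>. \<Sum>b'\<in>B. ev (t \<tau>) (crd b' u) * coef b b' (F \<tau>)) holomorphic_on \<H>"
      by (intro holomorphic_on_sum holomorphic_on_mult ev_holomorphic[OF crd_in_A[OF u] holo t_notin]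
          coef_holomorphic[OF open_UHP F_holo F_det b])
    thus ?thesis by (rule holomorphic_transform) (simp add: \<xi>\<Phi> b)
  qed
  show "\<Phi> u (modular_action \<gamma> \<tau>) = \<rho> \<gamma> (\<Phi> u \<tau>)" if \<gamma>: "\<gamma> \<in> principal_congruence_subgroup N" and \<tau>: "\<tau> \<in> \<H>" for \<gamma> \<tau>
  proof -
    have "t (modular_action \<gamma> \<tau>) = t \<tau>" using inv \<gamma> \<tau> by (simp add: invf_def)
    hence "val u (modular_action \<gamma> \<tau>) = val u \<tau>" by (simp add: val_def)
    thus ?thesis using \<gamma> \<tau> Gamma_subset_SL2Z[OF \<gamma>] by (simp add: \<Phi>_def F_eqv)
  qed
  show "egr (\<lambda>\<tau>. \<nu> (\<Phi> u (modular_action \<gamma> \<tau>)))" if \<gamma>: "\<gamma> \<in> SL2Z" for \<gamma>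
  proof -
    have "egr (\<lambda>\<tau>. \<Sum>b\<in>B. (\<Sum>b'\<in>B. norm (ev (t (modular_action \<gamma> \<tau>)) (crd b' u)) *
        norm (coef b b' (F (modular_action \<gamma> \<tau>)))) * \<nu> b)"
      by (intro egr_sum egr_mult egr_const egr_ev[OF ph crd_in_A[OF u] \<gamma>] coef_egr F_egr \<gamma> F_det modular_action_UHP
          sum_nonneg mult_nonneg_nonneg norm_ge_zero \<nu>_nonneg B_carrier) assumption+
    thus ?thesis
    proof (rule egr_mono)
      fix \<tau> assume \<tau>: "\<tau> \<in> \<H>"
      define w where "w = modular_action \<gamma> \<tau>"
      have w: "w \<in> \<H>" using \<gamma> \<tau> by (simp add: w_def)
      have "\<nu> (\<Phi> u w) \<le> (\<Sum>b\<in>B. cmod (\<xi> b (\<Phi> u w)) * \<nu> b)"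
        using w by (intro norm_le_coords norm) (simp add: \<Phi>_def F_det)
      also have "\<dots> \<le> (\<Sum>b\<in>B. (\<Sum>b'\<in>B. norm (ev (t w) (crd b' u)) * norm (coef b b' (F w))) * \<nu> b)"
      proof (intro sum_mono mult_right_mono \<nu>_nonneg B_carrier)
        fix b assume "b \<in> B"
        thus "cmod (\<xi> b (\<Phi> u w)) \<le> (\<Sum>b'\<in>B. norm (ev (t w) (crd b' u)) * norm (coef b b' (F w)))"
          using w by (simp only: \<xi>\<Phi> norm_mult[symmetric] norm_sum)
      qed
      finally show "\<nu> (\<Phi> u (modular_action \<gamma> \<tau>)) \<le> (\<Sum>b\<in>B. (\<Sum>b'\<in>B. norm (ev (t (modular_action \<gamma> \<tau>)) (crd b' u)) *
        norm (coef b b' (F (modular_action \<gamma> \<tau>)))) * \<nu> b)" by (simp only: w_def)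
    qed
  qed
qed

lemma invariant_function_rational:
  assumes "g holomorphic_on \<H>" "invf N g" "\<And>\<gamma>. \<gamma> \<in> SL2Z \<Longrightarrow> egr (\<lambda>\<tau>. norm (g (modular_action \<gamma> \<tau>)))"
  shows "\<exists>q\<in>carrier A. \<forall>\<tau>\<in>\<H>. g \<tau> = ev (t \<tau>) q"
proof -
  obtain p k where p: "\<And>\<tau>. \<tau> \<in> \<H> \<Longrightarrow> g \<tau> * (\<Prod>s\<in>S. t \<tau> - s) ^ k = poly p (t \<tau>)"
    using rational_in_hauptmodul[OF ph finite_S assms(1,2)] assms(3) unfolding exp_growth_rel_iff_egr by metis
  obtain q where q: "q \<in> carrier A" "\<And>z. z \<notin> S \<Longrightarrow> ev z q = poly p z / (\<Prod>s\<in>S. z - s) ^ k"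
    using pla_quotient[OF finite_S] by metis
  have "g \<tau> = ev (t \<tau>) q" if \<tau>: "\<tau> \<in> \<H>" for \<tau>
  proof -
    have "(\<Prod>s\<in>S. t \<tau> - s) ^ k \<noteq> 0" using t_notin[OF \<tau>] finite_S by auto
    from nonzero_eq_divide_eq[OF this, THEN iffD2, OF p[OF \<tau>]] show ?thesis using q(2)[OF t_notin[OF \<tau>]] by simp
  qed
  thus ?thesis using q(1) by blast
qed

text \<open>Applying the inverse of \<sigma>(F(\<tau>)) makes f invariant, so its coordinates are
  scalar invariant functions and hence regular functions of \<open>t\<close>. Their growth is
  obtained from that of \<open>\<nu>\<close> by the comparison of norms; \<open>adj2\<close> has the
  same size as F, so inversion costs nothing.\<close>

lemma \<Phi>_surj:
  assumes f: "f \<in> carrier M"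
  shows "\<exists>u\<in>K. \<Phi> u = f"
proof -
  have fE: "f \<in> \<H> \<rightarrow>\<^sub>E carrier \<gg>" and f_holo: "\<And>b. b \<in> B \<Longrightarrow> (\<lambda>\<tau>. \<xi> b (f \<tau>)) holomorphic_on \<H>"
    and f_eqv: "\<And>\<gamma> \<tau>. \<gamma> \<in> principal_congruence_subgroup N \<Longrightarrow> \<tau> \<in> \<H> \<Longrightarrow> f (modular_action \<gamma> \<tau>) = \<rho> \<gamma> (f \<tau>)"
    and f_egr: "\<And>\<gamma>. \<gamma> \<in> SL2Z \<Longrightarrow> egr (\<lambda>\<tau>. \<nu> (f (modular_action \<gamma> \<tau>)))"
    using f unfolding M_iff by blast+
  have fc: "f \<tau> \<in> carrier \<gg>" if "\<tau> \<in> \<H>" for \<tau> using fE that by auto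
  define y where "y = (\<lambda>\<tau>. \<sigma> (adj2 (F \<tau>)) (f \<tau>))"
  have y: "y \<tau> \<in> carrier \<gg>" "\<sigma> (F \<tau>) (y \<tau>) = f \<tau>" if "\<tau> \<in> \<H>" for \<tau>
    using that fc by (simp_all add: y_def F_det \<sigma>_adj2)
  have \<xi>y: "\<xi> b (y \<tau>) = (\<Sum>b'\<in>B. \<xi> b' (f \<tau>) * coef b b' (adj2 (F \<tau>)))" if "b \<in> B" "\<tau> \<in> \<H>" for b \<tau>
    using that fc by (simp add: y_def \<xi>_\<sigma> F_det)
  obtain C where C: "C \<ge> 0" "\<And>x b. x \<in> carrier \<gg> \<Longrightarrow> b \<in> B \<Longrightarrow> cmod (\<xi> b x) \<le> C * \<nu> x"
    using coords_le_norm[OF norm] by blast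
  have "\<exists>q\<in>carrier A. \<forall>\<tau>\<in>\<H>. \<xi> b (y \<tau>) = ev (t \<tau>) q" if b: "b \<in> B" for b
  proof (rule invariant_function_rational)
    have "(\<lambda>\<tau>. adj2 (F \<tau>) $ i $ j) holomorphic_on \<H>" for i j
    proof -
      have "i = 1 \<or> i = 2" "j = 1 \<or> j = 2" using exhaust_2 by auto
      thus ?thesis by (elim disjE) (auto intro!: holomorphic_intros F_holo)
    qed
    hence "(\<lambda>\<tau>. \<Sum>b'\<in>B. \<xi> b' (f \<tau>) * coef b b' (adj2 (F \<tau>))) holomorphic_on \<H>"
      using b by (intro holomorphic_on_sum holomorphic_on_mult f_holo coef_holomorphic[OF open_UHP]) (auto simp: F_det)
    thus "(\<lambda>\<tau>. \<xi> b (y \<tau>)) holomorphic_on \<H>" by (rule holomorphic_transform) (simp add: \<xi>y b)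
    show "invf N (\<lambda>\<tau>. \<xi> b (y \<tau>))"
      unfolding invf_def
    proof (intro ballI)
      fix \<gamma> \<tau> assume \<gamma>: "\<gamma> \<in> principal_congruence_subgroup N" and \<tau>: "\<tau> \<in> \<H>"
      have \<gamma>\<tau>: "modular_action \<gamma> \<tau> \<in> \<H>" using Gamma_subset_SL2Z[OF \<gamma>] \<tau> by simp
      have "\<sigma> (F (modular_action \<gamma> \<tau>)) (y (modular_action \<gamma> \<tau>)) = \<rho> \<gamma> (\<sigma> (F \<tau>) (y \<tau>))"
        using \<gamma> \<tau> \<gamma>\<tau> by (simp add: y f_eqv)
      also have "\<dots> = \<sigma> (F (modular_action \<gamma> \<tau>)) (y \<tau>)" using \<gamma> \<tau> y(1) by (simp add: F_eqv)
      \<comment> \<open>Injectivity of \<sigma> at the transformed point cancels the twist, so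
        \<rho> need not be inverted.\<close>
      finally have "y (modular_action \<gamma> \<tau>) = y \<tau>" using F_det[OF \<gamma>\<tau>] y(1)[OF \<tau>] y(1)[OF \<gamma>\<tau>] \<sigma>_inj by blast
      thus "\<xi> b (y (modular_action \<gamma> \<tau>)) = \<xi> b (y \<tau>)" by simp
    qed
    show "egr (\<lambda>\<tau>. cmod (\<xi> b (y (modular_action \<gamma> \<tau>))))" if \<gamma>: "\<gamma> \<in> SL2Z" for \<gamma>
    proof -
      \<comment> \<open>The absolute value is taken because \<open>egr_mult\<close> asks for
        nonnegative factors at every complex \<tau>, also outside the upper half-plane.\<close>
      define h where "h = (\<lambda>\<tau>. \<bar>\<nu> (f (modular_action \<gamma> \<tau>))\<bar>)"
      have "egr h"
        using f_egr[OF \<gamma>] by (rule egr_mono) (use \<gamma> fc \<nu>_nonneg in \<open>auto simp: h_def\<close>)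
      moreover have "egr (\<lambda>\<tau>. norm (coef b b' (adj2 (F (modular_action \<gamma> \<tau>)))))" if "b' \<in> B" for b'
        using F_egr[OF \<gamma>] \<gamma> b that by (intro coef_egr) (auto simp: F_det)
      ultimately have "egr (\<lambda>\<tau>. \<Sum>b'\<in>B. (C * h \<tau>) * norm (coef b b' (adj2 (F (modular_action \<gamma> \<tau>)))))"
        using C(1) by (intro egr_sum egr_mult egr_const) (auto simp: h_def)
      thus ?thesis
      proof (rule egr_mono)
        fix \<tau> assume \<tau>: "\<tau> \<in> \<H>"
        define w where "w = modular_action \<gamma> \<tau>"
        have w: "w \<in> \<H>" using \<gamma> \<tau> by (simp add: w_def)
        have "cmod (\<xi> b (y w)) \<le> (\<Sum>b'\<in>B. cmod (\<xi> b' (f w)) * norm (coef b b' (adj2 (F w))))"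
          unfolding \<xi>y[OF b w] norm_mult[symmetric] by (rule norm_sum)
        also have "\<dots> \<le> (\<Sum>b'\<in>B. (C * h \<tau>) * norm (coef b b' (adj2 (F w))))"
        proof (intro sum_mono mult_right_mono norm_ge_zero)
          fix b' assume "b' \<in> B"
          thus "cmod (\<xi> b' (f w)) \<le> C * h \<tau>" using C(2)[OF fc[OF w]] \<nu>_nonneg[OF fc[OF w]] by (simp add: h_def w_def)
        qed
        finally show "cmod (\<xi> b (y (modular_action \<gamma> \<tau>))) \<le>
            (\<Sum>b'\<in>B. (C * h \<tau>) * norm (coef b b' (adj2 (F (modular_action \<gamma> \<tau>)))))" by (simp only: w_def)
      qed
    qed
  qed
  then obtain q where q: "\<And>b. b \<in> B \<Longrightarrow> q b \<in> carrier A" "\<And>b \<tau>. b \<in> B \<Longrightarrow> \<tau> \<in> \<H> \<Longrightarrow> \<xi> b (y \<tau>) = ev (t \<tau>) (q b)"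
    by metis
  define u where "u = (\<Sum>b\<in>B. Poly_Mapping.single (b, q b) (1::complex))"
  have u: "u \<in> K" unfolding u_def using q(1) B_carrier by (intro K_sum K_closed(5))
  have crd_u: "crd b u = q b" if b: "b \<in> B" for b
  proof -
    have "crd b u = (\<Sum>b'\<in>B. if b' = b then q b' else 0)"
      unfolding u_def crd_sum crd_single using b by (intro sum.cong) (auto simp: \<xi>_delta ratfun_const_hom)
    thus ?thesis using b finite_B by simp
  qed
  have "val u \<tau> = y \<tau>" if \<tau>: "\<tau> \<in> \<H>" for \<tau>
    by (rule \<xi>_eqI) (use \<tau> in \<open>auto simp: y \<xi>_val crd_u q(2)\<close>)
  hence "\<Phi> u = f" using fE y(2) by (auto simp: \<Phi>_def PiE_def extensional_def fun_eq_iff)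
  thus ?thesis using u by blast
qed

lemma infinite_range_t: "infinite (t ` \<H>)"
proof
  assume "finite (t ` \<H>)"
  hence "bounded (t ` \<H>)" by (rule finite_imp_bounded)
  then obtain C where "\<And>\<tau>. \<tau> \<in> \<H> \<Longrightarrow> norm (t \<tau>) \<le> C" unfolding bounded_iff by blast
  moreover obtain \<tau> where "\<tau> \<in> \<H>" "norm (t \<tau>) > C" using large_value by blast
  ultimately show False by fastforce
qed

text \<open>\<open>t\<close> is unbounded and hence takes infinitely many values, and a rational
  function vanishing on all of them is 0.\<close>

lemma \<Phi>_eq_iff:
  assumes u: "u \<in> K" and v: "v \<in> K"
  shows "\<Phi> u = \<Phi> v \<longleftrightarrow> (\<forall>b\<in>B. crd b u = crd b v)"
proof
  assume "\<forall>b\<in>B. crd b u = crd b v"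
  hence "val u \<tau> = val v \<tau>" for \<tau> unfolding val_def by (intro lc_cong B_sub) simp
  thus "\<Phi> u = \<Phi> v" by (simp add: \<Phi>_def)
next
  assume eq: "\<Phi> u = \<Phi> v"
  show "\<forall>b\<in>B. crd b u = crd b v"
  proof
    fix b assume b: "b \<in> B"
    have "crd b (u - v) = 0"
    proof (rule ratfun_eq_0[OF infinite_range_t])
      fix z assume "z \<in> t ` \<H>"
      then obtain \<tau> where \<tau>: "\<tau> \<in> \<H>" "z = t \<tau>" by blast
      have "\<sigma> (F \<tau>) (val u \<tau>) = \<sigma> (F \<tau>) (val v \<tau>)" using fun_cong[OF eq, of \<tau>] \<tau> by (simp add: \<Phi>_def)
      hence "val u \<tau> = val v \<tau>" using \<sigma>_inj[OF F_det[OF \<tau>(1)] val_closed val_closed] by blast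
      hence e: "ev z (crd b u) = ev z (crd b v)" using \<xi>_val[OF b, of u \<tau>] \<xi>_val[OF b, of v \<tau>] \<tau> by simp
      have "ev z (crd b (u - v) + crd b v) = ev z (crd b (u - v)) + ev z (crd b v)"
        using \<tau> t_notin by (intro ev_add[of _ S] crd_in_A K_closed u v) auto
      thus "ev z (crd b (u - v)) = 0" by (simp add: crd_diff e)
    qed
    thus "crd b u = crd b v" by (simp add: crd_diff)
  qed
qed

text \<open>The twist acts by a Lie algebra automorphism at each \<tau>, so compatibility with the
  bracket reduces to multiplicativity of evaluation at \<open>t \<tau>\<close>.\<close>

lemma automorphic_isomorphic_loop: "lie_isomorphic complex_field M LA"
proof (rule loop_algebra_isomorphicI[of \<Phi>])
  fix u v assume uv: "u \<in> K" "v \<in> K"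
  have "val (u + v) \<tau> = val u \<tau> \<oplus> val v \<tau>" if "\<tau> \<in> \<H>" for \<tau>
    by (rule \<xi>_eqI) (use uv that in \<open>auto simp: \<xi>_add \<xi>_val crd_add ev_add[of _ S] crd_in_A t_notin\<close>)
  thus "\<Phi> (u + v) = \<Phi> u \<oplus>\<^bsub>M\<^esub> \<Phi> v"
    by (auto simp: zero_weight_automorphic_def \<Phi>_def fun_eq_iff \<sigma>_add F_det)
  have "val (free_loop_bracket \<gg> A u v) \<tau> = lie_bracket \<gg> (val u \<tau>) (val v \<tau>)" if \<tau>: "\<tau> \<in> \<H>" for \<tau>
  proof (rule \<xi>_eqI)
    fix b assume b: "b \<in> B"
    have cl: "ratfun_const (str b b' b'') * (crd b' u * crd b'' v) \<in> carrier A" for b' b''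
      by (intro pla_mult pla_const crd_in_A uv)
    have "\<xi> b (val (free_loop_bracket \<gg> A u v) \<tau>) =
        (\<Sum>b'\<in>B. \<Sum>b''\<in>B. ev (t \<tau>) (ratfun_const (str b b' b'') * (crd b' u * crd b'' v)))"
      using b uv t_notin[OF \<tau>] finite_B cl
      by (simp add: \<xi>_val crd_bracket ev_sum[of _ _ S] pla_sum)
    also have "\<dots> = (\<Sum>b'\<in>B. \<Sum>b''\<in>B. ev (t \<tau>) (crd b' u) * ev (t \<tau>) (crd b'' v) * str b b' b'')"
      using t_notin[OF \<tau>] uv by (simp add: ev_mult[of _ S] pla_mult pla_const crd_in_A mult_ac)
    also have "\<dots> = \<xi> b (lie_bracket \<gg> (val u \<tau>) (val v \<tau>))"
      using b by (simp add: \<xi>_bracket \<xi>_val)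
    finally show "\<xi> b (val (free_loop_bracket \<gg> A u v) \<tau>) = \<xi> b (lie_bracket \<gg> (val u \<tau>) (val v \<tau>))" .
  qed (auto intro: bracket_closed)
  thus "\<Phi> (free_loop_bracket \<gg> A u v) = lie_bracket M (\<Phi> u) (\<Phi> v)"
    by (auto simp: zero_weight_automorphic_def \<Phi>_def fun_eq_iff \<sigma>_bracket F_det)
next
  fix c u assume u: "u \<in> K"
  have "val (free_smult c u) \<tau> = c \<odot> val u \<tau>" if "\<tau> \<in> \<H>" for \<tau>
    by (rule \<xi>_eqI) (use u that in \<open>auto simp: \<xi>_smult \<xi>_val crd_free_smult ev_mult[of _ S] pla_const crd_in_A t_notin\<close>)
  thus "\<Phi> (free_smult c u) = c \<odot>\<^bsub>M\<^esub> \<Phi> u"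
    by (auto simp: zero_weight_automorphic_def \<Phi>_def fun_eq_iff \<sigma>_smult F_det)
qed (fact \<Phi>_closed \<Phi>_surj \<Phi>_eq_iff)+

end

lemma finite_punctures:
  "finite tetrahedral_punctures" "finite octahedral_punctures" "finite icosahedral_punctures" "finite dihedral_punctures"
  by (simp_all add: tetrahedral_punctures_def octahedral_punctures_def icosahedral_punctures_def dihedral_punctures_def Let_def)

lemma (in sl2_representation) automorphic_isomorphic_loop:
  assumes \<nu>: "is_norm \<gg> \<nu>" and N: "N \<in> {2,3,4,5}"
    and \<rho>: "\<And>\<gamma>. \<gamma> \<in> principal_congruence_subgroup N \<Longrightarrow> \<rho> \<gamma> = \<sigma> (cmat \<gamma>)"
    and even: "N = 2 \<Longrightarrow> \<rho> (- mat 1) = \<one>\<^bsub>lie_AutoGroup complex_field \<gg>\<^esub>"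
    and "finite S" and t: "\<exists>t. punctured_hauptmodul N t S"
  shows "lie_isomorphic complex_field (zero_weight_automorphic \<gg> \<nu> (principal_congruence_subgroup N) \<rho>)
    (loop_algebra \<gg> (punctured_line_algebra S))"
proof -
  obtain t where t: "punctured_hauptmodul N t S" using assms by blast
  obtain F :: "complex \<Rightarrow> complex^2^2" where F:
    "\<And>\<tau>. \<tau> \<in> \<H> \<Longrightarrow> det (F \<tau>) = 1" "\<And>i j. (\<lambda>\<tau>. F \<tau> $ i $ j) holomorphic_on \<H>"
    "\<And>\<gamma> \<tau>. \<gamma> \<in> principal_congruence_subgroup N \<Longrightarrow> \<tau> \<in> \<H> \<Longrightarrow>
       F (modular_action \<gamma> \<tau>) = cmat \<gamma> ** F \<tau> \<or> N = 2 \<and> F (modular_action \<gamma> \<tau>) = - (cmat \<gamma> ** F \<tau>)"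
    "\<And>\<gamma>. \<gamma> \<in> SL2Z \<Longrightarrow> egr (\<lambda>\<tau>. mnorm (F (modular_action \<gamma> \<tau>)))"
    using SL2_trivialisation[OF N] by blast
  \<comment> \<open>The condition on \<rho> at \<open>- mat 1\<close> makes the sign ambiguity of F
    invisible to \<sigma>.\<close>
  have neg: "\<sigma> (- A) x = \<sigma> A x" if "N = 2" "det A = 1" "x \<in> carrier \<gg>" for A x
  proof -
    have "- mat 1 \<in> principal_congruence_subgroup N" using that(1) by (simp add: Gamma_iff cong_def)
    hence "\<sigma> (cmat (- mat 1)) = \<one>\<^bsub>lie_AutoGroup complex_field \<gg>\<^esub>" using \<rho> even that(1) by metis
    moreover have "cmat (- mat 1) = - mat 1" by (simp add: cm2_eq_iff)
    ultimately have "\<sigma> (- mat 1) = (\<lambda>x\<in>carrier \<gg>. x)" by (simp add: lie_AutoGroup_def BijGroup_def)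
    moreover have "- A = - mat 1 ** A" by (simp add: cm2_eq_iff mult_nth2)
    moreover have "det (- mat 1 :: complex^2^2) = 1" by (simp add: det_2)
    ultimately show ?thesis using that \<sigma>_mult[of "- mat 1" A x] by simp
  qed
  interpret trivialised_loop_setting \<gg> B \<xi> \<sigma> S \<nu> N t F \<rho>
  proof
    fix \<gamma> \<tau> x assume \<gamma>: "\<gamma> \<in> principal_congruence_subgroup N" and \<tau>: "\<tau> \<in> \<H>" and x: "x \<in> carrier \<gg>"
    have "det (cmat \<gamma>) = 1"
    proof -
      have "det (cmat \<gamma>) = of_int (det \<gamma>)" by (simp add: det_2)
      thus ?thesis using Gamma_subset_SL2Z[OF \<gamma>] by (simp add: SL2Z_def)
    qed
    hence 1: "\<sigma> (cmat \<gamma> ** F \<tau>) x = \<rho> \<gamma> (\<sigma> (F \<tau>) x)" and 2: "det (cmat \<gamma> ** F \<tau>) = 1"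
      using F(1)[OF \<tau>] x \<gamma> by (simp_all add: \<sigma>_mult \<rho> det_mul)
    show "\<sigma> (F (modular_action \<gamma> \<tau>)) x = \<rho> \<gamma> (\<sigma> (F \<tau>) x)"
      using F(3)[OF \<gamma> \<tau>] 1 neg[OF _ 2 x] by auto
  qed (use \<nu> \<open>finite S\<close> t F in auto)
  show ?thesis by (rule automorphic_isomorphic_loop)
qed

theorem theorem7p2:
  fixes \<gg> :: "(complex, 'a) lie_algebra"
    and \<nu> :: "'a \<Rightarrow> real"
    and N :: nat
    and \<rho>bar :: "complex^2^2 \<Rightarrow> 'a \<Rightarrow> 'a"
    and \<rho> :: "int^2^2 \<Rightarrow> 'a \<Rightarrow> 'a"
  assumes "simple_lie_algebra complex_field \<gg>"
    and "finitely_spanned complex_field \<gg>"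
    and "is_norm \<gg> \<nu>"
    and "N \<in> {2, 3, 4, 5}"
    and "SL2C_complex_lie_hom \<gg> \<rho>bar"
    and "\<forall>\<gamma>\<in>principal_congruence_subgroup N. \<rho> \<gamma> = \<rho>bar (map_matrix of_int \<gamma>)"
  shows
    "(N = 3 \<longrightarrow>
        lie_isomorphic complex_field
          (zero_weight_automorphic \<gg> \<nu> (principal_congruence_subgroup N) \<rho>)
          (loop_algebra \<gg> (punctured_line_algebra tetrahedral_punctures))) \<and>
     (N = 4 \<longrightarrow>
        lie_isomorphic complex_field
          (zero_weight_automorphic \<gg> \<nu> (principal_congruence_subgroup N) \<rho>)
          (loop_algebra \<gg> (punctured_line_algebra octahedral_punctures))) \<and>
     (N = 5 \<longrightarrow>
        lie_isomorphic complex_field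
          (zero_weight_automorphic \<gg> \<nu> (principal_congruence_subgroup N) \<rho>)
          (loop_algebra \<gg> (punctured_line_algebra icosahedral_punctures))) \<and>
     (N = 2 \<longrightarrow> \<rho> (- mat 1) = \<one>\<^bsub>lie_AutoGroup complex_field \<gg>\<^esub> \<longrightarrow>
        lie_isomorphic complex_field
          (zero_weight_automorphic \<gg> \<nu> (principal_congruence_subgroup N) \<rho>)
          (loop_algebra \<gg> (punctured_line_algebra dihedral_punctures)))"
proof -
  interpret complex_lie_algebra \<gg>
    using assms(1) by (simp add: complex_lie_algebra_def simple_lie_algebra_def)
  obtain B \<xi> where "framed_lie_algebra \<gg> B \<xi>" by (rule frame_exists[OF assms(2)])
  then interpret sl2_representation \<gg> B \<xi> \<rho>bar
    by (intro sl2_representation.intro sl2_representation_axioms.intro assms(5))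
  have \<rho>: "\<rho> \<gamma> = \<rho>bar (cmat \<gamma>)" if "\<gamma> \<in> principal_congruence_subgroup N" for \<gamma>
    using assms(6) that by blast
  note iso = automorphic_isomorphic_loop[OF assms(3,4) \<rho>]
  show ?thesis
  proof (intro conjI impI)
    assume N: "N = 3"
    show "lie_isomorphic complex_field (zero_weight_automorphic \<gg> \<nu> (principal_congruence_subgroup N) \<rho>)
        (loop_algebra \<gg> (punctured_line_algebra tetrahedral_punctures))"
      by (rule iso) (use N finite_punctures(1) tetrahedral_hauptmodul in simp_all)
  next
    assume N: "N = 4"
    show "lie_isomorphic complex_field (zero_weight_automorphic \<gg> \<nu> (principal_congruence_subgroup N) \<rho>)
        (loop_algebra \<gg> (punctured_line_algebra octahedral_punctures))"
      by (rule iso) (use N finite_punctures(2) octahedral_hauptmodul in simp_all)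
  next
    assume N: "N = 5"
    show "lie_isomorphic complex_field (zero_weight_automorphic \<gg> \<nu> (principal_congruence_subgroup N) \<rho>)
        (loop_algebra \<gg> (punctured_line_algebra icosahedral_punctures))"
      by (rule iso) (use N finite_punctures(3) icosahedral_hauptmodul in simp_all)
  next
    assume N: "N = 2" and even: "\<rho> (- mat 1) = \<one>\<^bsub>lie_AutoGroup complex_field \<gg>\<^esub>"
    show "lie_isomorphic complex_field (zero_weight_automorphic \<gg> \<nu> (principal_congruence_subgroup N) \<rho>)
        (loop_algebra \<gg> (punctured_line_algebra dihedral_punctures))"
      by (rule iso) (use N even finite_punctures(4) dihedral_hauptmodul in simp_all)
  qed
qed

end
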